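(* Let $p,q,r$ be real coefficients satisfying the standing hypotheses (a), (b), (c) listed in the context, and assume in addition that $1/p\in L^\eta(\mathbb R)$ for some $\eta\in[1,\infty)$ and $q_-\in L^s(\mathbb R)$ for some $s\in[1,\infty]$, such that $\eta+s>2$ if $s\neq\infty$. Let $$\beta=\begin{cases}\Bigl(\bigl(\tfrac{2\eta-1}{\eta}\bigr)^2\lVert 1/p\rVert_\eta\lVert q_-\rVert_s\Bigr)^{\frac{\eta s}{2\eta s-\eta-s}} & \text{if } s\in[1,\infty),\\ \Bigl(\bigl(\tfrac{2\eta-1}{\eta}\bigr)^2\lVert 1/p\rVert_\eta\lVert q_-\rVert_\infty\Bigr)^{\frac{\eta}{2\eta-1}} & \text{if } s=\infty,\end{cases}\qquad \alpha=\begin{cases}\lVert q_-\rVert_s\,\beta^{\frac1s} & \text{if } s\in[1,\infty),\\ \lVert q_-\rVert_\infty & \text{if } s=\infty,\end{cases}$$ and let $g\in L^\infty(\mathbb R)$ be a nonnegative function such that $\mu(\Omega_g)\beta<1$, where $\Omega_g=\{x\in\mathbb R : r(x)g(x)<1\}$. Then $$\min\sigma(T)\geq\frac{-\alpha\lVert g\rVert_\infty}{1-\mu(\Omega_g)\beta}.$$ In the special case $1/r\in L^\infty(\mathbb R)$, the choice $g=1/r$ gives $\mu(\Omega_g)=0$ and $$\min\sigma(T)\geq-\Bigl(\bigl(\tfrac{2\eta-1}{\eta}\bigr)^2\lVert 1/p\rVert_\eta\Bigr)^{\frac{\eta}{2\eta s-\eta-s}}\lVert q_-\rVert_s^{\frac{2\eta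 s-s}{2\eta s-\eta-s}}\lVert 1/r\rVert_\infty\quad\text{if } s\in[1,\infty),$$ while, if $s=\infty$, $$\min\sigma(T)\geq-\lVert q_-\rVert_\infty\lVert 1/r\rVert_\infty.$$
   Context: Let $p,q,r:\mathbb R\to\mathbb R$ be measurable with $r,1/p,q\in L^1_{\mathrm{loc}}(\mathbb R)$. Let $L^1_{\mathrm u}(\mathbb R)$ be the space of all $h\in L^1_{\mathrm{loc}}(\mathbb R)$ with $\lVert h\rVert_{\mathrm u}:=\sup_{n\in\mathbb Z}\int_n^{n+1}|h(t)|\,\mathrm dt<\infty$. Standing hypotheses: (a) $p(x)>0$ for a.a. $x\in\mathbb R$ and $1/p\in L^\eta(\mathbb R)$ for some $\eta\in[1,\infty]$; (b) $q\in L^1_{\mathrm u}(\mathbb R)$; (c) $r(x)>0$ for a.a. $x\in\mathbb R$ and there exist $a,b\in\mathbb R$ with $a<b$ such that $\operatorname{ess\,inf}_{t\in\mathbb R\setminus[a,b]}r(t)>0$. $L^2_r(\mathbb R)=L^2(\mathbb R;r\,\mathrm dx)$ is the weighted $L^2$-space (complex-valued functions). The operator $T$ in $L^2_r(\mathbb R)$ is the maximal operator $$Tf=\tau f=\frac1r\left(-(pf')'+qf\right),\quad D(T)=\bigl\{f\in L^2_r(\mathbb R) : f,\,pf'\in AC_{\mathrm{loc}}(\mathbb R),\ \tau f\in L^2_r(\mathbb R)\bigr\},$$ where $AC_{\mathrm{loc}}(\mathbb R)$ denotes the locally absolutely continuous functions. It is known that under the standing hypotheses $T$ is self-adjoint and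 semibounded from below; $\sigma(T)$ is its spectrum. The negative part of $q$ is $q_-=(|q|-q)/2$. $\mu$ is Lebesgue measure on $\mathbb R$, and $\lVert\cdot\rVert_s$ is the (unweighted) norm of $L^s(\mathbb R)$, $s\in[1,\infty]$. *)

theory Defs
  imports "HOL-Probability.Essential_Supremum"
begin

section \<open>Function spaces\<close>

text \<open>Spaces of measurable functions are modelled as sets of functions rather than of equivalence
  classes; equality of their elements is equality almost everywhere. Measurable means Lebesgue
  measurable.\<close>

definition in_L1_loc :: "(real \<Rightarrow> real) \<Rightarrow> bool" where
  "in_L1_loc h \<longleftrightarrow> h \<in> borel_measurable lebesgue \<and> (\<forall>a b. h absolutely_integrable_on {a..b})"

definition in_L1_unif :: "(real \<Rightarrow> real) \<Rightarrow> bool" where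
  "in_L1_unif h \<longleftrightarrow> in_L1_loc h \<and>
     bdd_above (range (\<lambda>n::int. LINT t:{of_int n..of_int n + 1}|lebesgue. \<bar>h t\<bar>))"

definition in_Lp :: "ereal \<Rightarrow> (real \<Rightarrow> real) \<Rightarrow> bool" where
  "in_Lp s h \<longleftrightarrow> h \<in> borel_measurable lebesgue \<and>
     (if s = \<infinity> then esssup lebesgue (\<lambda>x. ereal \<bar>h x\<bar>) < \<infinity>
      else integrable lebesgue (\<lambda>x. \<bar>h x\<bar> powr real_of_ereal s))"

text \<open>Only meaningful for \<open>in_Lp s h\<close> with \<open>1 \<le> s\<close>.\<close>
definition Lp_norm :: "ereal \<Rightarrow> (real \<Rightarrow> real) \<Rightarrow> real" where
  "Lp_norm s h =
     (if s = \<infinity> then real_of_ereal (esssup lebesgue (\<lambda>x. ereal \<bar>h x\<bar>))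
      else (LINT x|lebesgue. \<bar>h x\<bar> powr real_of_ereal s) powr (1 / real_of_ereal s))"

definition ess_inf_on :: "real set \<Rightarrow> (real \<Rightarrow> real) \<Rightarrow> ereal" where
  "ess_inf_on A h = Sup {c. AE x in lebesgue. x \<in> A \<longrightarrow> c \<le> ereal (h x)}"

definition abs_cont_on_interval :: "real \<Rightarrow> real \<Rightarrow> (real \<Rightarrow> complex) \<Rightarrow> bool" where
  "abs_cont_on_interval a b f \<longleftrightarrow>
     (\<forall>\<epsilon>>0. \<exists>\<delta>>0. \<forall>I :: (real \<times> real) set.
        finite I \<and> (\<forall>(c, d)\<in>I. a \<le> c \<and> c < d \<and> d \<le> b) \<and>
        pairwise (\<lambda>(c, d) (c', d'). {c<..<d} \<inter> {c'<..<d'} = {}) I \<and>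
        (\<Sum>(c, d)\<in>I. d - c) < \<delta>
        \<longrightarrow> (\<Sum>(c, d)\<in>I. cmod (f d - f c)) < \<epsilon>)"

definition in_AC_loc :: "(real \<Rightarrow> complex) \<Rightarrow> bool" where
  "in_AC_loc f \<longleftrightarrow> (\<forall>a b. a < b \<longrightarrow> abs_cont_on_interval a b f)"

definition L2_weighted :: "(real \<Rightarrow> real) \<Rightarrow> (real \<Rightarrow> complex) set" where
  "L2_weighted r = {f \<in> borel_measurable lebesgue. integrable lebesgue (\<lambda>x. (cmod (f x))\<^sup>2 * r x)}"

definition L2_weighted_norm :: "(real \<Rightarrow> real) \<Rightarrow> (real \<Rightarrow> complex) \<Rightarrow> real" where
  "L2_weighted_norm r f = sqrt (LINT x|lebesgue. (cmod (f x))\<^sup>2 * r x)"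


section \<open>Spectrum of an operator in the weighted space\<close>

text \<open>The operator is given by its domain \<open>D\<close> and its action \<open>T\<close> on representatives. A point \<open>z\<close>
  belongs to the resolvent set iff \<open>T - z\<close> is a bijection from \<open>D\<close> onto the weighted space (up to
  equality almost everywhere) whose inverse is bounded.\<close>

definition resolvent_set ::
    "(real \<Rightarrow> real) \<Rightarrow> (real \<Rightarrow> complex) set \<Rightarrow> ((real \<Rightarrow> complex) \<Rightarrow> real \<Rightarrow> complex) \<Rightarrow> complex set" where
  "resolvent_set r D T = {z.
     (\<forall>h\<in>L2_weighted r. \<exists>f\<in>D. (AE x in lebesgue. T f x - z * f x = h x)) \<and>
     (\<forall>f\<in>D. \<forall>f'\<in>D. (AE x in lebesgue. T f x - z * f x = T f' x - z * f' x)
                      \<longrightarrow> (AE x in lebesgue. f x = f' x)) \<and>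
     (\<exists>C. \<forall>f\<in>D. L2_weighted_norm r f \<le> C * L2_weighted_norm r (\<lambda>x. T f x - z * f x))}"

definition spectrum_of ::
    "(real \<Rightarrow> real) \<Rightarrow> (real \<Rightarrow> complex) set \<Rightarrow> ((real \<Rightarrow> complex) \<Rightarrow> real \<Rightarrow> complex) \<Rightarrow> complex set" where
  "spectrum_of r D T = - resolvent_set r D T"

text \<open>A set of complex numbers has a minimum only if it is contained in the real line.\<close>
definition is_minimum :: "complex set \<Rightarrow> real \<Rightarrow> bool" where
  "is_minimum S m \<longleftrightarrow> complex_of_real m \<in> S \<and> (\<forall>z\<in>S. z \<in> \<real> \<and> m \<le> Re z)"


section \<open>The maximal Sturm--Liouville operator\<close>

text \<open>\<open>v\<close> is the locally absolutely continuous representative of \<open>p f'\<close>. There is at most one.\<close>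
definition has_quasi_deriv :: "(real \<Rightarrow> real) \<Rightarrow> (real \<Rightarrow> complex) \<Rightarrow> (real \<Rightarrow> complex) \<Rightarrow> bool" where
  "has_quasi_deriv p f v \<longleftrightarrow>
     in_AC_loc v \<and> (AE x in lebesgue. v x = of_real (p x) * vector_derivative f (at x))"

definition quasi_deriv :: "(real \<Rightarrow> real) \<Rightarrow> (real \<Rightarrow> complex) \<Rightarrow> real \<Rightarrow> complex" where
  "quasi_deriv p f = (THE v. has_quasi_deriv p f v)"

definition SL_op ::
    "(real \<Rightarrow> real) \<Rightarrow> (real \<Rightarrow> real) \<Rightarrow> (real \<Rightarrow> real) \<Rightarrow> (real \<Rightarrow> complex) \<Rightarrow> real \<Rightarrow> complex" where
  "SL_op p q r f = (\<lambda>x. of_real (1 / r x) *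
     (- vector_derivative (quasi_deriv p f) (at x) + of_real (q x) * f x))"

definition SL_dom ::
    "(real \<Rightarrow> real) \<Rightarrow> (real \<Rightarrow> real) \<Rightarrow> (real \<Rightarrow> real) \<Rightarrow> (real \<Rightarrow> complex) set" where
  "SL_dom p q r = {f \<in> L2_weighted r. in_AC_loc f \<and> (\<exists>v. has_quasi_deriv p f v) \<and>
     SL_op p q r f \<in> L2_weighted r}"

definition SL_spectrum :: "(real \<Rightarrow> real) \<Rightarrow> (real \<Rightarrow> real) \<Rightarrow> (real \<Rightarrow> real) \<Rightarrow> complex set" where
  "SL_spectrum p q r = spectrum_of r (SL_dom p q r) (SL_op p q r)"

definition SL_coefficients :: "(real \<Rightarrow> real) \<Rightarrow> (real \<Rightarrow> real) \<Rightarrow> (real \<Rightarrow> real) \<Rightarrow> bool" where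
  "SL_coefficients p q r \<longleftrightarrow>
     p \<in> borel_measurable lebesgue \<and> q \<in> borel_measurable lebesgue \<and> r \<in> borel_measurable lebesgue \<and>
     in_L1_loc r \<and> in_L1_loc (\<lambda>x. 1 / p x) \<and> in_L1_loc q \<and>
     (AE x in lebesgue. p x > 0) \<and> (\<exists>\<eta>\<ge>1. in_Lp \<eta> (\<lambda>x. 1 / p x)) \<and>
     in_L1_unif q \<and>
     (AE x in lebesgue. r x > 0) \<and> (\<exists>a b. a < b \<and> ess_inf_on (- {a..b}) r > 0)"

definition neg_part :: "(real \<Rightarrow> real) \<Rightarrow> real \<Rightarrow> real" where
  "neg_part q = (\<lambda>x. (\<bar>q x\<bar> - q x) / 2)"


section \<open>Constants of the spectral bound\<close>

definition SL_beta :: "(real \<Rightarrow> real) \<Rightarrow> (real \<Rightarrow> real) \<Rightarrow> real \<Rightarrow> ereal \<Rightarrow> real" where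
  "SL_beta p q \<eta> s =
     (((2 * \<eta> - 1) / \<eta>)\<^sup>2 * Lp_norm \<eta> (\<lambda>x. 1 / p x) * Lp_norm s (neg_part q)) powr
     (if s = \<infinity> then \<eta> / (2 * \<eta> - 1)
      else \<eta> * real_of_ereal s / (2 * \<eta> * real_of_ereal s - \<eta> - real_of_ereal s))"

definition SL_alpha :: "(real \<Rightarrow> real) \<Rightarrow> (real \<Rightarrow> real) \<Rightarrow> real \<Rightarrow> ereal \<Rightarrow> real" where
  "SL_alpha p q \<eta> s =
     (if s = \<infinity> then Lp_norm s (neg_part q)
      else Lp_norm s (neg_part q) * SL_beta p q \<eta> s powr (1 / real_of_ereal s))"

definition Omega :: "(real \<Rightarrow> real) \<Rightarrow> (real \<Rightarrow> real) \<Rightarrow> real set" where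
  "Omega r g = {x. r x * g x < 1}"

end

theory Submission
  imports Defs
begin

text \<open>
  Write \<open>\<gamma> = 2 - 1/\<eta>\<close> and \<open>\<sigma> = 1/s\<close>. The bound is a statement about the quadratic form
  \<open>\<integral> p f'^2 + \<integral> q f^2\<close> of \<open>T\<close>. The fundamental theorem of calculus for \<open>|f|^\<gamma>\<close> together with the
  Hoelder inequality gives \<open>sup |f|^(2\<gamma>) \<le> \<gamma>^2 ||1/p|| (\<integral> f^2)^(\<gamma>-1) \<integral> p f'^2\<close> (interpolation_line),
  and the Hoelder inequality gives \<open>\<integral> q_- f^2 \<le> ||q_-|| (sup f^2)^\<sigma> (\<integral> f^2)^(1-\<sigma>)\<close> (potential_bound).
  Eliminating the supremum (interpolation_numeric) yields \<open>\<integral> q_- f^2 - \<integral> p f'^2 \<le> \<alpha> \<integral> f^2\<close>, and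
  \<open>sup f^2 \<le> \<beta> \<integral> f^2\<close> whenever the left-hand side is nonnegative. It remains to return to the weight
  \<open>r\<close>: on \<open>\<Omega>\<close> the function \<open>f^2\<close> is at most its supremum, and off \<open>\<Omega>\<close> it is at most \<open>||g|| r f^2\<close>
  (mass_bound). Hence \<open>\<integral> f^2 \<le> \<mu>(\<Omega>) \<beta> \<integral> f^2 + ||g|| \<integral> r f^2\<close>, and solving for \<open>\<integral> f^2\<close> proves
  form_lower_bound.

  That the spectrum has a minimum, and that it is the infimum of the Rayleigh quotients, amounts to
  the self-adjointness of \<open>T\<close>. The same inequalities on intervals of length at least one, with some
  constant in place of the sharp one (interval_bounds), make the form coercive after adding a
  multiple \<open>\<Lambda>\<close> of the weighted scalar product. Minimisation of the associated functional
  (Riesz_by_minimization) then solves \<open>(T + \<Lambda>) f = h\<close> weakly, and the argument of du Bois-Reymond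
  shows that a weak solution lies in the maximal domain (weak_solution, weak_solution_regular).
  Conversely, if \<open>(T + \<Lambda>) f = 0\<close> and \<open>v = p f'\<close>, then integration by parts shows that \<open>v f\<close> grows by
  at least \<open>\<integral> r f^2\<close> over every interval of length at least one. If \<open>v f\<close> were positive somewhere, it
  would be positive on a right half-line; \<open>f^2\<close> would then be increasing there, which contradicts
  \<open>f \<in> L^2\<close>, and similarly for negative values. So \<open>f = 0\<close> (kernel_trivial). Hence every
  element of the maximal domain is one of the form solutions, \<open>T\<close> is symmetric, and \<open>(T f, f)\<close> is the
  value of the form at \<open>f\<close> (SL_rel_form, SL_symmetric, SL_lower_bound).

  Let \<open>m\<close> be the infimum of the Rayleigh quotients. For symmetric \<open>T\<close> the norm of \<open>(T - z) f\<close> is at least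
  \<open>\<delta>\<close> times the norm of \<open>f\<close>, where \<open>\<delta>\<close> is the distance of \<open>z\<close> from \<open>[m, \<infinity>)\<close> (resolvent_estimate), and a
  contraction argument transports surjectivity of \<open>T - w\<close> to that of \<open>T - z\<close> if \<open>|z - w| < \<delta>\<close>
  (onto_at_step). Walking from \<open>-\<Lambda>\<close> in small steps one reaches every \<open>z\<close> outside \<open>[m, \<infinity>)\<close>. The point
  \<open>m\<close> itself belongs to the spectrum by the Cauchy--Schwarz inequality for the nonnegative form of
  \<open>T - m\<close> (minimum_in_spectrum).
  Since the coefficients are real, most of the work concerns real functions, and a complex function
  enters through its real and imaginary part.

  Absolute continuity is given by the \<open>\<epsilon>\<close>-\<open>\<delta>\<close> condition, so the proof rests on the fact that an
  absolutely continuous function is the indefinite integral of its derivative. Its variation function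
  \<open>V\<close> is again absolutely continuous; \<open>V\<close> and \<open>V - f\<close> are increasing, the measures that they
  define are absolutely continuous, and the theorem of Radon and Nikodym provides densities, which are
  identified by Lebesgue differentiation.
\<close>

section \<open>Absolutely continuous functions have bounded variation\<close>

text \<open>Families of intervals are lists, and degenerate intervals are allowed: clipping the members of a
  family at a point and concatenating families on adjacent intervals then need no case distinctions.\<close>
definition nonoverlapping :: "real \<Rightarrow> real \<Rightarrow> (real \<times> real) list \<Rightarrow> bool" where
  "nonoverlapping a b xs \<longleftrightarrow> (\<forall>(c, d)\<in>set xs. a \<le> c \<and> c \<le> d \<and> d \<le> b) \<and>
     sorted_wrt (\<lambda>(c, d) (c', d'). {c<..<d} \<inter> {c'<..<d'} = {}) xs"

definition osc :: "(real \<Rightarrow> real) \<Rightarrow> (real \<times> real) list \<Rightarrow> real" where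
  "osc f xs = (\<Sum>(c, d)\<leftarrow>xs. \<bar>f d - f c\<bar>)"

abbreviation total_length :: "(real \<times> real) list \<Rightarrow> real" where
  "total_length \<equiv> osc (\<lambda>x. x)"

definition AC_list :: "real \<Rightarrow> real \<Rightarrow> (real \<Rightarrow> real) \<Rightarrow> bool" where
  "AC_list a b f \<longleftrightarrow> (\<forall>\<epsilon>>0. \<exists>\<delta>>0. \<forall>xs. nonoverlapping a b xs \<and> total_length xs < \<delta> \<longrightarrow> osc f xs < \<epsilon>)"

lemma AC_listD:
  assumes "AC_list a b f" "0 < e"
  obtains \<delta> where "\<delta> > 0" "\<And>xs. nonoverlapping a b xs \<Longrightarrow> total_length xs < \<delta> \<Longrightarrow> osc f xs < e"
  using assms unfolding AC_list_def by blast

lemma osc_simps [simp]: "osc f [] = 0" "osc f ((c, d) # xs) = \<bar>f d - f c\<bar> + osc f xs"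
  "osc f (xs @ ys) = osc f xs + osc f ys"
  by (auto simp: osc_def)

lemma osc_nonneg: "0 \<le> osc f xs"
  by (induction xs) auto

lemma nonoverlapping_Nil [simp]: "nonoverlapping a b []"
  by (simp add: nonoverlapping_def)

lemma nonoverlapping_Cons:
  "nonoverlapping a b ((c, d) # xs) \<longleftrightarrow> a \<le> c \<and> c \<le> d \<and> d \<le> b \<and> nonoverlapping a b xs \<and>
     (\<forall>(c', d')\<in>set xs. {c<..<d} \<inter> {c'<..<d'} = {})"
  unfolding nonoverlapping_def by auto

lemma nonoverlapping_append:
  "nonoverlapping a b (xs @ ys) \<longleftrightarrow> nonoverlapping a b xs \<and> nonoverlapping a b ys \<and>
     (\<forall>(c, d)\<in>set xs. \<forall>(c', d')\<in>set ys. {c<..<d} \<inter> {c'<..<d'} = {})"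
  unfolding nonoverlapping_def sorted_wrt_append by (auto simp: case_prod_unfold)

lemma nonoverlapping_mono:
  "nonoverlapping a b xs \<Longrightarrow> a' \<le> a \<Longrightarrow> b \<le> b' \<Longrightarrow> nonoverlapping a' b' xs"
  unfolding nonoverlapping_def by fastforce

text \<open>Degenerate members of a list contribute nothing to either sum. After their removal the list is
  distinct, so that the sums over the list are sums over its set of entries.\<close>
lemma AC_imp_AC_list:
  assumes "abs_cont_on_interval a b (\<lambda>x. complex_of_real (f x))"
  shows "AC_list a b f"
  unfolding AC_list_def
proof (intro allI impI)
  fix e :: real assume "e > 0"
  from assms[unfolded abs_cont_on_interval_def, rule_format, OF this]
  obtain \<delta> where \<delta>: "\<delta> > 0"
    and *: "\<forall>I :: (real \<times> real) set. finite I \<and> (\<forall>(c, d)\<in>I. a \<le> c \<and> c < d \<and> d \<le> b) \<and>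
        pairwise (\<lambda>(c, d) (c', d'). {c<..<d} \<inter> {c'<..<d'} = {}) I \<and>
        (\<Sum>(c, d)\<in>I. d - c) < \<delta> \<longrightarrow> (\<Sum>(c, d)\<in>I. cmod (complex_of_real (f d) - complex_of_real (f c))) < e"
    by (elim exE conjE) (rule that)
  have "osc f xs < e" if xs: "nonoverlapping a b xs" "total_length xs < \<delta>" for xs
  proof -
    define ys where "ys = filter (\<lambda>(c, d). c < d) xs"
    have osc_eq: "osc h xs = osc h ys" if "nonoverlapping a b xs" for h
      using that unfolding ys_def
    proof (induction xs)
      case (Cons y xs) then show ?case
        by (cases y) (auto simp: nonoverlapping_Cons)
    qed auto
    have ys: "nonoverlapping a b ys" "\<forall>(c, d)\<in>set ys. c < d"
      using xs(1) unfolding nonoverlapping_def ys_def by (auto intro: sorted_wrt_filter)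
    have "distinct ys \<and> pairwise (\<lambda>(c, d) (c', d'). {c<..<d} \<inter> {c'<..<d'} = {}) (set ys)"
      using ys
    proof (induction ys)
      case (Cons y ys)
      obtain c d where y: "y = (c, d)" by force
      have "(c, d) \<notin> set ys" 
      proof
        assume "(c, d) \<in> set ys"
        then have "{c<..<d} \<inter> {c<..<d} = {}" using Cons.prems y nonoverlapping_Cons by fastforce
        then show False using Cons.prems y by auto
      qed
      moreover have "distinct ys" "pairwise (\<lambda>(c, d) (c', d'). {c<..<d} \<inter> {c'<..<d'} = {}) (set ys)"
        using Cons y by (auto simp: nonoverlapping_Cons)
      moreover have "\<forall>(c', d')\<in>set ys. {c<..<d} \<inter> {c'<..<d'} = {}"
        using Cons.prems y nonoverlapping_Cons by fastforce
      ultimately show ?case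
        unfolding y by (fastforce simp: pairwise_insert)
    qed auto
    then have d: "distinct ys" and pw: "pairwise (\<lambda>(c, d) (c', d'). {c<..<d} \<inter> {c'<..<d'} = {}) (set ys)"
      by auto
    have os: "osc h ys = (\<Sum>(c, d)\<in>set ys. \<bar>h d - h c\<bar>)" for h
      unfolding osc_def using d by (rule sum_list_distinct_conv_sum_set)
    have "(\<Sum>(c, d)\<in>set ys. cmod (complex_of_real (f d) - complex_of_real (f c))) < e"
    proof (rule *[rule_format], intro conjI)
      show "\<forall>(c, d)\<in>set ys. a \<le> c \<and> c < d \<and> d \<le> b"
        using ys unfolding nonoverlapping_def by fastforce
      have "(\<Sum>(c, d)\<in>set ys. d - c) = (\<Sum>(c, d)\<in>set ys. \<bar>d - c\<bar>)"
        by (rule sum.cong) (use ys in auto)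
      also have "\<dots> = total_length xs" using os[of "\<lambda>x. x"] osc_eq[of "\<lambda>x. x"] xs by simp
      finally show "(\<Sum>(c, d)\<in>set ys. d - c) < \<delta>" using xs by simp
    qed (use pw in auto)
    also have "(\<Sum>(c, d)\<in>set ys. cmod (complex_of_real (f d) - complex_of_real (f c))) = osc f ys"
      unfolding os by (rule sum.cong) (auto simp flip: of_real_diff)
    finally show ?thesis using osc_eq xs by simp
  qed
  then show "\<exists>\<delta>>0. \<forall>xs. nonoverlapping a b xs \<and> total_length xs < \<delta> \<longrightarrow> osc f xs < e" using \<delta> by auto
qed

lemma total_length_emeasure:
  assumes "nonoverlapping a b xs"
  shows "ennreal (total_length xs) = emeasure lborel (\<Union>(c, d)\<in>set xs. {c<..<d})"
  using assms
proof (induction xs)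
  case (Cons y xs)
  obtain c d where y: "y = (c, d)" by force
  have "emeasure lborel (\<Union>(c, d)\<in>set (y # xs). {c<..<d}) = 
     emeasure lborel ({c<..<d} \<union> (\<Union>(c, d)\<in>set xs. {c<..<d}))"
    by (simp add: y)
  also have "\<dots> = emeasure lborel {c<..<d} + emeasure lborel (\<Union>(c, d)\<in>set xs. {c<..<d})"
    by (rule plus_emeasure[symmetric]) (use Cons.prems y in \<open>fastforce simp: nonoverlapping_Cons disjoint_iff\<close>)+
  also have "\<dots> = ennreal (d - c) + ennreal (total_length xs)"
    using Cons y by (auto simp: nonoverlapping_Cons)
  also have "\<dots> = ennreal (total_length (y # xs))"
    using Cons.prems by (simp add: y ennreal_plus[symmetric] osc_nonneg nonoverlapping_Cons del: ennreal_plus)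
  finally show ?case by simp
qed auto

lemma total_length_le:
  assumes "nonoverlapping a b xs" "a \<le> b"
  shows "total_length xs \<le> b - a"
proof -
  have "ennreal (total_length xs) \<le> emeasure lborel {a..b}"
    unfolding total_length_emeasure[OF assms(1)]
    by (rule emeasure_mono) (use assms(1) in \<open>fastforce simp: nonoverlapping_def\<close>)+
  then show ?thesis using assms(2) by (simp add: ennreal_le_iff)
qed

definition clip_left :: "real \<Rightarrow> (real \<times> real) list \<Rightarrow> (real \<times> real) list" where
  "clip_left t = map (\<lambda>(c, d). (min c t, min d t))"

definition clip_right :: "real \<Rightarrow> (real \<times> real) list \<Rightarrow> (real \<times> real) list" where
  "clip_right t = map (\<lambda>(c, d). (max c t, max d t))"

text \<open>Cutting each interval at \<open>t\<close> distributes a family over the two parts of \<open>[a,b]\<close>; by the triangle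
  inequality the oscillation can only grow.\<close>
lemma nonoverlapping_clip:
  assumes "nonoverlapping a b xs" "a \<le> t" "t \<le> b"
  shows "nonoverlapping a t (clip_left t xs)" "nonoverlapping t b (clip_right t xs)"
    "osc f xs \<le> osc f (clip_left t xs) + osc f (clip_right t xs)"
proof -
  have dis: "{min c t<..<min d t} \<inter> {min c' t<..<min d' t} = {} \<and> {max c t<..<max d t} \<inter> {max c' t<..<max d' t} = {}"
    if "{c<..<d} \<inter> {c'<..<d'} = {}" for c d c' d' :: real
    using that by (auto simp: min_def max_def disjoint_iff)
  show "nonoverlapping a t (clip_left t xs)" "nonoverlapping t b (clip_right t xs)"
    using assms unfolding nonoverlapping_def clip_left_def clip_right_def sorted_wrt_map
    by (auto simp: case_prod_unfold dis elim!: sorted_wrt_mono_rel[rotated])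
  show "osc f xs \<le> osc f (clip_left t xs) + osc f (clip_right t xs)"
  proof (induction xs)
    case (Cons y xs)
    obtain c d where y: "y = (c, d)" by force
    have "\<bar>f d - f c\<bar> \<le> \<bar>f (min d t) - f (min c t)\<bar> + \<bar>f (max d t) - f (max c t)\<bar>"
      by (auto simp: min_def max_def)
    then show ?case using Cons y by (auto simp: clip_left_def clip_right_def)
  qed (auto simp: clip_left_def clip_right_def)
qed

text \<open>On an interval shorter than the \<open>\<delta>\<close> that belongs to \<open>\<epsilon> = 1\<close> every oscillation is at most one,
  and bounds on adjacent intervals add up. Bisection extends this to \<open>[a,b]\<close>.\<close>
lemma AC_list_bounded_variation:
  assumes "AC_list a b f" "a \<le> b"
  shows "\<exists>B. \<forall>xs. nonoverlapping a b xs \<longrightarrow> osc f xs \<le> B"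
proof -
  obtain \<delta> where \<delta>: "\<delta> > 0" "\<And>xs. nonoverlapping a b xs \<Longrightarrow> total_length xs < \<delta> \<Longrightarrow> osc f xs < 1"
    using AC_listD[OF assms(1) zero_less_one] by blast
  \<comment> \<open>The induction concerns arbitrary intervals \<open>[u,v]\<close>, which may leave \<open>[a,b]\<close>.\<close>
  define P where "P u v \<longleftrightarrow> (\<exists>B. \<forall>xs. nonoverlapping (max a u) (min b v) xs \<longrightarrow> osc f xs \<le> B)" for u v
  have "P a b"
    using \<open>a \<le> b\<close>
  proof (induction rule: Bolzano)
    case (trans x y z)
    from trans obtain B1 where B1: "\<And>xs. nonoverlapping (max a x) (min b y) xs \<Longrightarrow> osc f xs \<le> B1" unfolding P_def by auto
    from trans obtain B2 where B2: "\<And>xs. nonoverlapping (max a y) (min b z) xs \<Longrightarrow> osc f xs \<le> B2" unfolding P_def by auto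
    have nn: "0 \<le> B1" "0 \<le> B2" using B1[of "[]"] B2[of "[]"] by auto
    have "osc f xs \<le> B1 + B2" if xs: "nonoverlapping (max a x) (min b z) xs" for xs
    proof (cases "max a x \<le> y \<and> y \<le> min b z")
      case True
      then have "min b y = y" "max a y = y" by auto
      with True show ?thesis
        using nonoverlapping_clip(1,2)[OF xs, of y] nonoverlapping_clip(3)[OF xs, of y f]
          B1[of "clip_left y xs"] B2[of "clip_right y xs"] by auto
    next
      case False
      then consider "y < a" | "y > b" using trans by force
      then show ?thesis
      proof cases
        case 1
        then have "nonoverlapping (max a y) (min b z) xs" using xs trans by (auto intro: nonoverlapping_mono)
        then show ?thesis using B2 nn by fastforce
      next
        case 2
        then have "nonoverlapping (max a x) (min b y) xs" using xs trans by (auto intro: nonoverlapping_mono)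
        then show ?thesis using B1 nn by fastforce
      qed
    qed
    then show ?case unfolding P_def by blast
  next
    case (local x)
    have "osc f xs \<le> 1" if "u \<le> x" "x \<le> v" "v - u < \<delta>" "nonoverlapping (max a u) (min b v) xs" for u v xs
    proof -
      have "nonoverlapping a b xs" using that(4) by (rule nonoverlapping_mono) auto
      moreover have "total_length xs \<le> min b v - max a u"
        using total_length_le[OF that(4)] that local by auto
      ultimately show ?thesis using \<delta>(2)[of xs] that by (auto simp: min_def max_def split: if_splits)
    qed
    then show ?case using \<delta> unfolding P_def by blast
  qed
  then show ?thesis by (simp add: P_def)
qed

definition variation :: "(real \<Rightarrow> real) \<Rightarrow> real \<Rightarrow> real \<Rightarrow> real" where
  "variation f x y = Sup (osc f ` {xs. nonoverlapping x y xs})"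

context
  fixes a b :: real and f :: "real \<Rightarrow> real"
  assumes ac: "AC_list a b f" and ab: "a \<le> b"
begin

lemma osc_le_variation:
  assumes "a \<le> x" "y \<le> b" "nonoverlapping x y xs"
  shows "osc f xs \<le> variation f x y"
proof -
  obtain B where "\<And>xs. nonoverlapping a b xs \<Longrightarrow> osc f xs \<le> B"
    using AC_list_bounded_variation[OF ac ab] by auto
  then have "bdd_above (osc f ` {xs. nonoverlapping x y xs})"
    using assms nonoverlapping_mono unfolding bdd_above_def by blast
  then show ?thesis unfolding variation_def using assms by (auto intro!: cSup_upper)
qed

lemma variation_le:
  assumes "\<And>xs. nonoverlapping x y xs \<Longrightarrow> osc f xs \<le> B"
  shows "variation f x y \<le> B"
  unfolding variation_def by (rule cSup_least) (use assms nonoverlapping_Nil[of x y] in blast)+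

lemma variation_approx:
  assumes "e > 0"
  obtains xs where "nonoverlapping x y xs" "variation f x y < osc f xs + e"
proof -
  have "\<not> (\<forall>xs. nonoverlapping x y xs \<longrightarrow> osc f xs \<le> variation f x y - e)"
    using variation_le[of x y "variation f x y - e"] assms by auto
  then show ?thesis using that by (meson add_strict_right_mono linorder_not_le less_diff_eq diff_less_eq)
qed

lemma variation_add:
  assumes "a \<le> x" "x \<le> y" "y \<le> z" "z \<le> b"
  shows "variation f x z = variation f x y + variation f y z"
proof (rule antisym)
  show "variation f x z \<le> variation f x y + variation f y z"
  proof (rule variation_le)
    fix xs assume xs: "nonoverlapping x z xs"
    show "osc f xs \<le> variation f x y + variation f y z"
      using nonoverlapping_clip(1,2)[OF xs assms(2,3)] nonoverlapping_clip(3)[OF xs assms(2,3), of f]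
        osc_le_variation[of x y "clip_left y xs"] osc_le_variation[of y z "clip_right y xs"] assms by linarith
  qed
  show "variation f x y + variation f y z \<le> variation f x z"
  proof (rule field_le_epsilon)
    fix e :: real assume "e > 0"
    then obtain xs ys where xs: "nonoverlapping x y xs" "variation f x y < osc f xs + e / 2"
      and ys: "nonoverlapping y z ys" "variation f y z < osc f ys + e / 2"
      by (metis half_gt_zero variation_approx)
    have "nonoverlapping x z (xs @ ys)"
      unfolding nonoverlapping_append
    proof (intro conjI)
      show "\<forall>(c, d)\<in>set xs. \<forall>(c', d')\<in>set ys. {c<..<d} \<inter> {c'<..<d'} = {}"
        using xs(1) ys(1) unfolding nonoverlapping_def by fastforce
    qed (use xs ys assms nonoverlapping_mono in blast)+
    from osc_le_variation[OF _ _ this] show "variation f x y + variation f y z \<le> variation f x z + e"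
      using xs ys assms by simp
  qed
qed

lemma variation_ge: "a \<le> x \<Longrightarrow> x \<le> y \<Longrightarrow> y \<le> b \<Longrightarrow> \<bar>f y - f x\<bar> \<le> variation f x y"
  using osc_le_variation[of x y "[(x, y)]"] by (simp add: nonoverlapping_Cons)

text \<open>Each interval of a family can be refined until the oscillation of \<open>f\<close> on it nearly exhausts the
  variation. The refined family is no longer than the original one, so the \<open>\<delta>\<close> of \<open>f\<close> for \<open>\<epsilon>/2\<close>
  serves for the variation function.\<close>
lemma AC_list_variation: "AC_list a b (variation f a)"
  unfolding AC_list_def
proof (intro allI impI)
  fix e :: real assume "e > 0"
  then have "0 < e / 2" by simp
  then obtain \<delta> where \<delta>: "\<delta> > 0" "\<And>xs. nonoverlapping a b xs \<Longrightarrow> total_length xs < \<delta> \<Longrightarrow> osc f xs < e / 2"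
    using AC_listD[OF ac] by blast
  have refine: "\<exists>ys. nonoverlapping a b ys \<and> total_length ys \<le> total_length xs \<and>
      (\<Union>(c, d)\<in>set ys. {c<..<d}) \<subseteq> (\<Union>(c, d)\<in>set xs. {c<..<d}) \<and> osc (variation f a) xs \<le> osc f ys + \<eta>"
    if "nonoverlapping a b xs" "\<eta> > 0" for xs \<eta>
    using that
  proof (induction xs arbitrary: \<eta>)
    case Nil
    then show ?case by (intro exI[of _ "[]"]) auto
  next
    case (Cons y xs)
    obtain c d where y: "y = (c, d)" by force
    have cd: "a \<le> c" "c \<le> d" "d \<le> b" "nonoverlapping a b xs"
      and dis: "\<forall>(c', d')\<in>set xs. {c<..<d} \<inter> {c'<..<d'} = {}"
      using Cons.prems y by (auto simp: nonoverlapping_Cons)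
    obtain ys where ys: "nonoverlapping a b ys" "total_length ys \<le> total_length xs"
      "(\<Union>(c, d)\<in>set ys. {c<..<d}) \<subseteq> (\<Union>(c, d)\<in>set xs. {c<..<d})" "osc (variation f a) xs \<le> osc f ys + \<eta>/2"
      using Cons.IH[OF cd(4), of "\<eta>/2"] Cons.prems by auto
    obtain zs where zs: "nonoverlapping c d zs" "variation f c d < osc f zs + \<eta>/2"
      using Cons.prems by (metis half_gt_zero variation_approx)
    have sub: "(\<Union>(c, d)\<in>set zs. {c<..<d}) \<subseteq> {c<..<d}"
      using zs(1) unfolding nonoverlapping_def by fastforce
    have "(\<Union>(c, d)\<in>set zs. {c<..<d}) \<inter> (\<Union>(c, d)\<in>set ys. {c<..<d}) = {}"
      using sub ys(3) dis by blast
    then have "nonoverlapping a b (zs @ ys)"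
      unfolding nonoverlapping_append using zs(1) ys(1) cd nonoverlapping_mono by blast
    moreover have "total_length (zs @ ys) \<le> total_length (y # xs)"
      using total_length_le[OF zs(1) cd(2)] ys(2) cd by (simp add: y)
    moreover have "(\<Union>(c, d)\<in>set (zs @ ys). {c<..<d}) \<subseteq> (\<Union>(c, d)\<in>set (y # xs). {c<..<d})"
      using sub ys(3) unfolding y by auto
    moreover have "variation f a d - variation f a c = variation f c d"
      using variation_add[of a c d] cd by simp
    then have "osc (variation f a) (y # xs) \<le> osc f (zs @ ys) + \<eta>"
      using zs ys variation_ge[of c d] cd by (simp add: y)
    ultimately show ?case by blast
  qed
  have "osc (variation f a) xs < e" if xs: "nonoverlapping a b xs" "total_length xs < \<delta>" for xs
  proof -
    from refine[OF xs(1), of "e/2"] \<open>e > 0\<close> obtain ys where ys: "nonoverlapping a b ys" "total_length ys \<le> total_length xs"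
      "osc (variation f a) xs \<le> osc f ys + e/2" by auto
    show ?thesis using \<delta>(2)[of ys] ys xs by simp
  qed
  then show "\<exists>\<delta>>0. \<forall>xs. nonoverlapping a b xs \<and> total_length xs < \<delta> \<longrightarrow> osc (variation f a) xs < e"
    using \<delta> by blast
qed

end

lemma AC_list_diff:
  assumes "AC_list a b f" "AC_list a b g"
  shows "AC_list a b (\<lambda>x. f x - g x)"
  unfolding AC_list_def
proof (intro allI impI)
  fix e :: real assume "e > 0"
  then have e2: "0 < e / 2" by simp
  obtain \<delta>1 where \<delta>1: "\<delta>1 > 0" "\<And>xs. nonoverlapping a b xs \<Longrightarrow> total_length xs < \<delta>1 \<Longrightarrow> osc f xs < e / 2"
    using AC_listD[OF assms(1) e2] by blast
  obtain \<delta>2 where \<delta>2: "\<delta>2 > 0" "\<And>xs. nonoverlapping a b xs \<Longrightarrow> total_length xs < \<delta>2 \<Longrightarrow> osc g xs < e / 2"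
    using AC_listD[OF assms(2) e2] by blast
  have "osc (\<lambda>x. f x - g x) xs \<le> osc f xs + osc g xs" for xs
    by (induction xs) auto
  then have "osc (\<lambda>x. f x - g x) xs < e" if "nonoverlapping a b xs" "total_length xs < min \<delta>1 \<delta>2" for xs
    using \<delta>1(2)[of xs] \<delta>2(2)[of xs] that by (smt (verit, best) field_sum_of_halves)
  then show "\<exists>\<delta>>0. \<forall>xs. nonoverlapping a b xs \<and> total_length xs < \<delta> \<longrightarrow> osc (\<lambda>x. f x - g x) xs < e"
    using \<delta>1 \<delta>2 by (intro exI[of _ "min \<delta>1 \<delta>2"]) auto
qed

section \<open>Absolutely continuous functions have densities\<close>

lemma AC_list_continuous:
  assumes "AC_list a b f"
  shows "continuous_on {a..b} f"
  unfolding continuous_on_iff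
proof (intro ballI allI impI)
  fix x e :: real assume x: "x \<in> {a..b}" and "e > 0"
  then obtain \<delta> where \<delta>: "\<delta> > 0" "\<And>xs. nonoverlapping a b xs \<Longrightarrow> total_length xs < \<delta> \<Longrightarrow> osc f xs < e"
    using AC_listD[OF assms] by blast
  have "dist (f y) (f x) < e" if "y \<in> {a..b}" "dist y x < \<delta>" for y
    using \<delta>(2)[of "[(min x y, max x y)]"] that x
    by (cases "x \<le> y") (auto simp: nonoverlapping_Cons dist_real_def)
  then show "\<exists>d>0. \<forall>y\<in>{a..b}. dist y x < d \<longrightarrow> dist (f y) (f x) < e" using \<delta>(1) by blast
qed

lemma distinct_pairwise_sorted_wrt:
  assumes "distinct xs" "pairwise R (set xs)"
  shows "sorted_wrt R xs"
  using assms by (induction xs) (auto simp: pairwise_insert)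

text \<open>A null set has an open neighbourhood \<open>U\<close> of small measure, and it is covered by countably many
  nonoverlapping intervals contained in \<open>U\<close>. Any finitely many of these have total length less than \<open>\<delta>\<close>,
  hence small measure under \<open>M\<close>, and continuity from below passes to all of them.\<close>
lemma mono_AC_list_null_set:
  fixes F :: "real \<Rightarrow> real"
  assumes ab: "a < b" and ac: "AC_list a b F" 
    and sets: "sets M = sets borel"
    and M: "\<And>c d. a \<le> c \<Longrightarrow> c \<le> d \<Longrightarrow> d \<le> b \<Longrightarrow> emeasure M {c..d} = ennreal \<bar>F d - F c\<bar>"
    and N: "N \<in> null_sets lborel" "N \<subseteq> {a..b}"
  shows "emeasure M N = 0"
proof -
  have "emeasure M N \<le> 0 + ennreal e" if "e > 0" for e
  proof -
    obtain \<delta> where \<delta>: "\<delta> > 0" "\<And>xs. nonoverlapping a b xs \<Longrightarrow> total_length xs < \<delta> \<Longrightarrow> osc F xs < e"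
      using AC_listD[OF ac \<open>e > 0\<close>] by blast
    have Nb: "N \<in> sets borel" "emeasure lborel N = 0" using N(1) by (auto simp: null_sets_def)
    obtain U where U: "open U" "N \<subseteq> U" "emeasure lborel (U - N) < \<delta>"
      using outer_regular_lborel[OF Nb(1) \<delta>(1)] by blast
    have "emeasure lborel U = emeasure lborel (U - N)"
      using U(1) Nb N(1) by (intro emeasure_Diff_null_set[symmetric]) auto
    with U have emU: "emeasure lborel U < \<delta>" by simp
    \<comment> \<open>this gauge forces the intervals of the covering lemma to stay in \<open>U\<close>\<close>
    define g where "g x = (if x \<in> U then U else UNIV)" for x
    have "gauge g" unfolding gauge_def g_def using U by auto
    have Nc: "N \<subseteq> cbox a b" "box a b \<noteq> {}" using N ab by auto
    show ?thesis
    proof (rule covering_lemma[OF Nc \<open>gauge g\<close>])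
    fix \<D> :: "real set set" assume \<D>: "countable \<D>" "\<Union>\<D> \<subseteq> cbox a b"
      "\<And>K. K \<in> \<D> \<Longrightarrow> interior K \<noteq> {} \<and> (\<exists>c d. K = cbox c d)"
      "pairwise (\<lambda>A B. interior A \<inter> interior B = {}) \<D>"
      "\<And>K. K \<in> \<D> \<Longrightarrow> \<exists>x \<in> N \<inter> K. K \<subseteq> g x"
      "\<And>u v. cbox u v \<in> \<D> \<Longrightarrow> \<exists>n. \<forall>i \<in> Basis. v \<bullet> i - u \<bullet> i = (b \<bullet> i - a \<bullet> i) / 2^n"
      "N \<subseteq> \<Union>\<D>"
    have KU: "K \<subseteq> U" if "K \<in> \<D>" for K
      using \<D>(5)[OF that] U(2) by (force simp: g_def)
    have K: "Inf K < Sup K \<and> K = {Inf K..Sup K} \<and> interior K = {Inf K<..<Sup K}" if "K \<in> \<D>" for K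
    proof -
      have "interior K \<noteq> {} \<and> (\<exists>c d. K = cbox c d)" using \<D>(3) that by blast
      then obtain c d where "K = {c..d}" "interior K \<noteq> {}" by auto
      then show ?thesis by auto
    qed
    have Kab: "a \<le> Inf K \<and> Sup K \<le> b" if "K \<in> \<D>" for K
    proof -
      have "Inf K \<in> K" "Sup K \<in> K" using K[OF that] by (metis atLeastAtMost_iff less_imp_le order_refl)+
      then show ?thesis using \<D>(2) that by (auto simp: subset_iff)
    qed
    have list_bound: "emeasure M (\<Union>(c, d)\<in>set xs. {c..d}) \<le> ennreal (osc F xs)" if "nonoverlapping a b xs" for xs
      using that
    proof (induction xs)
      case (Cons y xs)
      obtain c d where y: "y = (c, d)" by force
      have "emeasure M (\<Union>(c, d)\<in>set (y # xs). {c..d}) = emeasure M ({c..d} \<union> (\<Union>(c, d)\<in>set xs. {c..d}))"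
        by (simp add: y)
      also have "\<dots> \<le> emeasure M {c..d} + emeasure M (\<Union>(c, d)\<in>set xs. {c..d})"
        by (rule emeasure_subadditive) (auto simp: sets)
      also have "\<dots> \<le> ennreal \<bar>F d - F c\<bar> + ennreal (osc F xs)"
        using Cons y M[of c d] by (intro add_mono) (auto simp: nonoverlapping_Cons)
      also have "\<dots> = ennreal (osc F (y # xs))"
        by (simp add: y osc_nonneg ennreal_plus[symmetric] del: ennreal_plus)
      finally show ?case .
    qed auto
    have fin: "emeasure M (\<Union>\<D>0) \<le> ennreal e" if "finite \<D>0" "\<D>0 \<subseteq> \<D>" for \<D>0
    proof -
      obtain Ks where Ks: "set Ks = \<D>0" "distinct Ks" using finite_distinct_list \<open>finite \<D>0\<close> by blast
      define xs where "xs = map (\<lambda>K. (Inf K, Sup K)) Ks"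
      have "sorted_wrt (\<lambda>A B. interior A \<inter> interior B = {}) Ks"
        using Ks that \<D>(4) by (intro distinct_pairwise_sorted_wrt) (auto intro: pairwise_subset)
      then have sw: "sorted_wrt (\<lambda>A B. {Inf A<..<Sup A} \<inter> {Inf B<..<Sup B} = {}) Ks"
        by (rule sorted_wrt_mono_rel[rotated]) (use K Ks that in \<open>auto simp: subset_iff\<close>)
      have no: "nonoverlapping a b xs"
        unfolding nonoverlapping_def xs_def sorted_wrt_map
        using sw K Kab Ks that by (auto simp: less_imp_le subset_iff)
      have "(\<Union>(c, d)\<in>set xs. {c<..<d}) \<subseteq> U"
        using K KU Ks that unfolding xs_def by fastforce
      then have "ennreal (total_length xs) \<le> emeasure lborel U"
        unfolding total_length_emeasure[OF no] using U(1) by (intro emeasure_mono) auto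
      with emU have "ennreal (total_length xs) < ennreal \<delta>" by (rule order_le_less_trans[rotated])
      then have "total_length xs < \<delta>" by (simp add: ennreal_less_iff osc_nonneg)
      then have "osc F xs < e" using \<delta> no by blast
      moreover have "(\<Union>(c, d)\<in>set xs. {c..d}) = \<Union>\<D>0"
      proof -
        have "(\<Union>(c, d)\<in>set xs. {c..d}) = (\<Union>K\<in>\<D>0. {Inf K..Sup K})"
          unfolding xs_def using Ks by auto
        also have "\<dots> = (\<Union>K\<in>\<D>0. K)"
          using K that by (intro SUP_cong refl) auto
        finally show ?thesis by simp
      qed
      ultimately show ?thesis using list_bound[OF no] by (metis ennreal_leI less_imp_le order_trans)
    qed
    have "emeasure M (\<Union>\<D>) \<le> ennreal e"
    proof (cases "\<D> = {}")
      case False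
      define A where "A n = \<Union>(from_nat_into \<D> ` {..n})" for n :: nat
      have AD: "from_nat_into \<D> ` {..n} \<subseteq> \<D>" for n :: nat
        using False from_nat_into by blast
      have Ub: "\<Union>\<D>0 \<in> sets M" if "\<D>0 \<subseteq> \<D>" "countable \<D>0" for \<D>0
      proof -
        have "K \<in> sets M" if "K \<in> \<D>0" for K
          using K[of K] \<open>\<D>0 \<subseteq> \<D>\<close> that sets by (metis subset_iff atLeastAtMost_borel)
        then show ?thesis using that by (intro sets.countable_Union) auto
      qed
      have "(SUP n. emeasure M (A n)) = emeasure M (\<Union>n. A n)"
      proof (rule SUP_emeasure_incseq)
        show "range A \<subseteq> sets M" unfolding A_def using AD Ub by blast
        show "incseq A" unfolding A_def incseq_def by fastforce
      qed
      moreover have "(\<Union>n. A n) = \<Union>\<D>"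
      proof -
        have "(\<Union>n. A n) = \<Union>(range (from_nat_into \<D>))" unfolding A_def by blast
        then show ?thesis using range_from_nat_into[OF False \<D>(1)] by simp
      qed
      moreover have "(SUP n. emeasure M (A n)) \<le> ennreal e"
        by (rule SUP_least) (use fin AD in \<open>auto simp: A_def\<close>)
      ultimately show ?thesis by simp
    qed auto
    moreover have "emeasure M N \<le> emeasure M (\<Union>\<D>)"
    proof (rule emeasure_mono[OF \<D>(7)])
      have "K \<in> sets M" if "K \<in> \<D>" for K
        using K[OF that] sets by (metis atLeastAtMost_borel)
      then show "\<Union>\<D> \<in> sets M" using \<D>(1) by auto
    qed
    ultimately show "emeasure M N \<le> 0 + ennreal e" by simp
    qed
  qed
  then have "emeasure M N \<le> 0" by (rule ennreal_le_epsilon)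
  then show ?thesis by simp
qed

text \<open>The Lebesgue--Stieltjes measure of an increasing absolutely continuous function vanishes on null
  sets, so it has a Radon--Nikodym density.\<close>
lemma mono_AC_list_density:
  fixes F :: "real \<Rightarrow> real"
  assumes ab: "a < b" and ac: "AC_list a b F" 
    and mono: "\<And>x y. a \<le> x \<Longrightarrow> x \<le> y \<Longrightarrow> y \<le> b \<Longrightarrow> F x \<le> F y"
  shows "\<exists>d. set_integrable lebesgue {a..b} d \<and>
     (\<forall>x y. a \<le> x \<longrightarrow> x \<le> y \<longrightarrow> y \<le> b \<longrightarrow> (LINT t:{x..y}|lebesgue. d t) = F y - F x)"
proof -
  \<comment> \<open>The interval measure needs a function that is increasing on the whole line.\<close>
  define G where "G x = F (max a (min b x))" for x
  have monoG: "x \<le> y \<Longrightarrow> G x \<le> G y" for x y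
    unfolding G_def using ab by (intro mono) auto
  have contG: "continuous_on UNIV G" unfolding G_def
    by (rule continuous_on_compose2[OF AC_list_continuous[OF ac]]) (use ab in \<open>auto intro!: continuous_intros\<close>)
  define M where "M = density (interval_measure G) (indicator {a..b})"
  have setsM: "sets M = sets borel" by (simp add: M_def)
  have M: "emeasure M {c..d} = ennreal (F d - F c)" if "a \<le> c" "c \<le> d" "d \<le> b" for c d
  proof -
    have "{a..b} \<inter> {c..d} = {c..d}" using that by auto
    then have "emeasure M {c..d} = emeasure (interval_measure G) {c..d}"
      unfolding M_def by (subst emeasure_density) (auto simp: indicator_inter_arith[symmetric])
    also have "\<dots> = ennreal (G d - G c)"
      by (rule emeasure_interval_measure_Icc) (use that monoG contG in auto)
    also have "G d - G c = F d - F c" using that by (simp add: G_def)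
    finally show ?thesis .
  qed
  have UN: "emeasure M N = emeasure M (N \<inter> {a..b})" if "N \<in> sets borel" for N :: "real set"
    unfolding M_def using that by (auto simp: emeasure_density indicator_inter_arith intro!: nn_integral_cong split: split_indicator)
  have "absolutely_continuous lborel M"
    unfolding absolutely_continuous_def
  proof
    fix N :: "real set" assume N: "N \<in> null_sets lborel"
    then have "N \<inter> {a..b} \<in> null_sets lborel"
      by (metis atLeastAtMost_borel null_set_Int2 sets_lborel inf_commute)
    then have "emeasure M (N \<inter> {a..b}) = 0"
      using mono by (intro mono_AC_list_null_set[OF ab ac setsM]) (auto simp: M)
    then show "N \<in> null_sets M"
      using N UN[of N] by (auto simp: null_sets_def setsM)
  qed
  then obtain h where h: "h \<in> borel_measurable lborel" "density lborel h = M"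
    using sigma_finite_measure.Radon_Nikodym[OF sigma_finite_lborel, of M] setsM by auto
  have hint: "(\<integral>\<^sup>+x\<in>A. h x \<partial>lborel) = emeasure M A" if "A \<in> sets borel" for A
    using h that by (subst h(2)[symmetric], subst emeasure_density) auto
  have Mtot: "emeasure M UNIV = ennreal (F b - F a)"
    using UN[of UNIV] M[of a b] ab by simp
  have fin: "AE x in lborel. h x \<noteq> \<infinity>"
  proof (rule nn_integral_PInf_AE)
    show "(\<integral>\<^sup>+x. h x \<partial>lborel) \<noteq> \<infinity>" using hint[of UNIV] Mtot by simp
  qed (use h in simp)
  define d where "d x = enn2real (h x)" for x
  have dm: "d \<in> borel_measurable lborel" unfolding d_def using h(1) by measurable
  have ed: "(\<integral>\<^sup>+x\<in>A. ennreal (d x) \<partial>lborel) = emeasure M A" if "A \<in> sets borel" for A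
  proof -
    have "(\<integral>\<^sup>+x\<in>A. ennreal (d x) \<partial>lborel) = (\<integral>\<^sup>+x\<in>A. h x \<partial>lborel)"
      by (rule nn_integral_cong_AE, use fin in eventually_elim) (auto simp: d_def top.not_eq_extremum)
    then show ?thesis using hint[OF that] by simp
  qed
  have hb: "has_bochner_integral lborel (\<lambda>t. indicator {x..y} t *\<^sub>R d t) (F y - F x)"
    if "a \<le> x" "x \<le> y" "y \<le> b" for x y
  proof (rule has_bochner_integral_nn_integral)
    have "(\<integral>\<^sup>+t. ennreal (indicator {x..y} t *\<^sub>R d t) \<partial>lborel) = (\<integral>\<^sup>+t\<in>{x..y}. ennreal (d t) \<partial>lborel)"
      by (rule nn_integral_cong) (auto split: split_indicator)
    then show "(\<integral>\<^sup>+t. ennreal (indicator {x..y} t *\<^sub>R d t) \<partial>lborel) = ennreal (F y - F x)"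
      using ed[of "{x..y}"] M[OF that] by simp
    show "(\<lambda>t. indicator {x..y} t *\<^sub>R d t) \<in> borel_measurable lborel" using dm by measurable
  qed (use mono that in \<open>auto simp: d_def\<close>)
  have set: "set_integrable lebesgue {x..y} d \<and> (LINT t:{x..y}|lebesgue. d t) = F y - F x"
    if "a \<le> x" "x \<le> y" "y \<le> b" for x y
    using hb[OF that] dm unfolding set_integrable_def set_lebesgue_integral_def has_bochner_integral_iff
    by (subst integrable_completion, measurable) (auto simp: integral_completion)
  show ?thesis using set ab by (intro exI[of _ d]) auto
qed

text \<open>Jordan decomposition: both the variation function \<open>V\<close> and \<open>V - f\<close> are increasing and absolutely
  continuous.\<close>
lemma AC_list_density:
  assumes ab: "a < b" and ac: "AC_list a b f" 
  shows "\<exists>d. set_integrable lebesgue {a..b} d \<and>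
     (\<forall>x y. a \<le> x \<longrightarrow> x \<le> y \<longrightarrow> y \<le> b \<longrightarrow> (LINT t:{x..y}|lebesgue. d t) = f y - f x)"
proof -
  define V where "V = variation f a"
  have abl: "a \<le> b" using ab by simp
  have V: "\<bar>f y - f x\<bar> \<le> V y - V x" if "a \<le> x" "x \<le> y" "y \<le> b" for x y
    using variation_add[OF ac abl, of a x y] variation_ge[OF ac abl, of x y] that by (auto simp: V_def)
  have acV: "AC_list a b V" unfolding V_def by (rule AC_list_variation[OF ac abl])
  obtain d1 where d1: "set_integrable lebesgue {a..b} d1"
      "\<And>x y. a \<le> x \<Longrightarrow> x \<le> y \<Longrightarrow> y \<le> b \<Longrightarrow> (LINT t:{x..y}|lebesgue. d1 t) = V y - V x"
    using mono_AC_list_density[OF ab acV] V by (smt (verit))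
  obtain d2 where d2: "set_integrable lebesgue {a..b} d2"
      "\<And>x y. a \<le> x \<Longrightarrow> x \<le> y \<Longrightarrow> y \<le> b \<Longrightarrow> (LINT t:{x..y}|lebesgue. d2 t) = (V y - f y) - (V x - f x)"
    using mono_AC_list_density[OF ab AC_list_diff[OF acV ac]] V by (smt (verit))
  have "set_integrable lebesgue {x..y} d1" "set_integrable lebesgue {x..y} d2" if "a \<le> x" "y \<le> b" for x y
    using d1(1) d2(1) that by (auto elim!: set_integrable_subset)
  then show ?thesis using d1 d2
    by (intro exI[of _ "\<lambda>t. d1 t - d2 t"]) auto
qed

section \<open>Indefinite integrals\<close>

lemma borel_measurable_lebesgue_AE:
  fixes f g :: "real \<Rightarrow> 'b::{topological_space}"
  assumes f: "f \<in> borel_measurable lebesgue" and eq: "AE x in lebesgue. f x = g x"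
  shows "g \<in> borel_measurable lebesgue"
proof (rule measurableI)
  fix A :: "'b set" assume A: "A \<in> sets borel"
  have "f -` A \<inter> space lebesgue \<in> sets lebesgue" using f A by (rule measurable_sets)
  then show "g -` A \<inter> space lebesgue \<in> sets lebesgue"
    by (rule completion.in_sets_AE[rotated]) (use eq in \<open>auto elim!: eventually_mono\<close>)
qed auto

text \<open>The form in which absolute continuity is used throughout. The density is an argument of its own
  because it is determined only up to null sets.\<close>
definition primitive :: "(real \<Rightarrow> 'a::euclidean_space) \<Rightarrow> (real \<Rightarrow> 'a) \<Rightarrow> bool" where
  "primitive d f \<longleftrightarrow> (\<forall>a b. a \<le> b \<longrightarrow>
     set_integrable lebesgue {a..b} d \<and> (LINT t:{a..b}|lebesgue. d t) = f b - f a)"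

text \<open>Lebesgue differentiation is available for the averages over \<open>[x, x+h]\<close> with \<open>h > 0\<close>. Applied to the
  integrand reflected at the origin, it gives the averages to the left of \<open>x\<close> as well.\<close>
lemma indefinite_integral_deriv_AE:
  fixes d :: "real \<Rightarrow> 'a::euclidean_space"
  assumes d: "set_integrable lebesgue {a..b} d"
    and f: "\<And>x y. a \<le> x \<Longrightarrow> x \<le> y \<Longrightarrow> y \<le> b \<Longrightarrow> (LINT t:{x..y}|lebesgue. d t) = f y - f x"
  shows "AE x in lebesgue. x \<in> {a<..<b} \<longrightarrow> (f has_vector_derivative d x) (at x)"
proof -
  define g where "g x = (if x \<in> {a..b} then d x else 0)" for x
  have "d absolutely_integrable_on {a..b}" by (rule d)
  then have "d integrable_on {a..b}" by (rule set_lebesgue_integral_eq_integral)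
  then have "g integrable_on UNIV" unfolding g_def by (simp only: integrable_restrict_UNIV)
  then have g_int: "g integrable_on cbox u v" for u v by (rule integrable_on_subcbox) auto
  then have "(\<lambda>x. g (- x)) integrable_on cbox u v" for u v
    using integrable_reflect[of g "- u" "- v"] by simp
  then obtain N' where N': "negligible N'" "\<And>x e. x \<notin> N' \<Longrightarrow> 0 < e \<Longrightarrow>
      \<exists>\<delta>>0. \<forall>h. 0 < h \<and> h < \<delta> \<longrightarrow> norm (integral (cbox x (x + h *\<^sub>R One)) (\<lambda>x. g (- x)) /\<^sub>R h ^ DIM(real) - g (- x)) < e"
    using integrable_ccontinuous_explicit[of "\<lambda>x. g (- x)"] by metis
  obtain N where N: "negligible N" "\<And>x e. x \<notin> N \<Longrightarrow> 0 < e \<Longrightarrow>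
      \<exists>\<delta>>0. \<forall>h. 0 < h \<and> h < \<delta> \<longrightarrow> norm (integral (cbox x (x + h *\<^sub>R One)) g /\<^sub>R h ^ DIM(real) - g x) < e"
    using integrable_ccontinuous_explicit[of g] g_int by metis
  have int_g: "integral {x..y} g = f y - f x" if "a \<le> x" "x \<le> y" "y \<le> b" for x y
  proof -
    have "d absolutely_integrable_on {x..y}"
      using d by (rule set_integrable_subset) (use that in auto)
    then have "integral {x..y} d = f y - f x"
      using f[OF that] by (simp add: set_lebesgue_integral_eq_integral)
    moreover have "integral {x..y} g = integral {x..y} d"
      by (rule integral_cong) (use that in \<open>auto simp: g_def\<close>)
    ultimately show ?thesis by simp
  qed
  have "negligible (uminus ` N')"
    by (rule negligible_differentiable_image_negligible[OF _ N'(1)]) (auto intro!: derivative_intros)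
  then have "negligible (N \<union> uminus ` N')" using N(1) by auto
  moreover have "(f has_vector_derivative d x) (at x)" if x: "x \<in> {a<..<b}" "x \<notin> N \<union> uminus ` N'" for x
    unfolding has_vector_derivative_def has_derivative_iff_norm
  proof (intro conjI LIM_I)
    show "bounded_linear (\<lambda>h. h *\<^sub>R d x)" by (simp add: bounded_linear_scaleR_left)
    fix e :: real assume e: "e > 0"
    have nrm: "norm (v /\<^sub>R h) = norm v / h" if "0 < h" for v :: 'a and h
      using that by (simp add: divide_inverse mult.commute)
    have gx: "g x = d x" using x by (simp add: g_def)
    have "- x \<notin> N'" using x by force
    then obtain \<delta>1 where \<delta>1: "\<delta>1 > 0" "\<And>h. 0 < h \<Longrightarrow> h < \<delta>1 \<Longrightarrow> norm (integral {-x..-x+h} (\<lambda>x. g (- x)) /\<^sub>R h - d x) < e"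
      using N'(2)[of "-x" e] e gx by auto
    obtain \<delta>2 where \<delta>2: "\<delta>2 > 0" "\<And>h. 0 < h \<Longrightarrow> h < \<delta>2 \<Longrightarrow> norm (integral {x..x+h} g /\<^sub>R h - d x) < e"
      using N(2)[of x e] x e gx by auto
    define \<delta> where "\<delta> = min (min \<delta>1 \<delta>2) (min (b - x) (x - a))"
    have "\<delta> > 0" unfolding \<delta>_def using \<delta>1 \<delta>2 x by auto
    moreover have "norm (norm (f y - f x - (y - x) *\<^sub>R d x) / norm (y - x) - 0) < e"
      if y: "y \<noteq> x \<and> norm (y - x) < \<delta>" for y
    proof (cases "y > x")
      case True
      define h where "h = y - x"
      have h: "h > 0" "h < \<delta>2" "y = x + h" "y \<le> b" using True y by (auto simp: h_def \<delta>_def)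
      have "norm (integral {x..x+h} g /\<^sub>R h - d x) = norm (f y - f x - h *\<^sub>R d x) / h"
      proof -
        have "integral {x..x+h} g /\<^sub>R h - d x = (f y - f x - h *\<^sub>R d x) /\<^sub>R h"
          using int_g[of x y] x h by (simp add: scaleR_right_diff_distrib)
        then show ?thesis using nrm[OF h(1)] by simp
      qed
      then have "norm (f y - f x - h *\<^sub>R d x) / h < e" using \<delta>2(2)[of h] h(1,2) by simp
      moreover have "y - x = h" by (simp add: h_def)
      ultimately show ?thesis using h(1) by simp
    next
      case False
      define h where "h = x - y"
      have h: "h > 0" "h < \<delta>1" "y = x - h" "y \<ge> a" using False y by (auto simp: h_def \<delta>_def)
      have "integral {-x..-x+h} (\<lambda>x. g (- x)) = integral {x - h..x} g"
        using Henstock_Kurzweil_Integration.integral_reflect_real[of x "x - h" g] by (simp add: algebra_simps)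
      also have "\<dots> = f x - f y" using int_g[of y x] x h by simp
      finally have "integral {-x..-x+h} (\<lambda>x. g (- x)) /\<^sub>R h - d x = (f x - f y - h *\<^sub>R d x) /\<^sub>R h"
        using h by (simp add: scaleR_right_diff_distrib)
      then have "norm (integral {-x..-x+h} (\<lambda>x. g (- x)) /\<^sub>R h - d x) = norm (f x - f y - h *\<^sub>R d x) / h"
        using nrm[OF h(1)] by simp
      then have "norm (f x - f y - h *\<^sub>R d x) / h < e" using \<delta>1(2)[of h] h(1,2) by simp
      moreover have "norm (f y - f x - (y - x) *\<^sub>R d x) = norm (f x - f y - h *\<^sub>R d x)"
        by (subst norm_minus_cancel[symmetric]) (simp add: h_def algebra_simps)
      moreover have "norm (y - x) = h" using h(1) by (simp add: h_def)
      ultimately show ?thesis using h(1) by (simp only: diff_zero) simp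
    qed
    ultimately show "\<exists>s>0. \<forall>y. y \<noteq> x \<and> norm (y - x) < s \<longrightarrow>
        norm (norm (f y - f x - (y - x) *\<^sub>R d x) / norm (y - x) - 0) < e" by blast
  qed
  ultimately show ?thesis
    unfolding negligible_iff_null_sets by (intro AE_I'[of "N \<union> uminus ` N'"]) auto
qed

lemma primitive_deriv_AE:
  assumes "primitive d f"
  shows "AE x in lebesgue. (f has_vector_derivative d x) (at x)"
proof -
  have "AE x in lebesgue. \<forall>n::nat. x \<in> {- real n<..<real n} \<longrightarrow> (f has_vector_derivative d x) (at x)"
    unfolding AE_all_countable
    by (intro allI indefinite_integral_deriv_AE) (use assms in \<open>auto simp: primitive_def\<close>)
  then show ?thesis
  proof eventually_elim
    case (elim x)
    obtain n where "\<bar>x\<bar> < real n" using reals_Archimedean2 by blast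
    with elim[rule_format, of n] show ?case by (simp add: abs_less_iff)
  qed
qed

text \<open>The densities obtained on the intervals \<open>[-n-1, n+1]\<close> all agree almost everywhere with the
  derivative of \<open>f\<close>, which therefore serves as a density on the whole line.\<close>
lemma AC_imp_primitive_real:
  fixes f :: "real \<Rightarrow> real"
  assumes "in_AC_loc (\<lambda>x. complex_of_real (f x))"
  shows "\<exists>d. primitive d f"
proof -
  have "\<exists>d. set_integrable lebesgue {- real n - 1..real n + 1} d \<and>
     (\<forall>x y. - real n - 1 \<le> x \<longrightarrow> x \<le> y \<longrightarrow> y \<le> real n + 1 \<longrightarrow> (LINT t:{x..y}|lebesgue. d t) = f y - f x)" for n
    by (rule AC_list_density) (use assms in \<open>auto simp: in_AC_loc_def intro!: AC_imp_AC_list\<close>)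
  then obtain D where D: "\<And>n::nat. set_integrable lebesgue {- real n - 1..real n + 1} (D n)"
    "\<And>n x y. - real n - 1 \<le> x \<Longrightarrow> x \<le> y \<Longrightarrow> y \<le> real n + 1 \<Longrightarrow> (LINT t:{x..y}|lebesgue. D n t) = f y - f x"
    by metis
  define d where "d x = vector_derivative f (at x)" for x
  have eq: "AE x in lebesgue. x \<in> {- real n - 1<..<real n + 1} \<longrightarrow> D n x = d x" for n
    using indefinite_integral_deriv_AE[OF D(1)[of n], of f] D(2)[of n]
    by (auto elim!: eventually_mono simp: d_def vector_derivative_at)
  have "set_integrable lebesgue {a..b} d \<and> (LINT t:{a..b}|lebesgue. d t) = f b - f a" if "a \<le> b" for a b
  proof -
    obtain n where n: "max \<bar>a\<bar> \<bar>b\<bar> < real n" using reals_Archimedean2 by blast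
    have s: "set_integrable lebesgue {a..b} (D n)"
      by (rule set_integrable_subset[OF D(1)]) (use n in auto)
    then have m: "(\<lambda>x. indicator {a..b} x *\<^sub>R D n x) \<in> borel_measurable lebesgue"
      unfolding set_integrable_def by auto
    have ae: "AE x in lebesgue. indicator {a..b} x *\<^sub>R D n x = indicator {a..b} x *\<^sub>R d x"
      using eq[of n] by eventually_elim (use n in \<open>auto split: split_indicator\<close>)
    have m': "(\<lambda>x. indicator {a..b} x *\<^sub>R d x) \<in> borel_measurable lebesgue"
      by (rule borel_measurable_lebesgue_AE[OF m ae])
    have "set_integrable lebesgue {a..b} d"
      using s unfolding set_integrable_def by (rule integrable_cong_AE_imp[OF _ m']) (use ae in \<open>auto elim!: eventually_mono\<close>)
    moreover have "(LINT t:{a..b}|lebesgue. d t) = (LINT t:{a..b}|lebesgue. D n t)"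
      unfolding set_lebesgue_integral_def
      by (rule integral_cong_AE[OF m' m]) (use ae in \<open>auto elim!: eventually_mono\<close>)
    ultimately show ?thesis using D(2)[of n a b] that n by auto
  qed
  then show ?thesis unfolding primitive_def by blast
qed

lemma primitive_Complex:
  assumes "primitive d f" "primitive e g"
  shows "primitive (\<lambda>x. Complex (d x) (e x)) (\<lambda>x. Complex (f x) (g x))"
  unfolding primitive_def
proof (intro allI impI)
  fix a b :: real assume "a \<le> b"
  then have 1: "set_integrable lebesgue {a..b} d" "(LINT t:{a..b}|lebesgue. d t) = f b - f a"
    "set_integrable lebesgue {a..b} e" "(LINT t:{a..b}|lebesgue. e t) = g b - g a"
    using assms unfolding primitive_def by auto
  have "has_bochner_integral lebesgue
    (\<lambda>t. complex_of_real (indicator {a..b} t *\<^sub>R d t) + \<i> * complex_of_real (indicator {a..b} t *\<^sub>R e t))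
    (complex_of_real (f b - f a) + \<i> * complex_of_real (g b - g a))"
    using 1 unfolding set_integrable_def set_lebesgue_integral_def
    by (intro has_bochner_integral_add has_bochner_integral_mult_right has_bochner_integral_of_real)
       (auto simp: has_bochner_integral_iff)
  also have "(\<lambda>t. complex_of_real (indicator {a..b} t *\<^sub>R d t) + \<i> * complex_of_real (indicator {a..b} t *\<^sub>R e t)) =
     (\<lambda>t. indicator {a..b} t *\<^sub>R Complex (d t) (e t))"
    by (auto simp: fun_eq_iff complex_eq_iff)
  finally show "set_integrable lebesgue {a..b} (\<lambda>x. Complex (d x) (e x)) \<and>
      (LINT t:{a..b}|lebesgue. Complex (d t) (e t)) = Complex (f b) (g b) - Complex (f a) (g a)"
    unfolding set_integrable_def set_lebesgue_integral_def has_bochner_integral_iff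
    by (simp add: complex_eq_iff)
qed

text \<open>Local absolute continuity passes to every function whose increments are bounded by those of two
  locally absolutely continuous functions; two are needed for products.\<close>
lemma AC_loc_dominated:
  assumes f: "in_AC_loc f" and g: "in_AC_loc g"
    and h: "\<And>a b. a < b \<Longrightarrow> \<exists>M\<ge>0. \<forall>x\<in>{a..b}. \<forall>y\<in>{a..b}. cmod (h y - h x) \<le> M * (cmod (f y - f x) + cmod (g y - g x))"
  shows "in_AC_loc h"
  unfolding in_AC_loc_def abs_cont_on_interval_def
proof (intro allI impI)
  fix a b e :: real assume ab: "a < b" and e: "e > 0"
  obtain M where M: "M \<ge> 0" "\<And>x y. x \<in> {a..b} \<Longrightarrow> y \<in> {a..b} \<Longrightarrow> cmod (h y - h x) \<le> M * (cmod (f y - f x) + cmod (g y - g x))"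
    using h[OF ab] by blast
  define e' where "e' = e / (2 * (M + 1))"
  have e': "e' > 0" using M e by (simp add: e'_def)
  define fam where "fam I \<longleftrightarrow> finite I \<and> (\<forall>(c, d)\<in>I. a \<le> c \<and> c < d \<and> d \<le> b) \<and>
           pairwise (\<lambda>(c, d) (c', d'). {c<..<d} \<inter> {c'<..<d'} = {}) I" for I :: "(real \<times> real) set"
  have *: "\<exists>\<delta>>0. \<forall>I. fam I \<and> (\<Sum>(c, d)\<in>I. d - c) < \<delta> \<longrightarrow> (\<Sum>(c, d)\<in>I. cmod (k d - k c)) < e'"
    if "in_AC_loc k" for k
    using that[unfolded in_AC_loc_def abs_cont_on_interval_def, rule_format, OF ab e']
    unfolding fam_def conj_assoc .
  obtain \<delta>1 where \<delta>1: "\<delta>1 > 0" "\<And>I. fam I \<Longrightarrow> (\<Sum>(c, d)\<in>I. d - c) < \<delta>1 \<Longrightarrow> (\<Sum>(c, d)\<in>I. cmod (f d - f c)) < e'"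
    using *[OF f] by blast
  obtain \<delta>2 where \<delta>2: "\<delta>2 > 0" "\<And>I. fam I \<Longrightarrow> (\<Sum>(c, d)\<in>I. d - c) < \<delta>2 \<Longrightarrow> (\<Sum>(c, d)\<in>I. cmod (g d - g c)) < e'"
    using *[OF g] by blast
  have "(\<Sum>(c, d)\<in>I. cmod (h d - h c)) < e" if I: "fam I" "(\<Sum>(c, d)\<in>I. d - c) < min \<delta>1 \<delta>2" for I
  proof -
    have "(\<Sum>(c, d)\<in>I. cmod (h d - h c)) \<le> (\<Sum>(c, d)\<in>I. M * (cmod (f d - f c) + cmod (g d - g c)))"
    proof (rule sum_mono)
      fix z assume "z \<in> I"
      then show "(case z of (c, d) \<Rightarrow> cmod (h d - h c)) \<le> (case z of (c, d) \<Rightarrow> M * (cmod (f d - f c) + cmod (g d - g c)))"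
        using I(1) M(2) unfolding fam_def by (cases z) (force intro!: M(2))
    qed
    also have "\<dots> = M * ((\<Sum>(c, d)\<in>I. cmod (f d - f c)) + (\<Sum>(c, d)\<in>I. cmod (g d - g c)))"
      by (simp add: case_prod_unfold sum.distrib flip: sum_distrib_left)
    also have "\<dots> \<le> M * (e' + e')"
      using \<delta>1(2)[of I] \<delta>2(2)[of I] I M(1) by (intro mult_left_mono add_mono) auto
    also have "\<dots> < (M + 1) * (e' + e')" using e' by (simp add: algebra_simps)
    also have "\<dots> = e" using M(1) by (simp add: e'_def divide_eq_eq)
    finally show ?thesis .
  qed
  then show "\<exists>\<delta>>0. \<forall>I. finite I \<and> (\<forall>(c, d)\<in>I. a \<le> c \<and> c < d \<and> d \<le> b) \<and>
           pairwise (\<lambda>(c, d) (c', d'). {c<..<d} \<inter> {c'<..<d'} = {}) I \<and> (\<Sum>(c, d)\<in>I. d - c) < \<delta> \<longrightarrow>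
           (\<Sum>(c, d)\<in>I. cmod (h d - h c)) < e"
    using \<delta>1(1) \<delta>2(1) unfolding fam_def by (intro exI[of _ "min \<delta>1 \<delta>2"]) auto
qed

lemma primitiveD:
  assumes "primitive d f" "a \<le> b"
  shows "set_integrable lebesgue {a..b} d" "(LINT t:{a..b}|lebesgue. d t) = f b - f a"
  using assms unfolding primitive_def by auto

text \<open>Absolute continuity of the integral: cut \<open>|d|\<close> off at a height \<open>K\<close> so large that the integral of
  the excess is less than \<open>\<epsilon>/2\<close>. Below the height \<open>K\<close> a family of intervals contributes at most \<open>K\<close>
  times its total length.\<close>
lemma primitive_imp_AC:
  fixes f :: "real \<Rightarrow> complex"
  assumes f: "primitive d f"
  shows "in_AC_loc f"
  unfolding in_AC_loc_def abs_cont_on_interval_def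
proof (intro allI impI)
  fix a b e :: real assume ab: "a < b" and e: "e > 0"
  define u where "u x = indicator {a..b} x * norm (d x)" for x :: real
  have u: "integrable lebesgue u" "\<And>x. u x \<ge> 0"
    using primitiveD(1)[OF f, of a b] ab integrable_norm[of lebesgue "\<lambda>x. indicator {a..b} x *\<^sub>R d x"]
    by (auto simp: u_def[abs_def] set_integrable_def)
  have "(\<lambda>K. LINT x|lebesgue. u x - min (u x) (real K)) \<longlonglongrightarrow> integral\<^sup>L lebesgue (\<lambda>x::real. 0::real)"
  proof (rule integral_dominated_convergence[where w=u and s="\<lambda>K x. u x - min (u x) (real K)"])
    show "AE x in lebesgue. (\<lambda>K. u x - min (u x) (real K)) \<longlonglongrightarrow> 0"
    proof (rule AE_I2)
      fix x
      obtain n where "u x < real n" using reals_Archimedean2 by blast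
      then have "\<forall>K\<ge>n. u x - min (u x) (real K) = 0" by auto
      then show "(\<lambda>K. u x - min (u x) (real K)) \<longlonglongrightarrow> 0"
        by (intro tendsto_eventually eventually_sequentiallyI[of n]) auto
    qed
  qed (use u in auto)
  then have "eventually (\<lambda>K. (LINT x|lebesgue. u x - min (u x) (real K)) < e / 2) sequentially"
    using e by (intro order_tendstoD) auto
  then obtain K :: nat where K: "(LINT x|lebesgue. u x - min (u x) (real K)) < e / 2"
    by (auto simp: eventually_sequentially)
  define w where "w x = u x - min (u x) (real K)" for x
  have w: "integrable lebesgue w" "\<And>x. w x \<ge> 0" unfolding w_def[abs_def] using u
    by (auto intro!: integrable_diff Bochner_Integration.integrable_bound[OF u(1), of "\<lambda>x. min (u x) (real K)"])
  have "(\<Sum>(c, d)\<in>I. cmod (f d - f c)) < e"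
    if I: "finite I" "\<forall>(c, d)\<in>I. a \<le> c \<and> c < d \<and> d \<le> b"
      "pairwise (\<lambda>(c, d) (c', d'). {c<..<d} \<inter> {c'<..<d'} = {}) I" "(\<Sum>(c, d)\<in>I. d - c) < e / (2 * (real K + 1))" for I
  proof -
    have 1: "cmod (f d' - f c') \<le> (LINT x|lebesgue. indicator {c'<..<d'} x * w x) + real K * (d' - c')"
      if "(c', d') \<in> I" for c' d'
    proof -
      have cd: "a \<le> c'" "c' < d'" "d' \<le> b" using I(2) that by auto
      have "cmod (f d' - f c') = cmod (LINT t:{c'..d'}|lebesgue. d t)"
        using primitiveD(2)[OF f, of c' d'] cd by simp
      also have "\<dots> \<le> (LINT x|lebesgue. norm (indicator {c'..d'} x *\<^sub>R d x))"
        unfolding set_lebesgue_integral_def by (rule integral_norm_bound)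
      also have "\<dots> \<le> (LINT x|lebesgue. indicator {c'<..<d'} x * w x + real K * indicator {c'..d'} x)"
      proof (rule integral_mono_AE)
        show "integrable lebesgue (\<lambda>x. norm (indicator {c'..d'} x *\<^sub>R d x))"
          using primitiveD(1)[OF f, of c' d'] cd by (auto simp: set_integrable_def intro!: integrable_norm simp del: norm_scaleR)
        have "integrable lebesgue (\<lambda>x. indicator {c'<..<d'} x * w x)"
          using integrable_mult_indicator[OF _ w(1), of "{c'<..<d'}"] by simp
        moreover have "integrable lebesgue (\<lambda>x. indicator {c'..d'} x :: real)"
          using lmeasurable_iff_integrable[of "{c'..d'}"] by simp
        ultimately show "integrable lebesgue (\<lambda>x. indicator {c'<..<d'} x * w x + real K * indicator {c'..d'} x)"
          by (intro Bochner_Integration.integrable_add integrable_mult_right) auto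
        have "AE x in lebesgue. x \<noteq> c' \<and> x \<noteq> d'"
          by (rule AE_I'[of "{c', d'}"]) (auto simp flip: negligible_iff_null_sets)
        then show "AE x in lebesgue. norm (indicator {c'..d'} x *\<^sub>R d x) \<le> indicator {c'<..<d'} x * w x + real K * indicator {c'..d'} x"
          by eventually_elim (use cd in \<open>auto simp: w_def u_def indicator_def\<close>)
      qed
      also have "\<dots> = (LINT x|lebesgue. indicator {c'<..<d'} x * w x) + real K * (d' - c')"
        using integrable_mult_indicator[OF _ w(1), of "{c'<..<d'}"] cd by simp
      finally show ?thesis .
    qed
    have "(\<Sum>(c, d)\<in>I. cmod (f d - f c)) \<le> (\<Sum>(c, d)\<in>I. (LINT x|lebesgue. indicator {c<..<d} x * w x) + real K * (d - c))"
      using 1 by (intro sum_mono) auto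
    also have "\<dots> = (\<Sum>(c, d)\<in>I. (LINT x|lebesgue. indicator {c<..<d} x * w x)) + real K * (\<Sum>(c, d)\<in>I. d - c)"
      by (simp add: case_prod_unfold sum.distrib flip: sum_distrib_left)
    also have "(\<Sum>(c, d)\<in>I. (LINT x|lebesgue. indicator {c<..<d} x * w x)) =
       (LINT x|lebesgue. (\<Sum>(c, d)\<in>I. indicator {c<..<d} x * w x))"
      using integrable_mult_indicator[OF _ w(1)] by (subst Bochner_Integration.integral_sum) (auto simp: case_prod_unfold)
    also have "\<dots> \<le> (LINT x|lebesgue. w x)"
    proof (rule integral_mono)
      show "integrable lebesgue (\<lambda>x. \<Sum>(c, d)\<in>I. indicator {c<..<d} x * w x)"
        using integrable_mult_indicator[OF _ w(1)] by (auto simp: case_prod_unfold)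
      fix x
      have "(\<Sum>(c, d)\<in>I. indicator {c<..<d} x * w x) = (\<Sum>(c, d)\<in>I. indicator {c<..<d} x) * w x"
        by (simp add: case_prod_unfold sum_distrib_right)
      also have "(\<Sum>(c, d)\<in>I. indicator {c<..<d} x) = (indicator (\<Union>(c, d)\<in>I. {c<..<d}) x :: real)"
        unfolding case_prod_unfold
        by (rule indicator_UN_disjoint[symmetric])
           (use I(1,3) in \<open>auto simp: disjoint_family_on_def pairwise_def case_prod_unfold\<close>)
      also have "\<dots> * w x \<le> w x" using w(2)[of x] by (auto simp: indicator_def)
      finally show "(\<Sum>(c, d)\<in>I. indicator {c<..<d} x * w x) \<le> w x" .
    qed (use w in auto)
    also have "(LINT x|lebesgue. w x) < e / 2" using K by (simp add: w_def)
    also have "real K * (\<Sum>(c, d)\<in>I. d - c) \<le> real K * (e / (2 * (real K + 1)))"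
      using I(4) by (intro mult_left_mono) auto
    also have "\<dots> \<le> e / 2" using e by (simp add: field_simps)
    finally show ?thesis by simp
  qed
  then show "\<exists>\<delta>>0. \<forall>I. finite I \<and> (\<forall>(c, d)\<in>I. a \<le> c \<and> c < d \<and> d \<le> b) \<and>
           pairwise (\<lambda>(c, d) (c', d'). {c<..<d} \<inter> {c'<..<d'} = {}) I \<and> (\<Sum>(c, d)\<in>I. d - c) < \<delta> \<longrightarrow>
           (\<Sum>(c, d)\<in>I. cmod (f d - f c)) < e"
    using e by (intro exI[of _ "e / (2 * (real K + 1))"]) auto
qed

lemma primitive_imp_AC_real:
  assumes "primitive d f"
  shows "in_AC_loc (\<lambda>x. complex_of_real (f x))"
proof -
  have "primitive (\<lambda>x. 0::real) (\<lambda>x. 0)" by (simp add: primitive_def set_integrable_def set_lebesgue_integral_def)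
  from primitive_imp_AC[OF primitive_Complex[OF assms this]] show ?thesis
    by (simp add: complex_of_real_def)
qed

section \<open>Calculus of indefinite integrals\<close>

lemma primitive_continuous:
  fixes f :: "real \<Rightarrow> real"
  assumes "primitive d f"
  shows "continuous_on S f"
proof -
  have "continuous_on {a..b} f" for a b
  proof (cases "a < b")
    case True
    with primitive_imp_AC_real[OF assms] show ?thesis
      by (auto simp: in_AC_loc_def intro!: AC_list_continuous AC_imp_AC_list)
  next
    case False
    then have "{a..b} = {} \<or> {a..b} = {a}" by auto
    then show ?thesis by (auto simp: continuous_on_sing)
  qed
  have "isCont f x" for x
    using \<open>continuous_on {x-1..x+1} f\<close> by (auto intro!: continuous_on_interior)
  then show ?thesis by (simp add: continuous_at_imp_continuous_on)
qed

lemma primitive_measurable: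
  fixes f :: "real \<Rightarrow> real"
  assumes "primitive d f"
  shows "f \<in> borel_measurable lebesgue"
  using primitive_continuous[OF assms, of UNIV]
  by (intro measurable_completion) (simp add: borel_measurable_continuous_onI)

lemma primitive_deriv_measurable:
  fixes f :: "real \<Rightarrow> real"
  assumes "primitive d f"
  shows "d \<in> borel_measurable lebesgue"
proof (rule borel_measurable_LIMSEQ_metric)
  fix n :: nat
  show "(\<lambda>x. indicator {- real n..real n} x *\<^sub>R d x) \<in> borel_measurable lebesgue"
    using primitiveD(1)[OF assms, of "- real n" "real n"] by (auto simp: set_integrable_def)
next
  fix x
  obtain n where "\<bar>x\<bar> < real n" using reals_Archimedean2 by blast
  then have "\<forall>k\<ge>n. indicator {- real k..real k} x *\<^sub>R d x = d x" by (auto simp: indicator_def)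
  then show "(\<lambda>n. indicator {- real n..real n} x *\<^sub>R d x) \<longlonglongrightarrow> d x"
    by (intro tendsto_eventually eventually_sequentiallyI[of n]) auto
qed

lemma primitive_lincomb:
  fixes f :: "real \<Rightarrow> real"
  assumes "primitive d f" "primitive e g"
  shows "primitive (\<lambda>x. d x + c * e x) (\<lambda>x. f x + c * g x)"
  unfolding primitive_def
proof (intro allI impI)
  fix a b :: real assume "a \<le> b"
  note 1 = primitiveD[OF assms(1) this] and 2 = primitiveD[OF assms(2) this]
  have "(LINT t:{a..b}|lebesgue. d t + c * e t) = (LINT t:{a..b}|lebesgue. d t) + c * (LINT t:{a..b}|lebesgue. e t)"
    using 1 2 by (subst set_integral_add) auto
  then have "(LINT t:{a..b}|lebesgue. d t + c * e t) = (f b - f a) + c * (g b - g a)"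
    unfolding 1(2) 2(2) .
  then show "set_integrable lebesgue {a..b} (\<lambda>x. d x + c * e x) \<and>
      (LINT t:{a..b}|lebesgue. d t + c * e t) = f b + c * g b - (f a + c * g a)"
    using 1(1) 2(1) by (auto simp: algebra_simps)
qed

lemma primitive_cong_AE:
  fixes f :: "real \<Rightarrow> real"
  assumes f: "primitive d f" and ae: "AE x in lebesgue. d x = e x"
  shows "primitive e f"
  unfolding primitive_def
proof (intro allI impI)
  fix a b :: real assume "a \<le> b"
  note 1 = primitiveD[OF f this]
  have m: "d \<in> borel_measurable lebesgue" by (rule primitive_deriv_measurable[OF f])
  have m': "e \<in> borel_measurable lebesgue" by (rule borel_measurable_lebesgue_AE[OF m ae])
  have "set_integrable lebesgue {a..b} e"
    by (subst set_integrable_cong_AE[of _ _ d]) (use 1 m m' ae in \<open>auto elim!: eventually_mono\<close>)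
  moreover have "(LINT t:{a..b}|lebesgue. e t) = (LINT t:{a..b}|lebesgue. d t)"
    by (rule set_lebesgue_integral_cong_AE) (use 1 m m' ae in \<open>auto elim!: eventually_mono\<close>)
  ultimately show "set_integrable lebesgue {a..b} e \<and> (LINT t:{a..b}|lebesgue. e t) = f b - f a"
    using 1 by simp
qed

lemma primitive_unique:
  fixes f :: "real \<Rightarrow> real"
  assumes "primitive d f" "primitive e f"
  shows "AE x in lebesgue. d x = e x"
  using primitive_deriv_AE[OF assms(1)] primitive_deriv_AE[OF assms(2)]
  by eventually_elim (rule vector_derivative_unique_at)

text \<open>Composite functions are treated by this criterion: absolute continuity follows from an estimate of
  increments, and the density is the pointwise derivative, computed by the ordinary rules.\<close>
lemma AC_deriv_AE_imp_primitive:
  fixes f :: "real \<Rightarrow> real"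
  assumes "in_AC_loc (\<lambda>x. complex_of_real (f x))" "AE x in lebesgue. (f has_vector_derivative d x) (at x)"
  shows "primitive d f"
proof -
  obtain e where e: "primitive e f" using AC_imp_primitive_real[OF assms(1)] by blast
  have "AE x in lebesgue. e x = d x"
    using primitive_deriv_AE[OF e] assms(2) by eventually_elim (rule vector_derivative_unique_at)
  with e show ?thesis by (rule primitive_cong_AE)
qed

lemma primitive_bounded_on:
  fixes f :: "real \<Rightarrow> real"
  assumes "primitive d f"
  shows "\<exists>M\<ge>0. \<forall>x\<in>{a..b}. \<bar>f x\<bar> \<le> M"
proof -
  have "compact (f ` {a..b})"
    by (intro compact_continuous_image primitive_continuous[OF assms]) auto
  then obtain M where "M > 0" "\<forall>y\<in>f ` {a..b}. norm y \<le> M" using compact_imp_bounded bounded_pos by blast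
  then show ?thesis by (intro exI[of _ M]) auto
qed

lemma primitive_mult:
  fixes f g :: "real \<Rightarrow> real"
  assumes f: "primitive d f" and g: "primitive e g"
  shows "primitive (\<lambda>x. f x * e x + d x * g x) (\<lambda>x. f x * g x)"
proof (rule AC_deriv_AE_imp_primitive)
  show "in_AC_loc (\<lambda>x. complex_of_real (f x * g x))"
  proof (rule AC_loc_dominated[OF primitive_imp_AC_real[OF f] primitive_imp_AC_real[OF g]])
    fix a b :: real
    obtain M1 M2 where M: "M1 \<ge> 0" "\<And>x. x \<in> {a..b} \<Longrightarrow> \<bar>f x\<bar> \<le> M1" "M2 \<ge> 0" "\<And>x. x \<in> {a..b} \<Longrightarrow> \<bar>g x\<bar> \<le> M2"
      using primitive_bounded_on[OF f, of a b] primitive_bounded_on[OF g, of a b] by blast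
    have "\<bar>f y * g y - f x * g x\<bar> \<le> (M1 + M2) * (\<bar>f y - f x\<bar> + \<bar>g y - g x\<bar>)" if "x \<in> {a..b}" "y \<in> {a..b}" for x y
    proof -
      have "f y * g y - f x * g x = (f y - f x) * g y + f x * (g y - g x)" by (simp add: algebra_simps)
      also have "\<bar>\<dots>\<bar> \<le> \<bar>f y - f x\<bar> * \<bar>g y\<bar> + \<bar>f x\<bar> * \<bar>g y - g x\<bar>"
        by (metis abs_mult abs_triangle_ineq)
      also have "\<dots> \<le> \<bar>f y - f x\<bar> * (M1 + M2) + (M1 + M2) * \<bar>g y - g x\<bar>"
        using M(1,3) M(2)[OF that(1)] M(4)[OF that(2)] by (intro add_mono mult_mono) auto
      finally show ?thesis by (simp add: algebra_simps)
    qed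
    then show "\<exists>M\<ge>0. \<forall>x\<in>{a..b}. \<forall>y\<in>{a..b}. cmod (complex_of_real (f y * g y) - complex_of_real (f x * g x))
        \<le> M * (cmod (complex_of_real (f y) - complex_of_real (f x)) + cmod (complex_of_real (g y) - complex_of_real (g x)))"
      using M(1,3) by (intro exI[of _ "M1 + M2"]) (simp flip: of_real_diff of_real_mult)
  qed
  show "AE x in lebesgue. ((\<lambda>x. f x * g x) has_vector_derivative f x * e x + d x * g x) (at x)"
    using primitive_deriv_AE[OF f] primitive_deriv_AE[OF g] by eventually_elim (rule has_vector_derivative_mult)
qed

lemma primitive_compose:
  fixes f F :: "real \<Rightarrow> real"
  assumes f: "primitive d f" and F: "\<And>y. (F has_real_derivative F' y) (at y)" and F': "continuous_on UNIV F'"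
  shows "primitive (\<lambda>x. F' (f x) * d x) (\<lambda>x. F (f x))"
proof (rule AC_deriv_AE_imp_primitive)
  show "in_AC_loc (\<lambda>x. complex_of_real (F (f x)))"
  proof (rule AC_loc_dominated[OF primitive_imp_AC_real[OF f] primitive_imp_AC_real[OF f]])
    fix a b :: real
    obtain M where M: "M \<ge> 0" "\<And>x. x \<in> {a..b} \<Longrightarrow> \<bar>f x\<bar> \<le> M"
      using primitive_bounded_on[OF f, of a b] by blast
    have "compact (F' ` {-M..M})"
      by (intro compact_continuous_image continuous_on_subset[OF F']) auto
    then obtain L where L: "L > 0" "\<forall>y\<in>F' ` {-M..M}. norm y \<le> L" using compact_imp_bounded bounded_pos by blast
    have "\<bar>F (f y) - F (f x)\<bar> \<le> L * \<bar>f y - f x\<bar>" if "x \<in> {a..b}" "y \<in> {a..b}" for x y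
    proof -
      have "norm (F (f y) - F (f x)) \<le> L * norm (f y - f x)"
      proof (rule field_differentiable_bound[of "{-M..M}"])
        show "f x \<in> {-M..M}" "f y \<in> {-M..M}" using M(2)[OF that(1)] M(2)[OF that(2)] by auto
        show "(F has_real_derivative F' z) (at z within {-M..M})" for z
          using F by (rule has_field_derivative_at_within)
        show "norm (F' z) \<le> L" if "z \<in> {-M..M}" for z using L(2) that by auto
      qed auto
      then show ?thesis by simp
    qed
    then show "\<exists>M\<ge>0. \<forall>x\<in>{a..b}. \<forall>y\<in>{a..b}. cmod (complex_of_real (F (f y)) - complex_of_real (F (f x)))
        \<le> M * (cmod (complex_of_real (f y) - complex_of_real (f x)) + cmod (complex_of_real (f y) - complex_of_real (f x)))"
      using L(1) by (intro exI[of _ L]) (fastforce simp flip: of_real_diff of_real_mult simp: algebra_simps)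
  qed
  show "AE x in lebesgue. ((\<lambda>x. F (f x)) has_vector_derivative F' (f x) * d x) (at x)"
    using primitive_deriv_AE[OF f]
  proof eventually_elim
    case (elim x)
    have "(f has_real_derivative d x) (at x)" using elim by (simp add: has_real_derivative_iff_has_vector_derivative)
    then have "((\<lambda>x. F (f x)) has_real_derivative F' (f x) * d x) (at x)"
      using F by (rule DERIV_chain2[rotated])
    then show ?case by (simp add: has_real_derivative_iff_has_vector_derivative)
  qed
qed

text \<open>The value at the origin can be prescribed, which fixes the limit function in
  \<open>form_domain_complete\<close> below.\<close>
lemma ex_primitive:
  fixes d :: "real \<Rightarrow> real"
  assumes "\<And>a b. set_integrable lebesgue {a..b} d"
  shows "\<exists>f. primitive d f \<and> f 0 = c"
proof -
  define f where "f x = c + (if 0 \<le> x then (LINT t:{0..x}|lebesgue. d t) else - (LINT t:{x..0}|lebesgue. d t))" for x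
  have split: "(LINT t:{a..b}|lebesgue. d t) + (LINT t:{b..e}|lebesgue. d t) = (LINT t:{a..e}|lebesgue. d t)"
    if "a \<le> b" "b \<le> e" for a b e
  proof -
    have "{a..e} = {a..b} \<union> {b..e}" using that by auto
    moreover have "(LINT t:{a..b} \<union> {b..e}|lebesgue. d t) = (LINT t:{a..b}|lebesgue. d t) + (LINT t:{b..e}|lebesgue. d t)"
    proof (rule set_integral_Un_AE)
      have "AE x in lebesgue. x \<noteq> b"
        by (rule AE_I'[of "{b}"]) (auto simp flip: negligible_iff_null_sets)
      then show "AE x in lebesgue. \<not> (x \<in> {a..b} \<and> x \<in> {b..e})" by eventually_elim auto
    qed (use assms in auto)
    ultimately show ?thesis by simp
  qed
  have "(LINT t:{a..b}|lebesgue. d t) = f b - f a" if "a \<le> b" for a b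
  proof -
    consider "0 \<le> a" | "a < 0" "0 \<le> b" | "b < 0" by linarith
    then show ?thesis
    proof cases
      case 1 with split[of 0 a b] that show ?thesis by (simp add: f_def)
    next
      case 2 with split[of a 0 b] that show ?thesis by (simp add: f_def)
    next
      case 3 with split[of a b 0] that show ?thesis by (simp add: f_def)
    qed
  qed
  moreover have "f 0 = c"
  proof -
    have "(LINT t:{0..0}|lebesgue. d t) = 0"
      using split[of 0 0 0] by simp
    then show ?thesis by (simp add: f_def)
  qed
  ultimately show ?thesis using assms by (auto simp: primitive_def)
qed

section \<open>Hoelder and interpolation inequalities\<close>

text \<open>With the exponents written as weights \<open>a + b = 1\<close> on the integrands, the inequality is Young's
  inequality applied to the normalised functions \<open>U / \<integral> U\<close> and \<open>W / \<integral> W\<close>.\<close>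
lemma Hoelder_powr:
  fixes U W :: "'b \<Rightarrow> real"
  assumes U: "integrable M U" "\<And>x. 0 \<le> U x" and W: "integrable M W" "\<And>x. 0 \<le> W x"
    and ab: "0 < a" "0 < b" "a + b = 1"
  shows "integrable M (\<lambda>x. U x powr a * W x powr b)"
    "(LINT x|M. U x powr a * W x powr b) \<le> (LINT x|M. U x) powr a * (LINT x|M. W x) powr b"
proof -
  have young: "u powr a * w powr b \<le> a * u + b * w" if "0 \<le> u" "0 \<le> w" for u w :: real
    using Youngs_inequality_0[of a b u w] ab that by (cases "u = 0 \<or> w = 0") auto
  show int: "integrable M (\<lambda>x. U x powr a * W x powr b)"
  proof (rule Bochner_Integration.integrable_bound)
    show "integrable M (\<lambda>x. a * U x + b * W x)" using U W by auto
    show "AE x in M. norm (U x powr a * W x powr b) \<le> norm (a * U x + b * W x)"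
      using young U(2) W(2) ab by (intro AE_I2) (simp add: abs_of_nonneg)
  qed (use U W in measurable)
  define A B where "A = (LINT x|M. U x)" and "B = (LINT x|M. W x)"
  have AB: "A \<ge> 0" "B \<ge> 0" using U W by (auto simp: A_def B_def)
  show "(LINT x|M. U x powr a * W x powr b) \<le> A powr a * B powr b"
  proof (cases "A = 0 \<or> B = 0")
    case True
    then have "AE x in M. U x = 0 \<or> W x = 0"
      using integral_nonneg_eq_0_iff_AE[OF U(1)] integral_nonneg_eq_0_iff_AE[OF W(1)] U(2) W(2)
      by (auto simp: A_def B_def elim!: eventually_mono)
    then have "(LINT x|M. U x powr a * W x powr b) = (LINT x|M. 0)"
      using int by (intro integral_cong_AE) auto
    then show ?thesis by simp
  next
    case False
    then have pos: "A > 0" "B > 0" using AB by auto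
    have "U x powr a * W x powr b \<le> (A powr a * B powr b) * (a * (U x / A) + b * (W x / B))" for x
    proof -
      have "U x powr a * W x powr b = (A powr a * B powr b) * ((U x / A) powr a * (W x / B) powr b)"
        using pos U(2)[of x] W(2)[of x] by (simp add: powr_divide)
      also have "\<dots> \<le> (A powr a * B powr b) * (a * (U x / A) + b * (W x / B))"
        using pos U(2)[of x] W(2)[of x] by (intro mult_left_mono young) auto
      finally show ?thesis .
    qed
    then have "(LINT x|M. U x powr a * W x powr b) \<le> (LINT x|M. (A powr a * B powr b) * (a * (U x / A) + b * (W x / B)))"
      using U W int by (intro integral_mono) auto
    also have "\<dots> = A powr a * B powr b"
      using pos U W ab by (simp add: A_def[symmetric] B_def[symmetric])
    finally show ?thesis .
  qed
qed

lemma Cauchy_Schwarz_integral: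
  fixes u w :: "'b \<Rightarrow> real"
  assumes "u \<in> borel_measurable M" "w \<in> borel_measurable M"
    and "integrable M (\<lambda>x. (u x)\<^sup>2)" "integrable M (\<lambda>x. (w x)\<^sup>2)"
  shows "integrable M (\<lambda>x. u x * w x)"
    "(LINT x|M. \<bar>u x * w x\<bar>)\<^sup>2 \<le> (LINT x|M. (u x)\<^sup>2) * (LINT x|M. (w x)\<^sup>2)"
    "(LINT x|M. u x * w x)\<^sup>2 \<le> (LINT x|M. (u x)\<^sup>2) * (LINT x|M. (w x)\<^sup>2)"
proof -
  have eq: "((u x)\<^sup>2) powr (1/2) * ((w x)\<^sup>2) powr (1/2) = \<bar>u x * w x\<bar>" for x
    by (simp add: powr_half_sqrt abs_mult)
  note H = Hoelder_powr[of M "\<lambda>x. (u x)\<^sup>2" "\<lambda>x. (w x)\<^sup>2" "1/2" "1/2", unfolded eq]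
  have 1: "integrable M (\<lambda>x. \<bar>u x * w x\<bar>)" using H assms by simp
  show 2: "integrable M (\<lambda>x. u x * w x)"
    by (rule Bochner_Integration.integrable_bound[OF 1]) (use assms in auto)
  have nn: "0 \<le> (LINT x|M. (u x)\<^sup>2)" "0 \<le> (LINT x|M. (w x)\<^sup>2)" by auto
  have "(LINT x|M. \<bar>u x * w x\<bar>) \<le> sqrt (LINT x|M. (u x)\<^sup>2) * sqrt (LINT x|M. (w x)\<^sup>2)"
    using H(2) assms nn by (simp add: powr_half_sqrt)
  then have "(LINT x|M. \<bar>u x * w x\<bar>)\<^sup>2 \<le> (sqrt (LINT x|M. (u x)\<^sup>2) * sqrt (LINT x|M. (w x)\<^sup>2))\<^sup>2"
    by (rule power_mono) auto
  then show 3: "(LINT x|M. \<bar>u x * w x\<bar>)\<^sup>2 \<le> (LINT x|M. (u x)\<^sup>2) * (LINT x|M. (w x)\<^sup>2)"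
    using nn by (simp add: power_mult_distrib)
  have "(LINT x|M. u x * w x)\<^sup>2 \<le> (LINT x|M. \<bar>u x * w x\<bar>)\<^sup>2"
    using integral_abs_bound[of M "\<lambda>x. u x * w x"] by (simp add: abs_le_square_iff[symmetric])
  with 3 show "(LINT x|M. u x * w x)\<^sup>2 \<le> (LINT x|M. (u x)\<^sup>2) * (LINT x|M. (w x)\<^sup>2)" by simp
qed

text \<open>Here \<open>S\<close>, \<open>N\<close>, \<open>X\<close>, \<open>B\<close> stand for \<open>sup f^2\<close>, \<open>\<integral> f^2\<close>, the kinetic energy and the potential energy.
  If \<open>X \<le> B\<close>, the estimate of \<open>B\<close> may be inserted for \<open>X\<close> in that of \<open>S^\<gamma>\<close>; with \<open>y = S / N\<close> this reads
  \<open>y^\<gamma> \<le> A Q y^\<sigma>\<close>, and \<open>\<sigma> < \<gamma>\<close> bounds \<open>y\<close> by the constant \<open>(A Q)^(1/(\<gamma>-\<sigma>))\<close>. If \<open>B < X\<close>, the first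
  conclusion is trivial.\<close>
lemma interpolation_numeric:
  fixes \<gamma> \<sigma> A Q S N X B :: real
  assumes \<gamma>: "1 \<le> \<gamma>" and \<sigma>: "0 \<le> \<sigma>" "\<sigma> \<le> 1" "\<sigma> < \<gamma>"
    and nn: "0 \<le> A" "0 \<le> Q" "0 \<le> S" "0 \<le> N" "0 \<le> X"
    and S: "S powr \<gamma> \<le> A * N powr (\<gamma> - 1) * X"
    and B: "B \<le> Q * S powr \<sigma> * N powr (1 - \<sigma>)"
  shows "B - X \<le> Q * ((A * Q) powr (1 / (\<gamma> - \<sigma>))) powr \<sigma> * N"
    "X \<le> B \<Longrightarrow> S \<le> (A * Q) powr (1 / (\<gamma> - \<sigma>)) * N"
proof -
  define \<beta> where "\<beta> = (A * Q) powr (1 / (\<gamma> - \<sigma>))"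
  have *: "S \<le> \<beta> * N \<and> B \<le> Q * \<beta> powr \<sigma> * N" if XB: "X \<le> B"
  proof (cases "N = 0 \<or> S = 0")
    case True
    then have "B \<le> 0" using B \<sigma> by auto
    moreover have "S \<le> 0"
    proof (cases "S = 0")
      case False
      then have "N = 0" using True by simp
      then have "S powr \<gamma> \<le> 0" using S by simp
      then show ?thesis using False by simp
    qed auto
    ultimately show ?thesis using nn unfolding \<beta>_def
      by (meson mult_nonneg_nonneg order_trans powr_ge_zero)
  next
    case False
    then have pos: "S > 0" "N > 0" using nn by auto
    define y where "y = S / N"
    have y: "y > 0" "S = y * N" using pos by (auto simp: y_def)
    have "S powr \<sigma> * N powr (1 - \<sigma>) = y powr \<sigma> * N"
      using pos y(1) by (simp add: y(2) powr_mult powr_diff)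
    then have B': "B \<le> Q * y powr \<sigma> * N" using B by (simp add: mult.assoc)
    have "y powr \<gamma> * N powr \<gamma> \<le> A * N powr (\<gamma> - 1) * X"
      using S y pos by (simp add: powr_mult)
    also have "\<dots> \<le> A * N powr (\<gamma> - 1) * (Q * y powr \<sigma> * N)"
      using XB B' nn by (intro mult_left_mono) auto
    also have "\<dots> = A * Q * y powr \<sigma> * N powr \<gamma>"
      using pos by (simp add: powr_diff)
    finally have "y powr \<gamma> \<le> A * Q * y powr \<sigma>" using pos by simp
    then have "y powr (\<gamma> - \<sigma>) \<le> A * Q" using y(1) by (simp add: powr_diff divide_le_eq)
    then have "(y powr (\<gamma> - \<sigma>)) powr (1 / (\<gamma> - \<sigma>)) \<le> \<beta>"
      unfolding \<beta>_def using \<sigma> by (intro powr_mono2) auto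
    then have y\<beta>: "y \<le> \<beta>" using y(1) \<sigma> by (simp add: powr_powr)
    have "Q * y powr \<sigma> * N \<le> Q * \<beta> powr \<sigma> * N"
      using y\<beta> y(1) \<sigma> nn by (intro mult_right_mono mult_left_mono powr_mono2) auto
    moreover have "S \<le> \<beta> * N" using y\<beta> pos by (simp add: y(2))
    ultimately show ?thesis using B' by simp
  qed
  show "X \<le> B \<Longrightarrow> S \<le> (A * Q) powr (1 / (\<gamma> - \<sigma>)) * N" using * by (simp add: \<beta>_def)
  show "B - X \<le> Q * ((A * Q) powr (1 / (\<gamma> - \<sigma>))) powr \<sigma> * N"
  proof (cases "X \<le> B")
    case True
    with * have "B \<le> Q * \<beta> powr \<sigma> * N" by blast
    then show ?thesis using nn unfolding \<beta>_def by linarith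
  next
    case False
    have "0 \<le> Q * \<beta> powr \<sigma> * N" using nn by simp
    then show ?thesis using False unfolding \<beta>_def by linarith
  qed
qed

text \<open>The odd power is used instead of \<open>|u|^\<gamma>\<close> because it is continuously differentiable also at the
  origin and degenerates to the identity for \<open>\<gamma> = 1\<close>.\<close>
lemma has_derivative_abs_powr_odd:
  fixes \<gamma> y :: real
  assumes "\<gamma> > 1"
  shows "((\<lambda>u. sgn u * \<bar>u\<bar> powr \<gamma>) has_real_derivative \<gamma> * \<bar>y\<bar> powr (\<gamma> - 1)) (at y)"
proof -
  consider "y > 0" | "y < 0" | "y = 0" by linarith
  then show ?thesis
  proof cases
    case 1
    have "((\<lambda>u. u powr \<gamma>) has_real_derivative \<gamma> * \<bar>y\<bar> powr (\<gamma> - 1)) (at y)"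
      using 1 by (auto intro!: derivative_eq_intros simp: powr_diff field_simps)
    then show ?thesis
      by (rule DERIV_cong_ev[THEN iffD1, rotated -1, OF _ refl _ refl])
         (use eventually_nhds_in_open[of "{0<..}" y] 1 in \<open>auto elim!: eventually_mono\<close>)
  next
    case 2
    have "((\<lambda>u. - ((- u) powr \<gamma>)) has_real_derivative \<gamma> * \<bar>y\<bar> powr (\<gamma> - 1)) (at y)"
      using 2 by (auto intro!: derivative_eq_intros simp: powr_diff field_simps)
    then show ?thesis
      by (rule DERIV_cong_ev[THEN iffD1, rotated -1, OF _ refl _ refl])
         (use eventually_nhds_in_open[of "{..<0}" y] 2 in \<open>auto elim!: eventually_mono\<close>)
  next
    case 3
    have "((\<lambda>h. \<bar>h\<bar> powr (\<gamma> - 1)) \<longlongrightarrow> 0) (at (0::real))"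
      using assms by (intro tendsto_eq_intros | simp)+
    moreover have "eventually (\<lambda>h. \<bar>h\<bar> powr (\<gamma> - 1) = sgn h * \<bar>h\<bar> powr \<gamma> / h) (at (0::real))"
      by (rule eventually_at_filter[THEN iffD2], rule always_eventually)
         (auto simp: powr_diff sgn_if)
    ultimately have "((\<lambda>h. sgn h * \<bar>h\<bar> powr \<gamma> / h) \<longlongrightarrow> 0) (at (0::real))"
      by (rule Lim_transform_eventually)
    then show ?thesis using 3 assms by (simp add: DERIV_def)
  qed
qed

lemma continuous_on_abs_powr: "\<gamma> > 1 \<Longrightarrow> continuous_on UNIV (\<lambda>y::real. \<gamma> * \<bar>y\<bar> powr (\<gamma> - 1))"
  by (intro continuous_on_mult continuous_on_const continuous_on_powr' continuous_on_rabs continuous_on_id continuous_on_diff) auto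

lemma set_Hoelder_powr:
  fixes U W :: "'b \<Rightarrow> real"
  assumes U: "set_integrable M S U" "\<And>x. 0 \<le> U x" and W: "set_integrable M S W" "\<And>x. 0 \<le> W x"
    and ab: "0 < a" "0 < b" "a + b = 1"
  shows "set_integrable M S (\<lambda>x. U x powr a * W x powr b)"
    "(LINT x:S|M. U x powr a * W x powr b) \<le> (LINT x:S|M. U x) powr a * (LINT x:S|M. W x) powr b"
proof -
  have eq: "(indicator S x * U x) powr a * (indicator S x * W x) powr b = indicator S x * (U x powr a * W x powr b)" for x
    using ab by (auto simp: indicator_def)
  note H = Hoelder_powr[of M "\<lambda>x. indicator S x * U x" "\<lambda>x. indicator S x * W x" a b, unfolded eq]
  show "set_integrable M S (\<lambda>x. U x powr a * W x powr b)"
    "(LINT x:S|M. U x powr a * W x powr b) \<le> (LINT x:S|M. U x) powr a * (LINT x:S|M. W x) powr b"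
    using H U W ab by (auto simp: set_integrable_def set_lebesgue_integral_def)
qed

lemma set_Cauchy_Schwarz_integral:
  fixes u w :: "'b \<Rightarrow> real"
  assumes S: "S \<in> sets M" and "u \<in> borel_measurable M" "w \<in> borel_measurable M"
    and "set_integrable M S (\<lambda>x. (u x)\<^sup>2)" "set_integrable M S (\<lambda>x. (w x)\<^sup>2)"
  shows "set_integrable M S (\<lambda>x. u x * w x)"
    "(LINT x:S|M. \<bar>u x * w x\<bar>)\<^sup>2 \<le> (LINT x:S|M. (u x)\<^sup>2) * (LINT x:S|M. (w x)\<^sup>2)"
proof -
  have eq: "(indicator S x * u x)\<^sup>2 = indicator S x * (u x)\<^sup>2" "(indicator S x * w x)\<^sup>2 = indicator S x * (w x)\<^sup>2"
    "(indicator S x * u x) * (indicator S x * w x) = indicator S x * (u x * w x)"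
    "\<bar>indicator S x * (u x * w x)\<bar> = indicator S x * \<bar>u x * w x\<bar>" for x
    by (auto simp: indicator_def)
  note H = Cauchy_Schwarz_integral[of "\<lambda>x. indicator S x * u x" M "\<lambda>x. indicator S x * w x", unfolded eq]
  show "set_integrable M S (\<lambda>x. u x * w x)"
    "(LINT x:S|M. \<bar>u x * w x\<bar>)\<^sup>2 \<le> (LINT x:S|M. (u x)\<^sup>2) * (LINT x:S|M. (w x)\<^sup>2)"
    using H assms by (auto simp: set_integrable_def set_lebesgue_integral_def)
qed

lemma set_integral_mono_set:
  fixes h :: "real \<Rightarrow> real"
  assumes "set_integrable lebesgue B h" "A \<subseteq> B" "A \<in> sets lebesgue" "AE x in lebesgue. 0 \<le> h x"
  shows "(LINT x:A|lebesgue. h x) \<le> (LINT x:B|lebesgue. h x)"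
  unfolding set_lebesgue_integral_def
proof (rule integral_mono_AE)
  show "integrable lebesgue (\<lambda>x. indicator A x *\<^sub>R h x)"
    using set_integrable_subset[OF assms(1,3,2)] by (simp add: set_integrable_def)
  show "AE x in lebesgue. indicator A x *\<^sub>R h x \<le> indicator B x *\<^sub>R h x"
    using assms(4) by eventually_elim (use assms(2) in \<open>auto simp: indicator_def\<close>)
qed (use assms(1) in \<open>simp add: set_integrable_def\<close>)

lemma continuous_set_integrable:
  fixes h :: "real \<Rightarrow> real"
  assumes "continuous_on {a..b} h"
  shows "set_integrable lebesgue {a..b} h"
  using absolutely_integrable_continuous_real[OF assms] .

lemma ex_average:
  fixes f :: "real \<Rightarrow> real"
  assumes "a \<le> b" "continuous_on {a..b} f"
  shows "\<exists>y\<in>{a..b}. (b - a) * (f y)\<^sup>2 \<le> (LINT x:{a..b}|lebesgue. (f x)\<^sup>2)"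
proof -
  have c: "continuous_on {a..b} (\<lambda>x. (f x)\<^sup>2)" using assms by (intro continuous_intros)
  obtain y where y: "y \<in> {a..b}" "\<forall>x\<in>{a..b}. (f y)\<^sup>2 \<le> (f x)\<^sup>2"
    using continuous_attains_inf[OF _ _ c] assms(1) by auto
  have "(LINT x:{a..b}|lebesgue. (f y)\<^sup>2) \<le> (LINT x:{a..b}|lebesgue. (f x)\<^sup>2)"
    by (rule set_integral_mono) (use c y in \<open>auto intro!: continuous_set_integrable continuous_intros\<close>)
  moreover have "(LINT x:{a..b}|lebesgue. (f y)\<^sup>2) = (b - a) * (f y)\<^sup>2"
    using assms(1) by (subst set_integral_const) auto
  ultimately show ?thesis using y(1) by auto
qed

lemma primitive_diff_le:
  fixes f :: "real \<Rightarrow> real"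
  assumes f: "primitive d f" and yz: "y \<in> {a..b}" "z \<in> {a..b}"
  shows "\<bar>f z - f y\<bar> \<le> (LINT x:{a..b}|lebesgue. \<bar>d x\<bar>)"
proof -
  have *: "\<bar>f v - f u\<bar> \<le> (LINT x:{a..b}|lebesgue. \<bar>d x\<bar>)" if "a \<le> u" "u \<le> v" "v \<le> b" for u v
  proof -
    have "f v - f u = (LINT x:{u..v}|lebesgue. d x)" using primitiveD(2)[OF f that(2)] by simp
    also have "\<bar>\<dots>\<bar> \<le> (LINT x:{u..v}|lebesgue. \<bar>d x\<bar>)"
      using integral_norm_bound[of lebesgue "\<lambda>x. indicator {u..v} x *\<^sub>R d x"]
      by (simp add: set_lebesgue_integral_def abs_mult)
    also have "\<dots> \<le> (LINT x:{a..b}|lebesgue. \<bar>d x\<bar>)"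
      using that primitiveD(1)[OF f, of a b] by (intro set_integral_mono_set set_integrable_abs) auto
    finally show ?thesis .
  qed
  show ?thesis using *[of y z] *[of z y] yz by (cases "y \<le> z") (auto simp: abs_minus_commute)
qed

locale SL_leading =
  fixes p :: "real \<Rightarrow> real" and \<eta> :: real
  assumes p_meas: "p \<in> borel_measurable lebesgue" and p_pos: "AE x in lebesgue. p x > 0"
    and eta: "1 \<le> \<eta>" and p_Lp: "in_Lp \<eta> (\<lambda>x. 1 / p x)"
begin

text \<open>The derivative of \<open>|f|^\<gamma>\<close> is \<open>\<gamma> |f|^(\<gamma>-1) f'\<close>. With \<open>\<gamma> - 1 = 1 - 1/\<eta>\<close> the factor \<open>|f|^(2(\<gamma>-1))\<close> is
  the power of \<open>f^2\<close> with the exponent dual to \<open>1/\<eta>\<close>, so the Hoelder inequality against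
  \<open>1/p \<in> L^\<eta>\<close> leaves the integral of \<open>f^2\<close>.\<close>
definition "\<gamma> = (2 * \<eta> - 1) / \<eta>"

abbreviation "P \<equiv> Lp_norm \<eta> (\<lambda>x. 1 / p x)"

abbreviation "kinetic d \<equiv> (LINT x|lebesgue. p x * (d x)\<^sup>2)"

abbreviation "kinetic_on a b d \<equiv> (LINT x:{a..b}|lebesgue. p x * (d x)\<^sup>2)"

lemma gamma: "1 \<le> \<gamma>" "\<gamma> - 1 = 1 - 1 / \<eta>"
  using eta by (auto simp: \<gamma>_def field_simps)

lemma gamma_eq_1: "\<eta> = 1 \<Longrightarrow> \<gamma> = 1"
  unfolding \<gamma>_def by simp

lemma P_nonneg: "0 \<le> P"
  by (simp add: Lp_norm_def)

lemma p_int: "integrable lebesgue (\<lambda>x. \<bar>1 / p x\<bar> powr \<eta>)"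
  using p_Lp by (simp add: in_Lp_def)

lemma energy_nonneg: "0 \<le> (LINT x:A|lebesgue. p x * (d x)\<^sup>2)"
  unfolding set_lebesgue_integral_def
  by (rule integral_nonneg_AE, use p_pos in eventually_elim) (auto simp: indicator_def)

text \<open>The case \<open>\<eta> = 1\<close> is separate for two reasons: \<open>|f|^0\<close> has to be read as one also at the zeros of
  \<open>f\<close>, and the factor \<open>(\<integral> f^2)^0\<close> is one only if the integral does not vanish.\<close>
lemma weighted_Hoelder:
  fixes f :: "real \<Rightarrow> real"
  assumes f: "continuous_on UNIV f" and N: "\<eta> = 1 \<Longrightarrow> (LINT x:{a..b}|lebesgue. (f x)\<^sup>2) \<noteq> 0"
  defines "\<psi> \<equiv> \<lambda>x. if \<eta> = 1 then 1 else \<bar>f x\<bar> powr (\<gamma> - 1)"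
  shows "set_integrable lebesgue {a..b} (\<lambda>x. (\<psi> x * sqrt \<bar>1 / p x\<bar>)\<^sup>2)"
    "(LINT x:{a..b}|lebesgue. (\<psi> x * sqrt \<bar>1 / p x\<bar>)\<^sup>2) \<le> P * (LINT x:{a..b}|lebesgue. (f x)\<^sup>2) powr (\<gamma> - 1)"
proof -
  define N where "N = (LINT x:{a..b}|lebesgue. (f x)\<^sup>2)"
  have s: "set_integrable lebesgue {a..b} (\<lambda>x. \<bar>1 / p x\<bar> powr \<eta>)"
    using p_int set_integrable_subset[of lebesgue UNIV "\<lambda>x. \<bar>1 / p x\<bar> powr \<eta>" "{a..b}"]
    by (simp add: set_integrable_def)
  have le: "(LINT x:{a..b}|lebesgue. \<bar>1 / p x\<bar> powr \<eta>) \<le> (LINT x|lebesgue. \<bar>1 / p x\<bar> powr \<eta>)"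
    using set_integral_mono_set[of UNIV "\<lambda>x. \<bar>1 / p x\<bar> powr \<eta>" "{a..b}"] p_int
    by (simp add: set_integrable_def set_lebesgue_integral_def)
  have nn: "0 \<le> (LINT x:{a..b}|lebesgue. \<bar>1 / p x\<bar> powr \<eta>)"
    by (simp add: set_lebesgue_integral_def)
  have le2: "(LINT x:{a..b}|lebesgue. \<bar>1 / p x\<bar> powr \<eta>) powr (1 / \<eta>) \<le> P"
    unfolding Lp_norm_def using le nn eta by (simp add: powr_mono2)
  have "set_integrable lebesgue {a..b} (\<lambda>x. (\<psi> x * sqrt \<bar>1 / p x\<bar>)\<^sup>2) \<and>
    (LINT x:{a..b}|lebesgue. (\<psi> x * sqrt \<bar>1 / p x\<bar>)\<^sup>2) \<le> P * N powr (\<gamma> - 1)"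
  proof (cases "\<eta> = 1")
    case True
    have "(\<psi> x * sqrt \<bar>1 / p x\<bar>)\<^sup>2 = \<bar>1 / p x\<bar> powr \<eta>" for x
      using True by (simp add: \<psi>_def)
    moreover have "N powr (\<gamma> - 1) = 1"
      unfolding gamma_eq_1[OF True] using N[OF True] by (simp add: N_def)
    ultimately show ?thesis using s le2 True nn by simp
  next
    case False
    then have e: "\<eta> > 1" using eta by simp
    have "(\<psi> x * sqrt \<bar>1 / p x\<bar>)\<^sup>2 = (\<bar>1 / p x\<bar> powr \<eta>) powr (1 / \<eta>) * ((f x)\<^sup>2) powr (1 - 1 / \<eta>)" for x
    proof -
      have "((f x)\<^sup>2) powr (1 - 1 / \<eta>) = (\<bar>f x\<bar> powr (1 - 1 / \<eta>))\<^sup>2"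
        by (subst power2_abs[symmetric]) (simp only: power2_eq_square powr_mult abs_ge_zero)
      then show ?thesis
        using False e by (simp add: \<psi>_def gamma power_mult_distrib powr_powr)
    qed
    moreover have "set_integrable lebesgue {a..b} (\<lambda>x. (f x)\<^sup>2)"
      using f by (auto intro!: continuous_set_integrable continuous_intros intro: continuous_on_subset)
    then have "set_integrable lebesgue {a..b} (\<lambda>x. (\<bar>1 / p x\<bar> powr \<eta>) powr (1 / \<eta>) * ((f x)\<^sup>2) powr (1 - 1 / \<eta>))"
      "(LINT x:{a..b}|lebesgue. (\<bar>1 / p x\<bar> powr \<eta>) powr (1 / \<eta>) * ((f x)\<^sup>2) powr (1 - 1 / \<eta>))
       \<le> (LINT x:{a..b}|lebesgue. \<bar>1 / p x\<bar> powr \<eta>) powr (1 / \<eta>) * N powr (1 - 1 / \<eta>)"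
      unfolding N_def by (intro set_Hoelder_powr s; use e in simp)+
    moreover have "(LINT x:{a..b}|lebesgue. \<bar>1 / p x\<bar> powr \<eta>) powr (1 / \<eta>) * N powr (1 - 1 / \<eta>) \<le> P * N powr (\<gamma> - 1)"
      using le2 by (simp add: gamma mult_right_mono)
    ultimately show ?thesis by simp
  qed
  then show "set_integrable lebesgue {a..b} (\<lambda>x. (\<psi> x * sqrt \<bar>1 / p x\<bar>)\<^sup>2)"
    "(LINT x:{a..b}|lebesgue. (\<psi> x * sqrt \<bar>1 / p x\<bar>)\<^sup>2) \<le> P * (LINT x:{a..b}|lebesgue. (f x)\<^sup>2) powr (\<gamma> - 1)"
    by (auto simp: N_def)
qed

text \<open>The increment of \<open>|f|^\<gamma>\<close> from \<open>y\<close> to \<open>z\<close> is at most the integral of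
  \<open>\<gamma> |f|^(\<gamma>-1) |f'|\<close>, which is split as \<open>(|f|^(\<gamma>-1) / sqrt p) (sqrt p |f'|)\<close> for the Cauchy--Schwarz
  inequality.\<close>
lemma interpolation_interval:
  assumes f: "primitive d f" and ab: "a \<le> b"
    and E: "set_integrable lebesgue {a..b} (\<lambda>x. p x * (d x)\<^sup>2)" and yz: "y \<in> {a..b}" "z \<in> {a..b}"
  shows "\<bar>f z\<bar> powr \<gamma> \<le> \<bar>f y\<bar> powr \<gamma> + 
    \<gamma> * sqrt (P * (LINT x:{a..b}|lebesgue. (f x)\<^sup>2) powr (\<gamma> - 1) * (kinetic_on a b d))"
proof (cases "y = z \<or> (\<eta> = 1 \<and> (LINT x:{a..b}|lebesgue. (f x)\<^sup>2) = 0)")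
  case True
  then show ?thesis
  proof
    assume "y = z"
    then show ?thesis using gamma(1) P_nonneg energy_nonneg by simp
  next
    assume 1: "\<eta> = 1 \<and> (LINT x:{a..b}|lebesgue. (f x)\<^sup>2) = 0"
    show ?thesis
    proof (cases "a = b")
      case False
      have c: "continuous_on {a..b} (\<lambda>x. (f x)\<^sup>2)"
        using primitive_continuous[OF f] by (intro continuous_intros)
      have "(LINT x:{a..b}|lebesgue. (f x)\<^sup>2) = integral {a..b} (\<lambda>x. (f x)\<^sup>2)"
        by (rule set_lebesgue_integral_eq_integral[OF continuous_set_integrable[OF c]])
      then have "integral {a..b} (\<lambda>x. (f x)\<^sup>2) = 0" using 1 by simp
      then have "(f z)\<^sup>2 = 0" using integral_eq_0_iff[OF c] ab False yz by auto
      then show ?thesis using gamma(1) P_nonneg energy_nonneg by simp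
    qed (use yz gamma(1) P_nonneg energy_nonneg in auto)
  qed
next
  case False
  define N where "N = (LINT x:{a..b}|lebesgue. (f x)\<^sup>2)"
  define \<psi> where "\<psi> x = (if \<eta> = 1 then 1 else \<bar>f x\<bar> powr (\<gamma> - 1))" for x
  define F :: "real \<Rightarrow> real" where "F u = (if \<eta> = 1 then u else sgn u * \<bar>u\<bar> powr \<gamma>)" for u
  have fc: "continuous_on UNIV f" by (rule primitive_continuous[OF f])
  have fm: "f \<in> borel_measurable lebesgue" "d \<in> borel_measurable lebesgue"
    using primitive_measurable[OF f] primitive_deriv_measurable[OF f] by auto
  have \<psi>m: "\<psi> \<in> borel_measurable lebesgue" unfolding \<psi>_def[abs_def] using fm by measurable
  have F: "primitive (\<lambda>x. \<gamma> * \<psi> x * d x) (\<lambda>x. F (f x))"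
  proof (cases "\<eta> = 1")
    case True
    then show ?thesis using f unfolding F_def \<psi>_def gamma_eq_1[OF True] by simp
  next
    case False
    then have "\<eta> > 1" using eta by simp
    then have g: "\<gamma> > 1" by (simp add: \<gamma>_def field_simps)
    show ?thesis
      using primitive_compose[OF f has_derivative_abs_powr_odd[OF g] continuous_on_abs_powr[OF g]] False
      by (simp add: F_def[abs_def] \<psi>_def)
  qed
  have absF: "\<bar>F u\<bar> = \<bar>u\<bar> powr \<gamma>" for u
    by (auto simp: F_def \<gamma>_def abs_mult sgn_if)
  have 1: "set_integrable lebesgue {a..b} (\<lambda>x. (\<psi> x * sqrt \<bar>1 / p x\<bar>)\<^sup>2)"
    "(LINT x:{a..b}|lebesgue. (\<psi> x * sqrt \<bar>1 / p x\<bar>)\<^sup>2) \<le> P * N powr (\<gamma> - 1)"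
    unfolding \<psi>_def N_def by (rule weighted_Hoelder[OF fc]; use False in blast)+
  have wae: "AE x in lebesgue. p x * (d x)\<^sup>2 = (sqrt \<bar>p x\<bar> * d x)\<^sup>2"
    using p_pos by eventually_elim (simp add: power_mult_distrib)
  have 2: "set_integrable lebesgue {a..b} (\<lambda>x. (sqrt \<bar>p x\<bar> * d x)\<^sup>2)"
    "(LINT x:{a..b}|lebesgue. (sqrt \<bar>p x\<bar> * d x)\<^sup>2) = kinetic_on a b d"
    subgoal by (subst set_integrable_cong_AE[OF _ _ _ , of _ _ "\<lambda>x. p x * (d x)\<^sup>2"])
      (use E p_meas fm wae in \<open>auto elim!: eventually_mono\<close>)
    subgoal by (rule set_lebesgue_integral_cong_AE) (use p_meas fm wae in \<open>auto elim!: eventually_mono\<close>)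
    done
  define E where "E = kinetic_on a b d"
  have Enn: "0 \<le> E" unfolding E_def 2(2)[symmetric] by (simp add: set_lebesgue_integral_def)
  have "(LINT x:{a..b}|lebesgue. \<bar>(\<psi> x * sqrt \<bar>1 / p x\<bar>) * (sqrt \<bar>p x\<bar> * d x)\<bar>)\<^sup>2 \<le>
     (LINT x:{a..b}|lebesgue. (\<psi> x * sqrt \<bar>1 / p x\<bar>)\<^sup>2) * E"
    unfolding E_def 2(2)[symmetric]
    by (rule set_Cauchy_Schwarz_integral) (use 1 2 \<psi>m p_meas fm in auto)
  also have "\<dots> \<le> P * N powr (\<gamma> - 1) * E" using 1 Enn by (intro mult_right_mono) auto
  finally have "(LINT x:{a..b}|lebesgue. \<bar>(\<psi> x * sqrt \<bar>1 / p x\<bar>) * (sqrt \<bar>p x\<bar> * d x)\<bar>) \<le> sqrt (P * N powr (\<gamma> - 1) * E)"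
    by (rule real_le_rsqrt)
  also have "(LINT x:{a..b}|lebesgue. \<bar>(\<psi> x * sqrt \<bar>1 / p x\<bar>) * (sqrt \<bar>p x\<bar> * d x)\<bar>) = (LINT x:{a..b}|lebesgue. \<bar>\<psi> x * d x\<bar>)"
  proof (rule set_lebesgue_integral_cong_AE)
    show "AE x\<in>{a..b} in lebesgue. \<bar>\<psi> x * sqrt \<bar>1 / p x\<bar> * (sqrt \<bar>p x\<bar> * d x)\<bar> = \<bar>\<psi> x * d x\<bar>"
      using p_pos by eventually_elim (simp add: real_sqrt_divide)
  qed (use \<psi>m p_meas fm in auto)
  finally have 3: "(LINT x:{a..b}|lebesgue. \<bar>\<psi> x * d x\<bar>) \<le> sqrt (P * N powr (\<gamma> - 1) * E)" .
  have "\<bar>F (f z) - F (f y)\<bar> \<le> (LINT x:{a..b}|lebesgue. \<bar>\<gamma> * \<psi> x * d x\<bar>)"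
    by (rule primitive_diff_le[OF F yz])
  also have "\<dots> = \<gamma> * (LINT x:{a..b}|lebesgue. \<bar>\<psi> x * d x\<bar>)"
    using gamma(1) by (simp add: abs_mult mult.assoc)
  also have "\<dots> \<le> \<gamma> * sqrt (P * N powr (\<gamma> - 1) * E)" using 3 gamma(1) by (intro mult_left_mono) auto
  finally have "\<bar>F (f z)\<bar> \<le> \<bar>F (f y)\<bar> + \<gamma> * sqrt (P * N powr (\<gamma> - 1) * E)" by linarith
  then show ?thesis by (simp add: absF N_def E_def)
qed

end

text \<open>The essential supremum of \<open>|g|\<close> could be negative only if the whole line were a null set.\<close>
lemma Linf_bound:
  assumes "in_Lp \<infinity> g"
  shows "AE x in lebesgue. \<bar>g x\<bar> \<le> Lp_norm \<infinity> g" "0 \<le> Lp_norm \<infinity> g"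
proof -
  define e where "e = esssup lebesgue (\<lambda>x. ereal \<bar>g x\<bar>)"
  have e: "e < \<infinity>" "Lp_norm \<infinity> g = real_of_ereal e" using assms by (auto simp: in_Lp_def Lp_norm_def e_def)
  have ae: "AE x in lebesgue. ereal \<bar>g x\<bar> \<le> e" unfolding e_def by (rule esssup_AE)
  have "0 \<le> e"
  proof (rule ccontr)
    assume "\<not> 0 \<le> e"
    then have "e < 0" by simp
    have "AE x in lebesgue. x \<in> ({} :: real set)" using ae
      by eventually_elim (use \<open>e < 0\<close> in \<open>meson abs_ge_zero ereal_less_eq(5) leD order_trans\<close>)
    then have "AE x in lebesgue. (x :: real) \<notin> UNIV" by simp
    then have "(UNIV :: real set) \<in> null_sets lebesgue" by (subst AE_iff_null_sets) auto
    then show False by (simp add: null_sets_def)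
  qed
  with e obtain c where c: "e = ereal c" by (cases e) auto
  show "AE x in lebesgue. \<bar>g x\<bar> \<le> Lp_norm \<infinity> g" using ae by (auto simp: c e(2))
  show "0 \<le> Lp_norm \<infinity> g" using \<open>0 \<le> e\<close> e(2) c by simp
qed

lemma set_integrable_bounded_mult:
  fixes f g :: "real \<Rightarrow> real"
  assumes f: "set_integrable lebesgue A f" and g: "g \<in> borel_measurable lebesgue"
    and A: "A \<in> sets lebesgue" and fm: "f \<in> borel_measurable lebesgue"
    and bd: "AE x in lebesgue. x \<in> A \<longrightarrow> \<bar>g x\<bar> \<le> C"
  shows "set_integrable lebesgue A (\<lambda>x. g x * f x)"
  unfolding set_integrable_def
proof (rule Bochner_Integration.integrable_bound)
  show "integrable lebesgue (\<lambda>x. C * (indicator A x *\<^sub>R f x))"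
    using f by (simp add: set_integrable_def)
  show "AE x in lebesgue. norm (indicator A x *\<^sub>R (g x * f x)) \<le> norm (C * (indicator A x *\<^sub>R f x))"
    using bd by eventually_elim (auto simp: indicator_def abs_mult intro!: mult_right_mono)
qed (use f g fm A in \<open>measurable\<close>)

text \<open>The reciprocal of the exponent with \<open>1/\<infinity> = 0\<close>, so that one estimate covers all \<open>s\<close>.\<close>
definition inv_exp :: "ereal \<Rightarrow> real" where
  "inv_exp s = (if s = \<infinity> then 0 else 1 / real_of_ereal s)"

lemma inv_exp: "1 \<le> s \<Longrightarrow> 0 \<le> inv_exp s \<and> inv_exp s \<le> 1"
  by (cases s) (auto simp: inv_exp_def)

text \<open>Hoelder with the exponents \<open>s\<close> and \<open>s/(s-1)\<close>, after \<open>f^2\<close> has been split into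
  \<open>(f^2)^(1/s)\<close>, at most \<open>S^(1/s)\<close>, and \<open>(f^2)^(1-1/s)\<close>. The degenerate cases \<open>S = 0\<close> and
  \<open>\<integral> f^2 = 0\<close> are separate because of the powers with exponent zero.\<close>
lemma potential_bound:
  fixes f k :: "real \<Rightarrow> real"
  assumes s: "1 \<le> s" and k: "in_Lp s k" "\<And>x. 0 \<le> k x"
    and A: "A \<in> sets lebesgue" and f: "f \<in> borel_measurable lebesgue" "set_integrable lebesgue A (\<lambda>x. (f x)\<^sup>2)"
    and S: "0 \<le> S" "\<And>x. x \<in> A \<Longrightarrow> (f x)\<^sup>2 \<le> S"
  shows "set_integrable lebesgue A (\<lambda>x. k x * (f x)\<^sup>2)"
    "(LINT x:A|lebesgue. k x * (f x)\<^sup>2) \<le>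
       Lp_norm s k * S powr inv_exp s * (LINT x:A|lebesgue. (f x)\<^sup>2) powr (1 - inv_exp s)"
proof -
  define N where "N = (LINT x:A|lebesgue. (f x)\<^sup>2)"
  have N: "0 \<le> N" by (simp add: N_def set_lebesgue_integral_def)
  have km: "k \<in> borel_measurable lebesgue" using k(1) by (simp add: in_Lp_def)
  have Qnn: "0 \<le> Lp_norm s k" using k(1) Linf_bound(2)[of k] by (cases "s = \<infinity>") (auto simp: Lp_norm_def)
  have "set_integrable lebesgue A (\<lambda>x. k x * (f x)\<^sup>2) \<and>
    (LINT x:A|lebesgue. k x * (f x)\<^sup>2) \<le> Lp_norm s k * S powr inv_exp s * N powr (1 - inv_exp s)"
  proof (cases "N = 0 \<or> S = 0")
    case True
    have 0: "AE x in lebesgue. indicator A x *\<^sub>R (k x * (f x)\<^sup>2) = 0"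
    proof (cases "S = 0")
      case True
      then have "f x = 0" if "x \<in> A" for x using S(2)[OF that] by simp
      then show ?thesis by (auto simp: indicator_def)
    next
      case False
      then have "AE x in lebesgue. indicator A x *\<^sub>R (f x)\<^sup>2 = 0"
        using True f(2) by (subst integral_nonneg_eq_0_iff_AE[symmetric])
          (auto simp: N_def set_lebesgue_integral_def set_integrable_def)
      then show ?thesis by eventually_elim (auto simp: indicator_def)
    qed
    have "integrable lebesgue (\<lambda>x. indicator A x *\<^sub>R (k x * (f x)\<^sup>2)) \<longleftrightarrow> integrable lebesgue (\<lambda>x::real. 0::real)"
      by (rule integrable_cong_AE) (use 0 A km f in auto)
    moreover have "(LINT x|lebesgue. indicator A x *\<^sub>R (k x * (f x)\<^sup>2)) = (LINT x::real|lebesgue. (0::real))"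
      by (rule integral_cong_AE) (use 0 A km f in auto)
    ultimately show ?thesis using Qnn by (simp add: set_integrable_def set_lebesgue_integral_def)
  next
    case False
    then have NS: "N > 0" "S > 0" using N S by auto
    consider "s = \<infinity>" | "s = 1" | t where "s = ereal t" "1 < t" using s by (cases s) (auto, force simp: less_le)
    then show ?thesis
    proof cases
      case 1
      have ae: "AE x in lebesgue. \<bar>k x\<bar> \<le> Lp_norm s k" using Linf_bound(1)[of k] k(1) 1 by simp
      have i: "set_integrable lebesgue A (\<lambda>x. k x * (f x)\<^sup>2)"
        by (rule set_integrable_bounded_mult[where C="Lp_norm s k"]) (use ae f km A in \<open>auto elim!: eventually_mono\<close>)
      have "(LINT x:A|lebesgue. k x * (f x)\<^sup>2) \<le> (LINT x:A|lebesgue. Lp_norm s k * (f x)\<^sup>2)"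
        by (rule set_integral_mono_AE) (use i f ae in \<open>auto elim!: eventually_mono intro!: mult_right_mono\<close>)
      then show ?thesis using i NS by (simp add: N_def[symmetric] inv_exp_def 1)
    next
      case 2
      then have ki: "integrable lebesgue k" "Lp_norm s k = (LINT x|lebesgue. k x)"
        using k by (auto simp: in_Lp_def Lp_norm_def one_ereal_def abs_of_nonneg split: if_splits)
      have kA: "set_integrable lebesgue A k" "(LINT x:A|lebesgue. k x) \<le> Lp_norm s k"
        using ki k(2) A set_integral_mono_set[of UNIV k A] set_integrable_subset[of lebesgue UNIV k A]
        by (auto simp: set_integrable_def set_lebesgue_integral_def)
      have "set_integrable lebesgue A (\<lambda>x. (f x)\<^sup>2 * k x)"
        by (rule set_integrable_bounded_mult[where C=S]) (use S f km A kA in auto)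
      then have i: "set_integrable lebesgue A (\<lambda>x. k x * (f x)\<^sup>2)" by (simp add: mult.commute)
      have "(LINT x:A|lebesgue. k x * (f x)\<^sup>2) \<le> (LINT x:A|lebesgue. k x * S)"
        by (rule set_integral_mono) (use i kA S k in \<open>auto intro!: mult_left_mono\<close>)
      also have "\<dots> \<le> Lp_norm s k * S" using kA S by (simp add: mult_right_mono)
      finally show ?thesis using i NS 2 by (simp add: inv_exp_def)
    next
      case (3 t)
      then have t: "inv_exp s = 1 / t" "0 < 1 / t" "0 < 1 - 1 / t" by (auto simp: inv_exp_def)
      have ki: "integrable lebesgue (\<lambda>x. k x powr t)" "Lp_norm s k = (LINT x|lebesgue. k x powr t) powr (1 / t)"
        using k 3 by (auto simp: in_Lp_def Lp_norm_def abs_of_nonneg)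
      have kA: "set_integrable lebesgue A (\<lambda>x. k x powr t)" "(LINT x:A|lebesgue. k x powr t) \<le> (LINT x|lebesgue. k x powr t)"
        using ki k(2) A set_integral_mono_set[of UNIV "\<lambda>x. k x powr t" A] set_integrable_subset[of lebesgue UNIV "\<lambda>x. k x powr t" A]
        by (auto simp: set_integrable_def set_lebesgue_integral_def)
      have knn: "0 \<le> (LINT x:A|lebesgue. k x powr t)" by (simp add: set_lebesgue_integral_def)
      have H: "set_integrable lebesgue A (\<lambda>x. (k x powr t) powr (1/t) * ((f x)\<^sup>2) powr (1 - 1/t))"
        "(LINT x:A|lebesgue. (k x powr t) powr (1/t) * ((f x)\<^sup>2) powr (1 - 1/t))
          \<le> (LINT x:A|lebesgue. k x powr t) powr (1/t) * N powr (1 - 1/t)"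
        unfolding N_def by (intro set_Hoelder_powr kA f; use t in simp)+
      have kt: "(k x powr t) powr (1/t) = k x" for x using k(2)[of x] 3 by (simp add: powr_powr)
      have pt: "k x * (f x)\<^sup>2 \<le> S powr (1/t) * (k x * ((f x)\<^sup>2) powr (1 - 1/t))" if "x \<in> A" for x
      proof -
        have "(f x)\<^sup>2 = ((f x)\<^sup>2) powr (1/t) * ((f x)\<^sup>2) powr (1 - 1/t)"
          by (simp flip: powr_add)
        also have "\<dots> \<le> S powr (1/t) * ((f x)\<^sup>2) powr (1 - 1/t)"
          using S(2)[OF that] t by (intro mult_right_mono powr_mono2) auto
        finally show ?thesis using k(2)[of x] by (metis mult.left_commute mult_left_mono)
      qed
      have i: "set_integrable lebesgue A (\<lambda>x. k x * (f x)\<^sup>2)"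
        unfolding set_integrable_def
      proof (rule Bochner_Integration.integrable_bound)
        show "integrable lebesgue (\<lambda>x. S powr (1/t) * (indicator A x *\<^sub>R (k x * ((f x)\<^sup>2) powr (1 - 1/t))))"
          using H(1) by (simp add: set_integrable_def kt)
        show "AE x in lebesgue. norm (indicator A x *\<^sub>R (k x * (f x)\<^sup>2))
           \<le> norm (S powr (1/t) * (indicator A x *\<^sub>R (k x * ((f x)\<^sup>2) powr (1 - 1/t))))"
          using pt k(2) by (intro AE_I2) (auto simp: indicator_def abs_of_nonneg)
      qed (use km f A in measurable)
      have "(LINT x:A|lebesgue. k x * (f x)\<^sup>2) \<le> (LINT x:A|lebesgue. S powr (1/t) * (k x * ((f x)\<^sup>2) powr (1 - 1/t)))"
        by (rule set_integral_mono) (use i H(1) pt in \<open>auto simp: kt\<close>)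
      also have "\<dots> \<le> S powr (1/t) * ((LINT x:A|lebesgue. k x powr t) powr (1/t) * N powr (1 - 1/t))"
        using H(2) by (simp add: kt mult_left_mono)
      also have "\<dots> \<le> S powr (1/t) * (Lp_norm s k * N powr (1 - 1/t))"
        unfolding ki(2) using kA(2) knn t by (intro mult_left_mono mult_right_mono powr_mono2) auto
      finally show ?thesis using i by (simp add: t(1) mult_ac)
    qed
  qed
  then show "set_integrable lebesgue A (\<lambda>x. k x * (f x)\<^sup>2)"
    "(LINT x:A|lebesgue. k x * (f x)\<^sup>2) \<le>
       Lp_norm s k * S powr inv_exp s * (LINT x:A|lebesgue. (f x)\<^sup>2) powr (1 - inv_exp s)"
    by (auto simp: N_def)
qed

text \<open>On \<open>\<Omega>\<close> the integrand is at most \<open>S\<close>, and off \<open>\<Omega>\<close> it is at most \<open>r g f^2\<close>.\<close>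
lemma mass_bound:
  fixes f r g :: "real \<Rightarrow> real"
  assumes A: "A \<in> sets lebesgue" and rm: "r \<in> borel_measurable lebesgue"
    and gm: "g \<in> borel_measurable lebesgue"
    and f: "set_integrable lebesgue A (\<lambda>x. (f x)\<^sup>2)" "set_integrable lebesgue A (\<lambda>x. r x * (f x)\<^sup>2)"
    and S: "\<And>x. x \<in> A \<Longrightarrow> (f x)\<^sup>2 \<le> S" "0 \<le> S"
    and r: "AE x in lebesgue. 0 < r x" and g: "AE x in lebesgue. 0 \<le> g x \<and> g x \<le> G"
    and fin: "emeasure lebesgue (Omega r g) < \<infinity>"
  shows "(LINT x:A|lebesgue. (f x)\<^sup>2) \<le> measure lebesgue (Omega r g) * S + G * (LINT x:A|lebesgue. r x * (f x)\<^sup>2)"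
proof -
  have O: "Omega r g \<in> sets lebesgue"
  proof -
    have "Omega r g = {x \<in> space lebesgue. r x * g x < 1}" by (simp add: Omega_def)
    also have "\<dots> \<in> sets lebesgue" using rm gm by measurable
    finally show ?thesis .
  qed
  have iO: "integrable lebesgue (indicator (Omega r g) :: real \<Rightarrow> real)"
    using O fin by simp
  have "(LINT x:A|lebesgue. (f x)\<^sup>2) \<le> (LINT x|lebesgue. S * indicator (Omega r g) x + G * (indicator A x *\<^sub>R (r x * (f x)\<^sup>2)))"
    unfolding set_lebesgue_integral_def
  proof (rule integral_mono_AE)
    show "integrable lebesgue (\<lambda>x. indicator A x *\<^sub>R (f x)\<^sup>2)" using f by (simp add: set_integrable_def)
    show "integrable lebesgue (\<lambda>x. S * indicator (Omega r g) x + G * (indicator A x *\<^sub>R (r x * (f x)\<^sup>2)))"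
      using f iO by (intro Bochner_Integration.integrable_add integrable_mult_right) (auto simp: set_integrable_def)
    show "AE x in lebesgue. indicator A x *\<^sub>R (f x)\<^sup>2 \<le> S * indicator (Omega r g) x + G * (indicator A x *\<^sub>R (r x * (f x)\<^sup>2))"
      using r g
    proof eventually_elim
      case (elim x)
      show ?case
      proof (cases "x \<in> A")
        case xA: True
        show ?thesis
        proof (cases "x \<in> Omega r g")
          case True
          have "0 \<le> G * (r x * (f x)\<^sup>2)" using elim by (intro mult_nonneg_nonneg) auto
          then show ?thesis using S(1)[OF xA] True xA by simp
        next
          case False
          then have "1 \<le> r x * g x" by (simp add: Omega_def)
          also have "\<dots> \<le> r x * G" using elim by (intro mult_left_mono) auto
          finally have "1 * (f x)\<^sup>2 \<le> r x * G * (f x)\<^sup>2" by (intro mult_right_mono) auto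
          then show ?thesis using False xA by (simp add: mult_ac)
        qed
      qed (use S in \<open>auto simp: indicator_def\<close>)
    qed
  qed
  also have "\<dots> = measure lebesgue (Omega r g) * S + G * (LINT x:A|lebesgue. r x * (f x)\<^sup>2)"
    unfolding set_lebesgue_integral_def
    using f iO O by (subst Bochner_Integration.integral_add) (auto simp: set_integrable_def)
  finally show ?thesis .
qed

section \<open>The lower bound of the quadratic form\<close>

locale SL =
  fixes p q r :: "real \<Rightarrow> real" and \<eta> :: real and s :: ereal
  assumes coeff: "SL_coefficients p q r"
    and eta1: "1 \<le> \<eta>" and p_Lp: "in_Lp \<eta> (\<lambda>x. 1 / p x)"
    and s1: "1 \<le> s" and qneg_Lp: "in_Lp s (neg_part q)"
    and eta_s: "s \<noteq> \<infinity> \<Longrightarrow> \<eta> + s > 2"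

sublocale SL \<subseteq> SL_leading p \<eta>
  using coeff eta1 p_Lp by unfold_locales (auto simp: SL_coefficients_def)

context SL
begin

abbreviation "mass f \<equiv> (LINT x|lebesgue. r x * (f x)\<^sup>2)"

abbreviation "mass_on a b f \<equiv> (LINT x:{a..b}|lebesgue. r x * (f x)\<^sup>2)"

abbreviation "finite_mass f \<equiv> integrable lebesgue (\<lambda>x. r x * (f x)\<^sup>2)"

abbreviation "ip f g \<equiv> (LINT x|lebesgue. r x * (f x * g x))"

lemma q_meas: "q \<in> borel_measurable lebesgue" and r_meas: "r \<in> borel_measurable lebesgue"
  and r_loc: "set_integrable lebesgue {a..b} r" and q_loc: "set_integrable lebesgue {a..b} q"
  and pinv_loc: "set_integrable lebesgue {a..b} (\<lambda>x. 1 / p x)"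
  and r_pos: "AE x in lebesgue. 0 < r x"
  using coeff by (auto simp: SL_coefficients_def in_L1_loc_def)

text \<open>The essential infimum outside a bounded interval may be infinite; its minimum with one is a positive
  real bound.\<close>
lemma r_lower: obtains c a b where "0 < c" "a < b" "AE x in lebesgue. x \<notin> {a..b} \<longrightarrow> c \<le> r x"
proof -
  obtain a b where ab: "a < b" "ess_inf_on (- {a..b}) r > 0"
    using coeff by (auto simp: SL_coefficients_def)
  then obtain c where c: "AE x in lebesgue. x \<in> - {a..b} \<longrightarrow> c \<le> ereal (r x)" "0 < c"
    unfolding ess_inf_on_def less_Sup_iff by blast
  have m: "min c 1 = ereal (real_of_ereal (min c 1))" "0 < real_of_ereal (min c 1)"
    using c(2) by (cases c; auto simp: min_def one_ereal_def zero_ereal_def)+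
  have "AE x in lebesgue. x \<notin> {a..b} \<longrightarrow> real_of_ereal (min c 1) \<le> r x"
    using c(1)
  proof eventually_elim
    case (elim x)
    show ?case
    proof
      assume "x \<notin> {a..b}"
      then have "min c 1 \<le> ereal (r x)" using elim by (auto intro: min.coboundedI1)
      then show "real_of_ereal (min c 1) \<le> r x" using m(1) by (metis ereal_less_eq(3))
    qed
  qed
  with ab(1) m(2) show ?thesis using that by blast
qed

abbreviation "\<sigma> \<equiv> inv_exp s"

abbreviation "Q \<equiv> Lp_norm s (neg_part q)"

lemma Q_nonneg: "0 \<le> Q"
  using qneg_Lp Linf_bound(2)[of "neg_part q"] by (cases "s = \<infinity>") (auto simp: Lp_norm_def)

lemma neg_part_nonneg: "0 \<le> neg_part q x"
  by (simp add: neg_part_def)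

lemma neg_part_meas: "neg_part q \<in> borel_measurable lebesgue"
  using qneg_Lp by (simp add: in_Lp_def)

text \<open>The condition \<open>\<eta> + s > 2\<close> excludes exactly the case \<open>\<eta> = s = 1\<close>, in which \<open>\<sigma> = \<gamma> = 1\<close>.\<close>
lemma sigma: "0 \<le> \<sigma>" "\<sigma> \<le> 1" "\<sigma> < \<gamma>"
proof -
  show 1: "0 \<le> \<sigma>" "\<sigma> \<le> 1" using inv_exp[OF s1] by auto
  show "\<sigma> < \<gamma>"
  proof (cases s)
    case (real t)
    then have t: "1 \<le> t" "\<eta> + t > 2" using s1 eta_s by auto
    then have "1 / t < 1 \<or> 1 / \<eta> < 1" using eta1 by (auto simp: divide_less_eq)
    moreover have "1 / t \<le> 1" "1 / \<eta> \<le> 1" using t eta1 by auto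
    ultimately have "1 / t < 2 - 1 / \<eta>" by linarith
    moreover have "\<gamma> = 2 - 1 / \<eta>" using gamma(2) by linarith
    ultimately show ?thesis using real by (simp add: inv_exp_def)
  next
    case PInf
    then show ?thesis using gamma(1) by (simp add: inv_exp_def)
  qed (use s1 in auto)
qed

lemma SL_beta_eq: "SL_beta p q \<eta> s = (\<gamma>\<^sup>2 * P * Q) powr (1 / (\<gamma> - \<sigma>))"
proof -
  have "(if s = \<infinity> then \<eta> / (2 * \<eta> - 1) else \<eta> * real_of_ereal s / (2 * \<eta> * real_of_ereal s - \<eta> - real_of_ereal s))
     = 1 / (\<gamma> - \<sigma>)"
  proof (cases s)
    case (real t)
    then have "t \<ge> 1" using s1 by simp
    then have "\<gamma> - \<sigma> = (2 * \<eta> * t - \<eta> - t) / (\<eta> * t)"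
      using eta1 unfolding \<gamma>_def by (simp add: real inv_exp_def diff_divide_distrib)
    then show ?thesis using real by simp
  qed (use s1 in \<open>auto simp: inv_exp_def \<gamma>_def\<close>)
  then show ?thesis by (simp add: SL_beta_def \<gamma>_def[symmetric])
qed

text \<open>Only an inequality for \<open>s = \<infinity>\<close>: then \<open>\<sigma> = 0\<close>, and for \<open>\<beta> = 0\<close> the convention \<open>0 powr 0 = 0\<close> applies.\<close>
lemma SL_alpha_ge: "Q * (SL_beta p q \<eta> s) powr \<sigma> \<le> SL_alpha p q \<eta> s"
  using Q_nonneg by (auto simp: SL_alpha_def inv_exp_def mult_left_le)

lemma SL_alpha_nonneg: "0 \<le> SL_alpha p q \<eta> s"
  using Q_nonneg by (auto simp: SL_alpha_def)

text \<open>The sets where \<open>0 < r < 1/K\<close> decrease to the empty set. Since \<open>r\<close> is bounded below outside a bounded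
  interval, they have finite measure for large \<open>K\<close>, so their measure tends to zero.\<close>
lemma small_Omega:
  assumes "0 < e"
  shows "\<exists>K>0. emeasure lebesgue (Omega r (\<lambda>_. K)) < \<infinity> \<and> measure lebesgue (Omega r (\<lambda>_. K)) \<le> e"
proof -
  obtain c a b where c: "0 < c" "a < b" "AE x in lebesgue. x \<notin> {a..b} \<longrightarrow> c \<le> r x"
    using r_lower by blast
  \<comment> \<open>The summand \<open>1/c\<close> keeps the points outside \<open>[a,b]\<close>, where \<open>r \<ge> c\<close>, out of the set for every \<open>n\<close>.\<close>
  define A where "A n = {x \<in> {a..b}. 0 < r x \<and> r x * (real n + 1 / c) < 1}" for n :: nat
  have "A n = {a..b} \<inter> {x \<in> space lebesgue. 0 < r x \<and> r x * (real n + 1 / c) < 1}" for n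
    by (auto simp: A_def)
  moreover have "{a..b} \<inter> {x \<in> space lebesgue. 0 < r x \<and> r x * (real n + 1 / c) < 1} \<in> sets lebesgue" for n
  proof (rule sets.Int)
    show "{x \<in> space lebesgue. 0 < r x \<and> r x * (real n + 1 / c) < 1} \<in> sets lebesgue"
      using r_meas by measurable
  qed auto
  ultimately have Am: "A n \<in> sets lebesgue" for n by simp
  have Ale: "emeasure lebesgue (A n) \<le> emeasure lebesgue {a..b}" for n
    by (rule emeasure_mono) (auto simp: A_def)
  have fin: "emeasure lebesgue (A n) < \<infinity>" for n
    using Ale[of n] by (rule order_le_less_trans) (simp add: emeasure_lborel_Icc_eq)
  have "(\<lambda>n. measure lebesgue (A n)) \<longlonglongrightarrow> measure lebesgue (\<Inter>n. A n)"
  proof (rule Lim_measure_decseq)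
    show "decseq A"
    proof (rule decseq_SucI, rule subsetI)
      fix n x assume x: "x \<in> A (Suc n)"
      have "r x * (real n + 1 / c) \<le> r x * (real (Suc n) + 1 / c)"
        using x by (intro mult_left_mono) (auto simp: A_def)
      also have "\<dots> < 1" using x unfolding A_def by blast
      finally show "x \<in> A n" using x by (auto simp: A_def)
    qed
  qed (use Am fin in \<open>auto simp: less_top[symmetric]\<close>)
  moreover have "(\<Inter>n. A n) = {}"
  proof -
    have False if "\<forall>n. x \<in> A n" for x
    proof -
      have "0 < r x" using that by (auto simp: A_def)
      obtain n where "1 / r x < real n" using reals_Archimedean2 by blast
      then have "1 < r x * real n" using \<open>0 < r x\<close> by (simp add: divide_less_eq mult.commute)
      also have "\<dots> \<le> r x * (real n + 1 / c)" using \<open>0 < r x\<close> c by (intro mult_left_mono) auto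
      finally have "1 < r x * (real n + 1 / c)" .
      moreover have "r x * (real n + 1 / c) < 1" using that by (auto simp: A_def)
      ultimately show False by simp
    qed
    then show ?thesis by auto
  qed
  ultimately have "(\<lambda>n. measure lebesgue (A n)) \<longlonglongrightarrow> 0" by simp
  then have "eventually (\<lambda>n. measure lebesgue (A n) < e) sequentially"
    using assms by (rule order_tendstoD)
  then obtain n where n: "measure lebesgue (A n) < e" by (auto simp: eventually_sequentially)
  define K where "K = real n + 1 / c"
  have K: "K > 0" using c by (simp add: K_def add_nonneg_pos)
  have Om: "Omega r (\<lambda>_. K) \<in> sets lebesgue"
  proof -
    have "Omega r (\<lambda>_. K) = {x \<in> space lebesgue. r x * K < 1}" by (simp add: Omega_def)
    also have "\<dots> \<in> sets lebesgue" using r_meas by measurable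
    finally show ?thesis .
  qed
  have "emeasure lebesgue (Omega r (\<lambda>_. K)) = emeasure lebesgue (A n)"
  proof (rule emeasure_eq_AE[OF _ Om Am])
    show "AE x in lebesgue. (x \<in> Omega r (\<lambda>_. K)) = (x \<in> A n)"
      using c(3) r_pos
    proof eventually_elim
      case (elim x)
      have "1 \<le> r x * K" if "x \<notin> {a..b}"
      proof -
        have "1 \<le> c * K" using c by (simp add: K_def algebra_simps)
        also have "\<dots> \<le> r x * K" using elim(1) that K by (intro mult_right_mono) auto
        finally show ?thesis .
      qed
      then show ?case
        using elim by (cases "x \<in> {a..b}") (auto simp: A_def Omega_def K_def[symmetric])
    qed
  qed
  moreover from this have "measure lebesgue (Omega r (\<lambda>_. K)) = measure lebesgue (A n)"
    by (simp only: measure_def)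
  ultimately show ?thesis using K fin[of n] n by (intro exI[of _ K]) auto
qed

text \<open>Outside a bounded interval \<open>r\<close> is bounded below; on it \<open>f\<close> is bounded.\<close>
lemma L2_of_weighted:
  assumes f: "continuous_on UNIV f" "f \<in> borel_measurable lebesgue" and i: "finite_mass f"
  shows "integrable lebesgue (\<lambda>x. (f x)\<^sup>2)"
proof -
  obtain c a b where c: "0 < c" "a < b" "AE x in lebesgue. x \<notin> {a..b} \<longrightarrow> c \<le> r x"
    using r_lower by blast
  have s: "set_integrable lebesgue {a..b} (\<lambda>x. (f x)\<^sup>2)"
    using f by (auto intro!: continuous_set_integrable continuous_intros intro: continuous_on_subset)
  show ?thesis
  proof (rule Bochner_Integration.integrable_bound)
    show "integrable lebesgue (\<lambda>x. indicator {a..b} x *\<^sub>R (f x)\<^sup>2 + (1 / c) * (r x * (f x)\<^sup>2))"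
      using s i unfolding set_integrable_def by (intro Bochner_Integration.integrable_add integrable_mult_right)
    show "AE x in lebesgue. norm ((f x)\<^sup>2) \<le> norm (indicator {a..b} x *\<^sub>R (f x)\<^sup>2 + (1 / c) * (r x * (f x)\<^sup>2))"
      using c(3) r_pos
    proof eventually_elim
      case (elim x)
      have nn: "0 \<le> 1 / c * (r x * (f x)\<^sup>2)" using c elim by simp
      show ?case
      proof (cases "x \<in> {a..b}")
        case True
        then show ?thesis using nn by simp
      next
        case False
        then have "c * (f x)\<^sup>2 \<le> r x * (f x)\<^sup>2" using elim by (intro mult_right_mono) auto
        then have "(f x)\<^sup>2 \<le> 1 / c * (r x * (f x)\<^sup>2)" using c by (simp add: field_simps)
        moreover have "indicator {a..b} x *\<^sub>R (f x)\<^sup>2 = 0" using False by simp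
        ultimately show ?thesis unfolding real_norm_def by (simp only: add_0 abs_of_nonneg[OF nn] abs_power2)
      qed
    qed
  qed (use f in measurable)
qed

text \<open>The interval inequality with a starting point \<open>y\<close> at which \<open>f\<close> is arbitrarily small; such a point
  exists in every sufficiently long interval because \<open>f^2\<close> is integrable.\<close>
lemma interpolation_line:
  assumes f: "primitive d f" and E: "integrable lebesgue (\<lambda>x. p x * (d x)\<^sup>2)" and N: "integrable lebesgue (\<lambda>x. (f x)\<^sup>2)"
  shows "((f z)\<^sup>2) powr \<gamma> \<le> \<gamma>\<^sup>2 * P * (LINT x|lebesgue. (f x)\<^sup>2) powr (\<gamma> - 1) * kinetic d"
proof -
  define NN EE where "NN = (LINT x|lebesgue. (f x)\<^sup>2)" and "EE = kinetic d"
  have NN: "0 \<le> NN" by (simp add: NN_def)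
  have "\<bar>f z\<bar> powr \<gamma> \<le> \<gamma> * sqrt (P * NN powr (\<gamma> - 1) * EE) + e" if e: "e > 0" for e
  proof -
    \<comment> \<open>On an interval of this length the mean of \<open>f^2\<close> is less than \<open>e^(2/\<gamma>)\<close>.\<close>
    define L where "L = (NN + 1) / e powr (2 / \<gamma>)"
    have L: "L > 0" using NN e by (simp add: L_def)
    have sE: "set_integrable lebesgue {z..z+L} (\<lambda>x. p x * (d x)\<^sup>2)"
      using set_integrable_subset[of lebesgue UNIV "\<lambda>x. p x * (d x)\<^sup>2" "{z..z+L}"] E by (simp add: set_integrable_def)
    have NI: "(LINT x:{z..z+L}|lebesgue. (f x)\<^sup>2) \<le> NN"
      using set_integral_mono_set[of UNIV "\<lambda>x. (f x)\<^sup>2" "{z..z+L}"] N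
      by (simp add: set_integrable_def set_lebesgue_integral_def NN_def)
    have "AE x in lebesgue. 0 \<le> p x * (d x)\<^sup>2" using p_pos by eventually_elim auto
    then have EI: "(kinetic_on z (z+L) d) \<le> EE"
      using set_integral_mono_set[of UNIV "\<lambda>x. p x * (d x)\<^sup>2" "{z..z+L}"] E
      by (simp add: set_integrable_def set_lebesgue_integral_def EE_def)
    obtain y where y: "y \<in> {z..z+L}" "L * (f y)\<^sup>2 \<le> (LINT x:{z..z+L}|lebesgue. (f x)\<^sup>2)"
      using ex_average[of z "z + L" f] L primitive_continuous[OF f] by auto
    have "L * (f y)\<^sup>2 \<le> L * e powr (2 / \<gamma>)" using y(2) NI e by (simp add: L_def)
    then have "(f y)\<^sup>2 \<le> e powr (2 / \<gamma>)" using L by simp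
    then have "((f y)\<^sup>2) powr (\<gamma> / 2) \<le> (e powr (2 / \<gamma>)) powr (\<gamma> / 2)"
      using gamma(1) by (intro powr_mono2) auto
    moreover have "((f y)\<^sup>2) powr (\<gamma> / 2) = \<bar>f y\<bar> powr \<gamma>"
    proof -
      have "(f y)\<^sup>2 = \<bar>f y\<bar> powr 2" by simp
      then show ?thesis by (simp only: powr_powr) simp
    qed
    ultimately have ye: "\<bar>f y\<bar> powr \<gamma> \<le> e" using gamma(1) e by (simp add: powr_powr)
    have "P * (LINT x:{z..z+L}|lebesgue. (f x)\<^sup>2) powr (\<gamma> - 1) * (kinetic_on z (z+L) d)
        \<le> P * NN powr (\<gamma> - 1) * EE"
      using NI EI P_nonneg energy_nonneg gamma(1)
      by (intro mult_mono mult_nonneg_nonneg powr_mono2) (auto simp: set_lebesgue_integral_def)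
    then have "\<gamma> * sqrt (P * (LINT x:{z..z+L}|lebesgue. (f x)\<^sup>2) powr (\<gamma> - 1) * (kinetic_on z (z+L) d))
        \<le> \<gamma> * sqrt (P * NN powr (\<gamma> - 1) * EE)"
      using gamma(1) by (intro mult_left_mono) auto
    then show ?thesis
      using interpolation_interval[OF f _ sE y(1), of z] L ye by auto
  qed
  then have *: "\<bar>f z\<bar> powr \<gamma> \<le> \<gamma> * sqrt (P * NN powr (\<gamma> - 1) * EE)" by (rule field_le_epsilon)
  have EE: "0 \<le> EE" using energy_nonneg[of UNIV d] by (simp add: EE_def set_lebesgue_integral_def)
  have "((f z)\<^sup>2) powr \<gamma> = (\<bar>f z\<bar> powr \<gamma>)\<^sup>2"
    by (subst power2_abs[symmetric]) (simp only: power2_eq_square powr_mult abs_ge_zero)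
  also have "\<dots> \<le> (\<gamma> * sqrt (P * NN powr (\<gamma> - 1) * EE))\<^sup>2" using * by (intro power_mono) auto
  also have "\<dots> = \<gamma>\<^sup>2 * P * NN powr (\<gamma> - 1) * EE"
    using EE P_nonneg by (simp add: power_mult_distrib)
  finally show ?thesis by (simp add: NN_def EE_def)
qed

text \<open>If the left-hand side is positive, then \<open>sup f^2 \<le> \<beta> \<integral> f^2\<close>, and the estimate
  \<open>\<integral> f^2 \<le> \<mu>(\<Omega>) sup f^2 + ||g|| \<integral> r f^2\<close> can be solved for \<open>\<integral> f^2\<close>. For \<open>\<beta> = 0\<close> the
  hypothesis admits sets \<open>\<Omega>\<close> of infinite measure; in that case the left-hand side is not positive.\<close>
lemma form_lower_bound:
  assumes f: "primitive d f" and E: "integrable lebesgue (\<lambda>x. p x * (d x)\<^sup>2)" and R: "finite_mass f"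
    and g: "in_Lp \<infinity> g" "AE x in lebesgue. 0 \<le> g x"
    and small: "emeasure lebesgue (Omega r g) * ennreal (SL_beta p q \<eta> s) < 1"
  shows "(LINT x|lebesgue. neg_part q x * (f x)\<^sup>2) - kinetic d \<le>
    SL_alpha p q \<eta> s * Lp_norm \<infinity> g / (1 - measure lebesgue (Omega r g) * SL_beta p q \<eta> s) * mass f"
proof -
  define N X B R where "N = (LINT x|lebesgue. (f x)\<^sup>2)" and "X = kinetic d"
    and "B = (LINT x|lebesgue. neg_part q x * (f x)\<^sup>2)" and "R = mass f"
  define A where "A = \<gamma>\<^sup>2 * P"
  define S where "S = (A * N powr (\<gamma> - 1) * X) powr (1 / \<gamma>)"
  define \<beta> where "\<beta> = SL_beta p q \<eta> s"
  define \<mu> where "\<mu> = measure lebesgue (Omega r g)"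
  have fm: "f \<in> borel_measurable lebesgue" by (rule primitive_measurable[OF f])
  have Ni: "integrable lebesgue (\<lambda>x. (f x)\<^sup>2)"
    by (rule L2_of_weighted[OF primitive_continuous[OF f] fm R])
  have nn: "0 \<le> N" "0 \<le> X" "0 \<le> A" "0 \<le> S"
    using P_nonneg energy_nonneg[of UNIV d] by (auto simp: N_def X_def A_def S_def set_lebesgue_integral_def)
  have Rnn: "0 \<le> R" unfolding R_def by (rule integral_nonneg_AE, use r_pos in eventually_elim) auto
  have AX: "0 \<le> A * N powr (\<gamma> - 1) * X" using nn by simp
  have S\<gamma>: "S powr \<gamma> = A * N powr (\<gamma> - 1) * X"
    using AX gamma(1) by (simp add: S_def powr_powr)
  have fS: "(f z)\<^sup>2 \<le> S" for z
  proof -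
    have "((f z)\<^sup>2) powr \<gamma> \<le> A * N powr (\<gamma> - 1) * X"
      using interpolation_line[OF f E Ni, of z] by (simp add: A_def N_def X_def)
    then have "(((f z)\<^sup>2) powr \<gamma>) powr (1 / \<gamma>) \<le> S" unfolding S_def using gamma(1) by (intro powr_mono2) auto
    then show ?thesis using gamma(1) by (simp add: powr_powr)
  qed
  have B: "B \<le> Q * S powr \<sigma> * N powr (1 - \<sigma>)"
    using potential_bound(2)[OF s1 qneg_Lp neg_part_nonneg, of UNIV f S] fm Ni nn fS
    by (simp add: B_def N_def set_integrable_def set_lebesgue_integral_def)
  have \<beta>eq: "\<beta> = (A * Q) powr (1 / (\<gamma> - \<sigma>))" by (simp add: \<beta>_def SL_beta_eq A_def)
  note num = interpolation_numeric[OF gamma(1) sigma nn(3) Q_nonneg nn(4) nn(1) nn(2) eq_refl[OF S\<gamma>] B, folded \<beta>eq]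
  have \<beta>nn: "0 \<le> \<beta>" by (simp add: \<beta>eq)
  have \<mu>\<beta>: "\<mu> * \<beta> < 1"
  proof (cases "emeasure lebesgue (Omega r g) = \<infinity>")
    case True
    then show ?thesis by (simp add: \<mu>_def measure_def)
  next
    case False
    then have "emeasure lebesgue (Omega r g) = ennreal \<mu>" by (simp add: \<mu>_def emeasure_eq_ennreal_measure)
    then show ?thesis using small \<beta>nn by (simp add: \<mu>_def \<beta>_def ennreal_mult[symmetric] ennreal_less_iff flip: ennreal_1)
  qed
  have Gnn: "0 \<le> Lp_norm \<infinity> g" by (rule Linf_bound(2)[OF g(1)])
  have rhs: "0 \<le> SL_alpha p q \<eta> s * Lp_norm \<infinity> g / (1 - \<mu> * \<beta>) * R"
    using SL_alpha_nonneg Gnn \<mu>\<beta> Rnn by simp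
  have "B - X \<le> SL_alpha p q \<eta> s * Lp_norm \<infinity> g / (1 - \<mu> * \<beta>) * R"
  proof (cases "X \<le> B \<and> \<beta> \<noteq> 0")
    case False
    then have "B - X \<le> 0" using num(1) nn by auto
    then show ?thesis using rhs by simp
  next
    case True
    then have SN: "S \<le> \<beta> * N" using num(2) by simp
    have "emeasure lebesgue (Omega r g) < \<infinity>"
    proof (rule ccontr)
      assume "\<not> emeasure lebesgue (Omega r g) < \<infinity>"
      then have "emeasure lebesgue (Omega r g) = \<infinity>" by (metis infinity_ennreal_def top.not_eq_extremum)
      then show False using small True \<beta>nn by (simp add: \<beta>_def[symmetric] ennreal_top_mult)
    qed
    moreover have "AE x in lebesgue. 0 \<le> g x \<and> g x \<le> Lp_norm \<infinity> g"
      using g(2) Linf_bound(1)[OF g(1)] by eventually_elim auto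
    ultimately have "N \<le> \<mu> * S + Lp_norm \<infinity> g * R"
      using mass_bound[of UNIV r g f S "Lp_norm \<infinity> g"] fm r_meas g(1) Ni R fS nn r_pos
      by (simp add: N_def R_def \<mu>_def set_integrable_def set_lebesgue_integral_def in_Lp_def)
    also have "\<dots> \<le> \<mu> * (\<beta> * N) + Lp_norm \<infinity> g * R"
      using SN by (intro add_right_mono mult_left_mono) (auto simp: \<mu>_def)
    finally have "N * (1 - \<mu> * \<beta>) \<le> Lp_norm \<infinity> g * R" by (simp add: algebra_simps)
    then have NR: "N \<le> Lp_norm \<infinity> g * R / (1 - \<mu> * \<beta>)" using \<mu>\<beta> by (simp add: pos_le_divide_eq)
    have "B - X \<le> Q * \<beta> powr \<sigma> * N" using num(1) .
    also have "\<dots> \<le> SL_alpha p q \<eta> s * N" using SL_alpha_ge nn by (simp add: \<beta>_def mult_right_mono)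
    also have "\<dots> \<le> SL_alpha p q \<eta> s * (Lp_norm \<infinity> g * R / (1 - \<mu> * \<beta>))"
      using NR SL_alpha_nonneg by (rule mult_left_mono)
    finally show ?thesis by simp
  qed
  then show ?thesis by (simp add: B_def X_def \<mu>_def \<beta>_def R_def)
qed

section \<open>Coercivity on bounded intervals\<close>

lemma continuous_weight_integrable:
  fixes f h :: "real \<Rightarrow> real"
  assumes h: "set_integrable lebesgue {a..b} h" "h \<in> borel_measurable lebesgue" and f: "continuous_on UNIV f" 
  shows "set_integrable lebesgue {a..b} (\<lambda>x. h x * f x)"
proof -
  have "compact (f ` {a..b})"
    using f by (intro compact_continuous_image continuous_on_subset[OF f]) auto
  then obtain M where "\<forall>y\<in>f ` {a..b}. norm y \<le> M" using compact_imp_bounded bounded_iff by blast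
  then have "set_integrable lebesgue {a..b} (\<lambda>x. f x * h x)"
    using h f by (intro set_integrable_bounded_mult[where C=M])
      (auto intro!: measurable_completion borel_measurable_continuous_onI)
  then show ?thesis by (simp add: mult.commute)
qed

text \<open>On a bounded interval \<open>f\<close> need not be small anywhere, but on one of length at least one it takes a
  value with \<open>f(y)^2 \<le> \<integral> f^2\<close>. This replaces the kinetic energy \<open>E\<close> by \<open>X = E + \<integral> f^2\<close>
  in the interpolation inequality. The resulting multiple of \<open>\<integral> f^2\<close> is absorbed by \<open>small_Omega\<close>: if
  \<open>\<mu>(\<Omega>)\<close> is small enough, \<open>\<integral> f^2\<close> is at most a small multiple of \<open>E\<close> plus a large multiple of
  \<open>\<integral> r f^2\<close>. The constant is the same for all intervals, which is what the applications on growing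
  intervals use.\<close>
lemma interval_bounds:
  "\<exists>C>0. \<forall>a b d f. 1 \<le> b - a \<longrightarrow> primitive d f \<longrightarrow> set_integrable lebesgue {a..b} (\<lambda>x. p x * (d x)\<^sup>2) \<longrightarrow>
     set_integrable lebesgue {a..b} (\<lambda>x. neg_part q x * (f x)\<^sup>2) \<and>
     (LINT x:{a..b}|lebesgue. neg_part q x * (f x)\<^sup>2) \<le>
       (kinetic_on a b d) / 2 + C * mass_on a b f \<and>
     (\<forall>z\<in>{a..b}. (f z)\<^sup>2 \<le> C * ((kinetic_on a b d) + (mass_on a b f)))"
proof -
  define A where "A = (1 + \<gamma> * sqrt P)\<^sup>2"
  define C1 where "C1 = A powr (1 / \<gamma>)"
  define c where "c = 1 + 4 * Q * ((A * (4 * Q)) powr (1 / (\<gamma> - \<sigma>))) powr \<sigma>"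
  have A: "0 \<le> A" and C1: "0 \<le> C1" by (auto simp: A_def C1_def)
  have c: "1 \<le> c" using Q_nonneg by (simp add: c_def)
  \<comment> \<open>chosen so that \<open>\<mu> C1 \<le> 1 / (2 c)\<close> below\<close>
  obtain K where K: "K > 0" "emeasure lebesgue (Omega r (\<lambda>_. K)) < \<infinity>"
     "measure lebesgue (Omega r (\<lambda>_. K)) \<le> 1 / (2 * c * (C1 + 1))"
    using small_Omega[of "1 / (2 * c * (C1 + 1))"] c C1 by auto
  define \<mu> where "\<mu> = measure lebesgue (Omega r (\<lambda>_. K))"
  define C where "C = c * K + 2 * C1 * (1 + K) + 1"
  have Cpos: "C > 0" using c K C1 by (simp add: C_def add_nonneg_pos)
  have "set_integrable lebesgue {a..b} (\<lambda>x. neg_part q x * (f x)\<^sup>2) \<and>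
     (LINT x:{a..b}|lebesgue. neg_part q x * (f x)\<^sup>2) \<le>
       (kinetic_on a b d) / 2 + C * mass_on a b f \<and>
     (\<forall>z\<in>{a..b}. (f z)\<^sup>2 \<le> C * ((kinetic_on a b d) + (mass_on a b f)))"
    if ab: "1 \<le> b - a" and f: "primitive d f" and Ei: "set_integrable lebesgue {a..b} (\<lambda>x. p x * (d x)\<^sup>2)" for a b d f
  proof -
    define N E B R where "N = (LINT x:{a..b}|lebesgue. (f x)\<^sup>2)" and "E = kinetic_on a b d"
      and "B = (LINT x:{a..b}|lebesgue. neg_part q x * (f x)\<^sup>2)" and "R = mass_on a b f"
    have fc: "continuous_on UNIV f" and fm: "f \<in> borel_measurable lebesgue"
      using primitive_continuous[OF f] primitive_measurable[OF f] by auto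
    have Ni: "set_integrable lebesgue {a..b} (\<lambda>x. (f x)\<^sup>2)"
      using fc by (auto intro!: continuous_set_integrable continuous_intros intro: continuous_on_subset)
    have Ri: "set_integrable lebesgue {a..b} (\<lambda>x. r x * (f x)\<^sup>2)"
      by (intro continuous_weight_integrable r_loc r_meas continuous_intros fc)
    have nn: "0 \<le> N" "0 \<le> E" "0 \<le> R"
      using energy_nonneg[of "{a..b}" d] unfolding N_def E_def R_def set_lebesgue_integral_def
      by (auto intro!: integral_nonneg_AE eventually_mono[OF r_pos] simp: indicator_def)
    define X where "X = E + N"
    have X: "0 \<le> X" using nn by (simp add: X_def)
    define S where "S = (A * N powr (\<gamma> - 1) * X) powr (1 / \<gamma>)"
    have AX: "0 \<le> A * N powr (\<gamma> - 1) * X" using A X by simp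
    have S: "0 \<le> S" by (simp add: S_def)
    have S\<gamma>: "S powr \<gamma> = A * N powr (\<gamma> - 1) * X"
      using AX gamma(1) by (simp add: S_def powr_powr)
    obtain y where y: "y \<in> {a..b}" "(b - a) * (f y)\<^sup>2 \<le> N"
      unfolding N_def using ex_average[of a b f] ab primitive_continuous[OF f] by auto
    have yN: "(f y)\<^sup>2 \<le> N"
    proof -
      have "1 * (f y)\<^sup>2 \<le> (b - a) * (f y)\<^sup>2" using ab by (intro mult_right_mono) auto
      then show ?thesis using y(2) by simp
    qed
    have N\<gamma>: "N powr \<gamma> = N powr (\<gamma> - 1) * N"
      using nn(1) gamma(1) by (cases "N = 0") (auto simp: powr_diff)
    have sq: "u\<^sup>2 powr \<gamma> = (\<bar>u\<bar> powr \<gamma>)\<^sup>2" for u :: real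
      by (subst power2_abs[symmetric]) (simp only: power2_eq_square powr_mult abs_ge_zero)
    have fy: "\<bar>f y\<bar> powr \<gamma> \<le> sqrt (N powr (\<gamma> - 1) * X)"
    proof (rule real_le_rsqrt)
      have "(\<bar>f y\<bar> powr \<gamma>)\<^sup>2 = (f y)\<^sup>2 powr \<gamma>" by (simp add: sq)
      also have "\<dots> \<le> N powr \<gamma>" using yN gamma(1) by (intro powr_mono2) auto
      also have "\<dots> \<le> N powr (\<gamma> - 1) * X" unfolding N\<gamma> X_def using nn by (intro mult_left_mono) auto
      finally show "(\<bar>f y\<bar> powr \<gamma>)\<^sup>2 \<le> N powr (\<gamma> - 1) * X" .
    qed
    have fS: "(f z)\<^sup>2 \<le> S" if z: "z \<in> {a..b}" for z
    proof -
      have "sqrt (P * N powr (\<gamma> - 1) * E) \<le> sqrt P * sqrt (N powr (\<gamma> - 1) * X)"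
        unfolding real_sqrt_mult[symmetric] real_sqrt_le_iff mult.assoc X_def
        using nn P_nonneg by (intro mult_left_mono) auto
      then have "\<gamma> * sqrt (P * N powr (\<gamma> - 1) * E) \<le> \<gamma> * (sqrt P * sqrt (N powr (\<gamma> - 1) * X))"
        using gamma(1) by (intro mult_left_mono) auto
      then have "\<bar>f z\<bar> powr \<gamma> \<le> sqrt (N powr (\<gamma> - 1) * X) + \<gamma> * (sqrt P * sqrt (N powr (\<gamma> - 1) * X))"
        using interpolation_interval[OF f _ Ei y(1) z] ab fy by (simp add: N_def E_def)
      also have "\<dots> = (1 + \<gamma> * sqrt P) * sqrt (N powr (\<gamma> - 1) * X)" by (simp add: algebra_simps)
      finally have "(\<bar>f z\<bar> powr \<gamma>)\<^sup>2 \<le> ((1 + \<gamma> * sqrt P) * sqrt (N powr (\<gamma> - 1) * X))\<^sup>2"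
        by (rule power_mono) auto
      also have "\<dots> = A * N powr (\<gamma> - 1) * X" using X by (simp add: power_mult_distrib A_def)
      finally have "((f z)\<^sup>2 powr \<gamma>) powr (1 / \<gamma>) \<le> S"
        unfolding S_def sq[symmetric] using gamma(1) by (intro powr_mono2) auto
      then show ?thesis using gamma(1) by (simp add: powr_powr)
    qed
    have pot: "set_integrable lebesgue {a..b} (\<lambda>x. neg_part q x * (f x)\<^sup>2)"
      "B \<le> Q * S powr \<sigma> * N powr (1 - \<sigma>)"
      unfolding B_def N_def by (rule potential_bound[OF s1 qneg_Lp neg_part_nonneg _ fm Ni S fS]; simp)+
    \<comment> \<open>the factor 4 turns into the coefficient of the kinetic energy, which is to end up as 1/2\<close>
    then have "4 * B \<le> 4 * Q * S powr \<sigma> * N powr (1 - \<sigma>)" by simp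
    note num = interpolation_numeric(1)[OF gamma(1) sigma A _ S nn(1) X eq_refl[OF S\<gamma>] this]
    have B: "4 * B \<le> E + c * N"
      using num Q_nonneg by (simp add: X_def c_def algebra_simps)
    have SX: "S \<le> C1 * X"
    proof -
      have "N powr (\<gamma> - 1) * X \<le> X powr (\<gamma> - 1) * X"
        using nn gamma(1) X by (intro mult_right_mono powr_mono2) (auto simp: X_def)
      also have "\<dots> = X powr \<gamma>" using X gamma(1) by (cases "X = 0") (auto simp: powr_diff)
      finally have "A * N powr (\<gamma> - 1) * X \<le> A * X powr \<gamma>" using A by (simp add: mult.assoc mult_left_mono)
      then have "S \<le> (A * X powr \<gamma>) powr (1 / \<gamma>)"
        unfolding S_def using AX gamma(1) by (intro powr_mono2) auto
      also have "\<dots> = C1 * X" using A X gamma(1) by (simp add: powr_mult powr_powr C1_def)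
      finally show ?thesis .
    qed
    have \<mu>C1: "\<mu> * C1 \<le> 1 / (2 * c)"
    proof -
      have "\<mu> * C1 \<le> 1 / (2 * c * (C1 + 1)) * (C1 + 1)"
        using K(3) C1 c unfolding \<mu>_def by (intro mult_mono) auto
      also have "\<dots> = 1 / (2 * c)" using C1 by simp
      finally show ?thesis .
    qed
    have "N \<le> \<mu> * S + K * R"
      unfolding N_def \<mu>_def R_def
      by (rule mass_bound) (use fm r_meas Ni Ri fS S r_pos K in auto)
    also have "\<mu> * S \<le> \<mu> * (C1 * X)" using SX by (intro mult_left_mono) (auto simp: \<mu>_def)
    also have "\<mu> * (C1 * X) \<le> 1 / (2 * c) * X" using \<mu>C1 X by (simp only: mult.assoc[symmetric] mult_right_mono)
    also have "\<dots> \<le> E / (2 * c) + N / 2"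
    proof -
      have "N / (2 * c) \<le> N / 2" using c nn by (intro divide_left_mono) auto
      then show ?thesis by (simp add: X_def add_divide_distrib)
    qed
    finally have N: "N \<le> E / c + 2 * K * R" using c by (simp add: field_simps)
    have "c * N \<le> c * (E / c + 2 * K * R)" using N c by (intro mult_left_mono) auto
    also have "\<dots> = E + 2 * c * K * R" using c by (simp add: field_simps)
    finally have "B \<le> E / 2 + c * K / 2 * R" using B by simp
    also have "c * K / 2 * R \<le> C * R" using nn c K C1 by (intro mult_right_mono) (auto simp: C_def)
    finally have 1: "B \<le> E / 2 + C * R" by simp
    have 2: "(f z)\<^sup>2 \<le> C * (E + R)" if "z \<in> {a..b}" for z
    proof -
      have "E / c \<le> E" using c nn by (simp add: divide_le_eq mult_left_le mult_le_cancel_left1)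
      then have "X \<le> 2 * E + 2 * K * R" using N by (simp add: X_def)
      also have "\<dots> \<le> 2 * (1 + K) * (E + R)" using K nn by (simp add: algebra_simps)
      finally have "C1 * X \<le> C1 * (2 * (1 + K) * (E + R))" using C1 by (rule mult_left_mono)
      also have "\<dots> = (2 * C1 * (1 + K)) * (E + R)" by simp
      also have "\<dots> \<le> C * (E + R)" using nn c K by (intro mult_right_mono) (auto simp: C_def)
      finally show ?thesis using fS[OF that] SX by linarith
    qed
    show ?thesis using pot(1) 1 2 by (simp add: B_def E_def R_def)
  qed
  then show ?thesis using Cpos by blast
qed

end

section \<open>Minimisation of quadratic functionals and completeness\<close>

lemma quadratic_nonneg_discriminant:
  fixes a b c :: real
  assumes "\<And>t. 0 \<le> c + 2 * t * b + t\<^sup>2 * a" "0 \<le> a"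
  shows "b\<^sup>2 \<le> c * a"
proof (cases "a = 0")
  case True
  have "b = 0"
  proof (rule ccontr)
    assume "b \<noteq> 0"
    then show False using assms(1)[of "- (c + 1) / (2 * b)"] True by (simp add: field_simps)
  qed
  then show ?thesis using True by simp
next
  case False
  then have "a > 0" using assms by simp
  have "0 \<le> a * (c + 2 * (- b / a) * b + (- b / a)\<^sup>2 * a)"
    using assms(1)[of "- b / a"] \<open>a > 0\<close> by (intro mult_nonneg_nonneg) auto
  also have "\<dots> = c * a - b\<^sup>2" using \<open>a > 0\<close> by (simp add: field_simps power2_eq_square)
  finally show ?thesis by simp
qed

text \<open>The Riesz representation theorem for a positive form on a set with linear combinations, where
  completeness is stated for the form itself and elements need not be identified. For a minimising
  sequence of \<open>J f = B f f - 2 l f\<close>, the inequality \<open>J (f + t k) \<ge> inf J\<close> for all \<open>t\<close> shows that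
  \<open>B f k - l k\<close> is at most \<open>sqrt (J f - inf J)\<close> times the norm of \<open>k\<close>. So the sequence satisfies the
  equation asymptotically, it is Cauchy, and its limit solves the equation.\<close>
lemma Riesz_by_minimization:
  fixes V :: "'a set" and comb :: "'a \<Rightarrow> real \<Rightarrow> 'a \<Rightarrow> 'a" and B :: "'a \<Rightarrow> 'a \<Rightarrow> real" and l :: "'a \<Rightarrow> real"
  assumes V: "V \<noteq> {}" "\<And>f g c. f \<in> V \<Longrightarrow> g \<in> V \<Longrightarrow> comb f c g \<in> V"
    and B: "\<And>f g c h. f \<in> V \<Longrightarrow> g \<in> V \<Longrightarrow> h \<in> V \<Longrightarrow> B (comb f c g) h = B f h + c * B g h"
      "\<And>f g. f \<in> V \<Longrightarrow> g \<in> V \<Longrightarrow> B f g = B g f" "\<And>f. f \<in> V \<Longrightarrow> 0 \<le> B f f"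
    and l: "\<And>f g c. f \<in> V \<Longrightarrow> g \<in> V \<Longrightarrow> l (comb f c g) = l f + c * l g" "\<And>f. f \<in> V \<Longrightarrow> (l f)\<^sup>2 \<le> K * B f f"
    and K: "0 \<le> K"
    and complete: "\<And>X. (\<And>n::nat. X n \<in> V) \<Longrightarrow> 
      (\<And>e. e > 0 \<Longrightarrow> \<exists>N. \<forall>m\<ge>N. \<forall>n\<ge>N. B (comb (X m) (-1) (X n)) (comb (X m) (-1) (X n)) < e) \<Longrightarrow>
      \<exists>u\<in>V. (\<lambda>n. B (comb (X n) (-1) u) (comb (X n) (-1) u)) \<longlonglongrightarrow> 0"
  shows "\<exists>u\<in>V. \<forall>\<phi>\<in>V. B u \<phi> = l \<phi>"
proof -
  have B': "B h (comb f c g) = B h f + c * B h g" if "f \<in> V" "g \<in> V" "h \<in> V" for f g h c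
    using B(1,2) V(2) that by metis
  have BB: "B (comb f t k) (comb f t k) = B f f + 2 * t * B f k + t\<^sup>2 * B k k" if "f \<in> V" "k \<in> V" for f t k
    using that V(2) B(2)[of k f] by (simp add: B(1) B' algebra_simps power2_eq_square)
  have CS: "(B f k)\<^sup>2 \<le> B f f * B k k" if "f \<in> V" "k \<in> V" for f k
  proof (rule quadratic_nonneg_discriminant)
    show "0 \<le> B f f + 2 * t * B f k + t\<^sup>2 * B k k" for t
      unfolding BB[OF that, symmetric] by (rule B(3)[OF V(2)[OF that]])
  qed (rule B(3)[OF that(2)])
  define J where "J f = B f f - 2 * l f" for f
  have J_lower: "- K \<le> J f" if "f \<in> V" for f
  proof -
    have "(2 * l f)\<^sup>2 \<le> (K + B f f)\<^sup>2"
    proof -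
      have "(2 * l f)\<^sup>2 \<le> 4 * (K * B f f)" using l(2)[OF that] by (simp add: power_mult_distrib)
      also have "\<dots> \<le> (K + B f f)\<^sup>2" using zero_le_power2[of "K - B f f"] by (simp add: power2_eq_square algebra_simps)
      finally show ?thesis .
    qed
    then have "2 * l f \<le> K + B f f" by (rule power2_le_imp_le) (use K B(3)[OF that] in simp)
    then show ?thesis by (simp add: J_def)
  qed
  define I where "I = Inf (J ` V)"
  have bdd: "bdd_below (J ` V)" using J_lower by (auto simp: bdd_below_def)
  have I_le: "I \<le> J f" if "f \<in> V" for f
    unfolding I_def using that bdd by (intro cInf_lower) auto
  have J_eq: "J (comb f t k) = J f + 2 * t * (B f k - l k) + t\<^sup>2 * B k k" if "f \<in> V" "k \<in> V" for f t k
    using BB[OF that] l(1)[OF that] by (simp add: J_def algebra_simps)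
  have near: "(B f k - l k)\<^sup>2 \<le> (J f - I) * B k k" if "f \<in> V" "k \<in> V" for f k
  proof (rule quadratic_nonneg_discriminant)
    fix t show "0 \<le> J f - I + 2 * t * (B f k - l k) + t\<^sup>2 * B k k"
      using I_le[OF V(2)[OF that]] J_eq[OF that] by (smt (verit))
  qed (use B(3) that in auto)
  have "\<exists>f\<in>V. J f < I + 1 / real (Suc n)" for n
  proof -
    have "Inf (J ` V) < I + 1 / real (Suc n)" by (simp add: I_def)
    then show ?thesis using bdd V(1) by (subst (asm) cInf_less_iff) auto
  qed
  then obtain X where X: "\<And>n. X n \<in> V" "\<And>n. J (X n) < I + 1 / real (Suc n)" by metis
  define \<epsilon> where "\<epsilon> n = sqrt (J (X n) - I)" for n
  have eps: "0 \<le> \<epsilon> n" for n using I_le[OF X(1)] by (simp add: \<epsilon>_def)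
  have near': "\<bar>B (X n) k - l k\<bar> \<le> \<epsilon> n * sqrt (B k k)" if "k \<in> V" for n k
    using real_sqrt_le_mono[OF near[OF X(1) that]] by (simp add: \<epsilon>_def real_sqrt_mult)
  have sq0: "(\<lambda>n. sqrt (1 / real (Suc n))) \<longlonglongrightarrow> sqrt 0"
    by (intro tendsto_real_sqrt LIMSEQ_inverse_real_of_nat[unfolded inverse_eq_divide])
  have eps_le: "\<epsilon> n \<le> sqrt (1 / real (Suc n))" for n
    unfolding \<epsilon>_def using X(2)[of n] by (intro real_sqrt_le_mono) linarith
  have eps0: "\<epsilon> \<longlonglongrightarrow> 0"
    by (rule tendsto_sandwich[where f="\<lambda>_. 0" and h="\<lambda>n. sqrt (1 / real (Suc n))"])
       (use eps eps_le sq0 in \<open>auto intro!: always_eventually\<close>)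
  have "\<exists>u\<in>V. (\<lambda>n. B (comb (X n) (-1) u) (comb (X n) (-1) u)) \<longlonglongrightarrow> 0"
  proof (rule complete[OF X(1)])
    fix e :: real assume "e > 0"
    then have "eventually (\<lambda>n. \<epsilon> n < sqrt e / 3) sequentially"
      using eps0 by (intro order_tendstoD) auto
    then obtain N where N: "\<And>n. n \<ge> N \<Longrightarrow> \<epsilon> n < sqrt e / 3" by (auto simp: eventually_sequentially)
    have "B (comb (X m) (-1) (X n)) (comb (X m) (-1) (X n)) < e" if "m \<ge> N" "n \<ge> N" for m n
    proof -
      define k where "k = comb (X m) (-1) (X n)"
      have k: "k \<in> V" using X V by (simp add: k_def)
      define b where "b = sqrt (B k k)"
      have b: "0 \<le> b" "b * b = B k k" using B(3)[OF k] by (auto simp: b_def)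
      have "B k k = (B (X m) k - l k) - (B (X n) k - l k)"
        using B(1)[OF X(1) X(1) k, of m "-1" n] by (simp add: k_def)
      also have "\<dots> \<le> (\<epsilon> m + \<epsilon> n) * b"
        using near'[OF k, of m] near'[OF k, of n] by (simp add: b_def algebra_simps)
      finally have "b * b \<le> (\<epsilon> m + \<epsilon> n) * b" using b by simp
      then have "b \<le> \<epsilon> m + \<epsilon> n"
        using b(1) eps[of m] eps[of n] by (cases "b = 0") (simp_all add: mult_le_cancel_right)
      also have "\<dots> < sqrt e / 3 + sqrt e / 3" using N[OF that(1)] N[OF that(2)] by (rule add_strict_mono)
      also have "\<dots> \<le> sqrt e" using \<open>e > 0\<close> by simp
      finally have "b < sqrt e" .
      then show ?thesis unfolding k_def[symmetric] b_def by simp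
    qed
    then show "\<exists>N. \<forall>m\<ge>N. \<forall>n\<ge>N. B (comb (X m) (-1) (X n)) (comb (X m) (-1) (X n)) < e" by blast
  qed
  then obtain u where u: "u \<in> V" "(\<lambda>n. B (comb (X n) (-1) u) (comb (X n) (-1) u)) \<longlonglongrightarrow> 0" by blast
  have "B u \<phi> = l \<phi>" if \<phi>: "\<phi> \<in> V" for \<phi>
  proof -
    define D where "D n = comb (X n) (-1) u" for n
    have D: "D n \<in> V" for n using X u V by (simp add: D_def)
    have "\<bar>B u \<phi> - l \<phi>\<bar> \<le> \<epsilon> n * sqrt (B \<phi> \<phi>) + sqrt (B (D n) (D n)) * sqrt (B \<phi> \<phi>)" for n
    proof -
      have "B (D n) \<phi> = B (X n) \<phi> - B u \<phi>" using B(1)[OF X(1) u(1) \<phi>, of n "-1"] by (simp add: D_def)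
      moreover have "\<bar>B (D n) \<phi>\<bar> \<le> sqrt (B (D n) (D n)) * sqrt (B \<phi> \<phi>)"
        using real_sqrt_le_mono[OF CS[OF D[of n] \<phi>]] by (simp add: real_sqrt_mult)
      ultimately show ?thesis using near'[OF \<phi>, of n] by linarith
    qed
    moreover have "(\<lambda>n. \<epsilon> n * sqrt (B \<phi> \<phi>) + sqrt (B (D n) (D n)) * sqrt (B \<phi> \<phi>)) \<longlonglongrightarrow> 0 * sqrt (B \<phi> \<phi>) + sqrt 0 * sqrt (B \<phi> \<phi>)"
      using u(2) unfolding D_def by (intro tendsto_intros eps0)
    ultimately have "\<bar>B u \<phi> - l \<phi>\<bar> \<le> 0 * sqrt (B \<phi> \<phi>) + sqrt 0 * sqrt (B \<phi> \<phi>)"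
      by (intro LIMSEQ_le_const) auto
    then show ?thesis by simp
  qed
  then show ?thesis using u(1) by blast
qed

text \<open>The form in which Fatou's lemma serves for completeness: the bound is assumed for large \<open>n\<close> only.\<close>
lemma integrable_Fatou:
  fixes h :: "'b \<Rightarrow> real"
  assumes m: "\<And>n. g n \<in> borel_measurable M" "h \<in> borel_measurable M"
    and nn: "AE x in M. \<forall>n. 0 \<le> g n x" and lim: "AE x in M. (\<lambda>n. g n x) \<longlonglongrightarrow> h x"
    and bd: "\<And>n. n \<ge> N \<Longrightarrow> integrable M (g n) \<and> (LINT x|M. g n x) \<le> e"
  shows "integrable M h" "(LINT x|M. h x) \<le> e" "AE x in M. 0 \<le> h x"
proof -
  show h0: "AE x in M. 0 \<le> h x" using nn lim
    by eventually_elim (auto intro: LIMSEQ_le_const)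
  have e: "0 \<le> e"
  proof -
    have "0 \<le> (LINT x|M. g N x)" using nn by (intro integral_nonneg_AE) auto
    then show ?thesis using bd[of N] by simp
  qed
  have "(\<integral>\<^sup>+x. ennreal (h x) \<partial>M) = (\<integral>\<^sup>+x. liminf (\<lambda>n. ennreal (g (n + N) x)) \<partial>M)"
  proof (rule nn_integral_cong_AE, use lim in eventually_elim)
    case (elim x)
    then have "(\<lambda>n. ennreal (g (n + N) x)) \<longlonglongrightarrow> ennreal (h x)"
      by (intro tendsto_ennrealI LIMSEQ_ignore_initial_segment)
    then show ?case by (simp add: lim_imp_Liminf)
  qed
  also have "\<dots> \<le> liminf (\<lambda>n. \<integral>\<^sup>+x. ennreal (g (n + N) x) \<partial>M)"
    by (rule nn_integral_liminf) (use m in measurable)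
  also have "\<dots> \<le> ennreal e"
  proof (rule Liminf_le[OF _ always_eventually])
    show "\<forall>n. (\<integral>\<^sup>+x. ennreal (g (n + N) x) \<partial>M) \<le> ennreal e"
    proof
      fix n
      have "(\<integral>\<^sup>+x. ennreal (g (n + N) x) \<partial>M) = ennreal (LINT x|M. g (n + N) x)"
        using bd[of "n + N"] nn by (intro nn_integral_eq_integral) (auto elim!: eventually_mono)
      then show "(\<integral>\<^sup>+x. ennreal (g (n + N) x) \<partial>M) \<le> ennreal e" using bd[of "n + N"] by (simp add: ennreal_leI)
    qed
  qed auto
  finally have le: "(\<integral>\<^sup>+x. ennreal (h x) \<partial>M) \<le> ennreal e" .
  show i: "integrable M h"
    by (rule integrableI_nonneg[OF m(2) h0]) (use le in \<open>auto intro: order_le_less_trans\<close>)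
  have "ennreal (LINT x|M. h x) \<le> ennreal e" using nn_integral_eq_integral[OF i h0] le by simp
  then show "(LINT x|M. h x) \<le> e" using e by (simp add: ennreal_le_iff)
qed

lemma norm_add_square_le: "(norm (a + b))\<^sup>2 \<le> 2 * (norm a)\<^sup>2 + 2 * (norm (b :: 'a :: real_normed_vector))\<^sup>2"
proof -
  have "(norm (a + b))\<^sup>2 \<le> (norm a + norm b)\<^sup>2" by (intro power_mono norm_triangle_ineq) auto
  also have "\<dots> \<le> 2 * (norm a)\<^sup>2 + 2 * (norm b)\<^sup>2"
    using zero_le_power2[of "norm a - norm b"] by (simp add: power2_eq_square algebra_simps)
  finally show ?thesis .
qed

lemma L2_integrable_add:
  fixes F G :: "'b \<Rightarrow> 'a :: {banach, second_countable_topology}"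
  assumes "F \<in> borel_measurable M" "G \<in> borel_measurable M"
    "integrable M (\<lambda>x. (norm (F x))\<^sup>2)" "integrable M (\<lambda>x. (norm (G x))\<^sup>2)"
  shows "integrable M (\<lambda>x. (norm (F x + G x))\<^sup>2)"
proof (rule Bochner_Integration.integrable_bound)
  show "integrable M (\<lambda>x. 2 * (norm (F x))\<^sup>2 + 2 * (norm (G x))\<^sup>2)" using assms by auto
  show "AE x in M. norm ((norm (F x + G x))\<^sup>2) \<le> norm (2 * (norm (F x))\<^sup>2 + 2 * (norm (G x))\<^sup>2)"
    using norm_add_square_le by (intro AE_I2) auto
qed (use assms in measurable)

text \<open>Riesz--Fischer: for a subsequence with squared distances at most \<open>4^-j\<close> the series
  \<open>\<Sum> 2^j |F(k(j+1)) - F(k j)|^2\<close> has a finite integral. Hence the increments decrease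
  geometrically at almost every point, and Fatou's lemma identifies the pointwise limit as the limit in
  the mean.\<close>
lemma L2_complete:
  fixes F :: "nat \<Rightarrow> 'b \<Rightarrow> 'a :: {banach, second_countable_topology}"
  assumes m: "\<And>n. F n \<in> borel_measurable M" and i: "\<And>n. integrable M (\<lambda>x. (norm (F n x))\<^sup>2)"
    and cauchy: "\<And>e. e > 0 \<Longrightarrow> \<exists>N. \<forall>m\<ge>N. \<forall>n\<ge>N. (LINT x|M. (norm (F m x - F n x))\<^sup>2) < e"
  shows "\<exists>G. G \<in> borel_measurable M \<and> integrable M (\<lambda>x. (norm (G x))\<^sup>2) \<and>
    (\<forall>n. integrable M (\<lambda>x. (norm (F n x - G x))\<^sup>2)) \<and> (\<lambda>n. LINT x|M. (norm (F n x - G x))\<^sup>2) \<longlonglongrightarrow> 0"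
proof -
  have di: "integrable M (\<lambda>x. (norm (F a x - F b x))\<^sup>2)" for a b
    using L2_integrable_add[of "F a" M "\<lambda>x. - F b x"] m i by simp
  define P where "P j N \<longleftrightarrow> (\<forall>m\<ge>N. \<forall>n\<ge>N. (LINT x|M. (norm (F m x - F n x))\<^sup>2) < (1/4) ^ j)" for j N :: nat
  have exP: "\<exists>N. P j N" for j unfolding P_def by (rule cauchy) simp
  have Pmono: "P j N \<Longrightarrow> N \<le> N' \<Longrightarrow> P j N'" for j N N' unfolding P_def by auto
  have "\<exists>k. \<forall>j. P j (k j) \<and> k j < k (Suc j)"
  proof (rule dependent_nat_choice)
    show "\<exists>x. P 0 x" by (rule exP)
    fix x n
    obtain N where "P (Suc n) N" using exP by blast
    then have "P (Suc n) (max N (Suc x))" by (rule Pmono) simp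
    then show "\<exists>y. P (Suc n) y \<and> x < y" by (intro exI[of _ "max N (Suc x)"]) auto
  qed
  then obtain k where k: "\<And>j. P j (k j)" "\<And>j. k j < k (Suc j)" by blast
  have smk: "strict_mono k" using k(2) by (simp add: strict_mono_Suc_iff)
  define H where "H j x = norm (F (k (Suc j)) x - F (k j) x)" for j x
  have Hm: "H j \<in> borel_measurable M" for j unfolding H_def[abs_def] using m by measurable
  have Hle: "(\<integral>\<^sup>+x. ennreal ((H j x)\<^sup>2) \<partial>M) \<le> ennreal ((1/4) ^ j)" for j
  proof -
    have "(\<integral>\<^sup>+x. ennreal ((H j x)\<^sup>2) \<partial>M) = ennreal (LINT x|M. (H j x)\<^sup>2)"
      unfolding H_def by (rule nn_integral_eq_integral[OF di]) auto
    also have "(LINT x|M. (H j x)\<^sup>2) < (1/4) ^ j"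
      using k(1)[of j] k(2)[of j] unfolding P_def H_def by (meson less_imp_le order_refl)
    then have "ennreal (LINT x|M. (H j x)\<^sup>2) \<le> ennreal ((1/4) ^ j)" by (simp add: ennreal_leI)
    finally show ?thesis .
  qed
  have "(\<integral>\<^sup>+x. (\<Sum>j. ennreal (2 ^ j * (H j x)\<^sup>2)) \<partial>M) = (\<Sum>j. \<integral>\<^sup>+x. ennreal (2 ^ j * (H j x)\<^sup>2) \<partial>M)"
    by (rule nn_integral_suminf) (use Hm in measurable)
  also have "\<dots> \<le> (\<Sum>j. ennreal ((1/2) ^ j))"
  proof (rule suminf_le)
    fix j
    have "(\<integral>\<^sup>+x. ennreal (2 ^ j * (H j x)\<^sup>2) \<partial>M) = ennreal (2 ^ j) * (\<integral>\<^sup>+x. ennreal ((H j x)\<^sup>2) \<partial>M)"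
      using Hm by (subst nn_integral_cmult[symmetric]) (auto simp: ennreal_mult)
    also have "\<dots> \<le> ennreal (2 ^ j) * ennreal ((1/4) ^ j)" by (intro mult_left_mono Hle) auto
    also have "\<dots> = ennreal ((1/2) ^ j)" by (simp add: ennreal_mult[symmetric] power_mult_distrib[symmetric] del: ennreal_power)
    finally show "(\<integral>\<^sup>+x. ennreal (2 ^ j * (H j x)\<^sup>2) \<partial>M) \<le> ennreal ((1/2) ^ j)" .
  qed auto
  also have "\<dots> < \<infinity>"
    by (subst suminf_ennreal2) (auto intro!: summable_geometric)
  finally have "AE x in M. (\<Sum>j. ennreal (2 ^ j * (H j x)\<^sup>2)) \<noteq> \<infinity>"
    using Hm by (intro nn_integral_PInf_AE) auto
  then have conv: "AE x in M. convergent (\<lambda>j. F (k j) x)"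
  proof eventually_elim
    case (elim x)
    define T where "T = (\<Sum>j. ennreal (2 ^ j * (H j x)\<^sup>2))"
    have "T \<noteq> \<infinity>" using elim by (simp add: T_def)
    then obtain C where "T = ennreal C" "0 \<le> C" by (cases T) auto
    then have C: "(\<Sum>j. ennreal (2 ^ j * (H j x)\<^sup>2)) = ennreal C" "0 \<le> C" by (auto simp: T_def)
    have "H j x \<le> sqrt C * (1 / sqrt 2) ^ j" for j
    proof -
      have "(\<Sum>i\<in>{j}. ennreal (2 ^ i * (H i x)\<^sup>2)) \<le> ennreal C"
        unfolding C(1)[symmetric] by (rule sum_le_suminf) auto
      then have "2 ^ j * (H j x)\<^sup>2 \<le> C" using C(2) by (simp add: ennreal_le_iff)
      then have "(H j x)\<^sup>2 \<le> C * (1/2) ^ j" by (simp add: field_simps)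
      then have "H j x \<le> sqrt (C * (1/2) ^ j)" by (rule real_le_rsqrt)
      then show ?thesis by (simp add: real_sqrt_mult real_sqrt_power real_sqrt_divide)
    qed
    then have Hn: "norm (norm (F (k (Suc j)) x - F (k j) x)) \<le> sqrt C * (1 / sqrt 2) ^ j" for j
      unfolding H_def by simp
    have "summable (\<lambda>j. sqrt C * (1 / sqrt 2) ^ j)"
      by (intro summable_mult summable_geometric) simp
    then have "summable (\<lambda>j. norm (F (k (Suc j)) x - F (k j) x))"
      by (rule summable_comparison_test'[where N=0]) (rule Hn)
    then have "summable (\<lambda>j. F (k (Suc j)) x - F (k j) x)" by (rule summable_norm_cancel)
    then have "convergent (\<lambda>n. \<Sum>j<n. F (k (Suc j)) x - F (k j) x)" by (simp add: summable_iff_convergent)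
    then have "convergent (\<lambda>n. F (k n) x - F (k 0) x)" by (simp only: sum_lessThan_telescope[of "\<lambda>j. F (k j) x"])
    from convergent_add[OF this convergent_const[of "F (k 0) x"]] show ?case by simp
  qed
  define G where "G x = lim (\<lambda>j. F (k j) x)" for x
  have Gm: "G \<in> borel_measurable M" unfolding G_def[abs_def] using m by (rule borel_measurable_lim_metric)
  have lim: "AE x in M. (\<lambda>j. F (k j) x) \<longlonglongrightarrow> G x"
    using conv by eventually_elim (simp add: G_def convergent_LIMSEQ_iff)
  have *: "integrable M (\<lambda>x. (norm (F n x - G x))\<^sup>2) \<and> (LINT x|M. (norm (F n x - G x))\<^sup>2) \<le> e"
    if "\<And>j. j \<ge> N \<Longrightarrow> (LINT x|M. (norm (F n x - F (k j) x))\<^sup>2) \<le> e" for n N e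
  proof -
    have "AE x in M. (\<lambda>j. (norm (F n x - F (k j) x))\<^sup>2) \<longlonglongrightarrow> (norm (F n x - G x))\<^sup>2"
      using lim by eventually_elim (intro tendsto_intros)
    from integrable_Fatou[OF _ _ _ this, of N e] that di m Gm show ?thesis by auto
  qed
  have kge: "j \<le> k j" for j using smk by (rule strict_mono_imp_increasing)
  have lim0: "(\<lambda>n. LINT x|M. (norm (F n x - G x))\<^sup>2) \<longlonglongrightarrow> 0"
  proof (rule LIMSEQ_I)
    fix e :: real assume "e > 0"
    then obtain N where N: "\<forall>m\<ge>N. \<forall>n\<ge>N. (LINT x|M. (norm (F m x - F n x))\<^sup>2) < e / 2"
      using cauchy[of "e / 2"] by auto
    have "(LINT x|M. (norm (F n x - G x))\<^sup>2) \<le> e / 2" if "n \<ge> N" for n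
    proof -
      have "(LINT x|M. (norm (F n x - F (k j) x))\<^sup>2) \<le> e / 2" if "j \<ge> N" for j
        using N \<open>n \<ge> N\<close> that kge[of j] by (meson less_imp_le order_trans)
      then show ?thesis using *[of N n "e/2"] by blast
    qed
    then show "\<exists>no. \<forall>n\<ge>no. norm ((LINT x|M. (norm (F n x - G x))\<^sup>2) - 0) < e"
      using \<open>e > 0\<close> by (intro exI[of _ N]) (force simp: abs_of_nonneg intro: order_le_less_trans)
  qed
  have Di: "integrable M (\<lambda>x. (norm (F n x - G x))\<^sup>2)" for n
  proof -
    obtain N where N: "\<forall>m\<ge>N. \<forall>n\<ge>N. (LINT x|M. (norm (F m x - F n x))\<^sup>2) < 1" using cauchy[of 1] by auto
    have "(LINT x|M. (norm (F N x - F (k j) x))\<^sup>2) \<le> 1" if "j \<ge> N" for j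
      using N that kge[of j] by (meson less_imp_le order_refl order_trans)
    then have "integrable M (\<lambda>x. (norm (F N x - G x))\<^sup>2)" using *[of N N 1] by blast
    then have "integrable M (\<lambda>x. (norm ((F n x - F N x) + (F N x - G x)))\<^sup>2)"
      using di m Gm by (intro L2_integrable_add) auto
    then show ?thesis by simp
  qed
  have "integrable M (\<lambda>x. (norm (F 0 x + - (F 0 x - G x)))\<^sup>2)"
    by (rule L2_integrable_add) (use Di[of 0] i m Gm in \<open>auto simp: norm_minus_commute\<close>)
  then have "integrable M (\<lambda>x. (norm (G x))\<^sup>2)" by simp
  with Gm Di lim0 show ?thesis by blast
qed

section \<open>The form domain\<close>

lemma weighted_prod_integrable:
  fixes w f g :: "real \<Rightarrow> real"
  assumes w: "w \<in> borel_measurable lebesgue" and fg: "f \<in> borel_measurable lebesgue" "g \<in> borel_measurable lebesgue"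
    and i: "integrable lebesgue (\<lambda>x. \<bar>w x\<bar> * (f x)\<^sup>2)" "integrable lebesgue (\<lambda>x. \<bar>w x\<bar> * (g x)\<^sup>2)"
  shows "integrable lebesgue (\<lambda>x. w x * (f x * g x))"
proof (rule Bochner_Integration.integrable_bound)
  show "integrable lebesgue (\<lambda>x. \<bar>w x\<bar> * (f x)\<^sup>2 + \<bar>w x\<bar> * (g x)\<^sup>2)" using i by auto
  show "AE x in lebesgue. norm (w x * (f x * g x)) \<le> norm (\<bar>w x\<bar> * (f x)\<^sup>2 + \<bar>w x\<bar> * (g x)\<^sup>2)"
  proof (rule AE_I2)
    fix x
    have "2 * (\<bar>f x\<bar> * \<bar>g x\<bar>) \<le> (f x)\<^sup>2 + (g x)\<^sup>2"
      using zero_le_power2[of "\<bar>f x\<bar> - \<bar>g x\<bar>"] by (simp add: power2_diff)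
    moreover have "0 \<le> \<bar>f x\<bar> * \<bar>g x\<bar>" by simp
    ultimately have "\<bar>f x\<bar> * \<bar>g x\<bar> \<le> (f x)\<^sup>2 + (g x)\<^sup>2" by linarith
    then have "\<bar>f x * g x\<bar> \<le> (f x)\<^sup>2 + (g x)\<^sup>2" by (simp add: abs_mult)
    then have "\<bar>w x\<bar> * \<bar>f x * g x\<bar> \<le> \<bar>w x\<bar> * ((f x)\<^sup>2 + (g x)\<^sup>2)" by (intro mult_left_mono) auto
    then show "norm (w x * (f x * g x)) \<le> norm (\<bar>w x\<bar> * (f x)\<^sup>2 + \<bar>w x\<bar> * (g x)\<^sup>2)"
      by (simp add: abs_mult algebra_simps)
  qed
qed (use w fg in measurable)

lemma weighted_sq_add_integrable:
  fixes w f g :: "real \<Rightarrow> real"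
  assumes w: "w \<in> borel_measurable lebesgue" and fg: "f \<in> borel_measurable lebesgue" "g \<in> borel_measurable lebesgue"
    and i: "integrable lebesgue (\<lambda>x. \<bar>w x\<bar> * (f x)\<^sup>2)" "integrable lebesgue (\<lambda>x. \<bar>w x\<bar> * (g x)\<^sup>2)"
  shows "integrable lebesgue (\<lambda>x. \<bar>w x\<bar> * (f x + c * g x)\<^sup>2)"
proof -
  have "integrable lebesgue (\<lambda>x. \<bar>w x\<bar> * (f x)\<^sup>2 + (2 * c) * (\<bar>w x\<bar> * (f x * g x)) + c\<^sup>2 * (\<bar>w x\<bar> * (g x)\<^sup>2))"
    using i weighted_prod_integrable[of "\<lambda>x. \<bar>w x\<bar>" f g] w fg by simp
  then show ?thesis by (simp add: power2_eq_square algebra_simps)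
qed

lemma integrable_abs_weight:
  fixes w f :: "real \<Rightarrow> real"
  assumes w: "w \<in> borel_measurable lebesgue" "AE x in lebesgue. 0 < w x" and f: "f \<in> borel_measurable lebesgue"
  shows "integrable lebesgue (\<lambda>x. \<bar>w x\<bar> * f x) \<longleftrightarrow> integrable lebesgue (\<lambda>x. w x * f x)"
  by (rule integrable_cong_AE) (use w f in \<open>auto elim!: eventually_mono\<close>)

context SL
begin

definition C_int :: real where
  "C_int = (SOME C. C > 0 \<and> (\<forall>a b d f. 1 \<le> b - a \<longrightarrow> primitive d f \<longrightarrow> set_integrable lebesgue {a..b} (\<lambda>x. p x * (d x)\<^sup>2) \<longrightarrow>
     set_integrable lebesgue {a..b} (\<lambda>x. neg_part q x * (f x)\<^sup>2) \<and>
     (LINT x:{a..b}|lebesgue. neg_part q x * (f x)\<^sup>2) \<le>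
       (kinetic_on a b d) / 2 + C * mass_on a b f \<and>
     (\<forall>z\<in>{a..b}. (f z)\<^sup>2 \<le> C * ((kinetic_on a b d) + (mass_on a b f)))))"

lemma C_int:
  shows C_int_pos: "C_int > 0"
    and neg_part_interval: "1 \<le> b - a \<Longrightarrow> primitive d f \<Longrightarrow> set_integrable lebesgue {a..b} (\<lambda>x. p x * (d x)\<^sup>2) \<Longrightarrow>
     set_integrable lebesgue {a..b} (\<lambda>x. neg_part q x * (f x)\<^sup>2) \<and>
     (LINT x:{a..b}|lebesgue. neg_part q x * (f x)\<^sup>2) \<le>
       (kinetic_on a b d) / 2 + C_int * mass_on a b f"
    and sup_interval: "1 \<le> b - a \<Longrightarrow> primitive d f \<Longrightarrow> set_integrable lebesgue {a..b} (\<lambda>x. p x * (d x)\<^sup>2) \<Longrightarrow> z \<in> {a..b} \<Longrightarrow>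
     (f z)\<^sup>2 \<le> C_int * ((kinetic_on a b d) + (mass_on a b f))"
  using someI_ex[OF interval_bounds] unfolding C_int_def[symmetric] by blast+

text \<open>The choice of this shift has two reasons: it makes the form coercive (bform_coercive), and it makes
  \<open>v f\<close> grow by at least the full weighted integral of \<open>f^2\<close> for solutions of the homogeneous equation
  (kernel_interval).\<close>
definition \<Lambda> :: real where "\<Lambda> = 2 * C_int + 1"

text \<open>An element of the form domain is a function \<open>f\<close> together with a density \<open>d\<close> of it, since densities
  are determined only up to null sets.\<close>
definition in_form :: "(real \<Rightarrow> real) \<Rightarrow> (real \<Rightarrow> real) \<Rightarrow> bool" where
  "in_form f d \<longleftrightarrow> primitive d f \<and> integrable lebesgue (\<lambda>x. p x * (d x)\<^sup>2) \<and>
     finite_mass f \<and> integrable lebesgue (\<lambda>x. \<bar>q x\<bar> * (f x)\<^sup>2)"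

definition energy :: "(real \<Rightarrow> real) \<Rightarrow> (real \<Rightarrow> real) \<Rightarrow> real" where
  "energy f d = kinetic d + mass f + (LINT x|lebesgue. \<bar>q x\<bar> * (f x)\<^sup>2)"

text \<open>The bilinear form of \<open>T + \<Lambda>\<close>, on pairs of a function and a density.\<close>
definition bform :: "(real \<Rightarrow> real) \<times> (real \<Rightarrow> real) \<Rightarrow> (real \<Rightarrow> real) \<times> (real \<Rightarrow> real) \<Rightarrow> real" where
  "bform u v = (LINT x|lebesgue. p x * (snd u x * snd v x)) + (LINT x|lebesgue. q x * (fst u x * fst v x)) +
     \<Lambda> * (LINT x|lebesgue. r x * (fst u x * fst v x))"

definition comb :: "(real \<Rightarrow> real) \<times> (real \<Rightarrow> real) \<Rightarrow> real \<Rightarrow> (real \<Rightarrow> real) \<times> (real \<Rightarrow> real) \<Rightarrow> (real \<Rightarrow> real) \<times> (real \<Rightarrow> real)" where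
  "comb u c v = (\<lambda>x. fst u x + c * fst v x, \<lambda>x. snd u x + c * snd v x)"

lemma in_form_measurable:
  assumes "in_form f d"
  shows "f \<in> borel_measurable lebesgue" "d \<in> borel_measurable lebesgue"
  using assms primitive_measurable primitive_deriv_measurable by (auto simp: in_form_def)

lemma in_form_abs:
  assumes "in_form f d"
  shows "integrable lebesgue (\<lambda>x. \<bar>p x\<bar> * (d x)\<^sup>2)" "integrable lebesgue (\<lambda>x. \<bar>r x\<bar> * (f x)\<^sup>2)" "integrable lebesgue (\<lambda>x. \<bar>q x\<bar> * (f x)\<^sup>2)"
  using assms in_form_measurable[OF assms] integrable_abs_weight[OF p_meas p_pos, of "\<lambda>x. (d x)\<^sup>2"] integrable_abs_weight[OF r_meas r_pos, of "\<lambda>x. (f x)\<^sup>2"]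
  by (auto simp: in_form_def)

lemma in_form_comb:
  assumes "in_form f d" "in_form g e"
  shows "in_form (\<lambda>x. f x + c * g x) (\<lambda>x. d x + c * e x)"
  unfolding in_form_def
  using assms primitive_lincomb[of d f e g c] in_form_measurable[OF assms(1)] in_form_measurable[OF assms(2)]
    weighted_sq_add_integrable[OF p_meas, of d e c] weighted_sq_add_integrable[OF r_meas, of f g c] weighted_sq_add_integrable[OF q_meas, of f g c]
    in_form_abs[OF assms(1)] in_form_abs[OF assms(2)]
    integrable_abs_weight[OF p_meas p_pos, of "\<lambda>x. (d x + c * e x)\<^sup>2"] integrable_abs_weight[OF r_meas r_pos, of "\<lambda>x. (f x + c * g x)\<^sup>2"]
  by (auto simp: in_form_def)

lemma in_form_products:
  assumes "in_form f d" "in_form g e"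
  shows "integrable lebesgue (\<lambda>x. p x * (d x * e x))" "integrable lebesgue (\<lambda>x. q x * (f x * g x))"
    "integrable lebesgue (\<lambda>x. r x * (f x * g x))"
  using weighted_prod_integrable[OF p_meas, of d e] weighted_prod_integrable[OF q_meas, of f g] weighted_prod_integrable[OF r_meas, of f g]
    in_form_measurable[OF assms(1)] in_form_measurable[OF assms(2)] in_form_abs[OF assms(1)] in_form_abs[OF assms(2)]
  by auto

lemma bform_comb:
  assumes "in_form (fst u) (snd u)" "in_form (fst v) (snd v)" "in_form (fst w) (snd w)"
  shows "bform (comb u c v) w = bform u w + c * bform v w"
proof -
  note 1 = in_form_products[OF assms(1,3)] and 2 = in_form_products[OF assms(2,3)]
  have "(LINT x|lebesgue. p x * ((snd u x + c * snd v x) * snd w x)) =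
      (LINT x|lebesgue. p x * (snd u x * snd w x)) + c * (LINT x|lebesgue. p x * (snd v x * snd w x))"
    "(LINT x|lebesgue. q x * ((fst u x + c * fst v x) * fst w x)) =
      (LINT x|lebesgue. q x * (fst u x * fst w x)) + c * (LINT x|lebesgue. q x * (fst v x * fst w x))"
    "(LINT x|lebesgue. r x * ((fst u x + c * fst v x) * fst w x)) =
      (LINT x|lebesgue. r x * (fst u x * fst w x)) + c * (LINT x|lebesgue. r x * (fst v x * fst w x))"
    by (subst integral_mult_right_zero[symmetric], subst Bochner_Integration.integral_add[symmetric];
        use 1 2 in \<open>auto simp: algebra_simps\<close>)+
  then show ?thesis by (simp add: bform_def comb_def algebra_simps)
qed

lemma bform_sym: "bform u v = bform v u"
  by (simp add: bform_def mult.commute)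

lemma in_form_interval:
  assumes "in_form f d"
  shows "set_integrable lebesgue {a..b} (\<lambda>x. p x * (d x)\<^sup>2)"
    "kinetic_on a b d \<le> kinetic d"
    "mass_on a b f \<le> mass f"
proof -
  have "AE x in lebesgue. 0 \<le> p x * (d x)\<^sup>2" using p_pos by eventually_elim auto
  moreover have "AE x in lebesgue. 0 \<le> r x * (f x)\<^sup>2" using r_pos by eventually_elim auto
  ultimately
  show "set_integrable lebesgue {a..b} (\<lambda>x. p x * (d x)\<^sup>2)"
    "kinetic_on a b d \<le> kinetic d"
    "mass_on a b f \<le> mass f"
    using assms set_integral_mono_set[of UNIV "\<lambda>x. p x * (d x)\<^sup>2" "{a..b}"] set_integral_mono_set[of UNIV "\<lambda>x. r x * (f x)\<^sup>2" "{a..b}"]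
      set_integrable_subset[of lebesgue UNIV "\<lambda>x. p x * (d x)\<^sup>2" "{a..b}"]
    by (auto simp: in_form_def set_integrable_def set_lebesgue_integral_def)
qed

lemma in_form_sup:
  assumes "in_form f d"
  shows "(f z)\<^sup>2 \<le> C_int * ((kinetic d) + (mass f))"
proof -
  have "(f z)\<^sup>2 \<le> C_int * ((kinetic_on z (z+1) d) + (mass_on z (z+1) f))"
    by (rule sup_interval) (use assms in_form_interval(1)[OF assms] in \<open>auto simp: in_form_def\<close>)
  also have "\<dots> \<le> C_int * ((kinetic d) + (mass f))"
    using in_form_interval(2,3)[OF assms] C_int_pos by (intro mult_left_mono add_mono) auto
  finally show ?thesis .
qed

text \<open>The bound on intervals has a constant that does not depend on the interval, so Fatou's lemma applies
  to growing intervals.\<close>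
lemma in_form_neg_part:
  assumes "in_form f d"
  shows "integrable lebesgue (\<lambda>x. neg_part q x * (f x)\<^sup>2)"
    "(LINT x|lebesgue. neg_part q x * (f x)\<^sup>2) \<le>
      (kinetic d) / 2 + C_int * mass f" (is "_ \<le> ?R")
proof -
  note m = in_form_measurable[OF assms]
  define g where "g n x = indicator {- real n - 1..real n + 1} x * (neg_part q x * (f x)\<^sup>2)" for n :: nat and x
  have gl: "integrable lebesgue (g n) \<and> (LINT x|lebesgue. g n x) \<le> ?R" for n
  proof -
    have "set_integrable lebesgue {- real n - 1..real n + 1} (\<lambda>x. neg_part q x * (f x)\<^sup>2) \<and>
     (LINT x:{- real n - 1..real n + 1}|lebesgue. neg_part q x * (f x)\<^sup>2) \<le>
       (kinetic_on (- real n - 1) (real n + 1) d) / 2 + C_int * (mass_on (- real n - 1) (real n + 1) f)"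
      by (rule neg_part_interval) (use assms in_form_interval(1)[OF assms] in \<open>auto simp: in_form_def\<close>)
    moreover have "(kinetic_on (- real n - 1) (real n + 1) d) / 2 + C_int * (mass_on (- real n - 1) (real n + 1) f) \<le> ?R"
      using in_form_interval(2,3)[OF assms] C_int_pos by (intro add_mono mult_left_mono divide_right_mono) auto
    ultimately show ?thesis by (simp add: g_def[abs_def] set_integrable_def set_lebesgue_integral_def)
  qed
  have lim: "(\<lambda>n. g n x) \<longlonglongrightarrow> neg_part q x * (f x)\<^sup>2" for x
  proof -
    obtain n where "\<bar>x\<bar> < real n" using reals_Archimedean2 by blast
    then have "\<forall>k\<ge>n. g k x = neg_part q x * (f x)\<^sup>2" by (auto simp: g_def indicator_def)
    then show ?thesis by (intro tendsto_eventually eventually_sequentiallyI[of n]) auto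
  qed
  have gm: "g n \<in> borel_measurable lebesgue" for n using gl by auto
  note F = integrable_Fatou[of g lebesgue "\<lambda>x. neg_part q x * (f x)\<^sup>2" 0 ?R]
  show "integrable lebesgue (\<lambda>x. neg_part q x * (f x)\<^sup>2)" "(LINT x|lebesgue. neg_part q x * (f x)\<^sup>2) \<le> ?R"
    by (rule F(1) F(2); use gm gl lim m neg_part_meas neg_part_nonneg in \<open>auto simp: g_def\<close>)+
qed

lemma energy_parts_nonneg:
  shows "0 \<le> kinetic d" "0 \<le> mass f" "0 \<le> (LINT x|lebesgue. \<bar>q x\<bar> * (f x)\<^sup>2)"
proof -
  show "0 \<le> kinetic d" by (rule integral_nonneg_AE, use p_pos in eventually_elim) auto
  show "0 \<le> mass f" by (rule integral_nonneg_AE, use r_pos in eventually_elim) auto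
qed auto

text \<open>Write \<open>E\<close>, \<open>R\<close>, \<open>A\<close>, \<open>N\<close> for the integrals of \<open>p f'^2\<close>, \<open>r f^2\<close>, \<open>|q| f^2\<close>, \<open>q_- f^2\<close> and
  \<open>C\<close> for \<open>C_int\<close>. Since \<open>q = |q| - 2 q_-\<close>, the form is \<open>E + A - 2 N + \<Lambda> R\<close>. Four times it exceeds the energy
  \<open>E + R + A\<close> by \<open>3 E + 3 A - 8 N + (8 C + 3) R\<close>. This is nonnegative because
  \<open>6 N \<le> 3 E + 6 C R\<close> and \<open>2 N \<le> 2 A\<close>.\<close>
lemma bform_coercive:
  assumes "in_form f d"
  shows "energy f d \<le> 4 * bform (f, d) (f, d)"
proof -
  define E R A N where "E = kinetic d" and "R = mass f"
    and "A = (LINT x|lebesgue. \<bar>q x\<bar> * (f x)\<^sup>2)" and "N = (LINT x|lebesgue. neg_part q x * (f x)\<^sup>2)"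
  have "(LINT x|lebesgue. q x * (f x)\<^sup>2) = (LINT x|lebesgue. \<bar>q x\<bar> * (f x)\<^sup>2 - 2 * (neg_part q x * (f x)\<^sup>2))"
  proof (rule Bochner_Integration.integral_cong)
    fix x
    have "q x * (f x)\<^sup>2 = (\<bar>q x\<bar> - 2 * neg_part q x) * (f x)\<^sup>2"
      unfolding neg_part_def by (simp add: field_simps)
    then show "q x * (f x)\<^sup>2 = \<bar>q x\<bar> * (f x)\<^sup>2 - 2 * (neg_part q x * (f x)\<^sup>2)" by (simp add: left_diff_distrib)
  qed simp
  also have "\<dots> = A - 2 * N"
    using assms in_form_neg_part(1)[OF assms] by (simp add: A_def N_def in_form_def)
  finally have B: "bform (f, d) (f, d) = E + (A - 2 * N) + \<Lambda> * R"
    by (simp add: bform_def E_def R_def power2_eq_square)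
  have N: "N \<le> E / 2 + C_int * R" using in_form_neg_part(2)[OF assms] by (simp add: N_def E_def R_def)
  have "2 * N \<le> A + A"
  proof -
    have "neg_part q x * (f x)\<^sup>2 \<le> \<bar>q x\<bar> * (f x)\<^sup>2" for x
      by (rule mult_right_mono) (auto simp: neg_part_def)
    then have "N \<le> A" unfolding N_def A_def
      using assms in_form_neg_part(1)[OF assms] by (intro integral_mono) (auto simp: in_form_def)
    then show ?thesis by simp
  qed
  moreover have "0 \<le> E" "0 \<le> R" "0 \<le> A" using energy_parts_nonneg by (auto simp: E_def R_def A_def)
  moreover have "0 \<le> C_int * R" using \<open>0 \<le> R\<close> C_int_pos by simp
  ultimately show ?thesis
    using N by (simp add: energy_def B E_def[symmetric] R_def[symmetric] A_def[symmetric] \<Lambda>_def algebra_simps)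
qed

lemma bform_le_energy:
  assumes "in_form f d"
  shows "bform (f, d) (f, d) \<le> (1 + \<Lambda>) * energy f d"
proof -
  have 1: "(LINT x|lebesgue. q x * (f x)\<^sup>2) \<le> (LINT x|lebesgue. \<bar>q x\<bar> * (f x)\<^sup>2)"
    by (rule integral_mono) (use assms in_form_products(2)[OF assms assms] in \<open>auto simp: in_form_def power2_eq_square intro!: mult_right_mono\<close>)
  have L: "0 \<le> \<Lambda>" using C_int_pos by (simp add: \<Lambda>_def)
  have 2: "0 \<le> \<Lambda> * kinetic d" "0 \<le> \<Lambda> * (LINT x|lebesgue. \<bar>q x\<bar> * (f x)\<^sup>2)"
    using energy_parts_nonneg L by auto
  then show ?thesis
    using 1 energy_parts_nonneg(1)[of d] energy_parts_nonneg(2,3)[of f] by (simp add: bform_def energy_def power2_eq_square algebra_simps)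
qed

section \<open>Weak solutions\<close>

lemma energy_square_CS:
  assumes f: "primitive d f" and E: "integrable lebesgue (\<lambda>x. p x * (d x)\<^sup>2)" and ab: "a \<le> b"
  shows "(f b - f a)\<^sup>2 \<le> (LINT x:{a..b}|lebesgue. 1 / p x) * kinetic d"
proof -
  have dm: "d \<in> borel_measurable lebesgue" by (rule primitive_deriv_measurable[OF f])
  have ae1: "AE x in lebesgue. (sqrt \<bar>1 / p x\<bar>)\<^sup>2 = 1 / p x" using p_pos by eventually_elim simp
  have ae2: "AE x in lebesgue. (sqrt \<bar>p x\<bar> * d x)\<^sup>2 = p x * (d x)\<^sup>2" using p_pos by eventually_elim (simp add: power_mult_distrib)
  have Es: "set_integrable lebesgue {a..b} (\<lambda>x. p x * (d x)\<^sup>2)"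
    "kinetic_on a b d \<le> kinetic d"
  proof -
    have "AE x in lebesgue. 0 \<le> p x * (d x)\<^sup>2" using p_pos by eventually_elim auto
    then show "set_integrable lebesgue {a..b} (\<lambda>x. p x * (d x)\<^sup>2)"
      "kinetic_on a b d \<le> kinetic d"
      using E set_integral_mono_set[of UNIV "\<lambda>x. p x * (d x)\<^sup>2" "{a..b}"]
        set_integrable_subset[of lebesgue UNIV "\<lambda>x. p x * (d x)\<^sup>2" "{a..b}"]
      by (auto simp: set_integrable_def set_lebesgue_integral_def)
  qed
  have i1: "set_integrable lebesgue {a..b} (\<lambda>x. (sqrt \<bar>1 / p x\<bar>)\<^sup>2)"
    by (subst set_integrable_cong_AE[of _ _ "\<lambda>x. 1 / p x"]) (use ae1 pinv_loc p_meas in \<open>auto elim!: eventually_mono\<close>)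
  have i2: "set_integrable lebesgue {a..b} (\<lambda>x. (sqrt \<bar>p x\<bar> * d x)\<^sup>2)"
    by (subst set_integrable_cong_AE[of _ _ "\<lambda>x. p x * (d x)\<^sup>2"]) (use ae2 Es dm p_meas in \<open>auto elim!: eventually_mono\<close>)
  have e1: "(LINT x:{a..b}|lebesgue. (sqrt \<bar>1 / p x\<bar>)\<^sup>2) = (LINT x:{a..b}|lebesgue. 1 / p x)"
    by (rule set_lebesgue_integral_cong_AE) (use ae1 p_meas in \<open>auto elim!: eventually_mono\<close>)
  have e2: "(LINT x:{a..b}|lebesgue. (sqrt \<bar>p x\<bar> * d x)\<^sup>2) = kinetic_on a b d"
    by (rule set_lebesgue_integral_cong_AE) (use ae2 dm p_meas in \<open>auto elim!: eventually_mono\<close>)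
  have e3: "(LINT x:{a..b}|lebesgue. \<bar>sqrt \<bar>1 / p x\<bar> * (sqrt \<bar>p x\<bar> * d x)\<bar>) = (LINT x:{a..b}|lebesgue. \<bar>d x\<bar>)"
  proof (rule set_lebesgue_integral_cong_AE)
    show "AE x\<in>{a..b} in lebesgue. \<bar>sqrt \<bar>1 / p x\<bar> * (sqrt \<bar>p x\<bar> * d x)\<bar> = \<bar>d x\<bar>"
      using p_pos by eventually_elim (simp add: real_sqrt_divide)
  qed (use p_meas dm in auto)
  have inv0: "0 \<le> (LINT x:{a..b}|lebesgue. 1 / p x)" unfolding e1[symmetric] by (simp add: set_lebesgue_integral_def)
  have "(f b - f a)\<^sup>2 = \<bar>f b - f a\<bar>\<^sup>2" by simp
  also have "\<dots> \<le> (LINT x:{a..b}|lebesgue. \<bar>d x\<bar>)\<^sup>2"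
    using primitive_diff_le[OF f, of a a b b] ab by (intro power_mono) auto
  also have "\<dots> \<le> (LINT x:{a..b}|lebesgue. 1 / p x) * kinetic_on a b d"
    unfolding e1[symmetric] e2[symmetric] e3[symmetric]
    by (rule set_Cauchy_Schwarz_integral(2)) (use i1 i2 p_meas dm in auto)
  also have "\<dots> \<le> (LINT x:{a..b}|lebesgue. 1 / p x) * kinetic d"
    using Es inv0 by (intro mult_left_mono) auto
  finally show ?thesis .
qed

text \<open>\<open>2 |d| \<le> 1/p + p d^2\<close>, and \<open>1/p\<close> is locally integrable.\<close>
lemma energy_deriv_locally_integrable:
  assumes dm: "d \<in> borel_measurable lebesgue" and E: "integrable lebesgue (\<lambda>x. p x * (d x)\<^sup>2)"
  shows "set_integrable lebesgue {a..b} d"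
  unfolding set_integrable_def
proof (rule Bochner_Integration.integrable_bound)
  show "integrable lebesgue (\<lambda>x. indicator {a..b} x *\<^sub>R (1 / p x) + p x * (d x)\<^sup>2)"
    using pinv_loc[of a b] E by (auto simp: set_integrable_def)
  show "AE x in lebesgue. norm (indicator {a..b} x *\<^sub>R d x) \<le> norm (indicator {a..b} x *\<^sub>R (1 / p x) + p x * (d x)\<^sup>2)"
    using p_pos
  proof eventually_elim
    case (elim x)
    have "0 \<le> (1 - p x * \<bar>d x\<bar>)\<^sup>2 / p x" using elim by simp
    also have "\<dots> = 1 / p x + p x * (d x)\<^sup>2 - 2 * \<bar>d x\<bar>"
      using elim by (simp add: power2_diff power_mult_distrib field_simps power2_eq_square)
    finally have "\<bar>d x\<bar> \<le> 1 / p x + p x * (d x)\<^sup>2" by linarith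
    moreover have "0 \<le> 1 / p x" "0 \<le> p x * (d x)\<^sup>2" using elim by auto
    ultimately show ?case by (auto simp: indicator_def abs_of_nonneg simp del: zero_le_divide_1_iff)
  qed
  show "(\<lambda>x. indicator {a..b} x *\<^sub>R d x) \<in> borel_measurable lebesgue"
    by (intro borel_measurable_scaleR borel_measurable_indicator dm) auto
qed

text \<open>The derivatives converge in the space with weight \<open>p\<close>. The values at the origin converge by the
  pointwise bound, and with them the functions at every point, to a primitive of the limit.\<close>
lemma form_domain_complete:
  assumes X: "\<And>n::nat. in_form (f n) (d n)"
    and cauchy: "\<And>e. e > 0 \<Longrightarrow> \<exists>N. \<forall>m\<ge>N. \<forall>n\<ge>N. energy (\<lambda>x. f m x - f n x) (\<lambda>x. d m x - d n x) < e"
  shows "\<exists>g e. in_form g e \<and> (\<lambda>n. energy (\<lambda>x. f n x - g x) (\<lambda>x. d n x - e x)) \<longlonglongrightarrow> 0"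
proof -
  have sub: "in_form (\<lambda>x. f m x - f n x) (\<lambda>x. d m x - d n x)" for m n
    using in_form_comb[OF X[of m] X[of n], of "-1"] by simp
  note fm = in_form_measurable(1)[OF X] and dm = in_form_measurable(2)[OF X]
  define En where "En m n = (LINT x|lebesgue. p x * (d m x - d n x)\<^sup>2)" for m n
  define Rn where "Rn m n = (LINT x|lebesgue. r x * (f m x - f n x)\<^sup>2)" for m n
  define An where "An m n = (LINT x|lebesgue. \<bar>q x\<bar> * (f m x - f n x)\<^sup>2)" for m n
  have parts: "0 \<le> En m n" "0 \<le> Rn m n" "0 \<le> An m n" for m n
    using energy_parts_nonneg by (auto simp: En_def Rn_def An_def)
  have energy_eq: "energy (\<lambda>x. f m x - f n x) (\<lambda>x. d m x - d n x) = En m n + Rn m n + An m n" for m n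
    by (simp add: energy_def En_def Rn_def An_def)
  have cauchy': "\<exists>N. \<forall>m\<ge>N. \<forall>n\<ge>N. En m n < e \<and> Rn m n < e \<and> An m n < e" if "e > 0" for e
  proof -
    obtain N where N: "\<forall>m\<ge>N. \<forall>n\<ge>N. En m n + Rn m n + An m n < e"
      using cauchy \<open>e > 0\<close> unfolding energy_eq by blast
    have "En m n < e \<and> Rn m n < e \<and> An m n < e" if "m \<ge> N" "n \<ge> N" for m n
      using N that parts[of m n] by (smt (verit))
    then show ?thesis by blast
  qed
  \<comment> \<open>the derivatives converge in the space with weight \<open>p\<close>\<close>
  have pd: "AE x in lebesgue. (norm (sqrt \<bar>p x\<bar> * d n x))\<^sup>2 = p x * (d n x)\<^sup>2" for n
    using p_pos by eventually_elim (simp add: power_mult_distrib abs_mult)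
  have pdd: "AE x in lebesgue. (norm (sqrt \<bar>p x\<bar> * d m x - sqrt \<bar>p x\<bar> * d n x))\<^sup>2 = p x * (d m x - d n x)\<^sup>2" for m n
    using p_pos by eventually_elim (simp add: power_mult_distrib abs_mult flip: right_diff_distrib)
  have "\<exists>G. G \<in> borel_measurable lebesgue \<and> integrable lebesgue (\<lambda>x. (norm (G x))\<^sup>2) \<and>
    (\<forall>n. integrable lebesgue (\<lambda>x. (norm (sqrt \<bar>p x\<bar> * d n x - G x))\<^sup>2)) \<and>
    (\<lambda>n. LINT x|lebesgue. (norm (sqrt \<bar>p x\<bar> * d n x - G x))\<^sup>2) \<longlonglongrightarrow> 0"
  proof (rule L2_complete)
    show "(\<lambda>x. sqrt \<bar>p x\<bar> * d n x) \<in> borel_measurable lebesgue" for n using p_meas dm by measurable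
    show "integrable lebesgue (\<lambda>x. (norm (sqrt \<bar>p x\<bar> * d n x))\<^sup>2)" for n
      by (subst integrable_cong_AE[OF _ _ pd]) (use X[of n] p_meas dm[of n] in \<open>auto simp: in_form_def\<close>)
    have "(LINT x|lebesgue. (norm (sqrt \<bar>p x\<bar> * d m x - sqrt \<bar>p x\<bar> * d n x))\<^sup>2) = En m n" for m n
      unfolding En_def by (rule integral_cong_AE[OF _ _ pdd]) (use p_meas dm in measurable)
    note eq = this
    show "\<exists>N. \<forall>m\<ge>N. \<forall>n\<ge>N. (LINT x|lebesgue. (norm (sqrt \<bar>p x\<bar> * d m x - sqrt \<bar>p x\<bar> * d n x))\<^sup>2) < e"
      if "e > 0" for e using cauchy'[OF that] unfolding eq by blast
  qed
  then obtain G where G: "G \<in> borel_measurable lebesgue" "integrable lebesgue (\<lambda>x. (norm (G x))\<^sup>2)"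
    "\<And>n. integrable lebesgue (\<lambda>x. (norm (sqrt \<bar>p x\<bar> * d n x - G x))\<^sup>2)"
    "(\<lambda>n. LINT x|lebesgue. (norm (sqrt \<bar>p x\<bar> * d n x - G x))\<^sup>2) \<longlonglongrightarrow> 0" by blast
  define e where "e x = G x / sqrt \<bar>p x\<bar>" for x
  have em: "e \<in> borel_measurable lebesgue" unfolding e_def[abs_def] using G(1) p_meas by measurable
  have pe: "AE x in lebesgue. (norm (G x))\<^sup>2 = p x * (e x)\<^sup>2"
    using p_pos by eventually_elim (simp add: e_def power_divide)
  have pde: "AE x in lebesgue. (norm (sqrt \<bar>p x\<bar> * d n x - G x))\<^sup>2 = p x * (d n x - e x)\<^sup>2" for n
    using p_pos
  proof eventually_elim
    case (elim x)
    then have "sqrt \<bar>p x\<bar> * d n x - G x = sqrt \<bar>p x\<bar> * (d n x - e x)" by (simp add: e_def right_diff_distrib)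
    then show ?case using elim by (simp add: power_mult_distrib abs_mult)
  qed
  have Ee: "integrable lebesgue (\<lambda>x. p x * (e x)\<^sup>2)"
    using G(2) by (subst integrable_cong_AE[OF _ _ pe, symmetric]) (use G(1) p_meas em in auto)
  have Ede: "integrable lebesgue (\<lambda>x. p x * (d n x - e x)\<^sup>2)" for n
    using G(3)[of n] by (subst integrable_cong_AE[OF _ _ pde, symmetric]) (use G(1) p_meas em dm in auto)
  have "(LINT x|lebesgue. (norm (sqrt \<bar>p x\<bar> * d n x - G x))\<^sup>2) = (LINT x|lebesgue. p x * (d n x - e x)\<^sup>2)" for n
    by (rule integral_cong_AE[OF _ _ pde]) (use p_meas dm G(1) em in measurable)
  then have E0: "(\<lambda>n. LINT x|lebesgue. p x * (d n x - e x)\<^sup>2) \<longlonglongrightarrow> 0" using G(4) by simp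
  \<comment> \<open>the functions converge pointwise to a primitive of the limit\<close>
  have "Cauchy (\<lambda>n. f n 0)"
    unfolding Cauchy_def
  proof (intro allI impI)
    fix \<epsilon> :: real assume "\<epsilon> > 0"
    then have "\<epsilon>\<^sup>2 / (2 * C_int) > 0" using C_int_pos by simp
    then obtain N where N: "\<forall>m\<ge>N. \<forall>n\<ge>N. En m n < \<epsilon>\<^sup>2 / (2 * C_int) \<and> Rn m n < \<epsilon>\<^sup>2 / (2 * C_int) \<and> An m n < \<epsilon>\<^sup>2 / (2 * C_int)"
      using cauchy' by blast
    have "dist (f m 0) (f n 0) < \<epsilon>" if "m \<ge> N" "n \<ge> N" for m n
    proof -
      have "(f m 0 - f n 0)\<^sup>2 \<le> C_int * (En m n + Rn m n)"
        using in_form_sup[OF sub[of m n], of 0] by (simp add: En_def Rn_def)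
      also have "\<dots> < C_int * (\<epsilon>\<^sup>2 / (2 * C_int) + \<epsilon>\<^sup>2 / (2 * C_int))"
        using N that C_int_pos by (intro mult_strict_left_mono add_strict_mono) auto
      also have "\<dots> = \<epsilon>\<^sup>2" using C_int_pos by (simp add: field_simps)
      finally have "\<bar>f m 0 - f n 0\<bar>\<^sup>2 < \<epsilon>\<^sup>2" by simp
      then have "\<bar>f m 0 - f n 0\<bar> < \<epsilon>" by (rule power2_less_imp_less) (use \<open>\<epsilon> > 0\<close> in simp)
      then show ?thesis by (simp add: dist_real_def)
    qed
    then show "\<exists>M. \<forall>m\<ge>M. \<forall>n\<ge>M. dist (f m 0) (f n 0) < \<epsilon>" by blast
  qed
  then obtain c where c: "(\<lambda>n. f n 0) \<longlonglongrightarrow> c" by (auto simp: Cauchy_convergent_iff convergent_def)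
  obtain g where g: "primitive e g" "g 0 = c"
    using ex_primitive[OF energy_deriv_locally_integrable[OF em Ee]] by blast
  have gm: "g \<in> borel_measurable lebesgue" by (rule primitive_measurable[OF g(1)])
  have lim: "(\<lambda>n. f n x) \<longlonglongrightarrow> g x" for x
  proof -
    define K where "K = (LINT x:{min 0 x..max 0 x}|lebesgue. 1 / p x)"
    have b: "((f n x - g x) - (f n 0 - g 0))\<^sup>2 \<le> K * (LINT x|lebesgue. p x * (d n x - e x)\<^sup>2)" for n
    proof -
      have "primitive (\<lambda>x. d n x + (-1) * e x) (\<lambda>x. f n x + (-1) * g x)"
        by (rule primitive_lincomb) (use X g in \<open>auto simp: in_form_def\<close>)
      then have "primitive (\<lambda>x. d n x - e x) (\<lambda>x. f n x - g x)" by simp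
      from energy_square_CS[OF this Ede, of "min 0 x" "max 0 x"] show ?thesis
        unfolding K_def by (cases "0 \<le> x") (auto simp: min_def max_def power2_commute)
    qed
    have "(\<lambda>n. K * (LINT x|lebesgue. p x * (d n x - e x)\<^sup>2)) \<longlonglongrightarrow> K * 0"
      by (intro tendsto_intros E0)
    then have l: "(\<lambda>n. K * (LINT x|lebesgue. p x * (d n x - e x)\<^sup>2)) \<longlonglongrightarrow> 0" by simp
    have "(\<lambda>n. ((f n x - g x) - (f n 0 - g 0))\<^sup>2) \<longlonglongrightarrow> 0"
    proof (rule tendsto_sandwich[OF _ _ tendsto_const l])
      show "\<forall>\<^sub>F n in sequentially. 0 \<le> ((f n x - g x) - (f n 0 - g 0))\<^sup>2" by simp
      show "\<forall>\<^sub>F n in sequentially. ((f n x - g x) - (f n 0 - g 0))\<^sup>2 \<le> K * (LINT x|lebesgue. p x * (d n x - e x)\<^sup>2)"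
        using b by (intro always_eventually allI)
    qed
    then have "(\<lambda>n. sqrt (((f n x - g x) - (f n 0 - g 0))\<^sup>2)) \<longlonglongrightarrow> sqrt 0" by (rule tendsto_real_sqrt)
    then have "(\<lambda>n. (f n x - g x) - (f n 0 - g 0)) \<longlonglongrightarrow> 0" by (simp add: tendsto_rabs_zero_iff)
    from tendsto_add[OF tendsto_add[OF this c] tendsto_const[of "g x - g 0"]]
    show ?thesis using g(2) by simp
  qed
  \<comment> \<open>Fatou's lemma gives convergence for the weights \<open>r\<close> and \<open>|q|\<close>\<close>
  have weight: "integrable lebesgue (\<lambda>x. w x * (g x)\<^sup>2) \<and> (\<lambda>n. LINT x|lebesgue. w x * (f n x - g x)\<^sup>2) \<longlonglongrightarrow> 0"
    if wm: "w \<in> borel_measurable lebesgue" and w0: "AE x in lebesgue. 0 \<le> w x"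
      and wi: "\<And>n. integrable lebesgue (\<lambda>x. w x * (f n x)\<^sup>2)" "\<And>m n. integrable lebesgue (\<lambda>x. w x * (f m x - f n x)\<^sup>2)"
      and wc: "\<And>\<epsilon>. \<epsilon> > 0 \<Longrightarrow> \<exists>N. \<forall>m\<ge>N. \<forall>n\<ge>N. (LINT x|lebesgue. w x * (f m x - f n x)\<^sup>2) < \<epsilon>" for w
  proof -
    have limw: "AE x in lebesgue. (\<lambda>m. w x * (f n x - f m x)\<^sup>2) \<longlonglongrightarrow> w x * (f n x - g x)\<^sup>2" for n
      by (intro AE_I2 tendsto_intros lim)
    have nn: "AE x in lebesgue. \<forall>m. 0 \<le> w x * (f n x - f m x)\<^sup>2" for n using w0 by eventually_elim auto
    have F: "integrable lebesgue (\<lambda>x. w x * (f n x - g x)\<^sup>2) \<and> (LINT x|lebesgue. w x * (f n x - g x)\<^sup>2) \<le> \<epsilon>"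
      if "\<And>m. m \<ge> N \<Longrightarrow> (LINT x|lebesgue. w x * (f n x - f m x)\<^sup>2) \<le> \<epsilon>" for n N \<epsilon>
      using integrable_Fatou[OF _ _ nn limw, of n N \<epsilon>] that wi(2) wm fm gm by auto
    have lim0: "(\<lambda>n. LINT x|lebesgue. w x * (f n x - g x)\<^sup>2) \<longlonglongrightarrow> 0"
    proof (rule LIMSEQ_I)
      fix \<epsilon> :: real assume "\<epsilon> > 0"
      then obtain N where N: "\<forall>m\<ge>N. \<forall>n\<ge>N. (LINT x|lebesgue. w x * (f m x - f n x)\<^sup>2) < \<epsilon> / 2"
        using wc[of "\<epsilon> / 2"] by auto
      have "norm ((LINT x|lebesgue. w x * (f n x - g x)\<^sup>2) - 0) < \<epsilon>" if "n \<ge> N" for n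
      proof -
        have "(LINT x|lebesgue. w x * (f n x - g x)\<^sup>2) \<le> \<epsilon> / 2"
          using F[of N n "\<epsilon> / 2"] N that by (meson less_imp_le)
        moreover have "0 \<le> (LINT x|lebesgue. w x * (f n x - g x)\<^sup>2)"
          by (rule integral_nonneg_AE, use w0 in eventually_elim) auto
        ultimately show ?thesis using \<open>\<epsilon> > 0\<close> by simp
      qed
      then show "\<exists>no. \<forall>n\<ge>no. norm ((LINT x|lebesgue. w x * (f n x - g x)\<^sup>2) - 0) < \<epsilon>" by blast
    qed
    obtain N where N: "\<forall>m\<ge>N. \<forall>n\<ge>N. (LINT x|lebesgue. w x * (f m x - f n x)\<^sup>2) < 1" using wc[of 1] by auto
    have 1: "integrable lebesgue (\<lambda>x. w x * (f N x - g x)\<^sup>2)" using F[of N N 1] N by (meson less_imp_le order_refl)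
    have eqw: "integrable lebesgue (\<lambda>x. \<bar>w x\<bar> * h x) \<longleftrightarrow> integrable lebesgue (\<lambda>x. w x * h x)" if "h \<in> borel_measurable lebesgue" for h
      by (rule integrable_cong_AE) (use wm w0 that in \<open>auto elim!: eventually_mono\<close>)
    have "integrable lebesgue (\<lambda>x. \<bar>w x\<bar> * (f N x + (-1) * (f N x - g x))\<^sup>2)"
      by (rule weighted_sq_add_integrable[OF wm]) (use 1 wi(1)[of N] fm gm eqw in auto)
    then have "integrable lebesgue (\<lambda>x. \<bar>w x\<bar> * (g x)\<^sup>2)" by simp
    then have "integrable lebesgue (\<lambda>x. w x * (g x)\<^sup>2)" using eqw gm by auto
    with lim0 show ?thesis by blast
  qed
  have r: "finite_mass g \<and> (\<lambda>n. LINT x|lebesgue. r x * (f n x - g x)\<^sup>2) \<longlonglongrightarrow> 0"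
  proof (rule weight[OF r_meas])
    show "\<exists>N. \<forall>m\<ge>N. \<forall>n\<ge>N. (LINT x|lebesgue. r x * (f m x - f n x)\<^sup>2) < \<epsilon>" if "\<epsilon> > 0" for \<epsilon>
      using cauchy'[OF that] unfolding Rn_def by blast
  qed (use r_pos X sub in \<open>auto simp: in_form_def elim!: eventually_mono\<close>)
  have q: "integrable lebesgue (\<lambda>x. \<bar>q x\<bar> * (g x)\<^sup>2) \<and> (\<lambda>n. LINT x|lebesgue. \<bar>q x\<bar> * (f n x - g x)\<^sup>2) \<longlonglongrightarrow> 0"
  proof (rule weight)
    show "\<exists>N. \<forall>m\<ge>N. \<forall>n\<ge>N. (LINT x|lebesgue. \<bar>q x\<bar> * (f m x - f n x)\<^sup>2) < \<epsilon>" if "\<epsilon> > 0" for \<epsilon>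
      using cauchy'[OF that] unfolding An_def by blast
  qed (use q_meas X sub in \<open>auto simp: in_form_def\<close>)
  have "in_form g e" using g(1) Ee r q by (simp add: in_form_def)
  moreover have "(\<lambda>n. energy (\<lambda>x. f n x - g x) (\<lambda>x. d n x - e x)) \<longlonglongrightarrow> 0 + 0 + 0"
    unfolding energy_def by (intro tendsto_add E0 r[THEN conjunct2] q[THEN conjunct2])
  ultimately show ?thesis by auto
qed

text \<open>Riesz representation for the functional \<open>g \<mapsto> \<integral> r h g\<close>, which is bounded because the form
  dominates a quarter of the weighted integral of \<open>g^2\<close>.\<close>
lemma weak_solution:
  assumes h: "h \<in> borel_measurable lebesgue" "finite_mass h"
  shows "\<exists>f d. in_form f d \<and> (\<forall>g e. in_form g e \<longrightarrow> bform (f, d) (g, e) = (ip h g))"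
proof -
  define V where "V = {u. in_form (fst u) (snd u)}"
  define l where "l u = (LINT x|lebesgue. r x * (h x * fst u x))" for u :: "(real \<Rightarrow> real) \<times> (real \<Rightarrow> real)"
  have hi: "integrable lebesgue (\<lambda>x. \<bar>r x\<bar> * (h x)\<^sup>2)"
    using h integrable_abs_weight[OF r_meas r_pos, of "\<lambda>x. (h x)\<^sup>2"] by simp
  have li: "integrable lebesgue (\<lambda>x. r x * (h x * f x))" if "in_form f d" for f d
    using weighted_prod_integrable[OF r_meas h(1) in_form_measurable(1)[OF that] hi in_form_abs(2)[OF that]] .
  have "\<exists>u\<in>V. \<forall>\<phi>\<in>V. bform u \<phi> = l \<phi>"
  proof (rule Riesz_by_minimization[where comb=comb and K="4 * mass h"])
    have "in_form (\<lambda>x. 0) (\<lambda>x. 0)" by (simp add: in_form_def primitive_def set_integrable_def set_lebesgue_integral_def)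
    then show "V \<noteq> {}" unfolding V_def by force
    show "comb u c v \<in> V" if "u \<in> V" "v \<in> V" for u v c
      using that in_form_comb by (simp add: V_def comb_def)
    show "bform (comb u c v) w = bform u w + c * bform v w" if "u \<in> V" "v \<in> V" "w \<in> V" for u v w c
      using that bform_comb by (simp add: V_def)
    show "bform u v = bform v u" for u v by (rule bform_sym)
    show nn: "0 \<le> bform u u" if "u \<in> V" for u
    proof -
      have "0 \<le> energy (fst u) (snd u)" using energy_parts_nonneg by (simp add: energy_def)
      also have "\<dots> \<le> 4 * bform u u" using bform_coercive[of "fst u" "snd u"] that by (simp add: V_def)
      finally show ?thesis by simp
    qed
    show "l (comb u c v) = l u + c * l v" if "u \<in> V" "v \<in> V" for u v c
    proof -
      have iu: "integrable lebesgue (\<lambda>x. r x * (h x * fst u x))" and iv: "integrable lebesgue (\<lambda>x. r x * (h x * fst v x))"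
        using that by (auto simp: V_def intro: li)
      have "(LINT x|lebesgue. r x * (h x * (fst u x + c * fst v x))) =
        (LINT x|lebesgue. r x * (h x * fst u x) + c * (r x * (h x * fst v x)))"
        by (rule arg_cong[of _ _ "integral\<^sup>L lebesgue"]) (simp add: fun_eq_iff algebra_simps)
      also have "\<dots> = (LINT x|lebesgue. r x * (h x * fst u x)) + c * (LINT x|lebesgue. r x * (h x * fst v x))"
        by (subst Bochner_Integration.integral_add) (use iu iv in \<open>auto intro!: integrable_mult_right simp del: integrable_mult_right_iff\<close>)
      finally have "(LINT x|lebesgue. r x * (h x * (fst u x + c * fst v x))) =
        (LINT x|lebesgue. r x * (h x * fst u x)) + c * (LINT x|lebesgue. r x * (h x * fst v x))" .
      then show ?thesis by (simp add: l_def comb_def)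
    qed
    show "0 \<le> 4 * mass h" using energy_parts_nonneg(2)[of h] by simp
    show "(l u)\<^sup>2 \<le> 4 * mass h * bform u u" if "u \<in> V" for u
    proof -
      obtain f d where u: "u = (f, d)" by force
      with that have fd: "in_form f d" by (simp add: V_def)
      note fm = in_form_measurable(1)[OF fd]
      have a1: "AE x in lebesgue. (sqrt \<bar>r x\<bar> * h x)\<^sup>2 = r x * (h x)\<^sup>2" using r_pos by eventually_elim (simp add: power_mult_distrib)
      have a2: "AE x in lebesgue. (sqrt \<bar>r x\<bar> * f x)\<^sup>2 = r x * (f x)\<^sup>2" using r_pos by eventually_elim (simp add: power_mult_distrib)
      have a3: "AE x in lebesgue. (sqrt \<bar>r x\<bar> * h x) * (sqrt \<bar>r x\<bar> * f x) = r x * (h x * f x)"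
        using r_pos
      proof eventually_elim
        case (elim x)
        have "(sqrt \<bar>r x\<bar> * h x) * (sqrt \<bar>r x\<bar> * f x) = (sqrt \<bar>r x\<bar> * sqrt \<bar>r x\<bar>) * (h x * f x)"
          by (simp only: mult_ac)
        then show ?case using elim by simp
      qed
      have i1: "integrable lebesgue (\<lambda>x. (sqrt \<bar>r x\<bar> * h x)\<^sup>2)" 
        by (subst integrable_cong_AE[OF _ _ a1]) (use h r_meas in auto)
      have i2: "integrable lebesgue (\<lambda>x. (sqrt \<bar>r x\<bar> * f x)\<^sup>2)" 
        by (subst integrable_cong_AE[OF _ _ a2]) (use fd fm r_meas in \<open>auto simp: in_form_def\<close>)
      have e: "(LINT x|lebesgue. (sqrt \<bar>r x\<bar> * h x)\<^sup>2) = mass h"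
        "(LINT x|lebesgue. (sqrt \<bar>r x\<bar> * f x)\<^sup>2) = mass f"
        "(LINT x|lebesgue. (sqrt \<bar>r x\<bar> * h x) * (sqrt \<bar>r x\<bar> * f x)) = ip h f"
        by (rule integral_cong_AE[OF _ _ a1] integral_cong_AE[OF _ _ a2] integral_cong_AE[OF _ _ a3]; use r_meas fm h(1) in measurable)+
      have "(l u)\<^sup>2 \<le> mass h * mass f"
        using Cauchy_Schwarz_integral(3)[OF _ _ i1 i2] r_meas h(1) fm by (simp add: e l_def u)
      also have "\<dots> \<le> mass h * (4 * bform u u)"
      proof (rule mult_left_mono)
        show "mass f \<le> 4 * bform u u"
          using bform_coercive[OF fd] energy_parts_nonneg(1)[of d] energy_parts_nonneg(3)[of f]
          unfolding energy_def u by linarith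
      qed (rule energy_parts_nonneg(2))
      finally show ?thesis by simp
    qed
    fix X :: "nat \<Rightarrow> (real \<Rightarrow> real) \<times> (real \<Rightarrow> real)"
    assume X: "\<And>n. X n \<in> V" and cauchy: "\<And>e. e > 0 \<Longrightarrow> \<exists>N. \<forall>m\<ge>N. \<forall>n\<ge>N. bform (comb (X m) (-1) (X n)) (comb (X m) (-1) (X n)) < e"
    have Xn: "in_form (fst (X n)) (snd (X n))" for n using X by (simp add: V_def)
    have comb1: "comb u (-1) v = (\<lambda>x. fst u x - fst v x, \<lambda>x. snd u x - snd v x)" for u v by (simp add: comb_def)
    have sub: "in_form (\<lambda>x. fst u x - fst v x) (\<lambda>x. snd u x - snd v x)" if "in_form (fst u) (snd u)" "in_form (fst v) (snd v)" for u v
      using in_form_comb[OF that, of "-1"] by simp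
    have "\<exists>g e. in_form g e \<and> (\<lambda>n. energy (\<lambda>x. fst (X n) x - g x) (\<lambda>x. snd (X n) x - e x)) \<longlonglongrightarrow> 0"
    proof (rule form_domain_complete[OF Xn])
      fix e :: real assume "e > 0"
      then obtain N where N: "\<forall>m\<ge>N. \<forall>n\<ge>N. bform (comb (X m) (-1) (X n)) (comb (X m) (-1) (X n)) < e / 4"
        using cauchy[of "e / 4"] by auto
      have "energy (\<lambda>x. fst (X m) x - fst (X n) x) (\<lambda>x. snd (X m) x - snd (X n) x) < e" if "m \<ge> N" "n \<ge> N" for m n
      proof -
        have "bform (comb (X m) (-1) (X n)) (comb (X m) (-1) (X n)) < e / 4" using N that by blast
        then show ?thesis using bform_coercive[OF sub[OF Xn[of m] Xn[of n]]] by (simp add: comb1)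
      qed
      then show "\<exists>N. \<forall>m\<ge>N. \<forall>n\<ge>N. energy (\<lambda>x. fst (X m) x - fst (X n) x) (\<lambda>x. snd (X m) x - snd (X n) x) < e" by blast
    qed
    then obtain g e where ge: "in_form g e" "(\<lambda>n. energy (\<lambda>x. fst (X n) x - g x) (\<lambda>x. snd (X n) x - e x)) \<longlonglongrightarrow> 0" by blast
    have gV: "(g, e) \<in> V" using ge by (simp add: V_def)
    have in': "in_form (\<lambda>x. fst (X n) x - g x) (\<lambda>x. snd (X n) x - e x)" for n
      using sub[of "X n" "(g, e)"] Xn ge by simp
    have "(\<lambda>n. (1 + \<Lambda>) * energy (\<lambda>x. fst (X n) x - g x) (\<lambda>x. snd (X n) x - e x)) \<longlonglongrightarrow> (1 + \<Lambda>) * 0"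
      by (intro tendsto_intros ge)
    then have up: "(\<lambda>n. (1 + \<Lambda>) * energy (\<lambda>x. fst (X n) x - g x) (\<lambda>x. snd (X n) x - e x)) \<longlonglongrightarrow> 0" by simp
    have "(\<lambda>n. bform (comb (X n) (-1) (g, e)) (comb (X n) (-1) (g, e))) \<longlonglongrightarrow> 0"
    proof (rule tendsto_sandwich[OF _ _ tendsto_const up])
      show "\<forall>\<^sub>F n in sequentially. 0 \<le> bform (comb (X n) (-1) (g, e)) (comb (X n) (-1) (g, e))"
        by (intro always_eventually allI nn) (use in' in \<open>simp add: V_def comb_def\<close>)
      show "\<forall>\<^sub>F n in sequentially. bform (comb (X n) (-1) (g, e)) (comb (X n) (-1) (g, e)) \<le> (1 + \<Lambda>) * energy (\<lambda>x. fst (X n) x - g x) (\<lambda>x. snd (X n) x - e x)"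
        using bform_le_energy[OF in'] by (simp add: comb1)
    qed
    then show "\<exists>u\<in>V. (\<lambda>n. bform (comb (X n) (-1) u) (comb (X n) (-1) u)) \<longlonglongrightarrow> 0" using gV by blast
  qed
  then obtain u where "u \<in> V" "\<forall>\<phi>\<in>V. bform u \<phi> = l \<phi>" by blast
  then show ?thesis unfolding V_def l_def
    by (intro exI[of _ "fst u"] exI[of _ "snd u"]) auto
qed

end

section \<open>Regularity of weak solutions\<close>

lemma set_integral_pos:
  fixes h :: "real \<Rightarrow> real"
  assumes "a < b" "set_integrable lebesgue {a..b} h" "AE x in lebesgue. 0 < h x"
  shows "0 < (LINT x:{a..b}|lebesgue. h x)"
proof -
  have nn: "AE x in lebesgue. 0 \<le> indicator {a..b} x *\<^sub>R h x"
    using assms(3) by eventually_elim (auto simp: indicator_def)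
  have "(LINT x:{a..b}|lebesgue. h x) \<noteq> 0"
  proof
    assume "(LINT x:{a..b}|lebesgue. h x) = 0"
    then have "AE x in lebesgue. indicator {a..b} x *\<^sub>R h x = 0"
      using assms(2) nn by (subst integral_nonneg_eq_0_iff_AE[symmetric]) (auto simp: set_integrable_def set_lebesgue_integral_def)
    then have "AE x in lebesgue. x \<notin> {a..b}"
      using assms(3) by eventually_elim (auto simp: indicator_def split: if_splits)
    then have "{a..b} \<in> null_sets lebesgue" by (subst AE_iff_null_sets) auto
    then show False using assms(1) by (simp add: null_sets_def)
  qed
  moreover have "0 \<le> (LINT x:{a..b}|lebesgue. h x)"
    unfolding set_lebesgue_integral_def using nn by (rule integral_nonneg_AE)
  ultimately show ?thesis by simp
qed

context SL
begin

lemma bounded_over_p_integrable: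
  assumes "\<psi> \<in> borel_measurable lebesgue" "\<And>x. \<bar>\<psi> x\<bar> \<le> K"
  shows "set_integrable lebesgue {a..b} (\<lambda>x. \<psi> x * (1 / p x))"
  by (rule set_integrable_bounded_mult[where C=K]) (use assms pinv_loc p_meas in auto)

text \<open>The fundamental lemma of the calculus of variations for the weight \<open>1/p\<close>. One would like to test with
  \<open>G\<close> minus its mean, which need not be an admissible function. The bounded function
  \<open>\<psi> = arctan G - c\<close> is admissible; its mean value \<open>c\<close> lies strictly between \<open>-\<pi>/2\<close> and
  \<open>\<pi>/2\<close>, and \<open>\<psi> (G - tan c)\<close> is nonnegative by monotonicity, so it vanishes almost everywhere.\<close>
lemma du_Bois_Reymond:
  assumes ab: "a < b" and G: "G \<in> borel_measurable lebesgue" "set_integrable lebesgue {a..b} (\<lambda>x. G x * (1 / p x))"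
    and test: "\<And>\<psi>. \<psi> \<in> borel_measurable lebesgue \<Longrightarrow> (\<And>x. \<bar>\<psi> x\<bar> \<le> 2 * pi) \<Longrightarrow>
       (LINT x:{a..b}|lebesgue. \<psi> x * (1 / p x)) = 0 \<Longrightarrow> (LINT x:{a..b}|lebesgue. G x * (\<psi> x * (1 / p x))) = 0"
  shows "\<exists>c. AE x in lebesgue. x \<in> {a..b} \<longrightarrow> G x = c"
proof -
  define m where "m = (LINT x:{a..b}|lebesgue. 1 / p x)"
  have ip: "set_integrable lebesgue {a..b} (\<lambda>x. 1 / p x)" by (rule pinv_loc)
  have pinv: "AE x in lebesgue. 0 < 1 / p x" using p_pos by eventually_elim simp
  have m: "0 < m" unfolding m_def by (rule set_integral_pos[OF ab ip pinv])
  define A where "A x = arctan (G x)" for x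
  have Am: "A \<in> borel_measurable lebesgue" unfolding A_def[abs_def] using G(1)
    by (rule borel_measurable_continuous_on[rotated]) (auto intro!: continuous_intros)
  have Ab: "\<bar>A x\<bar> < pi / 2" for x unfolding A_def abs_less_iff using arctan_bounded[of "G x"] by linarith
  have iA: "set_integrable lebesgue {a..b} (\<lambda>x. A x * (1 / p x))"
    by (rule bounded_over_p_integrable[OF Am, of "pi/2"]) (use Ab in \<open>auto intro: less_imp_le\<close>)
  define c where "c = (LINT x:{a..b}|lebesgue. A x * (1 / p x)) / m"
  have cm: "(LINT x:{a..b}|lebesgue. A x * (1 / p x)) = c * m" using m by (simp add: c_def)
  have ipc: "set_integrable lebesgue {a..b} (\<lambda>x. C * (1 / p x))" for C by (intro set_integrable_mult_right ip)
  have mc: "(LINT x:{a..b}|lebesgue. C * (1 / p x)) = C * m" for C unfolding m_def by (rule set_integral_mult_right)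
  have "0 < (LINT x:{a..b}|lebesgue. (pi / 2) * (1 / p x) - A x * (1 / p x))"
  proof (rule set_integral_pos[OF ab])
    show "AE x in lebesgue. 0 < (pi / 2) * (1 / p x) - A x * (1 / p x)"
      using pinv
    proof eventually_elim
      case (elim x)
      have "A x * (1 / p x) < (pi / 2) * (1 / p x)" using Ab[of x] elim by (intro mult_strict_right_mono) auto
      then show ?case by simp
    qed
  qed (rule set_integral_diff(1)[OF ipc iA])
  also have "\<dots> = (pi / 2) * m - c * m"
    unfolding set_integral_diff(2)[OF ipc iA] mc cm ..
  finally have c1: "c < pi / 2" using m by (simp flip: left_diff_distrib add: zero_less_mult_iff)
  have "0 < (LINT x:{a..b}|lebesgue. A x * (1 / p x) + (pi / 2) * (1 / p x))"
  proof (rule set_integral_pos[OF ab])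
    show "AE x in lebesgue. 0 < A x * (1 / p x) + (pi / 2) * (1 / p x)"
      using pinv
    proof eventually_elim
      case (elim x)
      have "(- (pi / 2)) * (1 / p x) < A x * (1 / p x)" using Ab[of x] elim by (intro mult_strict_right_mono) auto
      then show ?case by simp
    qed
  qed (rule set_integral_add(1)[OF iA ipc])
  also have "\<dots> = c * m + (pi / 2) * m"
    unfolding set_integral_add(2)[OF iA ipc] mc cm ..
  finally have "0 < (c + pi / 2) * m" by (simp only: distrib_right)
  then have "0 < c + pi / 2" using m by (simp only: zero_less_mult_iff) linarith
  then have c2: "- (pi / 2) < c" by simp
  define \<psi> where "\<psi> x = A x - c" for x
  have \<psi>m: "\<psi> \<in> borel_measurable lebesgue" unfolding \<psi>_def[abs_def] using Am by measurable
  have \<psi>b: "\<bar>\<psi> x\<bar> \<le> 2 * pi" for x using Ab[of x] c1 c2 pi_gt_zero unfolding \<psi>_def abs_le_iff abs_less_iff by linarith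
  have "(LINT x:{a..b}|lebesgue. \<psi> x * (1 / p x)) = (LINT x:{a..b}|lebesgue. A x * (1 / p x) - c * (1 / p x))"
    by (simp only: \<psi>_def left_diff_distrib)
  also have "\<dots> = c * m - c * m"
    unfolding set_integral_diff(2)[OF iA ipc] mc cm ..
  finally have \<psi>0: "(LINT x:{a..b}|lebesgue. \<psi> x * (1 / p x)) = 0" by simp
  have i\<psi>: "set_integrable lebesgue {a..b} (\<lambda>x. \<psi> x * (1 / p x))" by (rule bounded_over_p_integrable[OF \<psi>m \<psi>b])
  have iG\<psi>: "set_integrable lebesgue {a..b} (\<lambda>x. \<psi> x * (G x * (1 / p x)))"
    by (rule set_integrable_bounded_mult[where C="2*pi"]) (use G p_meas \<psi>m \<psi>b in auto)
  have "(LINT x:{a..b}|lebesgue. \<psi> x * (G x * (1 / p x)) - tan c * (\<psi> x * (1 / p x))) =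
      (LINT x:{a..b}|lebesgue. G x * (\<psi> x * (1 / p x))) - tan c * (LINT x:{a..b}|lebesgue. \<psi> x * (1 / p x))"
    unfolding set_integral_diff(2)[OF iG\<psi> set_integrable_mult_right[OF i\<psi>]] set_integral_mult_right
    by (simp only: mult.left_commute)
  also have "\<dots> = 0" using test[OF \<psi>m \<psi>b \<psi>0] \<psi>0 by simp
  finally have z: "(LINT x:{a..b}|lebesgue. \<psi> x * (G x * (1 / p x)) - tan c * (\<psi> x * (1 / p x))) = 0" .
  have iz: "set_integrable lebesgue {a..b} (\<lambda>x. \<psi> x * (G x * (1 / p x)) - tan c * (\<psi> x * (1 / p x)))"
    by (intro set_integral_diff(1) set_integrable_mult_right iG\<psi> i\<psi>)
  have tanA: "tan (A x) = G x" for x by (simp add: A_def tan_arctan)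
  have sgn: "0 \<le> \<psi> x * (G x - tan c)" "\<psi> x * (G x - tan c) = 0 \<Longrightarrow> G x = tan c" for x
  proof -
    have b: "- (pi/2) < A x" "A x < pi/2" using Ab[of x] by (auto simp: abs_less_iff)
    consider "A x < c" | "A x = c" | "c < A x" by linarith
    then have "0 < \<psi> x * (G x - tan c) \<or> G x = tan c"
    proof cases
      case 1
      then have "G x < tan c" using tan_monotone[OF b(1) 1 c1] tanA by simp
      then show ?thesis using 1 by (simp add: \<psi>_def mult_neg_neg)
    next
      case 2 then show ?thesis using tanA by metis
    next
      case 3
      then have "tan c < G x" using tan_monotone[OF c2 3 b(2)] tanA by simp
      then show ?thesis using 3 by (simp add: \<psi>_def)
    qed
    then show "0 \<le> \<psi> x * (G x - tan c)" "\<psi> x * (G x - tan c) = 0 \<Longrightarrow> G x = tan c" by auto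
  qed
  have eq: "\<psi> x * (G x * (1 / p x)) - tan c * (\<psi> x * (1 / p x)) = (\<psi> x * (G x - tan c)) * (1 / p x)" for x
    by (simp add: algebra_simps diff_divide_distrib)
  have nn: "AE x in lebesgue. 0 \<le> indicator {a..b} x *\<^sub>R ((\<psi> x * (G x - tan c)) * (1 / p x))"
    using pinv by eventually_elim (use sgn(1) in \<open>auto simp: indicator_def\<close>)
  have "AE x in lebesgue. indicator {a..b} x *\<^sub>R ((\<psi> x * (G x - tan c)) * (1 / p x)) = 0"
    using iz z nn unfolding eq set_integrable_def set_lebesgue_integral_def
    by (subst integral_nonneg_eq_0_iff_AE[symmetric]) auto
  then have "AE x in lebesgue. x \<in> {a..b} \<longrightarrow> G x = tan c"
    using p_pos
  proof eventually_elim
    case (elim x)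
    show ?case
    proof
      assume "x \<in> {a..b}"
      then have "\<psi> x * (G x - tan c) = 0" using elim by simp
      then show "G x = tan c" by (rule sgn(2))
    qed
  qed
  then show ?thesis by blast
qed

text \<open>Let \<open>W\<close> be a primitive of the right-hand side. Integration by parts turns the weak equation into the
  statement that \<open>p d - W\<close> is orthogonal to every compactly supported \<open>\<delta> = \<psi>/p\<close> with mean zero. So
  \<open>p d - W\<close> is constant, and \<open>p d\<close> has an absolutely continuous representative.\<close>
lemma weak_solution_regular:
  assumes fd: "in_form f d" and h: "h \<in> borel_measurable lebesgue" "finite_mass h"
    and weak: "\<And>g e. in_form g e \<Longrightarrow> bform (f, d) (g, e) = ip h g"
  shows "\<exists>v. primitive (\<lambda>x. q x * f x + \<Lambda> * (r x * f x) - r x * h x) v \<and> (AE x in lebesgue. v x = p x * d x)"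
proof -
  define w where "w x = q x * f x + \<Lambda> * (r x * f x) - r x * h x" for x
  have f: "primitive d f" using fd by (simp add: in_form_def)
  note fc = primitive_continuous[OF f, of UNIV] and fm = in_form_measurable(1)[OF fd] and dm = in_form_measurable(2)[OF fd]
  have hi: "integrable lebesgue (\<lambda>x. \<bar>r x\<bar> * (h x)\<^sup>2)"
    using h integrable_abs_weight[OF r_meas r_pos, of "\<lambda>x. (h x)\<^sup>2"] by simp
  have rh: "set_integrable lebesgue {a..b} (\<lambda>x. r x * h x)" for a b
  proof -
    have "integrable lebesgue (\<lambda>x. r x * (indicator {a..b} x * h x))"
    proof (rule weighted_prod_integrable[OF r_meas _ h(1) _ hi])
      show "integrable lebesgue (\<lambda>x. \<bar>r x\<bar> * (indicator {a..b} x)\<^sup>2)"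
      proof -
        have "(indicator {a..b} x :: real)\<^sup>2 = indicator {a..b} x" for x by (simp add: indicator_def)
        then show ?thesis using set_integrable_abs[OF r_loc[of a b]] by (simp add: set_integrable_def mult.commute)
      qed
      show "indicator {a..b} \<in> borel_measurable lebesgue" by (rule borel_measurable_indicator) auto
    qed
    then show ?thesis by (simp add: set_integrable_def mult.left_commute)
  qed
  have wl: "set_integrable lebesgue {a..b} w" for a b
    unfolding w_def using rh continuous_weight_integrable[OF q_loc q_meas fc] continuous_weight_integrable[OF r_loc r_meas fc]
    by (intro set_integral_diff(1) set_integral_add(1) set_integrable_mult_right) auto
  obtain W where W: "primitive w W" using ex_primitive[OF wl] by blast
  note Wc = primitive_continuous[OF W, of UNIV] and Wm = primitive_measurable[OF W]
  define G where "G x = p x * d x - W x" for x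
  have Gm: "G \<in> borel_measurable lebesgue" unfolding G_def[abs_def] using p_meas dm Wm by measurable
  have Gp: "AE x in lebesgue. G x * (1 / p x) = d x - 1 / p x * W x"
    using p_pos by eventually_elim (simp add: G_def diff_divide_distrib)
  have iWp: "set_integrable lebesgue {a..b} (\<lambda>x. 1 / p x * W x)" for a b
    by (rule continuous_weight_integrable[OF pinv_loc _ Wc]) (use p_meas in measurable)
  have iG: "set_integrable lebesgue {a..b} (\<lambda>x. G x * (1 / p x))" if "a \<le> b" for a b
  proof (subst set_integrable_cong_AE[of _ _ "\<lambda>x. d x - 1 / p x * W x"])
    show "set_integrable lebesgue {a..b} (\<lambda>x. d x - 1 / p x * W x)"
      using iWp primitiveD(1)[OF f that] by (intro set_integral_diff(1))
    show "AE x\<in>{a..b} in lebesgue. G x * (1 / p x) = d x - 1 / p x * W x" using Gp by eventually_elim simp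
    show "(\<lambda>x. G x * (1 / p x)) \<in> borel_measurable lebesgue" using Gm p_meas by measurable
    show "(\<lambda>x. d x - 1 / p x * W x) \<in> borel_measurable lebesgue" using dm Wm p_meas by measurable
  qed simp
  have const: "\<exists>c. AE x in lebesgue. x \<in> {a..b} \<longrightarrow> G x = c" if ab: "a < b" for a b
  proof (rule du_Bois_Reymond[OF ab Gm iG])
    show "a \<le> b" using ab by simp
    fix \<psi> assume \<psi>m: "\<psi> \<in> borel_measurable lebesgue" and \<psi>b: "\<And>x. \<bar>\<psi> x\<bar> \<le> 2 * pi"
      and \<psi>0: "(LINT x:{a..b}|lebesgue. \<psi> x * (1 / p x)) = 0"
    define \<delta> where "\<delta> x = indicator {a..b} x * (\<psi> x * (1 / p x))" for x
    have i\<psi>: "set_integrable lebesgue {a'..b'} (\<lambda>x. \<psi> x * (1 / p x))" for a' b'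
      by (rule bounded_over_p_integrable[OF \<psi>m \<psi>b])
    have \<delta>i: "integrable lebesgue \<delta>" using i\<psi>[of a b] by (simp add: \<delta>_def[abs_def] set_integrable_def)
    have \<delta>m: "\<delta> \<in> borel_measurable lebesgue" using \<delta>i by auto
    have "set_integrable lebesgue {a'..b'} \<delta>" for a' b'
      using set_integrable_subset[of lebesgue UNIV \<delta> "{a'..b'}"] \<delta>i by (simp add: set_integrable_def)
    then obtain \<phi>0 where \<phi>0: "primitive \<delta> \<phi>0" using ex_primitive by blast
    define \<phi> where "\<phi> x = \<phi>0 x - \<phi>0 a" for x
    have \<phi>: "primitive \<delta> \<phi>" using \<phi>0 by (simp add: primitive_def \<phi>_def)
    note \<phi>c = primitive_continuous[OF \<phi>, of UNIV] and \<phi>m = primitive_measurable[OF \<phi>]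
    have \<phi>a: "\<phi> a = 0" by (simp add: \<phi>_def)
    have \<phi>b: "\<phi> b = 0"
    proof -
      have "\<phi> b - \<phi> a = (LINT x:{a..b}|lebesgue. \<delta> x)" using primitiveD(2)[OF \<phi>, of a b] ab by simp
      also have "\<dots> = (LINT x:{a..b}|lebesgue. \<psi> x * (1 / p x))"
        by (rule set_lebesgue_integral_cong) (auto simp: \<delta>_def)
      finally show ?thesis using \<psi>0 \<phi>a by simp
    qed
    have \<phi>out: "\<phi> x = 0" if out: "x \<notin> {a..b}" for x
    proof -
      have sp: "(LINT t:S|lebesgue. \<delta> t) = 0" if "AE t in lebesgue. t \<in> S \<longrightarrow> t \<notin> {a..b}" "S \<in> sets lebesgue" for S
      proof -
        have "(LINT t:S|lebesgue. \<delta> t) = (LINT t:S|lebesgue. 0)"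
        proof (rule set_lebesgue_integral_cong_AE)
          show "AE t\<in>S in lebesgue. \<delta> t = 0" using that(1) by eventually_elim (auto simp: \<delta>_def)
        qed (use that(2) \<delta>m in auto)
        then show ?thesis by simp
      qed
      have ne: "AE t in lebesgue. t \<noteq> c" for c :: real
        by (rule AE_I'[of "{c}"]) (auto simp flip: negligible_iff_null_sets)
      consider "x < a" | "b < x" using out by force
      then show ?thesis
      proof cases
        case 1
        have "\<phi> a - \<phi> x = (LINT t:{x..a}|lebesgue. \<delta> t)" using primitiveD(2)[OF \<phi>, of x a] 1 by simp
        also have "\<dots> = 0" by (rule sp) (use ne[of a] in \<open>auto elim!: eventually_mono\<close>)
        finally show ?thesis using \<phi>a by simp
      next
        case 2
        have "\<phi> x - \<phi> b = (LINT t:{b..x}|lebesgue. \<delta> t)" using primitiveD(2)[OF \<phi>, of b x] 2 by simp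
        also have "\<dots> = 0" by (rule sp) (use ne[of b] in \<open>auto elim!: eventually_mono\<close>)
        finally show ?thesis using \<phi>b by simp
      qed
    qed
    have supp: "integrable lebesgue (\<lambda>x. k x * \<phi> x)" "(LINT x|lebesgue. k x * \<phi> x) = (LINT x:{a..b}|lebesgue. k x * \<phi> x)"
      if "set_integrable lebesgue {a..b} k" "k \<in> borel_measurable lebesgue" for k
    proof -
      have eq: "(\<lambda>x. indicator {a..b} x *\<^sub>R (k x * \<phi> x)) = (\<lambda>x. k x * \<phi> x)"
        using \<phi>out by (auto simp: fun_eq_iff indicator_def)
      show "integrable lebesgue (\<lambda>x. k x * \<phi> x)" "(LINT x|lebesgue. k x * \<phi> x) = (LINT x:{a..b}|lebesgue. k x * \<phi> x)"
        using continuous_weight_integrable[OF that \<phi>c] unfolding set_integrable_def set_lebesgue_integral_def eq by auto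
    qed
    have sq: "integrable lebesgue (\<lambda>x. k x * (\<phi> x)\<^sup>2)" if "set_integrable lebesgue {a..b} k" "k \<in> borel_measurable lebesgue" for k
      using supp(1)[OF continuous_weight_integrable[OF that \<phi>c]] that(2) \<phi>m by (simp add: power2_eq_square mult.assoc)
    have form: "in_form \<phi> \<delta>"
      unfolding in_form_def
    proof (intro conjI \<phi> sq r_loc r_meas set_integrable_abs q_loc)
      have i2: "set_integrable lebesgue {a..b} (\<lambda>x. (\<psi> x)\<^sup>2 * (1 / p x))"
      proof (rule bounded_over_p_integrable)
        show "\<bar>(\<psi> x)\<^sup>2\<bar> \<le> (2 * pi)\<^sup>2" for x using power_mono[OF \<psi>b[of x], of 2] by simp
      qed (use \<psi>m in measurable)
      have ae: "AE x in lebesgue. p x * (\<delta> x)\<^sup>2 = indicator {a..b} x *\<^sub>R ((\<psi> x)\<^sup>2 * (1 / p x))"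
        using p_pos by eventually_elim (auto simp: \<delta>_def indicator_def power2_eq_square)
      show "integrable lebesgue (\<lambda>x. p x * (\<delta> x)\<^sup>2)"
        by (subst integrable_cong_AE[OF _ _ ae]) (use i2 p_meas \<delta>m in \<open>auto simp: set_integrable_def\<close>)
      show "(\<lambda>x. \<bar>q x\<bar>) \<in> borel_measurable lebesgue" using q_meas by measurable
    qed
    \<comment> \<open>integration by parts turns the weak equation into an integral of \<open>G\<close>\<close>
    have wm: "w \<in> borel_measurable lebesgue" unfolding w_def[abs_def] using q_meas r_meas fm h(1) by measurable
    have "(LINT x|lebesgue. w x * \<phi> x) = (LINT x|lebesgue. q x * (f x * \<phi> x) + \<Lambda> * (r x * (f x * \<phi> x)) - r x * (h x * \<phi> x))"
      by (rule arg_cong[of _ _ "integral\<^sup>L lebesgue"]) (simp add: w_def fun_eq_iff algebra_simps)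
    also have "\<dots> = (LINT x|lebesgue. q x * (f x * \<phi> x)) + \<Lambda> * ip f \<phi> - ip h \<phi>"
    proof -
      note 1 = in_form_products[OF fd form]
      have 2: "integrable lebesgue (\<lambda>x. r x * (h x * \<phi> x))"
        by (rule weighted_prod_integrable[OF r_meas h(1) \<phi>m hi in_form_abs(2)[OF form]])
      have 3: "integrable lebesgue (\<lambda>x. \<Lambda> * (r x * (f x * \<phi> x)))" by (rule integrable_mult_right[OF 1(3)])
      show ?thesis
        using Bochner_Integration.integral_diff[OF Bochner_Integration.integrable_add[OF 1(2) 3] 2]
          Bochner_Integration.integral_add[OF 1(2) 3] by simp
    qed
    finally have w\<phi>: "(LINT x|lebesgue. w x * \<phi> x) = - (LINT x|lebesgue. p x * (d x * \<delta> x))"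
      using weak[OF form] by (simp add: bform_def)
    have prod: "primitive (\<lambda>x. W x * \<delta> x + w x * \<phi> x) (\<lambda>x. W x * \<phi> x)" by (rule primitive_mult[OF W \<phi>])
    have "(LINT x:{a..b}|lebesgue. W x * \<delta> x + w x * \<phi> x) = 0"
      using primitiveD(2)[OF prod, of a b] ab \<phi>a \<phi>b by simp
    moreover have iW\<delta>: "set_integrable lebesgue {a..b} (\<lambda>x. \<delta> x * W x)"
      using continuous_weight_integrable[OF primitiveD(1)[OF \<phi>, of a b] \<delta>m Wc] ab by simp
    moreover have "set_integrable lebesgue {a..b} (\<lambda>x. w x * \<phi> x)"
      by (rule continuous_weight_integrable[OF wl wm \<phi>c])
    ultimately have "(LINT x:{a..b}|lebesgue. \<delta> x * W x) + (LINT x:{a..b}|lebesgue. w x * \<phi> x) = 0"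
      by (subst set_integral_add(2)[symmetric]) (auto simp: mult.commute)
    then have eq0: "(LINT x|lebesgue. p x * (d x * \<delta> x)) - (LINT x:{a..b}|lebesgue. \<delta> x * W x) = 0"
      using w\<phi> supp(2)[OF wl wm] by simp
    have "(LINT x:{a..b}|lebesgue. p x * (d x * \<delta> x)) = (LINT x|lebesgue. p x * (d x * \<delta> x))"
      unfolding set_lebesgue_integral_def by (rule Bochner_Integration.integral_cong) (auto simp: \<delta>_def indicator_def)
    moreover have "set_integrable lebesgue {a..b} (\<lambda>x. p x * (d x * \<delta> x))"
      using in_form_products(1)[OF fd form] set_integrable_subset[of lebesgue UNIV "\<lambda>x. p x * (d x * \<delta> x)" "{a..b}"]
      by (simp add: set_integrable_def)
    ultimately have "(LINT x:{a..b}|lebesgue. p x * (d x * \<delta> x) - \<delta> x * W x) = 0"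
      using eq0 iW\<delta> by (subst set_integral_diff(2)) auto
    also have "(LINT x:{a..b}|lebesgue. p x * (d x * \<delta> x) - \<delta> x * W x) = (LINT x:{a..b}|lebesgue. G x * (\<psi> x * (1 / p x)))"
      by (rule set_lebesgue_integral_cong) (auto simp: G_def \<delta>_def algebra_simps)
    finally show "(LINT x:{a..b}|lebesgue. G x * (\<psi> x * (1 / p x))) = 0" .
  qed
  have "\<exists>c. AE x in lebesgue. x \<in> {- real n - 1..real n + 1} \<longrightarrow> G x = c" for n by (rule const) simp
  then obtain c where c: "\<And>n. AE x in lebesgue. x \<in> {- real n - 1..real n + 1} \<longrightarrow> G x = c n" by metis
  \<comment> \<open>The constants for different intervals agree because all these intervals contain \<open>[-1,1]\<close>.\<close>
  have c0: "c n = c 0" for n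
  proof (rule ccontr)
    assume ne: "c n \<noteq> c 0"
    have "AE x in lebesgue. x \<notin> {-1..1::real}"
      using c[of n] c[of 0] by eventually_elim (use ne in auto)
    then have "{-1..1::real} \<in> null_sets lebesgue" by (subst AE_iff_null_sets) auto
    then show False by (simp add: null_sets_def)
  qed
  have "AE x in lebesgue. \<forall>n. x \<in> {- real n - 1..real n + 1} \<longrightarrow> G x = c 0"
    unfolding AE_all_countable
  proof
    fix n
    show "AE x in lebesgue. x \<in> {- real n - 1..real n + 1} \<longrightarrow> G x = c 0"
      using c[of n] unfolding c0[of n] .
  qed
  then have "AE x in lebesgue. W x + c 0 = p x * d x"
  proof eventually_elim
    case (elim x)
    obtain n where "\<bar>x\<bar> < real n" using reals_Archimedean2 by blast
    then show ?case using elim[rule_format, of n] by (auto simp: G_def abs_less_iff)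
  qed
  moreover have "primitive w (\<lambda>x. W x + c 0)" using W by (simp add: primitive_def)
  ultimately show ?thesis unfolding w_def[abs_def] by blast
qed

section \<open>The real maximal operator\<close>

lemma neg_part_ge: "- neg_part q x \<le> q x"
  unfolding neg_part_def by (cases "0 \<le> q x") (simp_all add: field_simps)

text \<open>Integration by parts: the increment of \<open>v f\<close> is \<open>\<integral> p d^2 + \<integral> q f^2 + \<Lambda> \<integral> r f^2\<close>. The
  negative part of \<open>q\<close> costs half the kinetic energy and \<open>C_int\<close> times the weighted integral, and \<open>\<Lambda>\<close>
  was chosen larger than \<open>C_int + 1\<close>.\<close>
lemma kernel_interval:
  assumes f: "primitive d f" and v: "primitive (\<lambda>x. q x * f x + \<Lambda> * (r x * f x)) v" and vd: "AE x in lebesgue. v x = p x * d x"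
    and ab: "1 \<le> b - a"
  shows "set_integrable lebesgue {a..b} (\<lambda>x. p x * (d x)\<^sup>2)"
    "kinetic_on a b d / 2 + mass_on a b f \<le> v b * f b - v a * f a"
    "0 \<le> mass_on a b f"
proof -
  note fc = primitive_continuous[OF f, of UNIV] and vc = primitive_continuous[OF v, of UNIV]
  note fm = primitive_measurable[OF f] and dm = primitive_deriv_measurable[OF f] and vm = primitive_measurable[OF v]
  have sc: "continuous_on UNIV (\<lambda>x. (f x)\<^sup>2)" using fc by (intro continuous_intros)
  have vdd: "AE x in lebesgue. d x * v x = p x * (d x)\<^sup>2" using vd by eventually_elim (simp add: power2_eq_square)
  have idv: "set_integrable lebesgue {a..b} (\<lambda>x. d x * v x)"
    by (rule continuous_weight_integrable[OF primitiveD(1)[OF f] dm vc]) (use ab in simp)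
  show Ei: "set_integrable lebesgue {a..b} (\<lambda>x. p x * (d x)\<^sup>2)"
    using idv by (subst set_integrable_cong_AE[of _ _ "\<lambda>x. d x * v x"]) (use vdd p_meas dm vm in \<open>auto elim!: eventually_mono\<close>)
  define E R B where "E = kinetic_on a b d" and "R = mass_on a b f"
    and "B = (LINT x:{a..b}|lebesgue. neg_part q x * (f x)\<^sup>2)"
  have Rn: "0 \<le> R" unfolding R_def set_lebesgue_integral_def
    by (rule integral_nonneg_AE, use r_pos in eventually_elim) (auto simp: indicator_def)
  then show "0 \<le> mass_on a b f" by (simp add: R_def)
  note N = neg_part_interval[OF ab f Ei]
  have iq: "set_integrable lebesgue {a..b} (\<lambda>x. q x * (f x)\<^sup>2)" by (rule continuous_weight_integrable[OF q_loc q_meas sc])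
  have ir: "set_integrable lebesgue {a..b} (\<lambda>x. r x * (f x)\<^sup>2)" by (rule continuous_weight_integrable[OF r_loc r_meas sc])
  have "- B \<le> (LINT x:{a..b}|lebesgue. q x * (f x)\<^sup>2)"
  proof -
    have "(LINT x:{a..b}|lebesgue. - (neg_part q x * (f x)\<^sup>2)) \<le> (LINT x:{a..b}|lebesgue. q x * (f x)\<^sup>2)"
    proof (rule set_integral_mono)
      show "- (neg_part q x * (f x)\<^sup>2) \<le> q x * (f x)\<^sup>2" for x
      proof -
        have "- neg_part q x * (f x)\<^sup>2 \<le> q x * (f x)\<^sup>2" by (rule mult_right_mono) (use neg_part_ge in auto)
        then show ?thesis by simp
      qed
      show "set_integrable lebesgue {a..b} (\<lambda>x. - (neg_part q x * (f x)\<^sup>2))"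
        using N by (simp add: set_integrable_def)
    qed (rule iq)
    then show ?thesis using N by (simp add: set_integral_uminus B_def)
  qed
  moreover have "B \<le> E / 2 + C_int * R" using N by (simp add: B_def E_def R_def)
  moreover have "v b * f b - v a * f a = E + (LINT x:{a..b}|lebesgue. q x * (f x)\<^sup>2) + \<Lambda> * R"
  proof -
    have prod: "primitive (\<lambda>x. v x * d x + (q x * f x + \<Lambda> * (r x * f x)) * f x) (\<lambda>x. v x * f x)"
      by (rule primitive_mult[OF v f])
    have "v b * f b - v a * f a = (LINT x:{a..b}|lebesgue. v x * d x + (q x * f x + \<Lambda> * (r x * f x)) * f x)"
      using primitiveD(2)[OF prod, of a b] ab by simp
    also have "\<dots> = (LINT x:{a..b}|lebesgue. p x * (d x)\<^sup>2 + (q x * (f x)\<^sup>2 + \<Lambda> * (r x * (f x)\<^sup>2)))"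
    proof (rule set_lebesgue_integral_cong_AE)
      show "AE x\<in>{a..b} in lebesgue. v x * d x + (q x * f x + \<Lambda> * (r x * f x)) * f x = p x * (d x)\<^sup>2 + (q x * (f x)\<^sup>2 + \<Lambda> * (r x * (f x)\<^sup>2))"
        using vdd by eventually_elim (simp add: algebra_simps power2_eq_square)
      show "(\<lambda>x. v x * d x + (q x * f x + \<Lambda> * (r x * f x)) * f x) \<in> borel_measurable lebesgue" 
        using vm dm fm q_meas r_meas by measurable
      show "(\<lambda>x. p x * (d x)\<^sup>2 + (q x * (f x)\<^sup>2 + \<Lambda> * (r x * (f x)\<^sup>2))) \<in> borel_measurable lebesgue"
        using p_meas dm fm q_meas r_meas by measurable
    qed simp
    also have "\<dots> = E + ((LINT x:{a..b}|lebesgue. q x * (f x)\<^sup>2) + \<Lambda> * R)"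
    proof -
      have 1: "set_integrable lebesgue {a..b} (\<lambda>x. \<Lambda> * (r x * (f x)\<^sup>2))" using ir by (intro set_integrable_mult_right)
      show ?thesis unfolding E_def R_def
        by (subst set_integral_add(2)[OF Ei set_integral_add(1)[OF iq 1]], subst set_integral_add(2)[OF iq 1]) simp
    qed
    finally show ?thesis by simp
  qed
  moreover have "0 \<le> C_int * R" using Rn C_int_pos by simp
  ultimately show "E / 2 + R \<le> v b * f b - v a * f a"
    by (simp add: \<Lambda>_def algebra_simps)
qed

text \<open>The sign of \<open>(f^2)' = 2 f f'\<close> is that of \<open>v f\<close>, since \<open>v = p f'\<close> and \<open>p > 0\<close>.\<close>
lemma monotone_square:
  assumes f: "primitive d f" and vd: "AE x in lebesgue. v x = p x * d x" and xy: "x \<le> y"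
    and pos: "\<And>t. t \<in> {x..y} \<Longrightarrow> 0 \<le> v t * f t"
  shows "(f x)\<^sup>2 \<le> (f y)\<^sup>2"
proof -
  have sq: "primitive (\<lambda>x. f x * d x + d x * f x) (\<lambda>x. f x * f x)" by (rule primitive_mult[OF f f])
  have "0 \<le> (LINT t:{x..y}|lebesgue. f t * d t + d t * f t)"
    unfolding set_lebesgue_integral_def
  proof (rule integral_nonneg_AE, use vd p_pos in eventually_elim)
    case (elim t)
    show ?case
    proof (cases "t \<in> {x..y}")
      case True
      have "0 \<le> p t * (d t * f t)" using pos[OF True] elim by (simp add: mult.assoc)
      then have "0 \<le> d t * f t" using elim by (simp add: zero_le_mult_iff)
      then show ?thesis using True by (simp add: mult.commute)
    qed simp
  qed
  then show ?thesis using primitiveD(2)[OF sq xy] by (simp add: power2_eq_square)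
qed

lemma not_bounded_below_L2:
  fixes f :: "real \<Rightarrow> real"
  assumes f: "continuous_on UNIV f" and i: "integrable lebesgue (\<lambda>x. (f x)\<^sup>2)"
    and c: "c > 0" and low: "(\<forall>x\<ge>a. c \<le> (f x)\<^sup>2) \<or> (\<forall>x\<le>a. c \<le> (f x)\<^sup>2)"
  shows False
proof -
  define N where "N = (LINT x|lebesgue. (f x)\<^sup>2)"
  have N: "0 \<le> N" by (simp add: N_def)
  define L where "L = (N + 1) / c"
  have L: "L > 0" using N c by (simp add: L_def)
  have "\<exists>u. \<forall>x\<in>{u..u+L}. c \<le> (f x)\<^sup>2" using low
    by (elim disjE) (rule exI[of _ a], simp, rule exI[of _ "a - L"], simp)
  then obtain u where u: "\<forall>x\<in>{u..u+L}. c \<le> (f x)\<^sup>2" by blast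
  obtain y where y: "y \<in> {u..u+L}" "L * (f y)\<^sup>2 \<le> (LINT x:{u..u+L}|lebesgue. (f x)\<^sup>2)"
    using ex_average[of u "u + L" f] L continuous_on_subset[OF f] by auto
  have "L * c \<le> L * (f y)\<^sup>2" using u y L by (intro mult_left_mono) auto
  also have "\<dots> \<le> N" using y(2) set_integral_mono_set[of UNIV "\<lambda>x. (f x)\<^sup>2" "{u..u+L}"] i
    by (simp add: set_integrable_def set_lebesgue_integral_def N_def)
  finally show False using c by (simp add: L_def)
qed

text \<open>By \<open>kernel_interval\<close> a positive value of \<open>v f\<close> at \<open>y\<close> propagates to all points beyond \<open>y + 1\<close>, where
  \<open>f^2\<close> is then increasing and bounded away from zero, contradicting square integrability. A
  negative value leads to the mirror image at \<open>-\<infinity>\<close>. So \<open>v f\<close> vanishes identically; by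
  \<open>kernel_interval\<close> so do the kinetic energy and the mass on every unit interval, and \<open>sup_interval\<close>
  gives \<open>f = 0\<close>.\<close>
lemma kernel_trivial:
  assumes f: "primitive d f" and v: "primitive (\<lambda>x. q x * f x + \<Lambda> * (r x * f x)) v" and vd: "AE x in lebesgue. v x = p x * d x"
    and i: "finite_mass f"
  shows "f z = 0"
proof -
  note fc = primitive_continuous[OF f, of UNIV]
  have i2: "integrable lebesgue (\<lambda>x. (f x)\<^sup>2)" by (rule L2_of_weighted[OF fc primitive_measurable[OF f] i])
  have incr: "v a * f a \<le> v b * f b" if "1 \<le> b - a" for a b
    using kernel_interval[OF f v vd that] energy_nonneg[of "{a..b}" d] by linarith
  have up: "v y * f y \<le> 0" for y
  proof (rule ccontr)
    assume "\<not> v y * f y \<le> 0"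
    then have pos: "0 < v y * f y" by simp
    have p1: "0 < v t * f t" if "t \<ge> y + 1" for t using incr[of t y] pos that by simp
    then have "f (y + 1) \<noteq> 0" by force
    then show False
    proof (intro not_bounded_below_L2[OF fc i2, of "(f (y + 1))\<^sup>2" "y + 1"])
      show "(\<forall>x\<ge>y+1. (f (y + 1))\<^sup>2 \<le> (f x)\<^sup>2) \<or> (\<forall>x\<le>y+1. (f (y + 1))\<^sup>2 \<le> (f x)\<^sup>2)"
        using monotone_square[OF f vd] p1 by (auto intro: less_imp_le)
    qed auto
  qed
  have dn: "0 \<le> v y * f y" for y
  proof (rule ccontr)
    assume "\<not> 0 \<le> v y * f y"
    then have neg: "v y * f y < 0" by simp
    have p1: "v t * f t < 0" if "t \<le> y - 1" for t using incr[of y t] neg that by simp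
    then have "f (y - 1) \<noteq> 0" by force
    then show False
    proof (intro not_bounded_below_L2[OF fc i2, of "(f (y - 1))\<^sup>2" "y - 1"])
      have "(f (y - 1))\<^sup>2 \<le> (f x)\<^sup>2" if "x \<le> y - 1" for x
      proof -
        have sq: "primitive (\<lambda>x. f x * d x + d x * f x) (\<lambda>x. f x * f x)" by (rule primitive_mult[OF f f])
        have "0 \<le> (LINT t:{x..y - 1}|lebesgue. - (f t * d t + d t * f t))"
          unfolding set_lebesgue_integral_def
        proof (rule integral_nonneg_AE, use vd p_pos in eventually_elim)
          case (elim t)
          show ?case
          proof (cases "t \<in> {x..y - 1}")
            case True
            have "p t * (d t * f t) < 0" using p1[of t] True elim by (simp add: mult.assoc)
            then have "d t * f t < 0" using elim by (simp add: mult_less_0_iff)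
            then show ?thesis using True by (simp add: mult.commute)
          qed simp
        qed
        then show ?thesis using primitiveD[OF sq that] by (simp add: power2_eq_square set_integral_uminus)
      qed
      then show "(\<forall>x\<ge>y-1. (f (y - 1))\<^sup>2 \<le> (f x)\<^sup>2) \<or> (\<forall>x\<le>y-1. (f (y - 1))\<^sup>2 \<le> (f x)\<^sup>2)" by blast
    qed auto
  qed
  have zero: "v y * f y = 0" for y using up[of y] dn[of y] by simp
  have one: "1 \<le> (z + 1) - z" by simp
  note K = kernel_interval[OF f v vd one]
  have 0: "(kinetic_on z (z+1) d) = 0" "(mass_on z (z+1) f) = 0"
    using K(2,3) zero[of z] zero[of "z + 1"] energy_nonneg[of "{z..z+1}" d] by auto
  have "(f z)\<^sup>2 \<le> 0" using sup_interval[OF one f K(1), of z] 0 by simp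
  then show ?thesis by simp
qed

text \<open>The graph of the real maximal operator: \<open>f\<close> has the quasi-derivative \<open>v = p f'\<close> and the image
  \<open>k = (- v' + q f) / r\<close>.\<close>
definition SL_rel :: "(real \<Rightarrow> real) \<Rightarrow> (real \<Rightarrow> real) \<Rightarrow> (real \<Rightarrow> real) \<Rightarrow> bool" where
  "SL_rel f v k \<longleftrightarrow> (\<exists>d. primitive d f \<and> (AE x in lebesgue. v x = p x * d x)) \<and>
     primitive (\<lambda>x. q x * f x - r x * k x) v \<and> k \<in> borel_measurable lebesgue \<and>
     finite_mass f \<and> finite_mass k"

lemma weighted_L2_lincomb:
  fixes f g :: "real \<Rightarrow> real"
  assumes "f \<in> borel_measurable lebesgue" "g \<in> borel_measurable lebesgue"
    "finite_mass f" "finite_mass g"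
  shows "integrable lebesgue (\<lambda>x. r x * (f x + c * g x)\<^sup>2)" "integrable lebesgue (\<lambda>x. r x * (f x * g x))"
proof -
  note e = integrable_abs_weight[OF r_meas r_pos]
  have 1: "integrable lebesgue (\<lambda>x. \<bar>r x\<bar> * (f x)\<^sup>2)" "integrable lebesgue (\<lambda>x. \<bar>r x\<bar> * (g x)\<^sup>2)"
    using e[of "\<lambda>x. (f x)\<^sup>2"] e[of "\<lambda>x. (g x)\<^sup>2"] assms by auto
  show "integrable lebesgue (\<lambda>x. r x * (f x + c * g x)\<^sup>2)"
    using weighted_sq_add_integrable[OF r_meas assms(1,2) 1, of c] e[of "\<lambda>x. (f x + c * g x)\<^sup>2"] assms by simp
  show "integrable lebesgue (\<lambda>x. r x * (f x * g x))"
    by (rule weighted_prod_integrable[OF r_meas assms(1,2) 1])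
qed

lemma solve_real:
  assumes h: "h \<in> borel_measurable lebesgue" "finite_mass h"
  shows "\<exists>f v d. SL_rel f v (\<lambda>x. h x - \<Lambda> * f x) \<and> in_form f d \<and> (AE x in lebesgue. v x = p x * d x) \<and>
    (\<forall>g e. in_form g e \<longrightarrow> bform (f, d) (g, e) = (ip h g))"
proof -
  obtain f d where fd: "in_form f d" and weak: "\<forall>g e. in_form g e \<longrightarrow> bform (f, d) (g, e) = ip h g"
    using weak_solution[OF h] by blast
  then obtain v where v: "primitive (\<lambda>x. q x * f x + \<Lambda> * (r x * f x) - r x * h x) v" "AE x in lebesgue. v x = p x * d x"
    using weak_solution_regular[OF fd h] by blast
  have "(\<lambda>x. q x * f x - r x * (h x - \<Lambda> * f x)) = (\<lambda>x. q x * f x + \<Lambda> * (r x * f x) - r x * h x)"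
    by (simp add: fun_eq_iff algebra_simps)
  with v have "primitive (\<lambda>x. q x * f x - r x * (h x - \<Lambda> * f x)) v" by (simp only:)
  moreover have "integrable lebesgue (\<lambda>x. r x * (h x - \<Lambda> * f x)\<^sup>2)"
    using weighted_L2_lincomb(1)[OF h(1) in_form_measurable(1)[OF fd] h(2), of "- \<Lambda>"] fd by (simp add: in_form_def)
  moreover have "(\<lambda>x. h x - \<Lambda> * f x) \<in> borel_measurable lebesgue" using h(1) in_form_measurable(1)[OF fd] by measurable
  ultimately have "SL_rel f v (\<lambda>x. h x - \<Lambda> * f x)" using fd v by (auto simp: SL_rel_def in_form_def)
  with fd v(2) weak show ?thesis by blast
qed

lemma SL_rel_measurable: "SL_rel f v k \<Longrightarrow> f \<in> borel_measurable lebesgue"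
  using primitive_measurable by (auto simp: SL_rel_def)

text \<open>Solving the equation weakly with the right-hand side \<open>(T + \<Lambda>) f\<close> gives an element of the form domain
  that differs from \<open>f\<close> by an element of the kernel of \<open>T + \<Lambda>\<close>, hence not at all.\<close>
lemma SL_rel_form:
  assumes "SL_rel f v k"
  shows "\<exists>d. in_form f d \<and> (\<forall>g e. in_form g e \<longrightarrow> bform (f, d) (g, e) = (LINT x|lebesgue. r x * ((k x + \<Lambda> * f x) * g x)))"
proof -
  obtain d where d: "primitive d f" "AE x in lebesgue. v x = p x * d x" using assms by (auto simp: SL_rel_def)
  have v: "primitive (\<lambda>x. q x * f x - r x * k x) v" and km: "k \<in> borel_measurable lebesgue"
    and i: "finite_mass f" "finite_mass k"
    using assms by (auto simp: SL_rel_def)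
  define h where "h x = k x + \<Lambda> * f x" for x
  have fm: "f \<in> borel_measurable lebesgue" by (rule SL_rel_measurable[OF assms])
  have h: "h \<in> borel_measurable lebesgue" "finite_mass h"
    unfolding h_def[abs_def] using km fm weighted_L2_lincomb(1)[OF km fm i(2,1)] by auto
  obtain f0 v0 d0 where s: "SL_rel f0 v0 (\<lambda>x. h x - \<Lambda> * f0 x)" "in_form f0 d0" "AE x in lebesgue. v0 x = p x * d0 x"
    "\<forall>g e. in_form g e \<longrightarrow> bform (f0, d0) (g, e) = ip h g"
    using solve_real[OF h] by blast
  have s': "primitive d0 f0" "primitive (\<lambda>x. q x * f0 x - r x * (h x - \<Lambda> * f0 x)) v0" "finite_mass f0"
    using s(1,2) by (auto simp: SL_rel_def in_form_def)
  have "f x + (-1) * f0 x = 0" for x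
  proof (rule kernel_trivial[where f="\<lambda>x. f x + (-1) * f0 x" and v="\<lambda>x. v x + (-1) * v0 x"])
    show "primitive (\<lambda>x. d x + (-1) * d0 x) (\<lambda>x. f x + (-1) * f0 x)" by (rule primitive_lincomb[OF d(1) s'(1)])
    have "primitive (\<lambda>x. (q x * f x - r x * k x) + (-1) * (q x * f0 x - r x * (h x - \<Lambda> * f0 x))) (\<lambda>x. v x + (-1) * v0 x)"
      by (rule primitive_lincomb[OF v s'(2)])
    also have "(\<lambda>x. (q x * f x - r x * k x) + (-1) * (q x * f0 x - r x * (h x - \<Lambda> * f0 x))) =
        (\<lambda>x. q x * (f x + (-1) * f0 x) + \<Lambda> * (r x * (f x + (-1) * f0 x)))"
      by (simp add: fun_eq_iff h_def algebra_simps)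
    finally show "primitive (\<lambda>x. q x * (f x + (-1) * f0 x) + \<Lambda> * (r x * (f x + (-1) * f0 x))) (\<lambda>x. v x + (-1) * v0 x)" .
    show "AE x in lebesgue. v x + (-1) * v0 x = p x * (d x + (-1) * d0 x)"
      using d(2) s(3) by eventually_elim (simp add: algebra_simps)
    show "integrable lebesgue (\<lambda>x. r x * (f x + (-1) * f0 x)\<^sup>2)"
      by (rule weighted_L2_lincomb(1)[OF fm in_form_measurable(1)[OF s(2)] i(1) s'(3)])
  qed
  then have "f = f0" by (simp add: fun_eq_iff)
  then show ?thesis using s(2,4) by (auto simp: h_def)
qed

lemma SL_symmetric:
  assumes "SL_rel f v k" "SL_rel f' v' k'"
  shows "ip k f' = ip f k'"
proof -
  obtain d where d: "in_form f d" "\<And>g e. in_form g e \<Longrightarrow> bform (f, d) (g, e) = (LINT x|lebesgue. r x * ((k x + \<Lambda> * f x) * g x))"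
    using SL_rel_form[OF assms(1)] by blast
  obtain d' where d': "in_form f' d'" "\<And>g e. in_form g e \<Longrightarrow> bform (f', d') (g, e) = (LINT x|lebesgue. r x * ((k' x + \<Lambda> * f' x) * g x))"
    using SL_rel_form[OF assms(2)] by blast
  note m = SL_rel_measurable[OF assms(1)] SL_rel_measurable[OF assms(2)]
  have km: "k \<in> borel_measurable lebesgue" "k' \<in> borel_measurable lebesgue"
    and i: "finite_mass f" "finite_mass k"
       "finite_mass f'" "finite_mass k'"
    using assms by (auto simp: SL_rel_def)
  have ff: "integrable lebesgue (\<lambda>x. r x * (f x * f' x))" by (rule weighted_L2_lincomb(2)) (use m i in auto)
  have kf: "integrable lebesgue (\<lambda>x. r x * (k x * f' x))" by (rule weighted_L2_lincomb(2)) (use m i km in auto)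
  have fk: "integrable lebesgue (\<lambda>x. r x * (f x * k' x))" by (rule weighted_L2_lincomb(2)) (use m i km in auto)
  have "bform (f, d) (f', d') = (LINT x|lebesgue. r x * (k x * f' x) + \<Lambda> * (r x * (f x * f' x)))"
    unfolding d(2)[OF d'(1)] by (rule arg_cong[of _ _ "integral\<^sup>L lebesgue"]) (simp add: fun_eq_iff algebra_simps)
  also have "\<dots> = ip k f' + \<Lambda> * ip f f'"
    by (subst Bochner_Integration.integral_add[OF kf integrable_mult_right[OF ff]]) simp
  finally have 1: "bform (f, d) (f', d') = ip k f' + \<Lambda> * ip f f'" .
  have "bform (f', d') (f, d) = (LINT x|lebesgue. r x * (f x * k' x) + \<Lambda> * (r x * (f x * f' x)))"
    unfolding d'(2)[OF d(1)] by (rule arg_cong[of _ _ "integral\<^sup>L lebesgue"]) (simp add: fun_eq_iff algebra_simps)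
  also have "\<dots> = ip f k' + \<Lambda> * ip f f'"
    by (subst Bochner_Integration.integral_add[OF fk integrable_mult_right[OF ff]]) simp
  finally show ?thesis using 1 bform_sym[of "(f, d)" "(f', d')"] by simp
qed

lemma SL_lower_bound:
  assumes "SL_rel f v k" and g: "in_Lp \<infinity> g" "AE x in lebesgue. 0 \<le> g x"
    and small: "emeasure lebesgue (Omega r g) * ennreal (SL_beta p q \<eta> s) < 1"
  shows "- (SL_alpha p q \<eta> s * Lp_norm \<infinity> g / (1 - measure lebesgue (Omega r g) * SL_beta p q \<eta> s)) * mass f
     \<le> ip k f"
proof -
  obtain d where d: "in_form f d" "\<And>g e. in_form g e \<Longrightarrow> bform (f, d) (g, e) = (LINT x|lebesgue. r x * ((k x + \<Lambda> * f x) * g x))"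
    using SL_rel_form[OF assms(1)] by blast
  note m = SL_rel_measurable[OF assms(1)]
  have km: "k \<in> borel_measurable lebesgue" and i: "finite_mass f" "finite_mass k"
    using assms by (auto simp: SL_rel_def)
  have kf: "integrable lebesgue (\<lambda>x. r x * (k x * f x))" by (rule weighted_L2_lincomb(2)) (use m i km in auto)
  have "bform (f, d) (f, d) = (LINT x|lebesgue. r x * (k x * f x) + \<Lambda> * (r x * (f x)\<^sup>2))"
    unfolding d(2)[OF d(1)] by (rule arg_cong[of _ _ "integral\<^sup>L lebesgue"]) (simp add: fun_eq_iff algebra_simps power2_eq_square)
  also have "\<dots> = ip k f + \<Lambda> * mass f"
    by (subst Bochner_Integration.integral_add[OF kf integrable_mult_right[OF i(1)]]) simp
  finally have 1: "ip k f = kinetic d + (LINT x|lebesgue. q x * (f x)\<^sup>2)"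
    by (simp add: bform_def power2_eq_square)
  have "(LINT x|lebesgue. - (neg_part q x * (f x)\<^sup>2)) \<le> (LINT x|lebesgue. q x * (f x)\<^sup>2)"
  proof (rule integral_mono)
    show "- (neg_part q x * (f x)\<^sup>2) \<le> q x * (f x)\<^sup>2" for x
    proof -
      have "- neg_part q x * (f x)\<^sup>2 \<le> q x * (f x)\<^sup>2" by (rule mult_right_mono) (use neg_part_ge in auto)
      then show ?thesis by simp
    qed
    show "integrable lebesgue (\<lambda>x. - (neg_part q x * (f x)\<^sup>2))" using in_form_neg_part(1)[OF d(1)] by simp
    show "integrable lebesgue (\<lambda>x. q x * (f x)\<^sup>2)" using in_form_products(2)[OF d(1) d(1)] by (simp add: power2_eq_square)
  qed
  moreover have "(LINT x|lebesgue. neg_part q x * (f x)\<^sup>2) - kinetic d \<le>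
    SL_alpha p q \<eta> s * Lp_norm \<infinity> g / (1 - measure lebesgue (Omega r g) * SL_beta p q \<eta> s) * mass f"
    by (rule form_lower_bound[OF _ _ _ g small]) (use d(1) in \<open>auto simp: in_form_def\<close>)
  ultimately show ?thesis using 1 by simp
qed

end

section \<open>The complex maximal operator\<close>

lemma continuous_AE_zero:
  fixes f :: "real \<Rightarrow> 'a :: real_normed_vector"
  assumes f: "continuous_on UNIV f" and z: "AE x in lebesgue. f x = 0"
  shows "f x = 0"
proof (rule ccontr)
  assume "f x \<noteq> 0"
  have "open {x. f x \<noteq> 0}"
    by (rule open_Collect_neq[OF f continuous_on_const])
  moreover have "negligible {x. f x \<noteq> 0}"
    unfolding negligible_iff_null_sets
  proof (subst AE_iff_null_sets)
    have "f \<in> borel_measurable lebesgue" using f by (intro measurable_completion) (simp add: borel_measurable_continuous_onI)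
    show "{x. f x \<noteq> 0} \<in> sets lebesgue"
      using \<open>open {x. f x \<noteq> 0}\<close> by auto
  qed (use z in \<open>auto elim!: eventually_mono\<close>)
  ultimately have "{x. f x \<noteq> 0} = {}" using open_not_negligible by blast
  then show False using \<open>f x \<noteq> 0\<close> by blast
qed

lemma AC_Re_Im_primitive:
  assumes "in_AC_loc f"
  shows "primitive (\<lambda>x. Re (vector_derivative f (at x))) (\<lambda>x. Re (f x))"
    "primitive (\<lambda>x. Im (vector_derivative f (at x))) (\<lambda>x. Im (f x))"
proof -
  have 1: "cmod (complex_of_real (Re z) - complex_of_real (Re w)) \<le> 1 * (cmod (z - w) + cmod (z - w))"
    "cmod (complex_of_real (Im z) - complex_of_real (Im w)) \<le> 1 * (cmod (z - w) + cmod (z - w))" for z w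
    using abs_Re_le_cmod[of "z - w"] abs_Im_le_cmod[of "z - w"] by (auto simp flip: of_real_diff)
  have 2: "in_AC_loc (\<lambda>x. complex_of_real (Re (f x)))" "in_AC_loc (\<lambda>x. complex_of_real (Im (f x)))"
    by (rule AC_loc_dominated[OF assms assms], rule exI[of _ 1], use 1 in auto)+
  then obtain d e where de: "primitive d (\<lambda>x. Re (f x))" "primitive e (\<lambda>x. Im (f x))"
    using AC_imp_primitive_real[OF 2(1)] AC_imp_primitive_real[OF 2(2)] by blast
  have P: "primitive (\<lambda>x. Complex (d x) (e x)) f" using primitive_Complex[OF de] by simp
  have ae: "AE x in lebesgue. vector_derivative f (at x) = Complex (d x) (e x)"
    using primitive_deriv_AE[OF P] by (auto elim!: eventually_mono simp: vector_derivative_at)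
  show "primitive (\<lambda>x. Re (vector_derivative f (at x))) (\<lambda>x. Re (f x))"
    by (rule primitive_cong_AE[OF de(1)]) (use ae in \<open>auto elim!: eventually_mono\<close>)
  show "primitive (\<lambda>x. Im (vector_derivative f (at x))) (\<lambda>x. Im (f x))"
    by (rule primitive_cong_AE[OF de(2)]) (use ae in \<open>auto elim!: eventually_mono\<close>)
qed

lemma AC_continuous:
  assumes "in_AC_loc f"
  shows "continuous_on S f"
proof -
  have "continuous_on S (\<lambda>x. Complex (Re (f x)) (Im (f x)))"
    unfolding Complex_eq
    by (intro continuous_intros primitive_continuous[OF AC_Re_Im_primitive(1)[OF assms]] primitive_continuous[OF AC_Re_Im_primitive(2)[OF assms]])
  then show ?thesis by simp
qed

text \<open>Two representatives agree almost everywhere and are continuous, so they are equal.\<close>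
lemma quasi_deriv_eq:
  assumes "has_quasi_deriv p f v"
  shows "quasi_deriv p f = v"
  unfolding quasi_deriv_def
proof (rule the_equality)
  show "has_quasi_deriv p f v" by (rule assms)
  fix w assume "has_quasi_deriv p f w"
  then have "AE x in lebesgue. w x - v x = 0" "continuous_on UNIV (\<lambda>x. w x - v x)"
    using assms AC_continuous[of w UNIV] AC_continuous[of v UNIV]
    by (auto simp: has_quasi_deriv_def intro!: continuous_intros)
  then have "w x - v x = 0" for x using continuous_AE_zero by blast
  then show "w = v" by (auto simp: fun_eq_iff)
qed

context SL
begin

abbreviation "T \<equiv> SL_op p q r"
abbreviation "D \<equiv> SL_dom p q r"
abbreviation "L2 \<equiv> L2_weighted r"
abbreviation "N \<equiv> L2_weighted_norm r"

lemma L2_iff: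
  "F \<in> L2 \<longleftrightarrow> (\<lambda>x. Re (F x)) \<in> borel_measurable lebesgue \<and> (\<lambda>x. Im (F x)) \<in> borel_measurable lebesgue \<and>
     integrable lebesgue (\<lambda>x. r x * (Re (F x))\<^sup>2) \<and> integrable lebesgue (\<lambda>x. r x * (Im (F x))\<^sup>2)"
proof -
  have eq: "(cmod (F x))\<^sup>2 * r x = r x * (Re (F x))\<^sup>2 + r x * (Im (F x))\<^sup>2" for x
    by (simp add: cmod_power2 algebra_simps)
  show ?thesis
  proof
    assume F: "F \<in> L2"
    then have m: "F \<in> borel_measurable lebesgue" and i: "integrable lebesgue (\<lambda>x. r x * (Re (F x))\<^sup>2 + r x * (Im (F x))\<^sup>2)"
      by (auto simp: L2_weighted_def eq)
    have mm: "(\<lambda>x. Re (F x)) \<in> borel_measurable lebesgue" "(\<lambda>x. Im (F x)) \<in> borel_measurable lebesgue"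
      using m by measurable
    have "integrable lebesgue (\<lambda>x. r x * (Re (F x))\<^sup>2)"
      by (rule Bochner_Integration.integrable_bound[OF i])
        (use r_meas mm in measurable, use r_pos in eventually_elim, simp)
    moreover have "integrable lebesgue (\<lambda>x. r x * (Im (F x))\<^sup>2)"
      by (rule Bochner_Integration.integrable_bound[OF i])
        (use r_meas mm in measurable, use r_pos in eventually_elim, simp)
    ultimately show "(\<lambda>x. Re (F x)) \<in> borel_measurable lebesgue \<and> (\<lambda>x. Im (F x)) \<in> borel_measurable lebesgue \<and>
     integrable lebesgue (\<lambda>x. r x * (Re (F x))\<^sup>2) \<and> integrable lebesgue (\<lambda>x. r x * (Im (F x))\<^sup>2)" using mm by blast
  next
    assume A: "(\<lambda>x. Re (F x)) \<in> borel_measurable lebesgue \<and> (\<lambda>x. Im (F x)) \<in> borel_measurable lebesgue \<and>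
     integrable lebesgue (\<lambda>x. r x * (Re (F x))\<^sup>2) \<and> integrable lebesgue (\<lambda>x. r x * (Im (F x))\<^sup>2)"
    then have "F \<in> borel_measurable lebesgue" by (subst borel_measurable_complex_iff) auto
    then show "F \<in> L2" using A by (auto simp: L2_weighted_def eq)
  qed
qed

lemma norm_L2_eq:
  assumes "F \<in> L2"
  shows "(N F)\<^sup>2 = (LINT x|lebesgue. r x * (Re (F x))\<^sup>2) + (LINT x|lebesgue. r x * (Im (F x))\<^sup>2)"
proof -
  have eq: "(cmod (F x))\<^sup>2 * r x = r x * (Re (F x))\<^sup>2 + r x * (Im (F x))\<^sup>2" for x
    by (simp add: cmod_power2 algebra_simps)
  have "0 \<le> (LINT x|lebesgue. (cmod (F x))\<^sup>2 * r x)"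
    by (rule integral_nonneg_AE, use r_pos in eventually_elim) simp
  then have "(N F)\<^sup>2 = (LINT x|lebesgue. (cmod (F x))\<^sup>2 * r x)" by (simp add: L2_weighted_norm_def)
  also have "\<dots> = (LINT x|lebesgue. r x * (Re (F x))\<^sup>2) + (LINT x|lebesgue. r x * (Im (F x))\<^sup>2)"
    unfolding eq by (rule Bochner_Integration.integral_add) (use assms L2_iff in auto)
  finally show ?thesis .
qed

lemma norm_nonneg: "0 \<le> N F"
  unfolding L2_weighted_norm_def by (rule real_sqrt_ge_zero, rule integral_nonneg_AE, use r_pos in eventually_elim) simp

lemma norm_cong_AE:
  assumes "F \<in> borel_measurable lebesgue" "G \<in> borel_measurable lebesgue" "AE x in lebesgue. F x = G x"
  shows "N F = N G"
  unfolding L2_weighted_norm_def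
proof (rule arg_cong[of _ _ sqrt], rule integral_cong_AE)
  show "AE x in lebesgue. (cmod (F x))\<^sup>2 * r x = (cmod (G x))\<^sup>2 * r x" using assms(3) by eventually_elim simp
qed (use assms r_meas in measurable)

text \<open>Real and imaginary part of the differential expression separate because the coefficients are real.\<close>
lemma SL_dom_rel:
  assumes "F \<in> D"
  shows "SL_rel (\<lambda>x. Re (F x)) (\<lambda>x. Re (quasi_deriv p F x)) (\<lambda>x. Re (T F x))"
    "SL_rel (\<lambda>x. Im (F x)) (\<lambda>x. Im (quasi_deriv p F x)) (\<lambda>x. Im (T F x))"
proof -
  obtain v where v: "has_quasi_deriv p F v" and F: "F \<in> L2" "in_AC_loc F" "T F \<in> L2"
    using assms by (auto simp: SL_dom_def)
  have qd: "quasi_deriv p F = v" by (rule quasi_deriv_eq[OF v])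
  have vAC: "in_AC_loc v" and vae: "AE x in lebesgue. v x = of_real (p x) * vector_derivative F (at x)"
    using v by (auto simp: has_quasi_deriv_def)
  note Fp = AC_Re_Im_primitive[OF F(2)] and vp = AC_Re_Im_primitive[OF vAC]
  have op: "T F x = of_real (1 / r x) * (- vector_derivative v (at x) + of_real (q x) * F x)" for x
    by (simp add: SL_op_def qd)
  have ae: "AE x in lebesgue. vector_derivative v (at x) = of_real (q x) * F x - of_real (r x) * T F x"
    using r_pos by eventually_elim (simp add: op)
  show "SL_rel (\<lambda>x. Re (F x)) (\<lambda>x. Re (quasi_deriv p F x)) (\<lambda>x. Re (T F x))"
    unfolding SL_rel_def qd
  proof (intro conjI exI)
    show "primitive (\<lambda>x. Re (vector_derivative F (at x))) (\<lambda>x. Re (F x))" by (rule Fp)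
    show "AE x in lebesgue. Re (v x) = p x * Re (vector_derivative F (at x))" using vae by eventually_elim simp
    show "primitive (\<lambda>x. q x * Re (F x) - r x * Re (T F x)) (\<lambda>x. Re (v x))"
      by (rule primitive_cong_AE[OF vp(1)], use ae in eventually_elim) simp
  qed (use F L2_iff in auto)
  show "SL_rel (\<lambda>x. Im (F x)) (\<lambda>x. Im (quasi_deriv p F x)) (\<lambda>x. Im (T F x))"
    unfolding SL_rel_def qd
  proof (intro conjI exI)
    show "primitive (\<lambda>x. Im (vector_derivative F (at x))) (\<lambda>x. Im (F x))" by (rule Fp)
    show "AE x in lebesgue. Im (v x) = p x * Im (vector_derivative F (at x))" using vae by eventually_elim simp
    show "primitive (\<lambda>x. q x * Im (F x) - r x * Im (T F x)) (\<lambda>x. Im (v x))"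
      by (rule primitive_cong_AE[OF vp(2)], use ae in eventually_elim) simp
  qed (use F L2_iff in auto)
qed

lemma SL_rel_dom:
  assumes 1: "SL_rel f1 v1 k1" and 2: "SL_rel f2 v2 k2"
  defines "F \<equiv> \<lambda>x. Complex (f1 x) (f2 x)"
  shows "F \<in> D" "AE x in lebesgue. T F x = Complex (k1 x) (k2 x)"
proof -
  obtain d1 d2 where d: "primitive d1 f1" "AE x in lebesgue. v1 x = p x * d1 x" "primitive d2 f2" "AE x in lebesgue. v2 x = p x * d2 x"
    using 1 2 by (auto simp: SL_rel_def)
  have v: "primitive (\<lambda>x. q x * f1 x - r x * k1 x) v1" "primitive (\<lambda>x. q x * f2 x - r x * k2 x) v2"
    using 1 2 by (auto simp: SL_rel_def)
  define V where "V x = Complex (v1 x) (v2 x)" for x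
  note Fp = primitive_Complex[OF d(1,3), folded F_def] and Vp = primitive_Complex[OF v, folded V_def]
  have Fd: "AE x in lebesgue. vector_derivative F (at x) = Complex (d1 x) (d2 x)"
    using primitive_deriv_AE[OF Fp] by (auto elim!: eventually_mono simp: vector_derivative_at)
  have Vd: "AE x in lebesgue. vector_derivative V (at x) = Complex (q x * f1 x - r x * k1 x) (q x * f2 x - r x * k2 x)"
    using primitive_deriv_AE[OF Vp] by (auto elim!: eventually_mono simp: vector_derivative_at)
  have hq: "has_quasi_deriv p F V"
    unfolding has_quasi_deriv_def
  proof
    show "in_AC_loc V" by (rule primitive_imp_AC[OF Vp])
    show "AE x in lebesgue. V x = of_real (p x) * vector_derivative F (at x)"
      using Fd d(2,4) by eventually_elim (simp add: V_def complex_eq_iff)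
  qed
  have qd: "quasi_deriv p F = V" by (rule quasi_deriv_eq[OF hq])
  show ae: "AE x in lebesgue. T F x = Complex (k1 x) (k2 x)"
  proof -
    have FR: "Re (F x) = f1 x" "Im (F x) = f2 x" for x by (simp_all add: F_def)
    show ?thesis using Vd r_pos by eventually_elim (simp add: SL_op_def qd complex_eq_iff FR)
  qed
  have km: "(\<lambda>x. Complex (k1 x) (k2 x)) \<in> L2" using 1 2 by (auto simp: L2_iff SL_rel_def)
  have Km: "(\<lambda>x. Complex (k1 x) (k2 x)) \<in> borel_measurable lebesgue"
    and Ki: "integrable lebesgue (\<lambda>x. (cmod (Complex (k1 x) (k2 x)))\<^sup>2 * r x)"
    using km by (auto simp: L2_weighted_def)
  have Tm: "T F \<in> borel_measurable lebesgue"
    by (rule borel_measurable_lebesgue_AE[OF Km], use ae in eventually_elim) (rule sym)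
  moreover have "integrable lebesgue (\<lambda>x. (cmod (T F x))\<^sup>2 * r x)"
  proof (rule integrable_cong_AE_imp[OF Ki])
    show "(\<lambda>x. (cmod (T F x))\<^sup>2 * r x) \<in> borel_measurable lebesgue" using Tm r_meas by measurable
    show "AE x in lebesgue. (cmod (Complex (k1 x) (k2 x)))\<^sup>2 * r x = (cmod (T F x))\<^sup>2 * r x"
      using ae by eventually_elim (simp only:)
  qed
  ultimately have TL: "T F \<in> L2" unfolding L2_weighted_def by blast
  have "finite_mass f1" "finite_mass f2"
    using 1 2 unfolding SL_rel_def by blast+
  then have "F \<in> L2" unfolding L2_iff F_def using SL_rel_measurable[OF 1] SL_rel_measurable[OF 2] by simp
  then show "F \<in> D" unfolding SL_dom_def using hq primitive_imp_AC[OF Fp] TL by blast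
qed

lemma SL_rel_lincomb:
  assumes 1: "SL_rel f1 v1 k1" and 2: "SL_rel f2 v2 k2"
  shows "SL_rel (\<lambda>x. f1 x + c * f2 x) (\<lambda>x. v1 x + c * v2 x) (\<lambda>x. k1 x + c * k2 x)"
proof -
  obtain d1 d2 where d: "primitive d1 f1" "AE x in lebesgue. v1 x = p x * d1 x" "primitive d2 f2" "AE x in lebesgue. v2 x = p x * d2 x"
    using 1 2 by (auto simp: SL_rel_def)
  have v: "primitive (\<lambda>x. q x * f1 x - r x * k1 x) v1" "primitive (\<lambda>x. q x * f2 x - r x * k2 x) v2"
    and k: "k1 \<in> borel_measurable lebesgue" "k2 \<in> borel_measurable lebesgue"
    and i: "finite_mass f1" "finite_mass k1"
      "finite_mass f2" "finite_mass k2"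
    using 1 2 by (auto simp: SL_rel_def)
  note fm = SL_rel_measurable[OF 1] SL_rel_measurable[OF 2]
  have "primitive (\<lambda>x. d1 x + c * d2 x) (\<lambda>x. f1 x + c * f2 x)" by (rule primitive_lincomb[OF d(1,3)])
  moreover have "AE x in lebesgue. v1 x + c * v2 x = p x * (d1 x + c * d2 x)" using d(2,4) by eventually_elim (simp add: algebra_simps)
  moreover have "primitive (\<lambda>x. q x * (f1 x + c * f2 x) - r x * (k1 x + c * k2 x)) (\<lambda>x. v1 x + c * v2 x)"
  proof -
    have "(\<lambda>x. q x * (f1 x + c * f2 x) - r x * (k1 x + c * k2 x)) = (\<lambda>x. (q x * f1 x - r x * k1 x) + c * (q x * f2 x - r x * k2 x))"
      by (simp add: fun_eq_iff algebra_simps)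
    then show ?thesis using primitive_lincomb[OF v, of c] by (simp only:)
  qed
  moreover have "(\<lambda>x. k1 x + c * k2 x) \<in> borel_measurable lebesgue" using k by measurable
  moreover note weighted_L2_lincomb(1)[OF fm i(1,3)] weighted_L2_lincomb(1)[OF k i(2,4)]
  ultimately show ?thesis unfolding SL_rel_def by blast
qed

lemma L2_lincomb:
  assumes "F \<in> L2" "G \<in> L2"
  shows "(\<lambda>x. F x + z * G x) \<in> L2"
proof -
  have R: "(\<lambda>x. Re (F x + z * G x)) = (\<lambda>x. (Re (F x) + Re z * Re (G x)) + (- Im z) * Im (G x))"
    and I: "(\<lambda>x. Im (F x + z * G x)) = (\<lambda>x. (Im (F x) + Re z * Im (G x)) + Im z * Re (G x))"
    by (auto simp: fun_eq_iff)
  have m: "(\<lambda>x. Re (F x) + Re z * Re (G x)) \<in> borel_measurable lebesgue" "(\<lambda>x. Im (F x) + Re z * Im (G x)) \<in> borel_measurable lebesgue"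
    using assms[unfolded L2_iff] by auto
  have i: "integrable lebesgue (\<lambda>x. r x * (Re (F x) + Re z * Re (G x))\<^sup>2)" "integrable lebesgue (\<lambda>x. r x * (Im (F x) + Re z * Im (G x))\<^sup>2)"
    by (rule weighted_L2_lincomb(1); use assms[unfolded L2_iff] in auto)+
  have "integrable lebesgue (\<lambda>x. r x * (Re (F x + z * G x))\<^sup>2)"
    using weighted_L2_lincomb(1)[OF m(1) _ i(1), of "\<lambda>x. Im (G x)" "- Im z"] assms[unfolded L2_iff] by (simp add: algebra_simps)
  moreover have "integrable lebesgue (\<lambda>x. r x * (Im (F x + z * G x))\<^sup>2)"
    using weighted_L2_lincomb(1)[OF m(2) _ i(2), of "\<lambda>x. Re (G x)" "Im z"] assms[unfolded L2_iff] by (simp add: algebra_simps)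
  moreover have "(\<lambda>x. Re (F x + z * G x)) \<in> borel_measurable lebesgue \<and> (\<lambda>x. Im (F x + z * G x)) \<in> borel_measurable lebesgue"
    unfolding R I using m assms[unfolded L2_iff] by auto
  ultimately show ?thesis unfolding L2_iff by blast
qed

lemma SL_dom_diff:
  assumes "F \<in> D" "G \<in> D"
  shows "(\<lambda>x. F x - G x) \<in> D" "AE x in lebesgue. T (\<lambda>x. F x - G x) x = T F x - T G x"
proof -
  note F = SL_dom_rel[OF assms(1)] and G = SL_dom_rel[OF assms(2)]
  note R = SL_rel_lincomb[OF F(1) G(1), of "-1"] and I = SL_rel_lincomb[OF F(2) G(2), of "-1"]
  have eq: "(\<lambda>x. Complex (Re (F x) + -1 * Re (G x)) (Im (F x) + -1 * Im (G x))) = (\<lambda>x. F x - G x)"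
    by (auto simp: fun_eq_iff complex_eq_iff)
  show "(\<lambda>x. F x - G x) \<in> D" using SL_rel_dom(1)[OF R I] unfolding eq .
  show "AE x in lebesgue. T (\<lambda>x. F x - G x) x = T F x - T G x"
    using SL_rel_dom(2)[OF R I] unfolding eq by eventually_elim (simp add: complex_eq_iff)
qed

lemma SL_dom_L2: "F \<in> D \<Longrightarrow> F \<in> L2" "F \<in> D \<Longrightarrow> T F \<in> L2"
  by (auto simp: SL_dom_def)

end

section \<open>The resolvent set\<close>

text \<open>Banach's fixed point theorem for a pseudo-metric, as is needed for functions that are identified only
  up to null sets.\<close>
lemma contraction_fixed_point:
  fixes X :: "'a set" and d :: "'a \<Rightarrow> 'a \<Rightarrow> real" and \<Phi> :: "'a \<Rightarrow> 'a"
  assumes X: "X \<noteq> {}" "\<And>x. x \<in> X \<Longrightarrow> \<Phi> x \<in> X"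
    and d: "\<And>x y. 0 \<le> d x y" "\<And>x. x \<in> X \<Longrightarrow> d x x = 0" "\<And>x y. x \<in> X \<Longrightarrow> y \<in> X \<Longrightarrow> d x y = d y x"
      "\<And>x y z. x \<in> X \<Longrightarrow> y \<in> X \<Longrightarrow> z \<in> X \<Longrightarrow> d x z \<le> d x y + d y z"
    and complete: "\<And>u. (\<And>n::nat. u n \<in> X) \<Longrightarrow> (\<And>e. e > 0 \<Longrightarrow> \<exists>N. \<forall>m\<ge>N. \<forall>n\<ge>N. d (u m) (u n) < e) \<Longrightarrow>
      \<exists>x\<in>X. (\<lambda>n. d (u n) x) \<longlonglongrightarrow> 0"
    and \<theta>: "0 \<le> \<theta>" "\<theta> < 1" "\<And>x y. x \<in> X \<Longrightarrow> y \<in> X \<Longrightarrow> d (\<Phi> x) (\<Phi> y) \<le> \<theta> * d x y"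
  shows "\<exists>x\<in>X. d (\<Phi> x) x = 0"
proof -
  obtain x0 where x0: "x0 \<in> X" using X by blast
  define u where "u n = (\<Phi> ^^ n) x0" for n
  have u: "u n \<in> X" for n by (induction n) (auto simp: u_def x0 X)
  have uS: "u (Suc n) = \<Phi> (u n)" for n by (simp add: u_def)
  define K where "K = d (u 0) (u 1)"
  have step: "d (u n) (u (Suc n)) \<le> \<theta> ^ n * K" for n
  proof (induction n)
    case (Suc n)
    have "d (u (Suc n)) (u (Suc (Suc n))) \<le> \<theta> * d (u n) (u (Suc n))" unfolding uS[of n] uS[of "Suc n"] by (rule \<theta>(3)[OF u X(2)[OF u]])
    also have "\<dots> \<le> \<theta> * (\<theta> ^ n * K)" using Suc \<theta>(1) by (rule mult_left_mono)
    finally show ?case by simp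
  qed (simp add: K_def)
  have far: "d (u n) (u (n + k)) \<le> \<theta> ^ n * (K / (1 - \<theta>)) * (1 - \<theta> ^ k)" for n k
  proof (induction k)
    case 0 then show ?case using d(2) u by simp
  next
    case (Suc k)
    have "d (u n) (u (n + Suc k)) \<le> d (u n) (u (n + k)) + d (u (n + k)) (u (n + Suc k))" by (rule d(4)[OF u u u])
    also have "\<dots> \<le> \<theta> ^ n * (K / (1 - \<theta>)) * (1 - \<theta> ^ k) + \<theta> ^ (n + k) * K"
      using Suc step[of "n + k"] by simp
    also have "\<theta> ^ (n + k) * K = \<theta> ^ n * (K / (1 - \<theta>)) * (\<theta> ^ k - \<theta> ^ Suc k)"
      using \<theta>(2) by (simp add: power_add field_simps)
    also have "\<theta> ^ n * (K / (1 - \<theta>)) * (1 - \<theta> ^ k) + \<theta> ^ n * (K / (1 - \<theta>)) * (\<theta> ^ k - \<theta> ^ Suc k) = \<theta> ^ n * (K / (1 - \<theta>)) * (1 - \<theta> ^ Suc k)"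
      by (simp only: distrib_left[symmetric]) simp
    finally show ?case .
  qed
  have K: "0 \<le> K / (1 - \<theta>)" using d(1) \<theta>(2) by (simp add: K_def)
  have far': "d (u n) (u m) \<le> \<theta> ^ n * (K / (1 - \<theta>))" if "n \<le> m" for n m
  proof -
    have "d (u n) (u m) \<le> \<theta> ^ n * (K / (1 - \<theta>)) * (1 - \<theta> ^ (m - n))" using far[of n "m - n"] that by simp
    also have "\<dots> \<le> \<theta> ^ n * (K / (1 - \<theta>)) * 1" using \<theta>(1) K by (intro mult_left_mono mult_nonneg_nonneg) auto
    finally show ?thesis by simp
  qed
  have "(\<lambda>n. \<theta> ^ n * (K / (1 - \<theta>))) \<longlonglongrightarrow> 0 * (K / (1 - \<theta>))"
    using \<theta> by (intro tendsto_mult tendsto_const LIMSEQ_power_zero) auto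
  then have lim0: "(\<lambda>n. \<theta> ^ n * (K / (1 - \<theta>))) \<longlonglongrightarrow> 0" by simp
  obtain x where x: "x \<in> X" "(\<lambda>n. d (u n) x) \<longlonglongrightarrow> 0"
  proof (atomize_elim, rule complete[OF u, simplified Bex_def])
    fix e :: real assume "e > 0"
    then have "eventually (\<lambda>n. \<theta> ^ n * (K / (1 - \<theta>)) < e) sequentially" using lim0 by (intro order_tendstoD)
    then obtain M where M: "\<And>n. n \<ge> M \<Longrightarrow> \<theta> ^ n * (K / (1 - \<theta>)) < e" by (auto simp: eventually_sequentially)
    have "d (u m) (u n) < e" if "m \<ge> M" "n \<ge> M" for m n
    proof (cases "m \<le> n")
      case True then show ?thesis using far'[of m n] M[of m] that by simp
    next
      case False then show ?thesis using far'[of n m] M[of n] that d(3)[OF u[of m] u[of n]] by simp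
    qed
    then show "\<exists>N. \<forall>m\<ge>N. \<forall>n\<ge>N. d (u m) (u n) < e" by blast
  qed
  have "d (\<Phi> x) x \<le> \<theta> * d (u n) x + d (u (Suc n)) x" for n
  proof -
    have "d (\<Phi> x) x \<le> d (\<Phi> x) (u (Suc n)) + d (u (Suc n)) x" by (rule d(4)) (use x u X in auto)
    also have "d (\<Phi> x) (u (Suc n)) \<le> \<theta> * d (u n) x" unfolding uS using \<theta>(3)[OF x(1) u] d(3)[OF x(1) u] by simp
    finally show ?thesis by simp
  qed
  moreover have "(\<lambda>n. \<theta> * d (u n) x + d (u (Suc n)) x) \<longlonglongrightarrow> \<theta> * 0 + 0"
    by (intro tendsto_intros x LIMSEQ_Suc)
  ultimately have "d (\<Phi> x) x \<le> \<theta> * 0 + 0" by (intro LIMSEQ_le_const) auto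
  then show ?thesis using x(1) d(1)[of "\<Phi> x" x] by (intro bexI[of _ x]) auto
qed

context SL
begin

lemma L2_meas: "F \<in> L2 \<Longrightarrow> F \<in> borel_measurable lebesgue"
  and L2_int: "F \<in> L2 \<Longrightarrow> integrable lebesgue (\<lambda>x. (cmod (F x))\<^sup>2 * r x)"
  by (auto simp: L2_weighted_def)

lemma norm_sq: "(N F)\<^sup>2 = (LINT x|lebesgue. (cmod (F x))\<^sup>2 * r x)"
proof -
  have "0 \<le> (LINT x|lebesgue. (cmod (F x))\<^sup>2 * r x)"
    by (rule integral_nonneg_AE, use r_pos in eventually_elim) simp
  then show ?thesis by (simp add: L2_weighted_norm_def)
qed

lemma sqrt_weight:
  assumes "F \<in> L2"
  shows "(\<lambda>x. of_real (sqrt \<bar>r x\<bar>) * F x) \<in> borel_measurable lebesgue"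
    "AE x in lebesgue. (norm (of_real (sqrt \<bar>r x\<bar>) * F x))\<^sup>2 = (cmod (F x))\<^sup>2 * r x"
    "integrable lebesgue (\<lambda>x. (norm (of_real (sqrt \<bar>r x\<bar>) * F x))\<^sup>2)"
    "(LINT x|lebesgue. (norm (of_real (sqrt \<bar>r x\<bar>) * F x))\<^sup>2) = (N F)\<^sup>2"
proof -
  note Fm = L2_meas[OF assms]
  show m: "(\<lambda>x. of_real (sqrt \<bar>r x\<bar>) * F x) \<in> borel_measurable lebesgue" using Fm r_meas by measurable
  show ae: "AE x in lebesgue. (norm (of_real (sqrt \<bar>r x\<bar>) * F x))\<^sup>2 = (cmod (F x))\<^sup>2 * r x"
    using r_pos by eventually_elim (simp add: norm_mult power_mult_distrib)
  show "integrable lebesgue (\<lambda>x. (norm (of_real (sqrt \<bar>r x\<bar>) * F x))\<^sup>2)"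
    by (subst integrable_cong_AE[OF _ _ ae]) (use m L2_int[OF assms] in auto)
  show "(LINT x|lebesgue. (norm (of_real (sqrt \<bar>r x\<bar>) * F x))\<^sup>2) = (N F)\<^sup>2"
    unfolding norm_sq by (rule integral_cong_AE[OF _ _ ae]) (use m L2_int[OF assms] in auto)
qed

lemma weighted_Cauchy_Schwarz:
  assumes F: "F \<in> L2" and G: "G \<in> L2"
  shows "integrable lebesgue (\<lambda>x. of_real (r x) * (F x * cnj (G x)))"
    "cmod (LINT x|lebesgue. of_real (r x) * (F x * cnj (G x))) \<le> N F * N G"
proof -
  define u where "u F x = norm (complex_of_real (sqrt \<bar>r x\<bar>) * F x)" for F x
  note sF = sqrt_weight[OF F, folded u_def] and sG = sqrt_weight[OF G, folded u_def]
  have m: "u F \<in> borel_measurable lebesgue" "u G \<in> borel_measurable lebesgue"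
    unfolding u_def[abs_def] using sF(1) sG(1) by (auto intro: borel_measurable_norm)
  note CS = Cauchy_Schwarz_integral[OF m sF(3) sG(3)]
  have Fm: "F \<in> borel_measurable lebesgue" and Gm: "G \<in> borel_measurable lebesgue" using L2_meas F G by auto
  have cm: "(\<lambda>x. of_real (r x) * (F x * cnj (G x))) \<in> borel_measurable lebesgue"
  proof -
    have "(\<lambda>x. cnj (G x)) \<in> borel_measurable lebesgue"
      using Gm by (rule borel_measurable_continuous_on[rotated]) (intro continuous_intros)
    then show ?thesis using Fm r_meas by measurable
  qed
  have ae: "AE x in lebesgue. norm (of_real (r x) * (F x * cnj (G x))) = u F x * u G x"
    using r_pos
  proof eventually_elim
    case (elim x)
    have "u F x * u G x = (sqrt \<bar>r x\<bar> * sqrt \<bar>r x\<bar>) * (norm (F x) * norm (G x))"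
      by (simp only: u_def norm_mult norm_of_real abs_sqrt_wlog) (simp add: mult_ac)
    then show ?case using elim by (simp add: norm_mult)
  qed
  show i: "integrable lebesgue (\<lambda>x. of_real (r x) * (F x * cnj (G x)))"
    by (rule Bochner_Integration.integrable_bound[OF CS(1) cm], use ae in eventually_elim) simp
  have "cmod (LINT x|lebesgue. of_real (r x) * (F x * cnj (G x))) \<le> (LINT x|lebesgue. norm (of_real (r x) * (F x * cnj (G x))))"
    by (rule integral_norm_bound)
  also have "\<dots> = (LINT x|lebesgue. u F x * u G x)"
    by (rule integral_cong_AE[OF _ _ ae]) (use cm m in measurable)
  also have "\<dots> \<le> N F * N G"
  proof (rule power2_le_imp_le)
    show "(LINT x|lebesgue. u F x * u G x)\<^sup>2 \<le> (N F * N G)\<^sup>2"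
      using CS(3) unfolding sF(4) sG(4) by (simp add: power_mult_distrib)
  qed (use norm_nonneg in simp)
  finally show "cmod (LINT x|lebesgue. of_real (r x) * (F x * cnj (G x))) \<le> N F * N G" .
qed

lemma norm_triangle:
  assumes F: "F \<in> L2" and G: "G \<in> L2"
  shows "N (\<lambda>x. F x + G x) \<le> N F + N G"
proof (rule power2_le_imp_le)
  note CS = weighted_Cauchy_Schwarz[OF F G]
  have eq: "(cmod (F x + G x))\<^sup>2 * r x = (cmod (F x))\<^sup>2 * r x + 2 * Re (of_real (r x) * (F x * cnj (G x))) + (cmod (G x))\<^sup>2 * r x" for x
    unfolding cmod_power2 by (simp add: power2_eq_square algebra_simps)
  have "(N (\<lambda>x. F x + G x))\<^sup>2 = (N F)\<^sup>2 + 2 * Re (LINT x|lebesgue. of_real (r x) * (F x * cnj (G x))) + (N G)\<^sup>2"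
  proof -
    have iR: "integrable lebesgue (\<lambda>x. Re (of_real (r x) * (F x * cnj (G x))))" by (rule integrable_Re[OF CS(1)])
    have "(LINT x|lebesgue. (cmod (F x))\<^sup>2 * r x + 2 * Re (of_real (r x) * (F x * cnj (G x))) + (cmod (G x))\<^sup>2 * r x) =
      (LINT x|lebesgue. (cmod (F x))\<^sup>2 * r x) + 2 * (LINT x|lebesgue. Re (of_real (r x) * (F x * cnj (G x)))) + (LINT x|lebesgue. (cmod (G x))\<^sup>2 * r x)"
      using Bochner_Integration.integral_add[OF Bochner_Integration.integrable_add[OF L2_int[OF F] integrable_mult_right[OF iR, of 2]] L2_int[OF G]]
        Bochner_Integration.integral_add[OF L2_int[OF F] integrable_mult_right[OF iR, of 2]] by simp
    then show ?thesis unfolding norm_sq eq integral_Re[OF CS(1)] .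
  qed
  also have "\<dots> \<le> (N F)\<^sup>2 + 2 * (N F * N G) + (N G)\<^sup>2"
    using CS(2) complex_Re_le_cmod[of "LINT x|lebesgue. of_real (r x) * (F x * cnj (G x))"] by linarith
  also have "\<dots> = (N F + N G)\<^sup>2" by (simp add: power2_eq_square algebra_simps)
  finally show "(N (\<lambda>x. F x + G x))\<^sup>2 \<le> (N F + N G)\<^sup>2" .
qed (use norm_nonneg in simp)

lemma norm_scale: "N (\<lambda>x. z * F x) = cmod z * N F"
proof -
  have "(N (\<lambda>x. z * F x))\<^sup>2 = (cmod z * N F)\<^sup>2"
    unfolding norm_sq power_mult_distrib by (simp add: norm_mult power_mult_distrib mult.assoc)
  then show ?thesis using norm_nonneg by (metis mult_nonneg_nonneg norm_ge_zero power2_eq_imp_eq)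
qed

lemma L2_minus: "F \<in> L2 \<Longrightarrow> G \<in> L2 \<Longrightarrow> (\<lambda>x. F x - G x) \<in> L2"
  using L2_lincomb[of F G "-1"] by simp

lemma norm_zero_AE:
  assumes F: "F \<in> L2" and z: "N F = 0"
  shows "AE x in lebesgue. F x = 0"
proof -
  have nn: "AE x in lebesgue. 0 \<le> (cmod (F x))\<^sup>2 * r x" using r_pos by eventually_elim simp
  have "(LINT x|lebesgue. (cmod (F x))\<^sup>2 * r x) = 0" using z norm_sq[of F] by simp
  then have "AE x in lebesgue. (cmod (F x))\<^sup>2 * r x = 0"
    using integral_nonneg_eq_0_iff_AE[OF L2_int[OF F] nn] by simp
  then show ?thesis using r_pos by eventually_elim simp
qed

lemma L2_weighted_complete:
  assumes F: "\<And>n::nat. F n \<in> L2" and cauchy: "\<And>e. e > 0 \<Longrightarrow> \<exists>M. \<forall>m\<ge>M. \<forall>n\<ge>M. N (\<lambda>x. F m x - F n x) < e"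
  shows "\<exists>G\<in>L2. (\<lambda>n. N (\<lambda>x. F n x - G x)) \<longlonglongrightarrow> 0"
proof -
  define u where "u n x = complex_of_real (sqrt \<bar>r x\<bar>) * F n x" for n x
  note s = sqrt_weight[OF F, folded u_def]
  have ud: "(LINT x|lebesgue. (norm (u m x - u n x))\<^sup>2) = (N (\<lambda>x. F m x - F n x))\<^sup>2" for m n
    using sqrt_weight(4)[OF L2_minus[OF F[of m] F[of n]]] by (simp add: u_def right_diff_distrib)
  have "\<exists>G. G \<in> borel_measurable lebesgue \<and> integrable lebesgue (\<lambda>x. (norm (G x))\<^sup>2) \<and>
    (\<forall>n. integrable lebesgue (\<lambda>x. (norm (u n x - G x))\<^sup>2)) \<and> (\<lambda>n. LINT x|lebesgue. (norm (u n x - G x))\<^sup>2) \<longlonglongrightarrow> 0"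
  proof (rule L2_complete)
    show "u n \<in> borel_measurable lebesgue" for n unfolding u_def[abs_def] using s(1)[of n] by (simp add: u_def)
    show "integrable lebesgue (\<lambda>x. (norm (u n x))\<^sup>2)" for n by (rule s(3))
    fix e :: real assume "e > 0"
    then obtain M where M: "\<forall>m\<ge>M. \<forall>n\<ge>M. N (\<lambda>x. F m x - F n x) < sqrt e" using cauchy[of "sqrt e"] by auto
    have "(N (\<lambda>x. F m x - F n x))\<^sup>2 < e" if "m \<ge> M" "n \<ge> M" for m n
    proof -
      have "N (\<lambda>x. F m x - F n x) < sqrt e" using M that by blast
      then have "(N (\<lambda>x. F m x - F n x))\<^sup>2 < (sqrt e)\<^sup>2" by (rule power_strict_mono) (use norm_nonneg in auto)
      then show ?thesis using \<open>e > 0\<close> by simp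
    qed
    then show "\<exists>N. \<forall>m\<ge>N. \<forall>n\<ge>N. (LINT x|lebesgue. (norm (u m x - u n x))\<^sup>2) < e" unfolding ud by blast
  qed
  then obtain H where H: "H \<in> borel_measurable lebesgue" "integrable lebesgue (\<lambda>x. (norm (H x))\<^sup>2)"
    "(\<lambda>n. LINT x|lebesgue. (norm (u n x - H x))\<^sup>2) \<longlonglongrightarrow> 0" by blast
  define G where "G x = H x / complex_of_real (sqrt \<bar>r x\<bar>)" for x
  have Gm: "G \<in> borel_measurable lebesgue" unfolding G_def[abs_def] using H(1) r_meas by measurable
  have HG: "AE x in lebesgue. H x = complex_of_real (sqrt \<bar>r x\<bar>) * G x" using r_pos by eventually_elim (simp add: G_def)
  have "integrable lebesgue (\<lambda>x. (cmod (G x))\<^sup>2 * r x)"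
  proof (rule integrable_cong_AE_imp[OF H(2)])
    show "(\<lambda>x. (cmod (G x))\<^sup>2 * r x) \<in> borel_measurable lebesgue" using Gm r_meas by measurable
    show "AE x in lebesgue. (norm (H x))\<^sup>2 = (cmod (G x))\<^sup>2 * r x"
      using HG r_pos by eventually_elim (simp add: norm_mult power_mult_distrib)
  qed
  then have GL: "G \<in> L2" using Gm by (simp add: L2_weighted_def)
  have "(LINT x|lebesgue. (norm (u n x - H x))\<^sup>2) = (N (\<lambda>x. F n x - G x))\<^sup>2" for n
  proof -
    have "(LINT x|lebesgue. (norm (u n x - H x))\<^sup>2) = (LINT x|lebesgue. (norm (complex_of_real (sqrt \<bar>r x\<bar>) * (F n x - G x)))\<^sup>2)"
    proof (rule integral_cong_AE)
      show "AE x in lebesgue. (norm (u n x - H x))\<^sup>2 = (norm (complex_of_real (sqrt \<bar>r x\<bar>) * (F n x - G x)))\<^sup>2"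
        using HG by eventually_elim (simp only: u_def right_diff_distrib)
      show "(\<lambda>x. (norm (u n x - H x))\<^sup>2) \<in> borel_measurable lebesgue" using s(1)[of n] H(1) by (simp add: u_def)
      show "(\<lambda>x. (norm (complex_of_real (sqrt \<bar>r x\<bar>) * (F n x - G x)))\<^sup>2) \<in> borel_measurable lebesgue"
        using sqrt_weight(3)[OF L2_minus[OF F[of n] GL]] by auto
    qed
    then show ?thesis using sqrt_weight(4)[OF L2_minus[OF F[of n] GL]] by simp
  qed
  then have "(\<lambda>n. (N (\<lambda>x. F n x - G x))\<^sup>2) \<longlonglongrightarrow> 0" using H(3) by simp
  then have "(\<lambda>n. sqrt ((N (\<lambda>x. F n x - G x))\<^sup>2)) \<longlonglongrightarrow> sqrt 0" by (rule tendsto_real_sqrt)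
  then have "(\<lambda>n. N (\<lambda>x. F n x - G x)) \<longlonglongrightarrow> 0" using norm_nonneg by (simp add: abs_of_nonneg)
  then show ?thesis using GL by blast
qed

text \<open>Surjectivity is the only part of the definition of the resolvent set that needs an existence proof;
  injectivity and boundedness follow from \<open>resolvent_estimate\<close> below.\<close>
definition onto_at :: "complex \<Rightarrow> bool" where
  "onto_at z \<longleftrightarrow> (\<forall>h\<in>L2. \<exists>F\<in>D. AE x in lebesgue. T F x - z * F x = h x)"

lemma onto_at_base: "onto_at (- of_real \<Lambda>)"
  unfolding onto_at_def
proof
  fix h assume h: "h \<in> L2"
  obtain f1 v1 where 1: "SL_rel f1 v1 (\<lambda>x. Re (h x) - \<Lambda> * f1 x)"
    using solve_real[of "\<lambda>x. Re (h x)"] h[unfolded L2_iff] by blast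
  obtain f2 v2 where 2: "SL_rel f2 v2 (\<lambda>x. Im (h x) - \<Lambda> * f2 x)"
    using solve_real[of "\<lambda>x. Im (h x)"] h[unfolded L2_iff] by blast
  show "\<exists>F\<in>D. AE x in lebesgue. T F x - (- of_real \<Lambda>) * F x = h x"
  proof (rule bexI[OF _ SL_rel_dom(1)[OF 1 2]])
    show "AE x in lebesgue. T (\<lambda>x. Complex (f1 x) (f2 x)) x - (- of_real \<Lambda>) * Complex (f1 x) (f2 x) = h x"
      using SL_rel_dom(2)[OF 1 2] by eventually_elim (simp add: complex_eq_iff)
  qed
qed

text \<open>The equation \<open>(T - z) F = h\<close> is the fixed point equation \<open>(T - w) F = h + (z - w) F\<close>, and the
  hypothesis on \<open>\<delta>\<close> makes the solution map contract distances by \<open>|z - w| / \<delta>\<close>.\<close>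
lemma onto_at_step:
  assumes w: "onto_at w" and \<delta>: "\<delta> > 0" "\<And>F. F \<in> D \<Longrightarrow> \<delta> * N F \<le> N (\<lambda>x. T F x - w * F x)"
    and z: "cmod (z - w) < \<delta>"
  shows "onto_at z"
  unfolding onto_at_def
proof
  fix h assume h: "h \<in> L2"
  have rhs: "(\<lambda>x. h x + (z - w) * F x) \<in> L2" if "F \<in> L2" for F using L2_lincomb[OF h that] .
  have "\<forall>F\<in>L2. \<exists>G. G \<in> D \<and> (AE x in lebesgue. T G x - w * G x = h x + (z - w) * F x)"
  proof
    fix F assume "F \<in> L2"
    from w[unfolded onto_at_def, rule_format, OF rhs[OF this]]
    show "\<exists>G. G \<in> D \<and> (AE x in lebesgue. T G x - w * G x = h x + (z - w) * F x)" unfolding Bex_def .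
  qed
  from bchoice[OF this] obtain \<Phi> where \<Phi>0: "\<forall>F\<in>L2. \<Phi> F \<in> D \<and> (AE x in lebesgue. T (\<Phi> F) x - w * \<Phi> F x = h x + (z - w) * F x)" ..
  have \<Phi>: "\<Phi> F \<in> D" "AE x in lebesgue. T (\<Phi> F) x - w * \<Phi> F x = h x + (z - w) * F x" if "F \<in> L2" for F
    using \<Phi>0[rule_format, OF that] by (rule conjunct1, rule conjunct2)
  have "\<exists>F\<in>L2. N (\<lambda>x. \<Phi> F x - F x) = 0"
  proof (rule contraction_fixed_point[where d="\<lambda>F G. N (\<lambda>x. F x - G x)" and \<theta>="cmod (z - w) / \<delta>"])
    show "L2 \<noteq> {}" using h by blast
    show "\<Phi> F \<in> L2" if "F \<in> L2" for F using \<Phi>(1)[OF that] SL_dom_L2 by blast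
    show "0 \<le> N (\<lambda>x. F x - G x)" for F G by (rule norm_nonneg)
    show "N (\<lambda>x. F x - F x) = 0" for F by (simp add: L2_weighted_norm_def)
    show "N (\<lambda>x. F x - G x) = N (\<lambda>x. G x - F x)" for F G by (simp add: L2_weighted_norm_def norm_minus_commute)
    show "N (\<lambda>x. F x - H x) \<le> N (\<lambda>x. F x - G x) + N (\<lambda>x. G x - H x)" if "F \<in> L2" "G \<in> L2" "H \<in> L2" for F G H
      using norm_triangle[OF L2_minus[OF that(1,2)] L2_minus[OF that(2,3)]] by simp
    show "\<exists>x\<in>L2. (\<lambda>n. N (\<lambda>xa. u n xa - x xa)) \<longlonglongrightarrow> 0"
      if "\<And>n. u n \<in> L2" "\<And>e. e > 0 \<Longrightarrow> \<exists>M. \<forall>m\<ge>M. \<forall>n\<ge>M. N (\<lambda>x. u m x - u n x) < e" for u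
      using L2_weighted_complete[OF that] .
    show "0 \<le> cmod (z - w) / \<delta>" "cmod (z - w) / \<delta> < 1" using \<delta>(1) z by auto
    fix F G assume FG: "F \<in> L2" "G \<in> L2"
    note PF = \<Phi>[OF FG(1)] and PG = \<Phi>[OF FG(2)]
    define E where "E x = \<Phi> F x - \<Phi> G x" for x
    have E: "E \<in> D" "AE x in lebesgue. T E x = T (\<Phi> F) x - T (\<Phi> G) x"
      unfolding E_def[abs_def] by (rule SL_dom_diff[OF PF(1) PG(1)])+
    have "\<delta> * N E \<le> N (\<lambda>x. T E x - w * E x)" by (rule \<delta>(2)[OF E(1)])
    also have "\<dots> = N (\<lambda>x. (z - w) * (F x - G x))"
    proof (rule norm_cong_AE)
      show "AE x in lebesgue. T E x - w * E x = (z - w) * (F x - G x)"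
        using E(2) PF(2) PG(2) 
      proof eventually_elim
        case (elim x)
        have "T E x - w * E x = (T (\<Phi> F) x - w * \<Phi> F x) - (T (\<Phi> G) x - w * \<Phi> G x)"
          unfolding elim(1) E_def by (simp add: algebra_simps)
        then show ?case unfolding elim(2,3) by (simp add: algebra_simps)
      qed
      show "(\<lambda>x. T E x - w * E x) \<in> borel_measurable lebesgue"
        using L2_meas[OF SL_dom_L2(1)[OF E(1)]] L2_meas[OF SL_dom_L2(2)[OF E(1)]] by measurable
      show "(\<lambda>x. (z - w) * (F x - G x)) \<in> borel_measurable lebesgue"
        using L2_meas[OF FG(1)] L2_meas[OF FG(2)] by measurable
    qed
    also have "\<dots> = cmod (z - w) * N (\<lambda>x. F x - G x)" by (rule norm_scale)
    finally show "N (\<lambda>x. \<Phi> F x - \<Phi> G x) \<le> cmod (z - w) / \<delta> * N (\<lambda>x. F x - G x)"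
      using \<delta>(1) by (simp add: E_def[abs_def] field_simps)
  qed
  then obtain F where F: "F \<in> L2" "N (\<lambda>x. \<Phi> F x - F x) = 0" by blast
  have "AE x in lebesgue. \<Phi> F x - F x = 0"
    by (rule norm_zero_AE[OF L2_minus F(2)]) (use F(1) \<Phi>(1) SL_dom_L2 in auto)
  then have "AE x in lebesgue. T (\<Phi> F) x - z * \<Phi> F x = h x"
    using \<Phi>(2)[OF F(1)]
  proof eventually_elim
    case (elim x)
    then have "F x = \<Phi> F x" by simp
    then show ?case using elim(2) by (simp add: algebra_simps)
  qed
  then show "\<exists>F\<in>D. AE x in lebesgue. T F x - z * F x = h x" using \<Phi>(1)[OF F(1)] by blast
qed

section \<open>The bottom of the spectrum\<close>

text \<open>For symmetric \<open>T\<close> the quotient \<open>(T F, F) / (F, F)\<close> is real, and by hypothesis it is at least \<open>m\<close>. So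
  \<open>((T - z) F, F)\<close> is \<open>(F, F)\<close> times the difference of a point of \<open>[m, \<infinity>)\<close> and \<open>z\<close>.\<close>
lemma resolvent_estimate:
  assumes m: "\<And>f v k. SL_rel f v k \<Longrightarrow> m * mass f \<le> ip k f"
    and \<delta>: "0 \<le> \<delta>" "\<And>t. m \<le> t \<Longrightarrow> \<delta> \<le> cmod (of_real t - z)" and F: "F \<in> D"
  shows "\<delta> * N F \<le> N (\<lambda>x. T F x - z * F x)"
proof -
  define f1 f2 k1 k2 where "f1 x = Re (F x)" and "f2 x = Im (F x)" and "k1 x = Re (T F x)" and "k2 x = Im (T F x)" for x
  define H where "H x = T F x - z * F x" for x
  note R1 = SL_dom_rel(1)[OF F, folded f1_def k1_def] and R2 = SL_dom_rel(2)[OF F, folded f2_def k2_def]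
  have FL: "F \<in> L2" and TL: "T F \<in> L2" using SL_dom_L2 F by auto
  have HL: "H \<in> L2" using L2_lincomb[OF TL FL, of "- z"] by (simp add: H_def[abs_def])
  have ms: "f1 \<in> borel_measurable lebesgue" "f2 \<in> borel_measurable lebesgue" "k1 \<in> borel_measurable lebesgue" "k2 \<in> borel_measurable lebesgue"
    and ins: "finite_mass f1" "finite_mass f2"
      "finite_mass k1" "finite_mass k2"
    using FL TL unfolding L2_iff f1_def f2_def k1_def k2_def by blast+
  define a where "a = ip k1 f1 + ip k2 f2"
  define R where "R = mass f1 + mass f2"
  have i11: "integrable lebesgue (\<lambda>x. r x * (k1 x * f1 x))" and i22: "integrable lebesgue (\<lambda>x. r x * (k2 x * f2 x))"
    and i21: "integrable lebesgue (\<lambda>x. r x * (k2 x * f1 x))" and i12: "integrable lebesgue (\<lambda>x. r x * (k1 x * f2 x))"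
    by (rule weighted_L2_lincomb(2); use ms ins in simp)+
  have NF: "(N F)\<^sup>2 = R" using norm_L2_eq[OF FL] by (simp add: R_def f1_def f2_def)
  have Rnn: "0 \<le> R" using NF by (metis zero_le_power2)
  define I where "I = (LINT x|lebesgue. of_real (r x) * (H x * cnj (F x)))"
  note CS = weighted_Cauchy_Schwarz[OF HL FL, folded I_def]
  have "Re I = (LINT x|lebesgue. Re (of_real (r x) * (H x * cnj (F x))))"
    unfolding I_def by (rule integral_Re[OF CS(1), symmetric])
  also have "\<dots> = (LINT x|lebesgue. (r x * (k1 x * f1 x) + r x * (k2 x * f2 x)) - Re z * (r x * (f1 x)\<^sup>2 + r x * (f2 x)\<^sup>2))"
    by (rule arg_cong[of _ _ "integral\<^sup>L lebesgue"]) (simp add: fun_eq_iff H_def f1_def f2_def k1_def k2_def power2_eq_square algebra_simps)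
  also have "\<dots> = a - Re z * R"
    using i11 i22 ins unfolding a_def R_def
    by (simp only: Bochner_Integration.integral_diff Bochner_Integration.integral_add Bochner_Integration.integrable_add integrable_mult_right integral_mult_right_zero)
  finally have ReI: "Re I = a - Re z * R" .
  have "Im I = (LINT x|lebesgue. Im (of_real (r x) * (H x * cnj (F x))))"
    unfolding I_def by (rule integral_Im[OF CS(1), symmetric])
  also have "\<dots> = (LINT x|lebesgue. (r x * (k2 x * f1 x) - r x * (k1 x * f2 x)) - Im z * (r x * (f1 x)\<^sup>2 + r x * (f2 x)\<^sup>2))"
    by (rule arg_cong[of _ _ "integral\<^sup>L lebesgue"]) (simp add: fun_eq_iff H_def f1_def f2_def k1_def k2_def power2_eq_square algebra_simps)
  also have "\<dots> = ip k2 f1 - ip k1 f2 - Im z * R"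
    using i21 i12 ins unfolding R_def
    by (simp only: Bochner_Integration.integral_diff Bochner_Integration.integral_add Bochner_Integration.integrable_add Bochner_Integration.integrable_diff integrable_mult_right integral_mult_right_zero)
  also have "ip k2 f1 = ip k1 f2"
    using SL_symmetric[OF R2 R1] by (simp add: mult.commute)
  finally have ImI: "Im I = - Im z * R" by simp
  have aR: "m * R \<le> a" using m[OF R1] m[OF R2] by (simp add: a_def R_def distrib_left)
  have "\<delta> * R \<le> cmod I"
  proof (cases "R = 0")
    case False
    then have R: "R > 0" using Rnn by simp
    have "I = of_real R * (of_real (a / R) - z)" using R by (simp add: complex_eq_iff ReI ImI algebra_simps)
    then have "cmod I = R * cmod (of_real (a / R) - z)" using R by (simp add: norm_mult)
    moreover have "m \<le> a / R" using aR R by (simp add: pos_le_divide_eq)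
    ultimately show ?thesis using \<delta>(2)[of "a / R"] R by simp
  qed simp
  also have "\<dots> \<le> N H * N F" by (rule CS(2))
  finally have "\<delta> * N F * N F \<le> N H * N F" unfolding NF[symmetric] by (simp add: power2_eq_square mult.assoc)
  then have "\<delta> * N F \<le> N H"
    using norm_nonneg[of F] norm_nonneg[of H] by (cases "N F = 0") (simp_all add: mult_le_cancel_right)
  then show ?thesis by (simp add: H_def[abs_def])
qed

text \<open>The segment from \<open>c\<close> to \<open>z\<close> is compact and does not meet the closed ray \<open>[m, \<infinity>)\<close>.\<close>
lemma distance_from_ray:
  assumes "\<not> (z \<in> \<real> \<and> m \<le> Re z)" "c < m"
  obtains \<delta> where "\<delta> > 0" "\<And>t u. m \<le> t \<Longrightarrow> u \<in> {0..1} \<Longrightarrow> \<delta> \<le> cmod (of_real t - (of_real c + of_real u * (z - of_real c)))"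
proof -
  define S where "S = (\<lambda>u. of_real c + of_real u * (z - of_real c)) ` {0..1::real}"
  have "compact S" unfolding S_def by (intro compact_continuous_image continuous_intros) auto
  moreover have "closed (complex_of_real ` {m..})"
  proof -
    have "complex_of_real ` {m..} = {w. Im w = 0} \<inter> {w. m \<le> Re w}"
      by (auto simp: complex_eq_iff image_iff intro!: exI[of _ "Re _"])
    moreover have "closed {w. Im w = 0}" by (intro closed_Collect_eq continuous_intros)
    moreover have "closed {w. m \<le> Re w}" by (intro closed_Collect_le continuous_intros)
    ultimately show ?thesis by auto
  qed
  moreover have "S \<inter> complex_of_real ` {m..} = {}"
  proof (rule ccontr)
    assume "S \<inter> complex_of_real ` {m..} \<noteq> {}"
    then obtain y where "y \<in> S" "y \<in> complex_of_real ` {m..}" by blast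
    then obtain u t where u: "u \<in> {0..1}" and t: "m \<le> t" and eq: "of_real c + of_real u * (z - of_real c) = complex_of_real t"
      unfolding S_def by (elim imageE) simp
    have 1: "c + u * (Re z - c) = t" and 2: "u * Im z = 0" using eq by (auto simp: complex_eq_iff)
    have "u \<noteq> 0" using 1 t assms(2) by auto
    then have "u > 0" "Im z = 0" using u 2 by auto
    then have "Re z < m" using assms(1) by (auto simp: complex_is_Real_iff)
    have "t = (1 - u) * c + u * Re z" using 1 by (simp add: algebra_simps)
    also have "\<dots> < (1 - u) * m + u * m"
    proof (rule add_le_less_mono)
      show "(1 - u) * c \<le> (1 - u) * m" using u assms(2) by (intro mult_left_mono) auto
      show "u * Re z < u * m" using \<open>u > 0\<close> \<open>Re z < m\<close> by simp
    qed
    also have "\<dots> = m" by (simp add: algebra_simps)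
    finally show False using t by simp
  qed
  ultimately obtain d where d: "d > 0" "\<forall>x\<in>S. \<forall>y\<in>complex_of_real ` {m..}. d \<le> dist x y"
    using separate_compact_closed by metis
  show ?thesis
  proof (rule that[OF d(1)])
    fix t u assume "m \<le> t" "u \<in> {0..1::real}"
    then have "d \<le> dist (of_real c + of_real u * (z - of_real c)) (complex_of_real t)" using d(2) by (auto simp: S_def)
    then show "d \<le> cmod (of_real t - (of_real c + of_real u * (z - of_real c)))" by (simp add: dist_norm norm_minus_commute)
  qed
qed

text \<open>The segment from \<open>-\<Lambda>\<close> to \<open>z\<close> has a positive distance \<open>\<delta>\<close> from the ray, so it can be walked in
  steps shorter than \<open>\<delta>\<close>.\<close>
lemma onto_at_outside:
  assumes m: "\<And>f v k. SL_rel f v k \<Longrightarrow> m * mass f \<le> ip k f"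
    and mL: "- \<Lambda> < m" and z: "\<not> (z \<in> \<real> \<and> m \<le> Re z)"
  shows "onto_at z"
proof -
  define w where "w u = of_real (- \<Lambda>) + of_real u * (z - of_real (- \<Lambda>))" for u :: real
  obtain \<delta> where \<delta>: "\<delta> > 0" "\<And>t u. m \<le> t \<Longrightarrow> u \<in> {0..1} \<Longrightarrow> \<delta> \<le> cmod (of_real t - w u)"
    using distance_from_ray[OF z mL] unfolding w_def by metis
  obtain n :: nat where n: "cmod (z - of_real (- \<Lambda>)) / \<delta> < real n" using reals_Archimedean2 by blast
  have n0: "n > 0" using n \<delta>(1) by (metis divide_nonneg_pos gr0I norm_ge_zero not_le of_nat_0)
  have "onto_at (w (real k / real n))" if "k \<le> n" for k
    using that
  proof (induction k)
    case 0
    then show ?case using onto_at_base by (simp add: w_def)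
  next
    case (Suc k)
    show ?case
    proof (rule onto_at_step[OF _ \<delta>(1)])
      show "onto_at (w (real k / real n))" using Suc by simp
      show "\<delta> * N F \<le> N (\<lambda>x. T F x - w (real k / real n) * F x)" if "F \<in> D" for F
        by (rule resolvent_estimate[OF m]) (use \<delta> that Suc.prems n0 in auto)
      have "w (real (Suc k) / real n) - w (real k / real n) = of_real (1 / real n) * (z - of_real (- \<Lambda>))"
      proof -
        have "w (real (Suc k) / real n) - w (real k / real n) = of_real (real (Suc k) / real n - real k / real n) * (z - of_real (- \<Lambda>))"
          by (simp add: w_def algebra_simps)
        also have "real (Suc k) / real n - real k / real n = 1 / real n" by (simp add: diff_divide_distrib[symmetric])
        finally show ?thesis .
      qed
      then have "cmod (w (real (Suc k) / real n) - w (real k / real n)) = cmod (z - of_real (- \<Lambda>)) / real n"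
        by (simp only: norm_mult norm_of_real) simp
      also have "\<dots> < \<delta>" using n n0 \<delta>(1) by (simp add: field_simps)
      finally show "cmod (w (real (Suc k) / real n) - w (real k / real n)) < \<delta>" .
    qed
  qed
  from this[of n] show ?thesis using n0 by (simp add: w_def)
qed

lemma outside_in_resolvent:
  assumes m: "\<And>f v k. SL_rel f v k \<Longrightarrow> m * mass f \<le> ip k f"
    and mL: "- \<Lambda> < m" and z: "\<not> (z \<in> \<real> \<and> m \<le> Re z)"
  shows "z \<in> resolvent_set r D T"
proof -
  obtain \<delta> where \<delta>: "\<delta> > 0" "\<And>t u. m \<le> t \<Longrightarrow> u \<in> {0..1} \<Longrightarrow> \<delta> \<le> cmod (of_real t - (of_real (- \<Lambda>) + of_real u * (z - of_real (- \<Lambda>))))"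
    using distance_from_ray[OF z mL] by metis
  have \<delta>z: "\<delta> \<le> cmod (of_real t - z)" if "m \<le> t" for t using \<delta>(2)[OF that, of 1] by simp
  have est: "\<delta> * N F \<le> N (\<lambda>x. T F x - z * F x)" if "F \<in> D" for F
    by (rule resolvent_estimate[OF m _ \<delta>z that]) (use \<delta>(1) in auto)
  have 1: "\<forall>h\<in>L2. \<exists>F\<in>D. AE x in lebesgue. T F x - z * F x = h x"
    using onto_at_outside[OF m mL z] unfolding onto_at_def .
  have 2: "AE x in lebesgue. F x = F' x" if F: "F \<in> D" and F': "F' \<in> D" and eq: "AE x in lebesgue. T F x - z * F x = T F' x - z * F' x" for F F'
  proof -
    define E where "E x = F x - F' x" for x
    have E: "E \<in> D" "AE x in lebesgue. T E x = T F x - T F' x"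
      unfolding E_def[abs_def] by (rule SL_dom_diff[OF F F'])+
    have "N (\<lambda>x. T E x - z * E x) = N (\<lambda>x. 0)"
    proof (rule norm_cong_AE)
      show "(\<lambda>x. T E x - z * E x) \<in> borel_measurable lebesgue"
        using L2_meas[OF SL_dom_L2(1)[OF E(1)]] L2_meas[OF SL_dom_L2(2)[OF E(1)]] by measurable
      show "AE x in lebesgue. T E x - z * E x = 0"
        using E(2) eq
      proof eventually_elim
        case (elim x)
        have "T E x - z * E x = (T F x - z * F x) - (T F' x - z * F' x)"
          unfolding elim(1) by (simp add: E_def algebra_simps)
        then show ?case using elim(2) by simp
      qed
    qed simp
    also have "\<dots> = 0" by (simp add: L2_weighted_norm_def)
    finally have "\<delta> * N E \<le> 0" using est[OF E(1)] by simp
    then have "N E \<le> 0" using \<delta>(1) by (simp add: mult_le_0_iff)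
    then have "N E = 0" using norm_nonneg[of E] by simp
    then have "AE x in lebesgue. E x = 0" by (rule norm_zero_AE[OF SL_dom_L2(1)[OF E(1)]])
    then show ?thesis by eventually_elim (simp add: E_def)
  qed
  have 3: "N F \<le> 1 / \<delta> * N (\<lambda>x. T F x - z * F x)" if "F \<in> D" for F
    using est[OF that] \<delta>(1) by (simp add: field_simps)
  show ?thesis unfolding resolvent_set_def
  proof (intro CollectI conjI)
    show "\<forall>F\<in>D. \<forall>F'\<in>D. (AE x in lebesgue. T F x - z * F x = T F' x - z * F' x) \<longrightarrow> (AE x in lebesgue. F x = F' x)"
      by (intro ballI impI) (rule 2)
    show "\<exists>C. \<forall>F\<in>D. N F \<le> C * N (\<lambda>x. T F x - z * F x)" by (intro exI[of _ "1 / \<delta>"] ballI) (rule 3)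
  qed (rule 1)
qed

text \<open>Suppose that \<open>(T - m) g = f\<close> has a solution with \<open>||g|| \<le> C ||f||\<close> for every \<open>f\<close>. The Cauchy--Schwarz inequality for
  the nonnegative form of \<open>T - m\<close> gives
  \<open>||f||^4 = ((T - m) g, f)^2 \<le> ((T - m) g, g) ((T - m) f, f)\<close>. The first factor is \<open>(f, g)\<close>, at most
  \<open>C ||f||^2\<close>. The second one is less than \<open>||f||^2 / C\<close> for an \<open>f\<close> whose Rayleigh quotient is close
  to \<open>m\<close>, which is a contradiction.\<close>
lemma minimum_in_spectrum:
  assumes m: "\<And>f v k. SL_rel f v k \<Longrightarrow> m * mass f \<le> ip k f"
    and approx: "\<And>e. e > 0 \<Longrightarrow> \<exists>f v k. SL_rel f v k \<and> 0 < mass f \<and>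
      (ip k f) < (m + e) * mass f"
  shows "of_real m \<notin> resolvent_set r D T"
proof
  assume res: "of_real m \<in> resolvent_set r D T"
  have onto: "\<forall>h\<in>L2. \<exists>F\<in>D. AE x in lebesgue. T F x - of_real m * F x = h x"
    and "\<exists>C. \<forall>F\<in>D. N F \<le> C * N (\<lambda>x. T F x - of_real m * F x)"
    using res unfolding resolvent_set_def by blast+
  then obtain C where C: "\<And>F. F \<in> D \<Longrightarrow> N F \<le> C * N (\<lambda>x. T F x - of_real m * F x)" by blast
  define e where "e = 1 / (\<bar>C\<bar> + 1)"
  have e: "e > 0" "e * \<bar>C\<bar> < 1" by (auto simp: e_def divide_less_eq)
  obtain f v k where f: "SL_rel f v k" and Rpos: "0 < mass f"
    and small: "ip k f < (m + e) * mass f"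
    using approx[OF e(1)] by blast
  define R where "R = mass f"
  have fm: "f \<in> borel_measurable lebesgue" and km: "k \<in> borel_measurable lebesgue"
    and fi: "finite_mass f" and ki: "finite_mass k"
    using f SL_rel_measurable[OF f] unfolding SL_rel_def by blast+
  have hL: "(\<lambda>x. Complex (f x) 0) \<in> L2" using fm fi by (simp add: L2_iff)
  obtain G where G: "G \<in> D" "AE x in lebesgue. T G x - of_real m * G x = Complex (f x) 0"
    using onto[rule_format, OF hL] by blast
  define g l where "g x = Re (G x)" and "l x = Re (T G x)" for x
  note Gr = SL_dom_rel(1)[OF G(1), folded g_def l_def]
  define w where "w x = Re (quasi_deriv p G x)" for x
  have gr: "SL_rel g w l" using Gr by (simp add: w_def[abs_def])
  have lg: "AE x in lebesgue. l x - m * g x = f x"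
    using G(2) by eventually_elim (simp add: g_def l_def complex_eq_iff)
  have gm: "g \<in> borel_measurable lebesgue" and lm: "l \<in> borel_measurable lebesgue"
    and gi: "finite_mass g" and li: "finite_mass l"
    using gr SL_rel_measurable[OF gr] unfolding SL_rel_def by blast+
  have GN: "mass g \<le> (N G)\<^sup>2"
  proof -
    have "0 \<le> (LINT x|lebesgue. r x * (Im (G x))\<^sup>2)" by (rule energy_parts_nonneg)
    then show ?thesis unfolding norm_L2_eq[OF SL_dom_L2(1)[OF G(1)]] by (simp add: g_def)
  qed
  have NR: "N (\<lambda>x. T G x - of_real m * G x) = sqrt R"
  proof -
    have "N (\<lambda>x. T G x - of_real m * G x) = N (\<lambda>x. Complex (f x) 0)"
      by (rule norm_cong_AE[OF _ L2_meas[OF hL] G(2)])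
        (use L2_meas[OF SL_dom_L2(1)[OF G(1)]] L2_meas[OF SL_dom_L2(2)[OF G(1)]] in measurable)
    moreover have "(N (\<lambda>x. Complex (f x) 0))\<^sup>2 = R" unfolding norm_L2_eq[OF hL] by (simp add: R_def)
    ultimately show ?thesis using norm_nonneg by (metis real_sqrt_unique)
  qed
  have Ng: "N G \<le> \<bar>C\<bar> * sqrt R"
  proof -
    have "N G \<le> C * sqrt R" using C[OF G(1)] by (simp add: NR)
    also have "\<dots> \<le> \<bar>C\<bar> * sqrt R" using Rpos by (intro mult_right_mono) (auto simp: R_def)
    finally show ?thesis .
  qed
  \<comment> \<open>the nonnegative symmetric form \<open>(k - m f, f)\<close> in the weighted space\<close>
  define ff fg gg kf kg lf lgg where "ff = R" and "fg = ip f g"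
    and "gg = mass g" and "kf = ip k f"
    and "kg = ip k g" and "lf = ip l f"
    and "lgg = ip l g"
  have ints: "integrable lebesgue (\<lambda>x. r x * (f x * g x))" "integrable lebesgue (\<lambda>x. r x * (k x * f x))"
    "integrable lebesgue (\<lambda>x. r x * (k x * g x))" "integrable lebesgue (\<lambda>x. r x * (l x * f x))" "integrable lebesgue (\<lambda>x. r x * (l x * g x))"
    by (rule weighted_L2_lincomb(2); use fm km gm lm fi ki gi li in simp)+
  have sym: "kg = lf" using SL_symmetric[OF f gr] by (simp add: kg_def lf_def mult.commute)
  have quad: "0 \<le> (kf - m * ff) + 2 * t * (kg - m * fg) + t\<^sup>2 * (lgg - m * gg)" for t
  proof -
    have "m * (LINT x|lebesgue. r x * (f x + t * g x)\<^sup>2) \<le> (LINT x|lebesgue. r x * ((k x + t * l x) * (f x + t * g x)))"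
      by (rule m[OF SL_rel_lincomb[OF f gr]])
    moreover have "(LINT x|lebesgue. r x * (f x + t * g x)\<^sup>2) = ff + (2 * t) * fg + t\<^sup>2 * gg"
    proof -
      have "(LINT x|lebesgue. r x * (f x + t * g x)\<^sup>2) = (LINT x|lebesgue. r x * (f x)\<^sup>2 + (2 * t) * (r x * (f x * g x)) + t\<^sup>2 * (r x * (g x)\<^sup>2))"
        by (rule arg_cong[of _ _ "integral\<^sup>L lebesgue"]) (simp add: fun_eq_iff power2_eq_square algebra_simps)
      also have "\<dots> = ff + (2 * t) * fg + t\<^sup>2 * gg"
        unfolding ff_def R_def fg_def gg_def using fi gi ints
        by (simp only: Bochner_Integration.integral_add Bochner_Integration.integrable_add integrable_mult_right integral_mult_right_zero)
      finally show ?thesis .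
    qed
    moreover have "(LINT x|lebesgue. r x * ((k x + t * l x) * (f x + t * g x))) = kf + t * kg + t * lf + t\<^sup>2 * lgg"
    proof -
      have "(LINT x|lebesgue. r x * ((k x + t * l x) * (f x + t * g x))) =
          (LINT x|lebesgue. r x * (k x * f x) + t * (r x * (k x * g x)) + t * (r x * (l x * f x)) + t\<^sup>2 * (r x * (l x * g x)))"
        by (rule arg_cong[of _ _ "integral\<^sup>L lebesgue"]) (simp add: fun_eq_iff power2_eq_square algebra_simps)
      also have "\<dots> = kf + t * kg + t * lf + t\<^sup>2 * lgg"
        unfolding kf_def kg_def lf_def lgg_def using ints
        by (simp only: Bochner_Integration.integral_add Bochner_Integration.integrable_add integrable_mult_right integral_mult_right_zero)
      finally show ?thesis .
    qed
    ultimately show ?thesis using sym by (simp add: algebra_simps)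
  qed
  have lgg_nn: "0 \<le> lgg - m * gg" using m[OF gr] by (simp add: lgg_def gg_def)
  have CS: "(kg - m * fg)\<^sup>2 \<le> (kf - m * ff) * (lgg - m * gg)"
    by (rule quadratic_nonneg_discriminant[OF quad lgg_nn])
  have b1: "kg - m * fg = R"
  proof -
    have "kg - m * fg = (LINT x|lebesgue. r x * (l x * f x) - m * (r x * (f x * g x)))"
      unfolding sym lf_def fg_def using ints by (simp only: Bochner_Integration.integral_diff integrable_mult_right integral_mult_right_zero)
    also have "\<dots> = R" unfolding R_def
    proof (rule integral_cong_AE)
      show "AE x in lebesgue. r x * (l x * f x) - m * (r x * (f x * g x)) = r x * (f x)\<^sup>2"
        using lg
      proof eventually_elim
        case (elim x)
        have "r x * (l x * f x) - m * (r x * (f x * g x)) = r x * ((l x - m * g x) * f x)" by (simp add: algebra_simps)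
        then show ?case unfolding elim by (simp add: power2_eq_square)
      qed
    qed (use r_meas lm fm gm in measurable)
    finally show ?thesis .
  qed
  have b2: "(lgg - m * gg)\<^sup>2 \<le> (\<bar>C\<bar> * R)\<^sup>2"
  proof -
    have "lgg - m * gg = (LINT x|lebesgue. r x * (l x * g x) - m * (r x * (g x)\<^sup>2))"
      unfolding lgg_def gg_def using ints gi by (simp only: Bochner_Integration.integral_diff integrable_mult_right integral_mult_right_zero)
    also have "\<dots> = fg" unfolding fg_def
    proof (rule integral_cong_AE)
      show "AE x in lebesgue. r x * (l x * g x) - m * (r x * (g x)\<^sup>2) = r x * (f x * g x)"
        using lg
      proof eventually_elim
        case (elim x)
        have "r x * (l x * g x) - m * (r x * (g x)\<^sup>2) = r x * ((l x - m * g x) * g x)" by (simp add: power2_eq_square algebra_simps)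
        then show ?case unfolding elim .
      qed
    qed (use r_meas lm fm gm in measurable)
    finally have eq: "lgg - m * gg = fg" .
    have "fg\<^sup>2 \<le> R * gg"
    proof (rule quadratic_nonneg_discriminant)
      fix t
      have "0 \<le> (LINT x|lebesgue. r x * (f x + t * g x)\<^sup>2)" by (rule energy_parts_nonneg)
      also have "(LINT x|lebesgue. r x * (f x + t * g x)\<^sup>2) = (LINT x|lebesgue. r x * (f x)\<^sup>2 + (2 * t) * (r x * (f x * g x)) + t\<^sup>2 * (r x * (g x)\<^sup>2))"
        by (rule arg_cong[of _ _ "integral\<^sup>L lebesgue"]) (simp add: fun_eq_iff power2_eq_square algebra_simps)
      also have "\<dots> = R + (2 * t) * fg + t\<^sup>2 * gg"
        unfolding R_def fg_def gg_def using fi gi ints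
        by (simp only: Bochner_Integration.integral_add Bochner_Integration.integrable_add integrable_mult_right integral_mult_right_zero)
      finally show "0 \<le> R + 2 * t * fg + t\<^sup>2 * gg" .
    qed (unfold gg_def, rule energy_parts_nonneg)
    also have "\<dots> \<le> R * (\<bar>C\<bar> * sqrt R)\<^sup>2"
    proof (rule mult_left_mono)
      have "gg \<le> (N G)\<^sup>2" using GN by (simp add: gg_def)
      also have "\<dots> \<le> (\<bar>C\<bar> * sqrt R)\<^sup>2" using Ng norm_nonneg by (intro power_mono) auto
      finally show "gg \<le> (\<bar>C\<bar> * sqrt R)\<^sup>2" .
    qed (use Rpos in \<open>simp add: R_def\<close>)
    also have "\<dots> = (\<bar>C\<bar> * R)\<^sup>2" using Rpos by (simp add: R_def power_mult_distrib power2_eq_square)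
    finally show ?thesis by (simp add: eq)
  qed
  have Rp: "0 < R" using Rpos by (simp add: R_def)
  have b2': "lgg - m * gg \<le> \<bar>C\<bar> * R" by (rule power2_le_imp_le[OF b2]) (use Rp in simp)
  have b3: "kf - m * ff \<le> e * R" using small by (simp add: kf_def ff_def R_def algebra_simps)
  have "R\<^sup>2 \<le> (e * R) * (\<bar>C\<bar> * R)"
    using CS unfolding b1 using mult_mono[OF b3 b2' _ lgg_nn] e(1) Rp by simp
  also have "\<dots> = (e * \<bar>C\<bar>) * R\<^sup>2" by (simp add: power2_eq_square)
  also have "\<dots> < 1 * R\<^sup>2" using e(2) Rp by (intro mult_strict_right_mono) auto
  finally show False by simp
qed

text \<open>Without a nonzero element of the domain there would be no Rayleigh quotients. The equation is solved
  with the indicator function of the unit interval on the right-hand side; the solution cannot vanish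
  because it would make that function vanish.\<close>
lemma ex_SL_rel_nonzero: "\<exists>f v k. SL_rel f v k \<and> 0 < mass f"
proof -
  define h :: "real \<Rightarrow> real" where "h = indicator {0..1}"
  have hm: "h \<in> borel_measurable lebesgue" unfolding h_def by (rule borel_measurable_indicator) auto
  have "(\<lambda>x. r x * (h x)\<^sup>2) = (\<lambda>x. indicator {0..1} x *\<^sub>R r x)" by (auto simp: h_def fun_eq_iff indicator_def)
  then have hi: "finite_mass h" using r_loc[of 0 1] by (simp add: set_integrable_def)
  obtain f v d where f: "SL_rel f v (\<lambda>x. h x - \<Lambda> * f x)" using solve_real[OF hm hi] by blast
  have "mass f \<noteq> 0"
  proof
    assume z: "mass f = 0"
    obtain d where d: "primitive d f" "AE x in lebesgue. v x = p x * d x" and v: "primitive (\<lambda>x. q x * f x - r x * (h x - \<Lambda> * f x)) v"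
      and fi: "finite_mass f"
      using f unfolding SL_rel_def by blast
    have "AE x in lebesgue. 0 \<le> r x * (f x)\<^sup>2" using r_pos by eventually_elim simp
    then have "AE x in lebesgue. r x * (f x)\<^sup>2 = 0" using integral_nonneg_eq_0_iff_AE[OF fi] z by simp
    then have "AE x in lebesgue. f x = 0" using r_pos by eventually_elim simp
    then have f0: "f x = 0" for x by (rule continuous_AE_zero[OF primitive_continuous[OF d(1)]])
    then have "f = (\<lambda>x. 0)" by (simp add: fun_eq_iff)
    have zero: "primitive (\<lambda>x::real. 0::real) (\<lambda>x. 0)" by (simp add: primitive_def set_integrable_def set_lebesgue_integral_def)
    have "AE x in lebesgue. d x = 0" by (rule primitive_unique[OF d(1)]) (simp add: \<open>f = (\<lambda>x. 0)\<close> zero)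
    then have "AE x in lebesgue. v x = 0" using d(2) by eventually_elim simp
    then have v0: "v x = 0" for x by (rule continuous_AE_zero[OF primitive_continuous[OF v]])
    then have "v = (\<lambda>x. 0)" by (simp add: fun_eq_iff)
    have "AE x in lebesgue. q x * f x - r x * (h x - \<Lambda> * f x) = 0" by (rule primitive_unique[OF v]) (simp add: \<open>v = (\<lambda>x. 0)\<close> zero)
    then have "AE x in lebesgue. x \<notin> {0..1::real}"
      using r_pos by eventually_elim (auto simp: f0 h_def indicator_def split: if_splits)
    then have "{0..1::real} \<in> null_sets lebesgue" by (subst AE_iff_null_sets) auto
    then show False by (simp add: null_sets_def)
  qed
  moreover have "0 \<le> mass f" by (rule energy_parts_nonneg)
  ultimately show ?thesis using f by (intro exI conjI) auto
qed

lemma SL_rel_coercive: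
  assumes "SL_rel f v k"
  shows "(1 / 4 - \<Lambda>) * mass f \<le> ip k f"
proof -
  obtain d where d: "in_form f d" "\<And>g e. in_form g e \<Longrightarrow> bform (f, d) (g, e) = (LINT x|lebesgue. r x * ((k x + \<Lambda> * f x) * g x))"
    using SL_rel_form[OF assms(1)] by blast
  have fm: "f \<in> borel_measurable lebesgue" and km: "k \<in> borel_measurable lebesgue"
    and fi: "finite_mass f" and ki: "finite_mass k"
    using assms SL_rel_measurable[OF assms] unfolding SL_rel_def by blast+
  have kf: "integrable lebesgue (\<lambda>x. r x * (k x * f x))" by (rule weighted_L2_lincomb(2)[OF km fm ki fi])
  have "bform (f, d) (f, d) = (LINT x|lebesgue. r x * (k x * f x) + \<Lambda> * (r x * (f x)\<^sup>2))"
    unfolding d(2)[OF d(1)] by (rule arg_cong[of _ _ "integral\<^sup>L lebesgue"]) (simp add: fun_eq_iff algebra_simps power2_eq_square)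
  also have "\<dots> = ip k f + \<Lambda> * mass f"
    by (subst Bochner_Integration.integral_add[OF kf integrable_mult_right[OF fi]]) simp
  finally have "4 * ((ip k f) + \<Lambda> * (mass f)) \<ge> energy f d"
    using bform_coercive[OF d(1)] by simp
  moreover have "mass f \<le> energy f d"
    using energy_parts_nonneg(1)[of d] energy_parts_nonneg(3)[of f] unfolding energy_def by linarith
  ultimately show ?thesis by (simp add: algebra_simps)
qed

lemma spectrum_minimum:
  "\<exists>m. is_minimum (SL_spectrum p q r) m \<and>
    (\<forall>c. (\<forall>f v k. SL_rel f v k \<longrightarrow> c * mass f \<le> (ip k f)) \<longrightarrow> c \<le> m)"
proof -
  define X where "X = {(ip k f) / (mass f) | f v k.
    SL_rel f v k \<and> 0 < (mass f)}"
  define m where "m = Inf X"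
  have Xne: "X \<noteq> {}" using ex_SL_rel_nonzero unfolding X_def by blast
  have lower: "c \<le> t" if "t \<in> X" and c: "\<And>f v k. SL_rel f v k \<Longrightarrow> c * mass f \<le> ip k f" for c t
    using that(1) c unfolding X_def by (auto simp: pos_le_divide_eq)
  have bdd: "bdd_below X"
    by (rule bdd_belowI[of _ "1 / 4 - \<Lambda>"], erule lower, rule SL_rel_coercive)
  have greatest: "c \<le> m" if "\<And>f v k. SL_rel f v k \<Longrightarrow> c * mass f \<le> ip k f" for c
    unfolding m_def by (rule cInf_greatest[OF Xne]) (rule lower[OF _ that])
  have mbound: "m * mass f \<le> ip k f" if f: "SL_rel f v k" for f v k
  proof (cases "0 < mass f")
    case True
    then have "ip k f / (mass f) \<in> X" unfolding X_def using f by blast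
    then have "m \<le> ip k f / (mass f)" unfolding m_def by (rule cInf_lower[OF _ bdd])
    then show ?thesis using True by (simp add: pos_le_divide_eq)
  next
    case False
    then have "mass f = 0" using energy_parts_nonneg(2)[of f] by simp
    then show ?thesis using SL_rel_coercive[OF f] by simp
  qed
  have approx: "\<exists>f v k. SL_rel f v k \<and> 0 < mass f \<and>
      (ip k f) < (m + e) * mass f" if "e > 0" for e
  proof -
    have "Inf X < m + e" using that by (simp add: m_def)
    then obtain t where "t \<in> X" "t < m + e" using cInf_less_iff[OF Xne bdd] by blast
    then obtain f v k where "SL_rel f v k" "0 < mass f"
      "ip k f / (mass f) < m + e" unfolding X_def by blast
    then show ?thesis by (intro exI[of _ f] exI[of _ v] exI[of _ k]) (simp add: pos_divide_less_eq)
  qed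
  have mL: "- \<Lambda> < m"
  proof -
    have "1 / 4 - \<Lambda> \<le> m" by (rule greatest) (rule SL_rel_coercive)
    then show ?thesis by simp
  qed
  have "is_minimum (SL_spectrum p q r) m"
    unfolding is_minimum_def SL_spectrum_def spectrum_of_def
  proof (intro conjI ballI)
    have "complex_of_real m \<notin> resolvent_set r D T"
      by (rule minimum_in_spectrum) (erule mbound, erule approx)
    then show "complex_of_real m \<in> - resolvent_set r D T" by blast
    fix z assume "z \<in> - resolvent_set r D T"
    moreover have "z \<in> resolvent_set r D T" if "\<not> (z \<in> \<real> \<and> m \<le> Re z)"
      by (rule outside_in_resolvent[OF _ mL that]) (erule mbound)
    ultimately have "z \<in> \<real> \<and> m \<le> Re z" by blast
    then show "z \<in> \<real>" "m \<le> Re z" by auto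
  qed
  then show ?thesis using greatest by (intro exI[of _ m] conjI) auto
qed

lemma SL_alpha_real:
  assumes "s \<noteq> \<infinity>"
  shows "SL_alpha p q \<eta> s = ((((2 * \<eta> - 1) / \<eta>)\<^sup>2 * P) powr (\<eta> / (2 * \<eta> * real_of_ereal s - \<eta> - real_of_ereal s)) *
     Q powr ((2 * \<eta> * real_of_ereal s - real_of_ereal s) / (2 * \<eta> * real_of_ereal s - \<eta> - real_of_ereal s)))"
proof -
  obtain t where t: "s = ereal t" "1 \<le> t" using assms s1 by (cases s) auto
  define E where "E = 2 * \<eta> * t - \<eta> - t"
  define A where "A = ((2 * \<eta> - 1) / \<eta>)\<^sup>2 * P"
  have A: "0 \<le> A" using P_nonneg by (simp add: A_def)
  have E: "E > 0"
  proof -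
    have "\<gamma> - \<sigma> = E / (\<eta> * t)" using t eta1 unfolding \<gamma>_def E_def by (simp add: inv_exp_def diff_divide_distrib)
    moreover have "\<gamma> - \<sigma> > 0" using sigma by simp
    moreover have "\<eta> * t > 0" using t eta1 by simp
    ultimately show ?thesis by (simp add: zero_less_divide_iff)
  qed
  have "SL_alpha p q \<eta> s = Q * ((A * Q) powr (\<eta> * t / E)) powr (1 / t)"
    using t by (simp add: SL_alpha_def SL_beta_def A_def E_def)
  also have "\<dots> = Q * (A powr (\<eta> / E) * Q powr (\<eta> / E))"
    using A Q_nonneg t E by (simp add: powr_powr powr_mult)
  also have "\<dots> = A powr (\<eta> / E) * Q powr (1 + \<eta> / E)"
    using Q_nonneg by (cases "Q = 0") (simp_all add: powr_add)
  also have "1 + \<eta> / E = (2 * \<eta> * t - t) / E" using E by (simp add: field_simps E_def)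
  finally show ?thesis using t by (simp add: A_def E_def)
qed

lemma minimum_bounds:
  "\<exists>m. is_minimum (SL_spectrum p q r) m \<and>
    (\<forall>g. in_Lp \<infinity> g \<and> (AE x in lebesgue. 0 \<le> g x) \<and>
         emeasure lebesgue (Omega r g) * ennreal (SL_beta p q \<eta> s) < 1 \<longrightarrow>
         m \<ge> - SL_alpha p q \<eta> s * Lp_norm \<infinity> g /
               (1 - measure lebesgue (Omega r g) * SL_beta p q \<eta> s))"
proof -
  obtain m where m: "is_minimum (SL_spectrum p q r) m"
    "\<And>c. (\<And>f v k. SL_rel f v k \<Longrightarrow> c * mass f \<le> (ip k f)) \<Longrightarrow> c \<le> m"
    using spectrum_minimum by blast
  have "m \<ge> - SL_alpha p q \<eta> s * Lp_norm \<infinity> g / (1 - measure lebesgue (Omega r g) * SL_beta p q \<eta> s)"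
    if g: "in_Lp \<infinity> g" "AE x in lebesgue. 0 \<le> g x" "emeasure lebesgue (Omega r g) * ennreal (SL_beta p q \<eta> s) < 1" for g
  proof -
    have "- (SL_alpha p q \<eta> s * Lp_norm \<infinity> g / (1 - measure lebesgue (Omega r g) * SL_beta p q \<eta> s)) \<le> m"
      by (rule m(2)) (rule SL_lower_bound[OF _ g])
    then show ?thesis by simp
  qed
  then show ?thesis using m(1) by blast
qed

lemma Omega_inverse_null: "emeasure lebesgue (Omega r (\<lambda>x. 1 / r x)) = 0"
proof -
  have O: "Omega r (\<lambda>x. 1 / r x) \<in> sets lebesgue"
  proof -
    have "Omega r (\<lambda>x. 1 / r x) = {x \<in> space lebesgue. r x * (1 / r x) < 1}" by (simp add: Omega_def)
    also have "\<dots> \<in> sets lebesgue" using r_meas by measurable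
    finally show ?thesis .
  qed
  have "AE x in lebesgue. x \<notin> Omega r (\<lambda>x. 1 / r x)" using r_pos by eventually_elim (simp add: Omega_def)
  then show ?thesis using AE_iff_null_sets[OF O] by (simp add: null_sets_def)
qed

end

theorem theorem3p5:
  fixes p q r :: "real \<Rightarrow> real" and \<eta> :: real and s :: ereal
  assumes "SL_coefficients p q r"
    and "1 \<le> \<eta>" and "in_Lp \<eta> (\<lambda>x. 1 / p x)"
    and "1 \<le> s" and "in_Lp s (neg_part q)"
    and "s \<noteq> \<infinity> \<Longrightarrow> \<eta> + s > 2"
  shows "\<exists>m. is_minimum (SL_spectrum p q r) m \<and>
    (\<forall>g. in_Lp \<infinity> g \<and> (AE x in lebesgue. 0 \<le> g x) \<and>
         emeasure lebesgue (Omega r g) * ennreal (SL_beta p q \<eta> s) < 1 \<longrightarrow>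
         m \<ge> - SL_alpha p q \<eta> s * Lp_norm \<infinity> g /
               (1 - measure lebesgue (Omega r g) * SL_beta p q \<eta> s)) \<and>
    (in_Lp \<infinity> (\<lambda>x. 1 / r x) \<longrightarrow>
       emeasure lebesgue (Omega r (\<lambda>x. 1 / r x)) = 0 \<and>
       (s \<noteq> \<infinity> \<longrightarrow>
         m \<ge> - ((((2 * \<eta> - 1) / \<eta>)\<^sup>2 * Lp_norm \<eta> (\<lambda>x. 1 / p x)) powr
                  (\<eta> / (2 * \<eta> * real_of_ereal s - \<eta> - real_of_ereal s)) *
                Lp_norm s (neg_part q) powr
                  ((2 * \<eta> * real_of_ereal s - real_of_ereal s) /
                   (2 * \<eta> * real_of_ereal s - \<eta> - real_of_ereal s)) *
                Lp_norm \<infinity> (\<lambda>x. 1 / r x))) \<and>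
       (s = \<infinity> \<longrightarrow> m \<ge> - (Lp_norm \<infinity> (neg_part q) * Lp_norm \<infinity> (\<lambda>x. 1 / r x))))"
proof -
  interpret SL p q r \<eta> s by (rule SL.intro) (use assms in auto)
  obtain m where m: "is_minimum (SL_spectrum p q r) m"
    and b: "\<And>g. in_Lp \<infinity> g \<Longrightarrow> (AE x in lebesgue. 0 \<le> g x) \<Longrightarrow>
         emeasure lebesgue (Omega r g) * ennreal (SL_beta p q \<eta> s) < 1 \<Longrightarrow>
         m \<ge> - SL_alpha p q \<eta> s * Lp_norm \<infinity> g / (1 - measure lebesgue (Omega r g) * SL_beta p q \<eta> s)"
    using minimum_bounds by blast
  note null = Omega_inverse_null
  have bi: "m \<ge> - (SL_alpha p q \<eta> s * Lp_norm \<infinity> (\<lambda>x. 1 / r x))" if "in_Lp \<infinity> (\<lambda>x. 1 / r x)"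
  proof -
    have "AE x in lebesgue. 0 \<le> 1 / r x" using r_pos by eventually_elim simp
    from b[OF that this] show ?thesis using null by (simp add: measure_def)
  qed
  show ?thesis
  proof (intro exI[of _ m] conjI impI allI m)
    fix g assume "in_Lp \<infinity> g \<and> (AE x in lebesgue. 0 \<le> g x) \<and> emeasure lebesgue (Omega r g) * ennreal (SL_beta p q \<eta> s) < 1"
    then show "m \<ge> - SL_alpha p q \<eta> s * Lp_norm \<infinity> g / (1 - measure lebesgue (Omega r g) * SL_beta p q \<eta> s)"
      using b by blast
  next
    show "emeasure lebesgue (Omega r (\<lambda>x. 1 / r x)) = 0" by (rule null)
  next
    assume r: "in_Lp \<infinity> (\<lambda>x. 1 / r x)" and s: "s \<noteq> \<infinity>"
    show "m \<ge> - ((((2 * \<eta> - 1) / \<eta>)\<^sup>2 * Lp_norm \<eta> (\<lambda>x. 1 / p x)) powr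
                  (\<eta> / (2 * \<eta> * real_of_ereal s - \<eta> - real_of_ereal s)) *
                Lp_norm s (neg_part q) powr
                  ((2 * \<eta> * real_of_ereal s - real_of_ereal s) /
                   (2 * \<eta> * real_of_ereal s - \<eta> - real_of_ereal s)) *
                Lp_norm \<infinity> (\<lambda>x. 1 / r x))"
      using bi[OF r] unfolding SL_alpha_real[OF s] .
  next
    assume r: "in_Lp \<infinity> (\<lambda>x. 1 / r x)" and s: "s = \<infinity>"
    show "m \<ge> - (Lp_norm \<infinity> (neg_part q) * Lp_norm \<infinity> (\<lambda>x. 1 / r x))"
      using bi[OF r] by (simp add: SL_alpha_def s)
  qed
qed

end
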